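(* Consider the following (mutually equivalent) conditions: (i) $\min\mathcal{I}_G=0$, where the minimum is taken over $y\in W^{2,2}(\Omega,\mathbb{R}^3)$ with $(\nabla y)^T\nabla y=G_{2\times2}$ a.e. in $\Omega$ ($W^{2,2}$ isometric immersions of $G_{2\times 2}$). (ii) There exists a $W^{2,2}$ isometric immersion $y:\Omega\to\mathbb{R}^3$ of $G_{2\times2}$ such that $\mathrm{sym}\big((\nabla y)^T\nabla\vec b\big)=0$ a.e. in $\Omega$. (iii) There exists a $W^{2,2}$ isometric immersion of $G_{2\times2}$ in $\mathbb{R}^3$ whose second fundamental form satisfies $\Pi_{ij}=-\frac1{\sqrt{G^{33}}}\Gamma^3_{ij}$ for $(i,j)\in\{(1,1),(1,2),(2,2)\}$. Each of these conditions is equivalent to the vanishing (identically in $\Omega$) of the following three Riemann curvatures of $G$: $$R^3_{112}=R^3_{221}=R_{1212}=0.$$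
   Context: $\Omega\subset\mathbb{R}^2$ is an open, bounded, smooth and simply connected set. $G:\bar\Omega\to\mathbb{R}^{3\times3}$ is a smooth field of symmetric positive definite matrices, regarded as a Riemannian metric on $\Omega\times\mathbb{R}$ independent of $x_3$ (so $\partial_3G=0$); $A=\sqrt G$. For $F\in\mathbb{R}^{3\times3}$, $F_{2\times2}$ is its principal (upper-left) $2\times2$ block, and $\mathrm{sym}\,F=\frac12(F+F^T)$. With $[G^{ij}]=G^{-1}$, the Christoffel symbols are $\Gamma^i_{kl}=\frac12\sum_{m=1}^3G^{im}(\partial_lG_{mk}+\partial_kG_{ml}-\partial_mG_{kl})$, and the Riemann curvatures are $$R^s_{ijk}=\partial_j\Gamma^s_{ik}-\partial_k\Gamma^s_{ij}+\sum_{m=1}^3\Gamma^s_{jm}\Gamma^m_{ik}-\sum_{m=1}^3\Gamma^s_{km}\Gamma^m_{ij},\qquad R_{sijk}=\sum_{m=1}^3G_{sm}R^m_{ijk}.$$ $W:\mathbb{R}^{3\times3}\to[0,+\infty]$ is $\mathcal{C}^2$ in a neighborhood of $SO(3)$ and there is $c>0$ such that for all $F\in\mathbb{R}^{3\times3}$, $R\in SO(3)$: $W(R)=0$, $W(RF)=W(F)$, $W(F)\ge c\,\mathrm{dist}^2(F,SO(3))$. Put $\mathcal{Q}_3(F)=D^2W(\mathrm{Id})(F,F)$ and $\mathcal{Q}_2(x',F_{2\times2})=\min\{\mathcal{Q}_3(A(x')^{-1}\tilde FA(x')^{-1});\ \tilde F\in\mathbb{R}^{3\times3},\ \tilde F_{2\times2}=F_{2\times2}\}$.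 For a $W^{2,2}$ isometric immersion $y$ of $G_{2\times2}$, let $\vec N=\frac{\partial_1y\times\partial_2y}{|\partial_1y\times\partial_2y|}$, $\Pi_{ij}=\langle\partial_iy,\partial_j\vec N\rangle$ (second fundamental form), $\vec b=(\nabla y)(G_{2\times2})^{-1}\begin{bmatrix}G_{13}\\ G_{23}\end{bmatrix}+\frac{\sqrt{\det G}}{\sqrt{\det G_{2\times2}}}\vec N$ (equivalently, $\vec b$ is the unique field such that $Q=[\partial_1y,\partial_2y,\vec b]$ satisfies $Q^TQ=G$, $\det Q>0$), and $$\mathcal{I}_G(y)=\frac1{24}\int_\Omega\mathcal{Q}_2\big(x',(\nabla y)^T\nabla\vec b\big)\,\mathrm{d}x'.$$ *)

theory Defs
  imports "HOL-Analysis.Analysis"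
begin

section \<open>Classical smoothness\<close>

primrec Ck_on :: "nat \<Rightarrow> 'a::euclidean_space set \<Rightarrow> ('a \<Rightarrow> 'b::real_normed_vector) \<Rightarrow> bool" where
  "Ck_on 0 U f \<longleftrightarrow> continuous_on U f"
| "Ck_on (Suc k) U f \<longleftrightarrow>
     (\<forall>x\<in>U. f differentiable (at x)) \<and>
     (\<forall>v. Ck_on k U (\<lambda>x. frechet_derivative f (at x) v))"

text \<open>The predicates \<open>Ck_on\<close> and \<open>smooth_on\<close> are meant for open sets. Smoothness on a closure is
  expressed by a smooth extension to an open neighbourhood.\<close>

definition smooth_on :: "'a::euclidean_space set \<Rightarrow> ('a \<Rightarrow> 'b::real_normed_vector) \<Rightarrow> bool" where
  "smooth_on U f \<longleftrightarrow> (\<forall>k. Ck_on k U f)"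

definition smooth_extends_on :: "'a::euclidean_space set \<Rightarrow> ('a \<Rightarrow> 'b::real_normed_vector) \<Rightarrow> bool" where
  "smooth_extends_on S f \<longleftrightarrow>
     (\<exists>U g. open U \<and> S \<subseteq> U \<and> smooth_on U g \<and> (\<forall>x\<in>S. g x = f x))"

text \<open>Smoothness of the boundary, by local defining functions; the set lies locally on one side.\<close>

definition smooth_boundary :: "'a::euclidean_space set \<Rightarrow> bool" where
  "smooth_boundary \<Omega> \<longleftrightarrow>
     (\<forall>p\<in>frontier \<Omega>. \<exists>U \<rho>. open U \<and> p \<in> U \<and> smooth_on U (\<rho> :: 'a \<Rightarrow> real) \<and>
        (\<forall>x\<in>U. \<exists>v. frechet_derivative \<rho> (at x) v \<noteq> 0) \<and>
        \<Omega> \<inter> U = {x\<in>U. \<rho> x < 0})"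

definition pd :: "'n::finite \<Rightarrow> (real^'n \<Rightarrow> 'b::real_normed_vector) \<Rightarrow> real^'n \<Rightarrow> 'b" where
  "pd i f x = frechet_derivative f (at x) (axis i 1)"

section \<open>Weak derivatives and Sobolev spaces\<close>

definition test_function :: "(real^'n::finite) set \<Rightarrow> (real^'n \<Rightarrow> real) \<Rightarrow> bool" where
  "test_function \<Omega> \<phi> \<longleftrightarrow>
     smooth_on UNIV \<phi> \<and> compact (closure {x. \<phi> x \<noteq> 0}) \<and> closure {x. \<phi> x \<noteq> 0} \<subseteq> \<Omega>"

definition loc_integrable :: "(real^'n::finite) set \<Rightarrow> (real^'n \<Rightarrow> 'b::euclidean_space) \<Rightarrow> bool" where
  "loc_integrable \<Omega> f \<longleftrightarrow> (\<forall>K. compact K \<and> K \<subseteq> \<Omega> \<longrightarrow> integrable (lebesgue_on K) f)"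

definition has_weak_pd ::
    "(real^'n::finite) set \<Rightarrow> 'n \<Rightarrow> (real^'n \<Rightarrow> 'b::euclidean_space) \<Rightarrow> (real^'n \<Rightarrow> 'b) \<Rightarrow> bool" where
  "has_weak_pd \<Omega> i f g \<longleftrightarrow> loc_integrable \<Omega> f \<and> loc_integrable \<Omega> g \<and>
     (\<forall>\<phi>. test_function \<Omega> \<phi> \<longrightarrow>
        (LINT x|lebesgue_on \<Omega>. pd i \<phi> x *\<^sub>R f x) = - (LINT x|lebesgue_on \<Omega>. \<phi> x *\<^sub>R g x))"

text \<open>A representative of the weak derivative, which is determined only up to a null set
  (and arbitrary if no weak derivative exists).\<close>

definition weak_pd ::
    "(real^'n::finite) set \<Rightarrow> 'n \<Rightarrow> (real^'n \<Rightarrow> 'b::euclidean_space) \<Rightarrow> real^'n \<Rightarrow> 'b" where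
  "weak_pd \<Omega> i f = (SOME g. has_weak_pd \<Omega> i f g)"

definition weak_grad ::
    "(real^'n::finite) set \<Rightarrow> (real^'n \<Rightarrow> real^'m::finite) \<Rightarrow> real^'n \<Rightarrow> real^'n^'m" where
  "weak_grad \<Omega> f x = (\<chi> k j. weak_pd \<Omega> j f x $ k)"

definition L2_on :: "(real^'n::finite) set \<Rightarrow> (real^'n \<Rightarrow> 'b::euclidean_space) \<Rightarrow> bool" where
  "L2_on \<Omega> f \<longleftrightarrow> f \<in> borel_measurable (lebesgue_on \<Omega>) \<and>
     integrable (lebesgue_on \<Omega>) (\<lambda>x. (norm (f x))\<^sup>2)"

text \<open>\<open>sobolev2 k \<Omega>\<close> is the space $W^{k,2}(\Omega)$.\<close>

primrec sobolev2 :: "nat \<Rightarrow> (real^'n::finite) set \<Rightarrow> (real^'n \<Rightarrow> 'b::euclidean_space) \<Rightarrow> bool" where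
  "sobolev2 0 \<Omega> f \<longleftrightarrow> L2_on \<Omega> f"
| "sobolev2 (Suc k) \<Omega> f \<longleftrightarrow> L2_on \<Omega> f \<and> (\<forall>i. \<exists>g. has_weak_pd \<Omega> i f g \<and> sobolev2 k \<Omega> g)"

section \<open>Matrices\<close>

definition spd :: "real^'n^'n::finite \<Rightarrow> bool" where
  "spd M \<longleftrightarrow> transpose M = M \<and> (\<forall>v. v \<noteq> 0 \<longrightarrow> v \<bullet> (M *v v) > 0)"

definition spd_sqrt :: "real^'n^'n::finite \<Rightarrow> real^'n^'n" where
  "spd_sqrt M = (THE A. spd A \<and> A ** A = M)"

definition sym_part :: "real^'n^'n::finite \<Rightarrow> real^'n^'n" where
  "sym_part F = (1/2) *\<^sub>R (F + transpose F)"

definition block22 :: "real^3^3 \<Rightarrow> real^2^2" where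
  "block22 F = vector [vector [F$1$1, F$1$2], vector [F$2$1, F$2$2]]"

definition SO3 :: "(real^3^3) set" where
  "SO3 = {R. rotation_matrix R}"

section \<open>Curvature\<close>

definition christoffel ::
    "(real^'n::finite \<Rightarrow> real^'n^'n) \<Rightarrow> 'n \<Rightarrow> 'n \<Rightarrow> 'n \<Rightarrow> real^'n \<Rightarrow> real" where
  "christoffel g i k l x = 1/2 * (\<Sum>m\<in>UNIV. matrix_inv (g x) $ i $ m *
     (pd l (\<lambda>z. g z $ m $ k) x + pd k (\<lambda>z. g z $ m $ l) x - pd m (\<lambda>z. g z $ k $ l) x))"

text \<open>\<open>riemann g s i j k\<close> is $R^s_{ijk}$ and \<open>riemann_low g s i j k\<close> is $R_{sijk}$.\<close>

definition riemann ::
    "(real^'n::finite \<Rightarrow> real^'n^'n) \<Rightarrow> 'n \<Rightarrow> 'n \<Rightarrow> 'n \<Rightarrow> 'n \<Rightarrow> real^'n \<Rightarrow> real" where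
  "riemann g s i j k x =
     pd j (christoffel g s i k) x - pd k (christoffel g s i j) x
     + (\<Sum>m\<in>UNIV. christoffel g s j m x * christoffel g m i k x)
     - (\<Sum>m\<in>UNIV. christoffel g s k m x * christoffel g m i j x)"

definition riemann_low ::
    "(real^'n::finite \<Rightarrow> real^'n^'n) \<Rightarrow> 'n \<Rightarrow> 'n \<Rightarrow> 'n \<Rightarrow> 'n \<Rightarrow> real^'n \<Rightarrow> real" where
  "riemann_low g s i j k x = (\<Sum>m\<in>UNIV. g x $ s $ m * riemann g m i j k x)"

text \<open>A field on the plane, regarded as a field on space that is independent of $x_3$.\<close>

definition planar :: "real^3 \<Rightarrow> real^2" where
  "planar x = vector [x$1, x$2]"

definition midplane :: "real^2 \<Rightarrow> real^3" where
  "midplane x = vector [x$1, x$2, 0]"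

definition cylindrical :: "(real^2 \<Rightarrow> real^3^3) \<Rightarrow> real^3 \<Rightarrow> real^3^3" where
  "cylindrical G = G \<circ> planar"

section \<open>Elastic energy\<close>

definition stored_energy :: "(real^3^3 \<Rightarrow> ennreal) \<Rightarrow> bool" where
  "stored_energy W \<longleftrightarrow>
     (\<exists>U. open U \<and> SO3 \<subseteq> U \<and> (\<forall>F\<in>U. W F < \<infinity>) \<and> Ck_on 2 U (\<lambda>F. enn2real (W F))) \<and>
     (\<exists>c>0. \<forall>F. \<forall>R\<in>SO3.
        W R = 0 \<and> W (R ** F) = W F \<and> W F \<ge> ennreal (c * (infdist F SO3)\<^sup>2))"

definition Q3 :: "(real^3^3 \<Rightarrow> ennreal) \<Rightarrow> real^3^3 \<Rightarrow> real" where
  "Q3 W F =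
     frechet_derivative (\<lambda>Z. frechet_derivative (\<lambda>Y. enn2real (W Y)) (at Z) F) (at (mat 1)) F"

definition Q2 :: "(real^3^3 \<Rightarrow> ennreal) \<Rightarrow> (real^2 \<Rightarrow> real^3^3) \<Rightarrow> real^2 \<Rightarrow> real^2^2 \<Rightarrow> real" where
  "Q2 W G x F =
     (LEAST q. q \<in> {Q3 W (matrix_inv (spd_sqrt (G x)) ** H ** matrix_inv (spd_sqrt (G x))) |H.
                      block22 H = F})"

section \<open>Isometric immersions\<close>

definition iso_immersions :: "(real^2) set \<Rightarrow> (real^2 \<Rightarrow> real^3^3) \<Rightarrow> (real^2 \<Rightarrow> real^3) set" where
  "iso_immersions \<Omega> G = {y. sobolev2 2 \<Omega> y \<and>
     (AE x in lebesgue_on \<Omega>. transpose (weak_grad \<Omega> y x) ** weak_grad \<Omega> y x = block22 (G x))}"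

definition unit_normal :: "(real^2) set \<Rightarrow> (real^2 \<Rightarrow> real^3) \<Rightarrow> real^2 \<Rightarrow> real^3" where
  "unit_normal \<Omega> y x =
     (let n = cross3 (weak_pd \<Omega> 1 y x) (weak_pd \<Omega> 2 y x) in n /\<^sub>R norm n)"

definition second_ff :: "(real^2) set \<Rightarrow> (real^2 \<Rightarrow> real^3) \<Rightarrow> 2 \<Rightarrow> 2 \<Rightarrow> real^2 \<Rightarrow> real" where
  "second_ff \<Omega> y i j x = weak_pd \<Omega> i y x \<bullet> weak_pd \<Omega> j (unit_normal \<Omega> y) x"

text \<open>The field $\vec b$ completing $\nabla y$ to $Q = [\partial_1 y, \partial_2 y, \vec b]$ with
  $Q^T Q = G$ and $\det Q > 0$.\<close>

definition cosserat ::
    "(real^2) set \<Rightarrow> (real^2 \<Rightarrow> real^3^3) \<Rightarrow> (real^2 \<Rightarrow> real^3) \<Rightarrow> real^2 \<Rightarrow> real^3" where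
  "cosserat \<Omega> G y x =
     weak_grad \<Omega> y x *v (matrix_inv (block22 (G x)) *v vector [G x $ 1 $ 3, G x $ 2 $ 3])
     + (sqrt (det (G x)) / sqrt (det (block22 (G x)))) *\<^sub>R unit_normal \<Omega> y x"

definition bending_tensor ::
    "(real^2) set \<Rightarrow> (real^2 \<Rightarrow> real^3^3) \<Rightarrow> (real^2 \<Rightarrow> real^3) \<Rightarrow> real^2 \<Rightarrow> real^2^2" where
  "bending_tensor \<Omega> G y x =
     transpose (weak_grad \<Omega> y x) ** weak_grad \<Omega> (cosserat \<Omega> G y) x"

text \<open>The integrand is nonnegative: $W \<ge> 0 = W(\mathrm{Id})$ makes \<open>Q3\<close>, hence \<open>Q2\<close>, nonnegative.
  So the nonnegative Lebesgue integral is the integral meant.\<close>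

definition bending_energy ::
    "(real^3^3 \<Rightarrow> ennreal) \<Rightarrow> (real^2) set \<Rightarrow> (real^2 \<Rightarrow> real^3^3) \<Rightarrow> (real^2 \<Rightarrow> real^3) \<Rightarrow> ennreal" where
  "bending_energy W \<Omega> G y =
     ennreal (1/24) * (\<integral>\<^sup>+x. ennreal (Q2 W G x (bending_tensor \<Omega> G y x)) \<partial>lebesgue_on \<Omega>)"

end

theory Submission
  imports Defs "HOL-Complex_Analysis.Riemann_Mapping"
begin

text \<open>Let \<open>p\<^sub>i = \<partial>\<^sub>i y\<close> and \<open>Q = [p\<^sub>1, p\<^sub>2, b]\<close>. Differentiating \<open>Q\<^sup>T Q = G\<close> weakly determines every product
  of a column of \<open>Q\<close> with a derivative of a column of \<open>Q\<close>, except for \<open>b \<bullet> \<partial>\<^sub>j p\<^sub>i\<close>. The symmetric part of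
  \<open>(\<nabla>y)\<^sup>T \<nabla>b\<close> and the difference between the second fundamental form and its prescribed value are both
  multiples of \<open>\<Gamma>\<^sub>3\<^sub>i\<^sub>j - b \<bullet> \<partial>\<^sub>j p\<^sub>i\<close>, with \<open>\<Gamma>\<^sub>3\<^sub>i\<^sub>j\<close> the Christoffel symbol of the first kind; the energy
  density is bounded below by the square of the symmetric part, and vanishes with it. So all conditions say that
  \<open>b \<bullet> \<partial>\<^sub>j p\<^sub>i = \<Gamma>\<^sub>3\<^sub>i\<^sub>j\<close>, which means that \<open>\<partial>\<^sub>j Q = Q \<Gamma>\<^sub>j\<close>. Commuting weak derivatives yields
  \<open>R\<^sup>s\<^sub>i\<^sub>1\<^sub>2 = 0\<close> for all \<open>s\<close> and \<open>i\<close>, and these curvatures vanish as soon as the three given ones do, by antisymmetry.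

  Conversely, if the curvatures vanish, the linear system \<open>\<partial>\<^sub>j Q = Q \<Gamma>\<^sub>j\<close>, \<open>\<partial>\<^sub>j y = q\<^sub>j\<close> is integrable. The Riemann map
  transports it to the disc, where integration along rays solves it; \<open>Q\<^sup>T Q - G\<close> solves a homogeneous linear
  system, so it vanishes if it does at one point. The solution is smooth in the open set only, but \<open>Q\<close> and its
  derivatives are bounded, and so is \<open>y\<close> because the boundary is regular; hence \<open>y\<close> is in \<open>W\<^sup>2\<^sup>,\<^sup>2\<close>.\<close>

section \<open>Calculus of smooth functions\<close>

text \<open>An isometric immersion in W^{2,2} has a frame with only one weak derivative, and a weak
  derivative is a choice fixed up to a null set. Two facts make the classical computation
  legitimate. The isometry bounds the tangent vectors, so a product rule for locally bounded factors
  covers every product that occurs. And the structure equations express the derivatives of the frame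
  through the frame itself, so its second derivatives exist without being assumed.

  Three curvatures suffice because R_{ai12} is antisymmetric in a and i, hence given by the entries
  12, 31 and 32. Once the first is zero, R^3_{i12} equals G^{33} R_{3i12} for i = 1, 2, and G^{33}
  is positive.

  The energy density hides a minimum over matrices that varies with the point. Whether its integral
  vanishes is therefore read off from a measurable lower bound, a constant multiple of the squared
  symmetric part.

  In the converse direction, rays from one point need a star-shaped domain. The Riemann map may
  supply it because the integrability condition is invariant under pullback.\<close>

lemma Ck_on_cong:
  assumes "open U" "Ck_on k U f" "\<And>x. x \<in> U \<Longrightarrow> f x = g x"
  shows "Ck_on k U g"
  using assms(2,3)
proof (induction k arbitrary: f g)
  case 0
  then show ?case by (simp cong: continuous_on_cong)
next
  case (Suc k)
  have d: "(g has_derivative frechet_derivative f (at x)) (at x)" if "x \<in> U" for x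
    by (rule has_derivative_transform_within_open[of f _ x UNIV U])
      (use Suc.prems that assms(1) in \<open>auto simp flip: frechet_derivative_works\<close>)
  then have eq: "frechet_derivative f (at x) = frechet_derivative g (at x)" if "x \<in> U" for x
    using frechet_derivative_at that by blast
  have "Ck_on k U (\<lambda>x. frechet_derivative g (at x) v)" for v
    by (rule Suc.IH[of "\<lambda>x. frechet_derivative f (at x) v"]) (use Suc.prems eq in auto)
  moreover have "g differentiable (at x)" if "x \<in> U" for x
    using d[OF that] differentiableI by blast
  ultimately show ?case by simp
qed

text \<open>Lets the derivative be supplied as a formula \<open>f'\<close>. On the open set it
  agrees with the choice made by \<open>frechet_derivative\<close>, so inductions can continue with
  the formula.\<close>

lemma Ck_on_SucI:
  assumes "open U" "\<And>x. x \<in> U \<Longrightarrow> (f has_derivative f' x) (at x)"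
    and "\<And>v. Ck_on k U (\<lambda>x. f' x v)"
  shows "Ck_on (Suc k) U f"
proof -
  have eq: "f' x = frechet_derivative f (at x)" if "x \<in> U" for x
    using assms(2)[OF that] by (rule frechet_derivative_at)
  have "Ck_on k U (\<lambda>x. frechet_derivative f (at x) v)" for v
    by (rule Ck_on_cong[OF assms(1,3)]) (simp add: eq)
  moreover have "f differentiable (at x)" if "x \<in> U" for x
    using assms(2)[OF that] differentiableI by blast
  ultimately show ?thesis by simp
qed

lemma Ck_on_has_derivative:
  assumes "Ck_on (Suc k) U f" "x \<in> U"
  shows "(f has_derivative frechet_derivative f (at x)) (at x)"
  using assms frechet_derivative_works by auto

lemma Ck_on_frechet_derivative:
  "Ck_on (Suc k) U f \<Longrightarrow> Ck_on k U (\<lambda>x. frechet_derivative f (at x) v)"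
  by simp

lemma Ck_on_SucD:
  assumes "Ck_on (Suc k) U f"
  shows "Ck_on k U f"
  using assms
proof (induction k arbitrary: f)
  case 0
  then show ?case
    by (auto intro!: continuous_at_imp_continuous_on differentiable_imp_continuous_within)
next
  case (Suc k)
  then show ?case by (metis Ck_on.simps(2))
qed

lemma Ck_on_const: "Ck_on k U (\<lambda>x. c)"
proof (induction k arbitrary: c)
  case (Suc k)
  then show ?case by (simp add: frechet_derivative_const)
qed simp

lemma Ck_on_bounded_linear:
  assumes "open U" "bounded_linear L" "Ck_on k U f"
  shows "Ck_on k U (\<lambda>x. L (f x))"
  using assms(3)
proof (induction k arbitrary: f)
  case 0
  then show ?case
    using assms(2) by (simp add: bounded_linear.continuous_on)
next
  case (Suc k)
  show ?case
    by (rule Ck_on_SucI[OF assms(1) bounded_linear.has_derivative[OF assms(2) Ck_on_has_derivative[OF Suc.prems]]])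
      (use Suc in auto)
qed

lemma Ck_on_add:
  assumes "open U" "Ck_on k U f" "Ck_on k U g"
  shows "Ck_on k U (\<lambda>x. f x + g x)"
  using assms(2,3)
proof (induction k arbitrary: f g)
  case 0
  then show ?case by (simp add: continuous_on_add)
next
  case (Suc k)
  show ?case
    by (rule Ck_on_SucI[OF assms(1) has_derivative_add[OF Ck_on_has_derivative[OF Suc.prems(1)] Ck_on_has_derivative[OF Suc.prems(2)]]])
      (use Suc in auto)
qed

lemma Ck_on_mult:
  fixes f g :: "'a::euclidean_space \<Rightarrow> real"
  assumes "open U" "Ck_on k U f" "Ck_on k U g"
  shows "Ck_on k U (\<lambda>x. f x * g x)"
  using assms(2,3)
proof (induction k arbitrary: f g)
  case 0
  then show ?case by (simp add: continuous_on_mult)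
next
  case (Suc k)
  show ?case
  proof (rule Ck_on_SucI[OF assms(1) has_derivative_mult[OF Ck_on_has_derivative[OF Suc.prems(1)] Ck_on_has_derivative[OF Suc.prems(2)]]])
    fix v
    have "Ck_on k U f" "Ck_on k U g" using Suc.prems Ck_on_SucD by blast+
    then show "Ck_on k U (\<lambda>x. f x * frechet_derivative g (at x) v + frechet_derivative f (at x) v * g x)"
      using Suc.prems by (intro Ck_on_add[OF assms(1)] Suc.IH) auto
  qed
qed

lemma Ck_on_ident: "Ck_on k U (\<lambda>x. x)"
  by (cases k) (simp_all add: Ck_on_const flip: frechet_derivative_at[OF has_derivative_ident])

text \<open>The directional derivative of the composite is the derivative of \<open>e\<close> at
  \<open>q x\<close> times a derivative of \<open>q\<close>. The induction keeps \<open>e\<close>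
  general, so that its hypothesis applies to the derivative of \<open>e\<close> with the same
  \<open>q\<close>.\<close>

lemma Ck_on_compose_1D:
  fixes e :: "real \<Rightarrow> real" and q :: "'a::euclidean_space \<Rightarrow> real"
  assumes "open U" "Ck_on k UNIV e" "Ck_on k U q"
  shows "Ck_on k U (\<lambda>x. e (q x))"
  using assms(2,3)
proof (induction k arbitrary: e)
  case 0
  then show ?case using continuous_on_compose2[of UNIV e U q] by simp
next
  case (Suc k)
  show ?case
  proof (rule Ck_on_SucI[OF assms(1)])
    fix x assume "x \<in> U"
    show "((\<lambda>x. e (q x)) has_derivative (\<lambda>v. frechet_derivative e (at (q x)) 1 * frechet_derivative q (at x) v)) (at x)"
    proof -
      have 1: "(e has_derivative frechet_derivative e (at (q x))) (at (q x))"
        by (rule Ck_on_has_derivative[OF Suc.prems(1) UNIV_I])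
      then interpret e: linear "frechet_derivative e (at (q x))" by (rule has_derivative_linear)
      have 2: "frechet_derivative e (at (q x)) t = frechet_derivative e (at (q x)) 1 * t" for t
        using e.scaleR[of t 1] by simp
      show ?thesis
        using has_derivative_compose[OF Ck_on_has_derivative[OF Suc.prems(2) \<open>x \<in> U\<close>] 1]
        by (subst (asm) 2)
    qed
  next
    fix v
    show "Ck_on k U (\<lambda>x. frechet_derivative e (at (q x)) 1 * frechet_derivative q (at x) v)"
      by (rule Ck_on_mult[OF assms(1)
            Suc.IH[OF Ck_on_frechet_derivative[OF Suc.prems(1)] Ck_on_SucD[OF Suc.prems(2)]]
            Ck_on_frechet_derivative[OF Suc.prems(2)]])
  qed
qed

lemma Ck_on_affine:
  assumes "bounded_linear L" "Ck_on k UNIV f"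
  shows "Ck_on k UNIV (\<lambda>x. f (a + L x))"
  using assms(2)
proof (induction k arbitrary: f)
  case 0
  then have "continuous_on UNIV f" by simp
  moreover have "continuous_on UNIV (\<lambda>x. a + L x)"
    by (rule continuous_on_add[OF continuous_on_const linear_continuous_on[OF assms(1)]])
  ultimately have "continuous_on UNIV (\<lambda>x. f (a + L x))"
    by (rule continuous_on_compose2) simp
  then show ?case by simp
next
  case (Suc k)
  show ?case
  proof (rule Ck_on_SucI)
    fix x
    have "((\<lambda>x. a + L x) has_derivative L) (at x)"
      using has_derivative_add[OF has_derivative_const bounded_linear_imp_has_derivative[OF assms(1)]] by simp
    then show "((\<lambda>x. f (a + L x)) has_derivative (\<lambda>v. frechet_derivative f (at (a + L x)) (L v))) (at x)"
      by (rule has_derivative_compose[OF _ Ck_on_has_derivative[OF Suc.prems UNIV_I]])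
  next
    show "Ck_on k UNIV (\<lambda>x. frechet_derivative f (at (a + L x)) (L v))" for v
      by (rule Suc.IH[OF Ck_on_frechet_derivative[OF Suc.prems]])
  qed simp
qed

text \<open>For \<open>n = 0\<close> this is the classical function exp(-1/t), flat at the origin.
  The powers of 1/t are carried along because the family is then closed under differentiation up to
  linear combinations, as the induction on the order of smoothness requires.\<close>

definition flat_exp :: "nat \<Rightarrow> real \<Rightarrow> real" where
  "flat_exp n t = (if t > 0 then inverse t ^ n * exp (- inverse t) else 0)"

lemma flat_exp_tendsto_0: "(flat_exp n \<longlongrightarrow> 0) (at 0)"
proof -
  have "((\<lambda>t. inverse t ^ n * exp (- inverse t)) \<longlongrightarrow> 0) (at_right (0::real))"
  proof -
    have *: "((\<lambda>s::real. s ^ n / exp s) \<longlongrightarrow> 0) at_top" by (rule tendsto_power_div_exp_0)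
    have "((\<lambda>t::real. inverse t ^ n / exp (inverse t)) \<longlongrightarrow> 0) (at_right 0)"
      using filterlim_compose[OF * filterlim_inverse_at_top_right] .
    then show ?thesis by (simp add: exp_minus divide_inverse)
  qed
  then have "(flat_exp n \<longlongrightarrow> 0) (at_right 0)"
    by (rule Lim_transform_eventually) (auto simp: flat_exp_def eventually_at_filter)
  moreover have "(flat_exp n \<longlongrightarrow> 0) (at_left 0)"
    by (rule tendsto_eventually) (auto simp: flat_exp_def eventually_at_filter)
  ultimately show ?thesis by (simp add: filterlim_split_at)
qed

lemma flat_exp_has_derivative:
  "(flat_exp n has_real_derivative flat_exp (n + 2) t - real n * flat_exp (Suc n) t) (at t)"
proof (cases "t = 0")
  case True
  \<comment> \<open>The difference quotient at the origin is again a member of the family, so the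
    derivative there is the limit of that member, zero.\<close>
  have "(\<lambda>h. flat_exp n h / h) = flat_exp (Suc n)"
    by (auto simp: flat_exp_def divide_inverse)
  then have "(\<lambda>h. (flat_exp n (0 + h) - flat_exp n 0) / h) \<midarrow>0\<rightarrow> 0"
    using flat_exp_tendsto_0[of "Suc n"] by (simp add: flat_exp_def)
  then show ?thesis
    using True by (simp add: DERIV_def flat_exp_def)
next
  case False
  show ?thesis
  proof (cases "t > 0")
    case True
    have "((\<lambda>t. inverse t ^ n * exp (- inverse t)) has_real_derivative
        (real n * inverse t ^ (n - 1) * - (inverse t)\<^sup>2) * exp (- inverse t)
        + inverse t ^ n * (exp (- inverse t) * (inverse t)\<^sup>2)) (at t)"
      using True by (auto intro!: derivative_eq_intros simp: power2_eq_square)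
    also have "(real n * inverse t ^ (n - 1) * - (inverse t)\<^sup>2) * exp (- inverse t)
        + inverse t ^ n * (exp (- inverse t) * (inverse t)\<^sup>2)
      = flat_exp (n + 2) t - real n * flat_exp (Suc n) t"
      using True by (cases n) (simp_all add: flat_exp_def power2_eq_square algebra_simps)
    finally have "((\<lambda>t. inverse t ^ n * exp (- inverse t)) has_real_derivative flat_exp (n + 2) t - real n * flat_exp (Suc n) t) (at t)" .
    then show ?thesis
      by (rule DERIV_cong_ev[THEN iffD1, rotated -1])
         (use True in \<open>auto simp: flat_exp_def eventually_nhds intro!: exI[of _ "{0<..}"]\<close>)
  next
    case False
    with \<open>t \<noteq> 0\<close> have "t < 0" by simp
    have "((\<lambda>t. 0) has_real_derivative flat_exp (n + 2) t - real n * flat_exp (Suc n) t) (at t)"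
      using \<open>t < 0\<close> by (simp add: flat_exp_def)
    then show ?thesis
      by (rule DERIV_cong_ev[THEN iffD1, rotated -1])
         (use \<open>t < 0\<close> in \<open>auto simp: flat_exp_def eventually_nhds intro!: exI[of _ "{..<0}"]\<close>)
  qed
qed

lemma Ck_on_flat_exp: "Ck_on k UNIV (flat_exp n)"
proof (induction k arbitrary: n)
  case 0
  show ?case
    using DERIV_isCont[OF flat_exp_has_derivative] by (simp add: continuous_at_imp_continuous_on)
next
  case (Suc k)
  show ?case
  proof (rule Ck_on_SucI)
    show "(flat_exp n has_derivative (\<lambda>v. (flat_exp (n + 2) t + (- real n) * flat_exp (Suc n) t) * v)) (at t)" for t
      using flat_exp_has_derivative[of n t] by (simp add: has_field_derivative_def)
    show "Ck_on k UNIV (\<lambda>t. (flat_exp (n + 2) t + - real n * flat_exp (Suc n) t) * v)" for v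
      by (intro Ck_on_mult Ck_on_add Ck_on_const open_UNIV Suc)
  qed simp
qed

text \<open>The squared norm is a polynomial and hence smooth at the origin too.\<close>

definition bump :: "real \<Rightarrow> 'a::euclidean_space \<Rightarrow> real" where
  "bump r x = flat_exp 0 (r\<^sup>2 - x \<bullet> x)"

lemma smooth_on_bump: "smooth_on UNIV (bump r)"
  unfolding smooth_on_def
proof
  fix k
  have 1: "Ck_on k UNIV (\<lambda>x::'a. x \<bullet> b)" for b
    by (rule Ck_on_bounded_linear[OF _ _ Ck_on_ident]) (auto intro: bounded_linear_inner_left)
  have 2: "Ck_on k UNIV (\<lambda>x::'a. \<Sum>b\<in>B. (- (x \<bullet> b)) * (x \<bullet> b))" if "finite B" for B
    using that
  proof (induction B)
    case (insert b B)
    have "Ck_on k UNIV (\<lambda>x::'a. (-1) * (x \<bullet> b) * (x \<bullet> b))"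
      by (intro Ck_on_mult 1 Ck_on_const open_UNIV)
    then have "Ck_on k UNIV (\<lambda>x::'a. (-1) * (x \<bullet> b) * (x \<bullet> b) + (\<Sum>b\<in>B. (- (x \<bullet> b)) * (x \<bullet> b)))"
      using insert by (intro Ck_on_add open_UNIV)
    with insert show ?case by (simp cong: if_cong)
  qed (simp add: Ck_on_const)
  have "Ck_on k UNIV (\<lambda>x::'a. r\<^sup>2 + (\<Sum>b\<in>Basis. (- (x \<bullet> b)) * (x \<bullet> b)))"
    by (intro Ck_on_add Ck_on_const open_UNIV 2 finite_Basis)
  moreover have "r\<^sup>2 + (\<Sum>b\<in>Basis. (- (x \<bullet> b)) * (x \<bullet> b)) = r\<^sup>2 - x \<bullet> x" for x :: 'a
    by (subst (3) euclidean_inner) (simp add: sum_negf)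
  ultimately have "Ck_on k UNIV (\<lambda>x::'a. r\<^sup>2 - x \<bullet> x)" by simp
  then show "Ck_on k UNIV (bump r :: 'a \<Rightarrow> real)"
    unfolding bump_def using Ck_on_compose_1D[OF open_UNIV Ck_on_flat_exp] by blast
qed

lemma bump_nonneg: "bump r x \<ge> 0"
  by (simp add: bump_def flat_exp_def)

lemma bump_pos_iff:
  assumes "r > 0"
  shows "bump r x \<noteq> 0 \<longleftrightarrow> norm x < r"
proof -
  have "norm x < r \<longleftrightarrow> x \<bullet> x < r\<^sup>2"
    unfolding power2_norm_eq_inner[symmetric] using assms
    by (metis less_imp_le norm_ge_zero pos2 power_strict_mono power_less_imp_less_base)
  then show ?thesis by (auto simp: bump_def flat_exp_def)
qed

lemma smooth_on_mult:
  fixes f g :: "'a::euclidean_space \<Rightarrow> real"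
  assumes "open U" "smooth_on U f" "smooth_on U g"
  shows "smooth_on U (\<lambda>x. f x * g x)"
  using assms Ck_on_mult unfolding smooth_on_def by blast

lemma smooth_on_affine:
  assumes "bounded_linear L" "smooth_on UNIV f"
  shows "smooth_on UNIV (\<lambda>x. f (a + L x))"
  using assms Ck_on_affine unfolding smooth_on_def by blast

lemma smooth_on_const: "smooth_on U (\<lambda>x. c)"
  by (simp add: smooth_on_def Ck_on_const)

lemma smooth_on_frechet_derivative:
  assumes "smooth_on U f"
  shows "smooth_on U (\<lambda>x. frechet_derivative f (at x) v)"
  using assms unfolding smooth_on_def by (metis Ck_on.simps(2))

lemma smooth_on_has_derivative:
  assumes "smooth_on U f" "x \<in> U"
  shows "(f has_derivative frechet_derivative f (at x)) (at x)"
  using assms Ck_on_has_derivative smooth_on_def by blast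

lemma smooth_on_continuous_on: "smooth_on U f \<Longrightarrow> continuous_on U f"
  by (metis Ck_on.simps(1) smooth_on_def)

text \<open>The second difference of \<open>f\<close> over the parallelogram with sides
  \<open>h u\<close> and \<open>h v\<close> is evaluated by the mean value theorem twice, once in
  each direction. It is symmetric in \<open>u\<close> and \<open>v\<close>, so exchanging them turns
  the same number into a value of the other mixed derivative.\<close>

lemma mixed_derivative_step:
  fixes f :: "'a::real_normed_vector \<Rightarrow> real"
  assumes h: "h > 0"
    and f: "\<And>x. x \<in> U \<Longrightarrow> (f has_derivative f' x) (at x)"
    and g: "\<And>x. x \<in> U \<Longrightarrow> ((\<lambda>x. f' x u) has_derivative f'' x) (at x)"
    and U: "\<And>s t. 0 \<le> s \<Longrightarrow> s \<le> h \<Longrightarrow> 0 \<le> t \<Longrightarrow> t \<le> h \<Longrightarrow> a + s *\<^sub>R u + t *\<^sub>R v \<in> U"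
  shows "\<exists>s t. 0 < s \<and> s < h \<and> 0 < t \<and> t < h \<and>
      f (a + h *\<^sub>R u + h *\<^sub>R v) - f (a + h *\<^sub>R u) - f (a + h *\<^sub>R v) + f a = h * h * f'' (a + s *\<^sub>R u + t *\<^sub>R v) v"
proof -
  define \<phi> where "\<phi> s = f (a + s *\<^sub>R u + h *\<^sub>R v) - f (a + s *\<^sub>R u + 0 *\<^sub>R v)" for s
  have df: "((\<lambda>s. f (a + s *\<^sub>R u + t *\<^sub>R v)) has_real_derivative f' (a + s *\<^sub>R u + t *\<^sub>R v) u) (at s)"
    if "0 \<le> s" "s \<le> h" "0 \<le> t" "t \<le> h" for s t
  proof -
    interpret l: linear "f' (a + s *\<^sub>R u + t *\<^sub>R v)" using f[OF U[OF that]] has_derivative_linear by blast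
    have "((\<lambda>s. a + s *\<^sub>R u + t *\<^sub>R v) has_derivative (\<lambda>r. r *\<^sub>R u)) (at s)"
      by (auto intro!: derivative_eq_intros)
    from has_derivative_compose[OF this f[OF U[OF that]]] show ?thesis
      by (simp add: has_field_derivative_def l.scaleR mult.commute[of _ "f' _ u"])
  qed
  have "\<exists>s. 0 < s \<and> s < h \<and> \<phi> h - \<phi> 0 = (h - 0) * (f' (a + s *\<^sub>R u + h *\<^sub>R v) u - f' (a + s *\<^sub>R u + 0 *\<^sub>R v) u)"
  proof (rule MVT2[OF h])
    fix s assume "0 \<le> s" "s \<le> h"
    then show "(\<phi> has_real_derivative f' (a + s *\<^sub>R u + h *\<^sub>R v) u - f' (a + s *\<^sub>R u + 0 *\<^sub>R v) u) (at s)"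
      unfolding \<phi>_def by (intro DERIV_diff df) (use h in auto)
  qed
  then obtain s where s: "0 < s" "s < h" "\<phi> h - \<phi> 0 = h * (f' (a + s *\<^sub>R u + h *\<^sub>R v) u - f' (a + s *\<^sub>R u + 0 *\<^sub>R v) u)"
    by auto
  have "\<exists>t. 0 < t \<and> t < h \<and> f' (a + s *\<^sub>R u + h *\<^sub>R v) u - f' (a + s *\<^sub>R u + 0 *\<^sub>R v) u = (h - 0) * f'' (a + s *\<^sub>R u + t *\<^sub>R v) v"
  proof (rule MVT2[OF h])
    fix t assume t: "0 \<le> t" "t \<le> h"
    have x: "a + s *\<^sub>R u + t *\<^sub>R v \<in> U" using U t s by simp
    interpret l: linear "f'' (a + s *\<^sub>R u + t *\<^sub>R v)" using g[OF x] has_derivative_linear by blast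
    have "((\<lambda>t. a + s *\<^sub>R u + t *\<^sub>R v) has_derivative (\<lambda>r. r *\<^sub>R v)) (at t)"
      by (auto intro!: derivative_eq_intros)
    from has_derivative_compose[OF this g[OF x]]
    show "((\<lambda>t. f' (a + s *\<^sub>R u + t *\<^sub>R v) u) has_real_derivative f'' (a + s *\<^sub>R u + t *\<^sub>R v) v) (at t)"
      by (simp add: has_field_derivative_def l.scaleR mult.commute[of _ "f'' _ v"])
  qed
  then obtain t where t: "0 < t" "t < h"
    "f' (a + s *\<^sub>R u + h *\<^sub>R v) u - f' (a + s *\<^sub>R u + 0 *\<^sub>R v) u = h * f'' (a + s *\<^sub>R u + t *\<^sub>R v) v"
    by auto
  have "f (a + h *\<^sub>R u + h *\<^sub>R v) - f (a + h *\<^sub>R u) - f (a + h *\<^sub>R v) + f a = \<phi> h - \<phi> 0"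
    by (simp add: \<phi>_def)
  also have "\<dots> = h * h * f'' (a + s *\<^sub>R u + t *\<^sub>R v) v"
    using s(3) t(3) by simp
  finally show ?thesis using s t by blast
qed

lemma mixed_derivatives_commute:
  fixes f :: "'a::real_normed_vector \<Rightarrow> real"
  assumes "open U" "a \<in> U"
    and f: "\<And>x. x \<in> U \<Longrightarrow> (f has_derivative f' x) (at x)"
    and gu: "\<And>x. x \<in> U \<Longrightarrow> ((\<lambda>x. f' x u) has_derivative fu x) (at x)"
    and gv: "\<And>x. x \<in> U \<Longrightarrow> ((\<lambda>x. f' x v) has_derivative fv x) (at x)"
    and cu: "continuous_on U (\<lambda>x. fu x v)" and cv: "continuous_on U (\<lambda>x. fv x u)"
  shows "fu a v = fv a u"
proof (rule ccontr)
  assume ne: "fu a v \<noteq> fv a u"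
  \<comment> \<open>Half the gap: numbers strictly within \<open>e\<close> of the two values cannot
    coincide.\<close>
  define e where "e = \<bar>fu a v - fv a u\<bar> / 2"
  have e: "e > 0" using ne by (simp add: e_def)
  have "((\<lambda>x. fu x v) \<longlongrightarrow> fu a v) (at a)" "((\<lambda>x. fv x u) \<longlongrightarrow> fv a u) (at a)"
    using cu cv assms(1,2) continuous_on_eq_continuous_at isCont_def by blast+
  then have "eventually (\<lambda>x. dist (fu x v) (fu a v) < e) (nhds a)" "eventually (\<lambda>x. dist (fv x u) (fv a u) < e) (nhds a)"
    using e by (auto simp: tendsto_iff eventually_at_filter elim!: eventually_mono) 
  moreover have "eventually (\<lambda>x. x \<in> U) (nhds a)" using assms eventually_nhds_in_open by blast
  ultimately have "eventually (\<lambda>x. dist (fu x v) (fu a v) < e \<and> dist (fv x u) (fv a u) < e \<and> x \<in> U) (nhds a)"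
    by eventually_elim auto
  then obtain d where d: "d > 0" "\<And>x. dist x a < d \<Longrightarrow> dist (fu x v) (fu a v) < e \<and> dist (fv x u) (fv a u) < e \<and> x \<in> U"
    by (auto simp: eventually_nhds_metric)
  \<comment> \<open>Small enough for the whole parallelogram to stay within distance
    \<open>d\<close> of \<open>a\<close>; the summand 1 keeps the denominator positive when both
    vectors are zero.\<close>
  define h where "h = d / (2 * (norm u + norm v + 1))"
  have h: "h > 0" using d(1) by (auto simp: h_def intro!: divide_pos_pos add_nonneg_pos)
  have near: "dist (a + s *\<^sub>R u + t *\<^sub>R v) a < d" if "0 \<le> s" "s \<le> h" "0 \<le> t" "t \<le> h" for s t
  proof -
    have "dist (a + s *\<^sub>R u + t *\<^sub>R v) a \<le> s * norm u + t * norm v"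
      using norm_triangle_ineq[of "s *\<^sub>R u" "t *\<^sub>R v"] that by (simp add: dist_norm add.assoc)
    also have "\<dots> \<le> h * norm u + h * norm v" using that by (intro add_mono mult_right_mono) auto
    also have "\<dots> \<le> h * (norm u + norm v + 1)" using h by (simp add: algebra_simps)
    also have "\<dots> = d / 2"
    proof -
      have "norm u + norm v + 1 \<noteq> 0" using norm_ge_zero[of u] norm_ge_zero[of v] by linarith
      then have "h * (norm u + norm v + 1) = d / 2"
        unfolding h_def by (subst times_divide_eq_left, subst mult_divide_mult_cancel_right) auto
      then show ?thesis .
    qed
    finally show ?thesis using d(1) by linarith
  qed
  obtain s t where st: "0 < s" "s < h" "0 < t" "t < h" and
    1: "f (a + h *\<^sub>R u + h *\<^sub>R v) - f (a + h *\<^sub>R u) - f (a + h *\<^sub>R v) + f a = h * h * fu (a + s *\<^sub>R u + t *\<^sub>R v) v"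
    using mixed_derivative_step[where U = U and a = a and v = v, OF h f gu] d(2)[OF near] by auto
  have near': "dist (a + s *\<^sub>R v + t *\<^sub>R u) a < d" if "0 \<le> s" "s \<le> h" "0 \<le> t" "t \<le> h" for s t
    using near[OF that(3,4,1,2)] by (simp add: algebra_simps)
  obtain s' t' where st': "0 < s'" "s' < h" "0 < t'" "t' < h" and
    2: "f (a + h *\<^sub>R v + h *\<^sub>R u) - f (a + h *\<^sub>R v) - f (a + h *\<^sub>R u) + f a = h * h * fv (a + s' *\<^sub>R v + t' *\<^sub>R u) u"
    using mixed_derivative_step[where U = U and a = a and v = u, OF h f gv] d(2)[OF near'] by auto
  have "fu (a + s *\<^sub>R u + t *\<^sub>R v) v = fv (a + s' *\<^sub>R v + t' *\<^sub>R u) u"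
    using 1 2 h by (simp add: add.commute add.left_commute algebra_simps)
  then show False
    using d(2)[OF near] d(2)[OF near'] st st' unfolding e_def dist_real_def
    by (smt (verit) less_eq_real_def field_sum_of_halves)
qed

section \<open>Mollification\<close>

lemma nn_integral_lborel_translation:
  fixes f :: "'a::euclidean_space \<Rightarrow> ennreal"
  assumes [measurable]: "f \<in> borel_measurable borel"
  shows "(\<integral>\<^sup>+y. f (z + y) \<partial>lborel) = (\<integral>\<^sup>+y. f y \<partial>lborel)"
  using nn_integral_distr[of "(+) z" lborel borel f] lborel_distr_plus[of z] by simp

lemma integral_lborel_translation:
  fixes f :: "'a::euclidean_space \<Rightarrow> real"
  assumes [measurable]: "f \<in> borel_measurable borel"
  shows "(\<integral>y. f (z + y) \<partial>lborel) = (\<integral>y. f y \<partial>lborel)"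
  using integral_distr[of "(+) z" lborel borel f] lborel_distr_plus[of z] by simp

lemma integrable_lborel_translation:
  fixes f :: "'a::euclidean_space \<Rightarrow> real"
  assumes "integrable lborel f"
  shows "integrable lborel (\<lambda>y. f (z + y))"
  using integrable_distr[of "(+) z" lborel borel f] lborel_distr_plus[of z] assms by simp

text \<open>A set of finite measure is enclosed between a compact \<open>K\<close> and an open
  \<open>U\<close> whose difference is small. When \<open>z\<close> is so short that translation by
  it or its negative keeps \<open>K\<close> inside \<open>U\<close>, the two indicators can differ
  at \<open>y\<close> only if \<open>y\<close> or \<open>z + y\<close> lies in
  \<open>U - K\<close>.\<close>

lemma L1_translation_indicator:
  fixes A :: "'a::euclidean_space set"
  assumes A: "A \<in> sets borel" "emeasure lborel A < \<infinity>" and e: "e > 0"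
  shows "\<exists>d>0. \<forall>z. norm z < d \<longrightarrow>
    (\<integral>\<^sup>+y. ennreal \<bar>indicator A (z + y) - indicator A y\<bar> \<partial>lborel) \<le> ennreal e"
proof -
  obtain U where U: "open U" "A \<subseteq> U" "emeasure lborel (U - A) < ennreal (e / 4)"
    using outer_regular_lborel[OF A(1), of "e / 4"] e by auto
  \<comment> \<open>Inner regularity by compact sets is a property of finite measures, and Lebesgue
    measure restricted to \<open>A\<close> is one.\<close>
  define M where "M = density lborel (indicator A :: 'a \<Rightarrow> ennreal)"
  have emM: "emeasure M B = emeasure lborel (A \<inter> B)" if "B \<in> sets borel" for B
    using A(1) that by (simp add: M_def emeasure_density indicator_inter_arith[symmetric])
  have "emeasure M A = (SUP K \<in> {K. K \<subseteq> A \<and> compact K}. emeasure M K)"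
    using A by (intro inner_regular) (auto simp: M_def emM[unfolded M_def] sets_eq_imp_space_eq[of _ borel])
  moreover have "emeasure M A = emeasure lborel A" using A emM by simp
  ultimately have SUP: "(SUP K \<in> {K. K \<subseteq> A \<and> compact K}. emeasure M K) = emeasure lborel A" by simp
  obtain K where K: "K \<subseteq> A" "compact K" "emeasure lborel A < emeasure lborel K + ennreal (e / 4)"
  \<comment> \<open>The strict inequality that selects \<open>K\<close> from the supremum fails for
    a null set, where the empty set serves.\<close>
  proof (cases "emeasure lborel A = 0")
    case True
    then show ?thesis using that[of "{}"] e by auto
  next
    case False
    have "emeasure lborel A - ennreal (e / 4) < emeasure lborel A"
      using False A e by (intro ennreal_between) (auto simp: zero_less_iff_neq_zero)
    then obtain K where K: "K \<subseteq> A" "compact K" "emeasure lborel A - ennreal (e / 4) < emeasure M K"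
      using SUP by (metis (no_types, lifting) less_SUP_iff mem_Collect_eq)
    moreover have "emeasure M K = emeasure lborel K"
      using K by (subst emM) (auto simp: Int_absorb1 borel_compact)
    moreover have "emeasure lborel A < emeasure lborel K + ennreal (e / 4)"
    proof (rule ccontr)
      assume "\<not> ?thesis"
      then have "(emeasure lborel K + ennreal (e / 4)) - ennreal (e / 4) \<le> emeasure lborel A - ennreal (e / 4)"
        by (intro ennreal_minus_mono) (auto simp: not_less)
      then show False using calculation by (auto simp: ennreal_add_diff_cancel_right not_less[symmetric])
    qed
    ultimately show ?thesis using that[of K] by blast
  qed
  have [measurable]: "A \<in> sets borel" "K \<in> sets borel" "U \<in> sets borel"
    using A K U by (auto simp: borel_compact)
  have Kfin: "emeasure lborel K < \<infinity>" using K(1) A emeasure_mono[of K A lborel] by (auto simp: le_less_trans)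
  have AK: "emeasure lborel (A - K) \<le> ennreal (e / 4)"
    using K A Kfin by (subst emeasure_Diff) (auto simp: ennreal_minus_le_iff less_imp_le)
  have "emeasure lborel (U - K) \<le> emeasure lborel (U - A) + emeasure lborel (A - K)"
    by (rule order_trans[OF emeasure_mono emeasure_subadditive]) auto
  also have "\<dots> \<le> ennreal (e / 4) + ennreal (e / 4)" using U(3) AK by (intro add_mono) auto
  also have "\<dots> = ennreal (e / 2)" using e by (simp flip: ennreal_plus)
  finally have UK: "emeasure lborel (U - K) \<le> ennreal (e / 2)" .
  obtain d where d: "d > 0" "(\<Union>x\<in>K. cball x d) \<subseteq> U"
    using compact_subset_open_imp_cball_epsilon_subset[OF K(2) U(1)] K(1) U(2) by blast
  have "(\<integral>\<^sup>+y. ennreal \<bar>indicator A (z + y) - indicator A y\<bar> \<partial>lborel) \<le> ennreal e" if "norm z < d" for z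
  proof -
    have inU: "x + z \<in> U" "x - z \<in> U" if "x \<in> K" for x
      using d(2) that \<open>norm z < d\<close> by (auto simp: dist_norm subset_eq dest!: bspec)
    have "(\<integral>\<^sup>+y. ennreal \<bar>indicator A (z + y) - indicator A y\<bar> \<partial>lborel)
        \<le> (\<integral>\<^sup>+y. indicator (U - K) (z + y) + indicator (U - K) y \<partial>lborel)"
    proof (intro nn_integral_mono)
      fix y
      have "ennreal 1 \<le> 1" by simp
      then show "ennreal \<bar>indicator A (z + y) - indicator A y\<bar> \<le> indicator (U - K) (z + y) + indicator (U - K) y"
        using inU[of "z + y"] inU[of y] K(1) U(2)
        by (auto simp: indicator_def add.commute split: if_splits)
    qed
    also have "\<dots> = emeasure lborel (U - K) + emeasure lborel (U - K)"
      by (subst nn_integral_add) (simp_all add: nn_integral_lborel_translation)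
    also have "\<dots> \<le> ennreal (e / 2) + ennreal (e / 2)" using UK by (intro add_mono)
    also have "\<dots> = ennreal e" using e by (simp flip: ennreal_plus)
    finally show ?thesis .
  qed
  with d(1) show ?thesis by blast
qed

text \<open>A density argument in the form of induction over integrable functions: multiples of
  indicators, sums, dominated limits. In the limit case the translate is compared through a term
  \<open>s i\<close> of the sequence, and the translated error equals the untranslated one by
  invariance of the measure.\<close>

lemma L1_translation:
  fixes u :: "'a::euclidean_space \<Rightarrow> real"
  assumes "integrable lborel u"
  shows "\<forall>e>0. \<exists>d>0. \<forall>z. norm z < d \<longrightarrow> (\<integral>\<^sup>+y. ennreal \<bar>u (z + y) - u y\<bar> \<partial>lborel) \<le> ennreal e"
  using assms
proof (induction rule: integrable_induct)
  case (base A c)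
  show ?case
  proof (intro allI impI)
    fix e :: real assume e: "e > 0"
    obtain d where d: "d > 0" "\<And>z. norm z < d \<Longrightarrow>
        (\<integral>\<^sup>+y. ennreal \<bar>indicator A (z + y) - indicator A y\<bar> \<partial>lborel) \<le> ennreal (e / (\<bar>c\<bar> + 1))"
      using L1_translation_indicator[of A "e / (\<bar>c\<bar> + 1)"] base e by auto
    have [measurable]: "A \<in> sets borel" using base by simp
    have "(\<integral>\<^sup>+y. ennreal \<bar>indicator A (z + y) *\<^sub>R c - indicator A y *\<^sub>R c\<bar> \<partial>lborel) \<le> ennreal e" if "norm z < d" for z
    proof -
      have "(\<integral>\<^sup>+y. ennreal \<bar>indicator A (z + y) *\<^sub>R c - indicator A y *\<^sub>R c\<bar> \<partial>lborel)
        = (\<integral>\<^sup>+y. ennreal \<bar>c\<bar> * ennreal \<bar>indicator A (z + y) - indicator A y\<bar> \<partial>lborel)"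
        by (intro nn_integral_cong) (simp add: mult.commute flip: ennreal_mult abs_mult right_diff_distrib)
      also have "\<dots> = ennreal \<bar>c\<bar> * (\<integral>\<^sup>+y. ennreal \<bar>indicator A (z + y) - indicator A y\<bar> \<partial>lborel)"
        by (rule nn_integral_cmult) measurable
      also have "\<dots> \<le> ennreal \<bar>c\<bar> * ennreal (e / (\<bar>c\<bar> + 1))"
        using d(2)[OF that] by (intro mult_left_mono) auto
      also have "\<dots> \<le> ennreal e" using e
        by (simp add: divide_simps flip: ennreal_mult) 
      finally show ?thesis .
    qed
    with d(1) show "\<exists>d>0. \<forall>z. norm z < d \<longrightarrow> (\<integral>\<^sup>+y. ennreal \<bar>indicator A (z + y) *\<^sub>R c - indicator A y *\<^sub>R c\<bar> \<partial>lborel) \<le> ennreal e"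
      by blast
  qed
next
  case (add f g)
  have [measurable]: "f \<in> borel_measurable borel" "g \<in> borel_measurable borel" using add by auto
  show ?case
  proof (intro allI impI)
    fix e :: real assume e: "e > 0"
    then have "e / 2 > 0" by simp
    from add.IH(1)[rule_format, OF this] add.IH(2)[rule_format, OF this]
    obtain d1 d2 where d: "d1 > 0" "d2 > 0"
      "\<And>z. norm z < d1 \<Longrightarrow> (\<integral>\<^sup>+y. ennreal \<bar>f (z + y) - f y\<bar> \<partial>lborel) \<le> ennreal (e / 2)"
      "\<And>z. norm z < d2 \<Longrightarrow> (\<integral>\<^sup>+y. ennreal \<bar>g (z + y) - g y\<bar> \<partial>lborel) \<le> ennreal (e / 2)"
      by blast
    have "(\<integral>\<^sup>+y. ennreal \<bar>(f (z + y) + g (z + y)) - (f y + g y)\<bar> \<partial>lborel) \<le> ennreal e" if "norm z < min d1 d2" for z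
    proof -
      have "(\<integral>\<^sup>+y. ennreal \<bar>(f (z + y) + g (z + y)) - (f y + g y)\<bar> \<partial>lborel)
         \<le> (\<integral>\<^sup>+y. ennreal \<bar>f (z + y) - f y\<bar> + ennreal \<bar>g (z + y) - g y\<bar> \<partial>lborel)"
        by (intro nn_integral_mono) (auto simp flip: ennreal_plus intro!: ennreal_leI)
      also have "\<dots> \<le> ennreal (e / 2) + ennreal (e / 2)"
        using d(3,4)[of z] that by (subst nn_integral_add) (auto intro!: add_mono)
      also have "\<dots> = ennreal e" using e by (simp flip: ennreal_plus)
      finally show ?thesis .
    qed
    then show "\<exists>d>0. \<forall>z. norm z < d \<longrightarrow> (\<integral>\<^sup>+y. ennreal \<bar>(f (z + y) + g (z + y)) - (f y + g y)\<bar> \<partial>lborel) \<le> ennreal e"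
      using d(1,2) by (intro exI[of _ "min d1 d2"]) auto
  qed
next
  case (lim f s)
  have [measurable]: "f \<in> borel_measurable borel" "\<And>i. s i \<in> borel_measurable borel" using lim by auto
  show ?case
  proof (intro allI impI)
    fix e :: real assume e: "e > 0"
    have "(\<lambda>i. \<integral>\<^sup>+x. norm (f x - s i x) \<partial>lborel) \<longlonglongrightarrow> 0"
    proof (rule nn_integral_dominated_convergence_norm[where w = "\<lambda>x. 2 * norm (f x)"])
      show "AE x in lborel. (\<lambda>i. s i x) \<longlonglongrightarrow> f x" using lim by auto
      show "AE x in lborel. norm (s j x) \<le> 2 * norm (f x)" for j using lim by auto
      show "(\<integral>\<^sup>+ x. ennreal (2 * norm (f x)) \<partial>lborel) < \<infinity>"
        using lim(4)
        by (auto simp: integrable_iff_bounded ennreal_mult nn_integral_cmult ennreal_mult_less_top)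
    qed auto
    then have "(\<lambda>i. \<integral>\<^sup>+x. norm (s i x - f x) \<partial>lborel) \<longlonglongrightarrow> 0"
      by (simp add: abs_minus_commute)
    then have "eventually (\<lambda>i. (\<integral>\<^sup>+x. norm (s i x - f x) \<partial>lborel) < ennreal (e / 3)) sequentially"
      using e by (intro order_tendstoD) auto
    then obtain i where i: "(\<integral>\<^sup>+x. norm (s i x - f x) \<partial>lborel) < ennreal (e / 3)"
      by (auto simp: eventually_sequentially)
    obtain d where d: "d > 0" "\<And>z. norm z < d \<Longrightarrow> (\<integral>\<^sup>+y. ennreal \<bar>s i (z + y) - s i y\<bar> \<partial>lborel) \<le> ennreal (e / 3)"
      using lim.IH[of i, rule_format, of "e / 3"] e by auto
    have "(\<integral>\<^sup>+y. ennreal \<bar>f (z + y) - f y\<bar> \<partial>lborel) \<le> ennreal e" if "norm z < d" for z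
    proof -
      have "(\<integral>\<^sup>+y. ennreal \<bar>f (z + y) - f y\<bar> \<partial>lborel)
         \<le> (\<integral>\<^sup>+y. ennreal \<bar>s i (z + y) - f (z + y)\<bar> + (ennreal \<bar>s i (z + y) - s i y\<bar> + ennreal \<bar>s i y - f y\<bar>) \<partial>lborel)"
        by (intro nn_integral_mono) (auto simp flip: ennreal_plus intro!: ennreal_leI)
      also have "\<dots> = (\<integral>\<^sup>+y. ennreal \<bar>s i (z + y) - f (z + y)\<bar> \<partial>lborel) + ((\<integral>\<^sup>+y. ennreal \<bar>s i (z + y) - s i y\<bar> \<partial>lborel) + (\<integral>\<^sup>+y. ennreal \<bar>s i y - f y\<bar> \<partial>lborel))"
        by (simp add: nn_integral_add)
      also have "(\<integral>\<^sup>+y. ennreal \<bar>s i (z + y) - f (z + y)\<bar> \<partial>lborel) = (\<integral>\<^sup>+y. ennreal \<bar>s i y - f y\<bar> \<partial>lborel)"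
        by (rule nn_integral_lborel_translation[of "\<lambda>y. ennreal \<bar>s i y - f y\<bar>"]) simp
      also have "(\<integral>\<^sup>+y. ennreal \<bar>s i y - f y\<bar> \<partial>lborel) + ((\<integral>\<^sup>+y. ennreal \<bar>s i (z + y) - s i y\<bar> \<partial>lborel) + (\<integral>\<^sup>+y. ennreal \<bar>s i y - f y\<bar> \<partial>lborel))
         \<le> ennreal (e / 3) + (ennreal (e / 3) + ennreal (e / 3))"
        using i d(2)[OF that] by (intro add_mono) auto
      also have "\<dots> = ennreal e" using e by (simp flip: ennreal_plus)
      finally show ?thesis .
    qed
    with d(1) show "\<exists>d>0. \<forall>z. norm z < d \<longrightarrow> (\<integral>\<^sup>+y. ennreal \<bar>f (z + y) - f y\<bar> \<partial>lborel) \<le> ennreal e"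
      by blast
  qed
qed


lemma integrable_bounded_mult:
  fixes f g :: "'a \<Rightarrow> real"
  assumes "integrable M f" "g \<in> borel_measurable M" "AE x in M. \<bar>g x\<bar> \<le> B"
  shows "integrable M (\<lambda>x. f x * g x)"
proof (rule Bochner_Integration.integrable_bound)
  show "integrable M (\<lambda>x. B * f x)" using assms by simp
  show "AE x in M. norm (f x * g x) \<le> norm (B * f x)"
    using assms(3)
  proof eventually_elim
    case (elim x)
    then have "\<bar>f x\<bar> * \<bar>g x\<bar> \<le> \<bar>f x\<bar> * \<bar>B\<bar>" by (intro mult_left_mono) auto
    then show ?case by (simp add: abs_mult mult.commute)
  qed
qed (use assms in auto)

section \<open>Mollifiers and convergence of mollifications\<close>

lemma continuous_on_bump: "continuous_on UNIV (bump r)"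
  by (rule smooth_on_continuous_on[OF smooth_on_bump])

lemma borel_measurable_bump [measurable]: "bump r \<in> borel_measurable borel"
  by (rule borel_measurable_continuous_onI[OF continuous_on_bump])

lemma bump_le_1: "bump r x \<le> 1"
  by (simp add: bump_def flat_exp_def)

lemma integrable_bump:
  assumes "r > 0"
  shows "integrable lborel (bump r :: 'a::euclidean_space \<Rightarrow> real)"
proof -
  have "integrable lborel (\<lambda>x::'a. indicator (cball 0 r) x *\<^sub>R bump r x)"
    by (intro borel_integrable_compact continuous_on_subset[OF continuous_on_bump]) auto
  moreover have "(\<lambda>x::'a. indicator (cball 0 r) x *\<^sub>R bump r x) = bump r"
    using bump_pos_iff[OF assms] by (force simp: indicator_def)
  ultimately show ?thesis by (simp only:)
qed

lemma integral_bump_pos: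
  assumes "r > 0"
  shows "(\<integral>x. bump r (x :: 'a::euclidean_space) \<partial>lborel) > 0"
proof (rule ccontr)
  assume "\<not> ?thesis"
  moreover have "(\<integral>x. bump r (x :: 'a) \<partial>lborel) \<ge> 0" by (simp add: bump_nonneg)
  ultimately have "(\<integral>x. bump r (x :: 'a) \<partial>lborel) = 0" by simp
  then have "AE x in lborel. bump r (x :: 'a) = 0"
    using integral_nonneg_eq_0_iff_AE[OF integrable_bump[OF assms, where 'a = 'a]] by (simp add: bump_nonneg)
  then have "AE x in lborel. (x :: 'a) \<notin> ball 0 r"
    using bump_pos_iff[OF assms] by (auto elim!: AE_mp)
  then have "emeasure lborel (ball (0 :: 'a) r) = 0"
    by (subst AE_iff_measurable[symmetric, where P = "\<lambda>x. x \<notin> ball 0 r"]) auto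
  then have "ball (0::'a) r \<in> null_sets lebesgue" by (auto simp: null_sets_def)
  then have "negligible (ball (0::'a) r)" by (simp add: negligible_iff_null_sets)
  then show False using open_not_negligible[of "ball (0::'a) r"] assms by auto
qed

definition mollifier :: "nat \<Rightarrow> 'a::euclidean_space \<Rightarrow> real" where
  "mollifier n z = bump (inverse (real (Suc n))) z * inverse (\<integral>x. bump (inverse (real (Suc n))) (x::'a) \<partial>lborel)"

lemma smooth_on_mollifier: "smooth_on UNIV (mollifier n)"
  unfolding mollifier_def by (intro smooth_on_mult smooth_on_bump smooth_on_const open_UNIV)

lemma borel_measurable_mollifier [measurable]: "mollifier n \<in> borel_measurable borel"
  unfolding mollifier_def by measurable

lemma mollifier_nonneg: "mollifier n z \<ge> 0"
  using integral_bump_pos[of "inverse (real (Suc n))"] by (simp add: mollifier_def bump_nonneg)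

lemma mollifier_nonzero_iff: "mollifier n (z::'a::euclidean_space) \<noteq> 0 \<longleftrightarrow> norm z < inverse (real (Suc n))"
  using integral_bump_pos[of "inverse (real (Suc n))", where 'a = 'a] bump_pos_iff[of "inverse (real (Suc n))" z]
  by (simp add: mollifier_def)

text \<open>Evenness lets a convolution move from one factor of an integral to the other without
  reflecting the kernel.\<close>

lemma mollifier_uminus: "mollifier n (- z) = mollifier n z"
  by (simp add: mollifier_def bump_def)

lemma integrable_mollifier: "integrable lborel (mollifier n)"
  unfolding mollifier_def by (intro integrable_mult_left integrable_bump) simp

lemma integral_mollifier: "(\<integral>x. mollifier n (x::'a::euclidean_space) \<partial>lborel) = 1"
  using integral_bump_pos[of "inverse (real (Suc n))", where 'a = 'a]
  by (simp add: mollifier_def)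

lemma mollifier_bounded: "\<exists>B. \<forall>z. \<bar>mollifier n (z::'a::euclidean_space)\<bar> \<le> B"
proof -
  let ?I = "inverse (\<integral>x. bump (inverse (real (Suc n))) (x::'a) \<partial>lborel)"
  have "\<bar>mollifier n z\<bar> \<le> 1 * \<bar>?I\<bar>" for z :: 'a
    unfolding mollifier_def abs_mult using bump_le_1[of _ z] bump_nonneg[of _ z]
    by (intro mult_right_mono) auto
  then show ?thesis by blast
qed

text \<open>Since the mollifier has mass one, the error at \<open>y\<close> is an average of the
  differences \<open>u (z + y) - u y\<close>. Tonelli exchanges the average with the integral over
  \<open>y\<close>, and every translation that contributes is shorter than \<open>d\<close>.\<close>

lemma mollification_L1:
  fixes u :: "'a::euclidean_space \<Rightarrow> real"
  assumes u: "integrable lborel u" and e: "e > 0"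
    and d: "\<And>z. norm z < d \<Longrightarrow> (\<integral>\<^sup>+y. ennreal \<bar>u (z + y) - u y\<bar> \<partial>lborel) \<le> ennreal e"
    and n: "inverse (real (Suc n)) \<le> d"
  shows "(\<integral>\<^sup>+y. ennreal \<bar>(\<integral>x. u x * mollifier n (x - y) \<partial>lborel) - u y\<bar> \<partial>lborel) \<le> ennreal e"
proof -
  have [measurable]: "u \<in> borel_measurable borel" using u by auto
  obtain B where B: "\<And>z. \<bar>mollifier n (z::'a)\<bar> \<le> B" using mollifier_bounded by blast
  have 1: "ennreal \<bar>(\<integral>x. u x * mollifier n (x - y) \<partial>lborel) - u y\<bar> \<le> (\<integral>\<^sup>+z. ennreal (\<bar>u (z + y) - u y\<bar> * mollifier n z) \<partial>lborel)" for y
  proof -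
    have 2: "(\<integral>x. u x * mollifier n (x - y) \<partial>lborel) = (\<integral>z. u (y + z) * mollifier n z \<partial>lborel)"
      using integral_lborel_translation[of "\<lambda>x. u x * mollifier n (x - y)" y] by simp
    have i1: "integrable lborel (\<lambda>z. u (y + z) * mollifier n z)"
      by (rule integrable_bounded_mult[OF integrable_lborel_translation[OF u], of _ B]) (use B in auto)
    have "(\<integral>x. u x * mollifier n (x - y) \<partial>lborel) - u y = (\<integral>z. u (y + z) * mollifier n z \<partial>lborel) - (\<integral>z. u y * mollifier n (z::'a) \<partial>lborel)"
      by (simp add: 2 integral_mollifier)
    also have "\<dots> = (\<integral>z. (u (y + z) - u y) * mollifier n z \<partial>lborel)"
      using i1 integrable_mollifier by (subst Bochner_Integration.integral_diff[symmetric]) (auto simp: algebra_simps)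
    finally have 3: "(\<integral>x. u x * mollifier n (x - y) \<partial>lborel) - u y = (\<integral>z. (u (y + z) - u y) * mollifier n z \<partial>lborel)" .
    have i2: "integrable lborel (\<lambda>z. (u (y + z) - u y) * mollifier n z)"
      using Bochner_Integration.integrable_diff[OF i1 integrable_mult_right[OF integrable_mollifier[of n], of "u y"]]
      by (simp add: algebra_simps)
    show ?thesis
      unfolding 3 using integral_norm_bound_ennreal[OF i2] by (simp add: abs_mult mollifier_nonneg add.commute)
  qed
  have "(\<integral>\<^sup>+y. ennreal \<bar>(\<integral>x. u x * mollifier n (x - y) \<partial>lborel) - u y\<bar> \<partial>lborel)
    \<le> (\<integral>\<^sup>+y. (\<integral>\<^sup>+z. ennreal (\<bar>u (z + y) - u y\<bar> * mollifier n z) \<partial>lborel) \<partial>lborel)"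
    by (intro nn_integral_mono 1)
  also have "\<dots> = (\<integral>\<^sup>+z. (\<integral>\<^sup>+y. ennreal (\<bar>u (z + y) - u y\<bar> * mollifier n z) \<partial>lborel) \<partial>lborel)"
    by (rule lborel_pair.Fubini') measurable
  also have "\<dots> \<le> (\<integral>\<^sup>+z. ennreal e * ennreal (mollifier n (z::'a)) \<partial>lborel)"
  proof (intro nn_integral_mono)
    fix z :: 'a
    have "(\<integral>\<^sup>+y. ennreal (\<bar>u (z + y) - u y\<bar> * mollifier n z) \<partial>lborel) = (\<integral>\<^sup>+y. ennreal \<bar>u (z + y) - u y\<bar> \<partial>lborel) * ennreal (mollifier n z)"
      by (subst nn_integral_multc[symmetric]) (auto simp: ennreal_mult mollifier_nonneg)
    also have "\<dots> \<le> ennreal e * ennreal (mollifier n z)"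
      using d[of z] n mollifier_nonzero_iff[of n z] by (cases "mollifier n z = 0") (auto intro!: mult_right_mono)
    finally show "(\<integral>\<^sup>+y. ennreal (\<bar>u (z + y) - u y\<bar> * mollifier n z) \<partial>lborel) \<le> ennreal e * ennreal (mollifier n z)" .
  qed
  also have "\<dots> = ennreal e * (\<integral>\<^sup>+z. ennreal (mollifier n (z::'a)) \<partial>lborel)"
    by (rule nn_integral_cmult) simp
  also have "(\<integral>\<^sup>+z. ennreal (mollifier n (z::'a)) \<partial>lborel) = 1"
    using nn_integral_eq_integral[OF integrable_mollifier[of n, where 'a = 'a]] by (simp add: mollifier_nonneg integral_mollifier)
  finally show ?thesis by simp
qed

text \<open>Convergence in the mean, tested against a bounded function. This weak form is what the
  uniqueness of weak derivatives and the product rule consume.\<close>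

lemma mollification_pairing_tendsto:
  fixes u v :: "'a::euclidean_space \<Rightarrow> real"
  assumes u: "integrable lborel u" and v: "v \<in> borel_measurable borel" "\<And>y. \<bar>v y\<bar> \<le> M"
  shows "(\<lambda>n. \<integral>y. v y * (\<integral>x. u x * mollifier n (x - y) \<partial>lborel) \<partial>lborel) \<longlonglongrightarrow> (\<integral>y. v y * u y \<partial>lborel)"
proof (rule LIMSEQ_I)
  fix r :: real assume r: "r > 0"
  have [measurable]: "u \<in> borel_measurable borel" "v \<in> borel_measurable borel" using u v by auto
  have M: "M \<ge> 0" using v(2)[of 0] by linarith
  \<comment> \<open>The error of the pairing is at most \<open>e * M\<close>, which this choice
    keeps below \<open>r\<close> also when \<open>M = 0\<close>.\<close>
  define e where "e = r / (2 * (M + 1))"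
  have e: "e > 0" using r M by (simp add: e_def)
  obtain d where d: "d > 0" "\<And>z. norm z < d \<Longrightarrow> (\<integral>\<^sup>+y. ennreal \<bar>u (z + y) - u y\<bar> \<partial>lborel) \<le> ennreal e"
    using L1_translation[OF u, rule_format, OF e] by blast
  obtain N where N: "inverse (real (Suc N)) < d" using reals_Archimedean[OF d(1)] by blast
  have "norm ((\<integral>y. v y * (\<integral>x. u x * mollifier n (x - y) \<partial>lborel) \<partial>lborel) - (\<integral>y. v y * u y \<partial>lborel)) < r" if "n \<ge> N" for n
  proof -
    define m where "m y = (\<integral>x. u x * mollifier n (x - y) \<partial>lborel)" for y
    have [measurable]: "m \<in> borel_measurable borel" unfolding m_def by measurable
    have "inverse (real (Suc n)) \<le> d"
      using N that by (smt (verit) le_imp_inverse_le of_nat_0_less_iff of_nat_mono zero_less_Suc Suc_le_mono)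
    then have 1: "(\<integral>\<^sup>+y. ennreal \<bar>m y - u y\<bar> \<partial>lborel) \<le> ennreal e"
      unfolding m_def by (intro mollification_L1[OF u e d(2)])
    then have i: "integrable lborel (\<lambda>y. m y - u y)"
      by (auto simp: integrable_iff_bounded intro: le_less_trans)
    then have iv: "integrable lborel (\<lambda>y. (m y - u y) * v y)"
      by (rule integrable_bounded_mult[of _ _ _ M]) (use v in auto)
    have iu: "integrable lborel (\<lambda>y. u y * v y)"
      by (rule integrable_bounded_mult[of _ _ _ M]) (use u v in auto)
    have im: "integrable lborel (\<lambda>y. m y * v y)"
      using Bochner_Integration.integrable_add[OF iv iu] by (simp add: algebra_simps)
    have "\<bar>(\<integral>y. v y * m y \<partial>lborel) - (\<integral>y. v y * u y \<partial>lborel)\<bar> = \<bar>\<integral>y. (m y - u y) * v y \<partial>lborel\<bar>"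
      using im iu by (subst Bochner_Integration.integral_diff[symmetric]) (auto simp: algebra_simps)
    also have "\<dots> \<le> (\<integral>y. \<bar>(m y - u y) * v y\<bar> \<partial>lborel)" using integral_norm_bound[of lborel "\<lambda>y. (m y - u y) * v y"] by simp
    also have "\<dots> \<le> (\<integral>y. \<bar>m y - u y\<bar> * M \<partial>lborel)"
      using integrable_abs[OF iv] i v(2) by (intro integral_mono) (auto simp: abs_mult mult_left_mono)
    also have "\<dots> = (\<integral>y. \<bar>m y - u y\<bar> \<partial>lborel) * M" by simp
    also have "\<dots> \<le> e * M"
    proof (intro mult_right_mono M)
      have "ennreal (\<integral>y. \<bar>m y - u y\<bar> \<partial>lborel) = (\<integral>\<^sup>+y. ennreal \<bar>m y - u y\<bar> \<partial>lborel)"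
        using i by (intro nn_integral_eq_integral[symmetric]) auto
      then show "(\<integral>y. \<bar>m y - u y\<bar> \<partial>lborel) \<le> e" using 1 e by (metis ennreal_le_iff less_imp_le)
    qed
    also have "\<dots> < r" using r M by (simp add: e_def field_simps add_nonneg_pos)
    finally show ?thesis by (simp add: m_def)
  qed
  then show "\<exists>N. \<forall>n\<ge>N. norm ((\<integral>y. v y * (\<integral>x. u x * mollifier n (x - y) \<partial>lborel) \<partial>lborel) - (\<integral>y. v y * u y \<partial>lborel)) < r"
    by blast
qed

text \<open>The tensor product of \<open>u\<close> and \<open>v\<close> is integrable on the product
  space and the kernel is bounded, so Fubini applies to their product.\<close>

lemma fubini_kernel:
  fixes u v :: "'a::euclidean_space \<Rightarrow> real"
  assumes u: "integrable lborel u" and v: "integrable lborel v"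
    and k: "k \<in> borel_measurable borel" "\<And>z. \<bar>k z\<bar> \<le> B"
  shows "(\<integral>y. v y * (\<integral>x. u x * k (x - y) \<partial>lborel) \<partial>lborel) = (\<integral>x. u x * (\<integral>y. v y * k (x - y) \<partial>lborel) \<partial>lborel)" (is ?eq)
    and "integrable lborel (\<lambda>y. v y * (\<integral>x. u x * k (x - y) \<partial>lborel))" (is ?int)
proof -
  have [measurable]: "u \<in> borel_measurable borel" "v \<in> borel_measurable borel" "k \<in> borel_measurable borel"
    using u v k by auto
  have "integrable (lborel \<Otimes>\<^sub>M lborel) (\<lambda>(x, y). u x * v y)"
    by (rule lborel_pair.Fubini_integrable) (use u v in \<open>auto simp: abs_mult\<close>)
  then have "integrable (lborel \<Otimes>\<^sub>M lborel) (\<lambda>z. (case z of (x, y) \<Rightarrow> u x * v y) * (case z of (x, y) \<Rightarrow> k (x - y)))"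
    by (rule integrable_bounded_mult[of _ _ _ B]) (use k in auto)
  then have I: "integrable (lborel \<Otimes>\<^sub>M lborel) (\<lambda>(x, y). u x * v y * k (x - y))"
    by (simp add: case_prod_unfold)
  have e1: "v y * (\<integral>x. u x * k (x - y) \<partial>lborel) = (\<integral>x. u x * v y * k (x - y) \<partial>lborel)" for y
    by (subst integral_mult_right_zero[symmetric]) (auto simp: algebra_simps)
  have e2: "u x * (\<integral>y. v y * k (x - y) \<partial>lborel) = (\<integral>y. u x * v y * k (x - y) \<partial>lborel)" for x
    by (subst integral_mult_right_zero[symmetric]) (auto simp: algebra_simps)
  show ?eq unfolding e1 e2 using lborel_pair.Fubini_integral[OF I] .
  show ?int unfolding e1 using lborel_pair.integrable_snd[OF I] by simp
qed

text \<open>Pairing with the sign of \<open>u\<close> on \<open>K\<close> gives zero from index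
  \<open>N\<close> on, while the pairings tend to the integral of the absolute value of
  \<open>u\<close> over \<open>K\<close>.\<close>

lemma AE_zero_of_mollification:
  fixes u :: "'a::euclidean_space \<Rightarrow> real"
  assumes u: "integrable lborel u" and K: "K \<in> sets borel"
    and 0: "\<And>n y. n \<ge> N \<Longrightarrow> y \<in> K \<Longrightarrow> (\<integral>x. u x * mollifier n (x - y) \<partial>lborel) = 0"
  shows "AE y in lborel. y \<in> K \<longrightarrow> u y = 0"
proof -
  have [measurable]: "u \<in> borel_measurable borel" "K \<in> sets borel" using u K by auto
  define v where "v y = indicator K y * sgn (u y)" for y
  have [measurable]: "v \<in> borel_measurable borel" unfolding v_def by measurable
  have v: "\<bar>v y\<bar> \<le> 1" for y by (simp add: v_def indicator_def sgn_if)
  have "(\<lambda>n. \<integral>y. v y * (\<integral>x. u x * mollifier n (x - y) \<partial>lborel) \<partial>lborel) \<longlonglongrightarrow> (\<integral>y. v y * u y \<partial>lborel)"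
    by (rule mollification_pairing_tendsto[OF u _ v]) measurable
  moreover have z: "v y * (\<integral>x. u x * mollifier n (x - y) \<partial>lborel) = 0" if "n \<ge> N" for n y
    using 0[OF that, of y] by (auto simp: v_def indicator_def)
  then have "\<forall>\<^sub>F n in sequentially. (\<integral>y. v y * (\<integral>x. u x * mollifier n (x - y) \<partial>lborel) \<partial>lborel) = 0"
    unfolding eventually_sequentially by (intro exI[of _ N] allI impI) (simp only: z integral_zero)
  then have "(\<lambda>n. \<integral>y. v y * (\<integral>x. u x * mollifier n (x - y) \<partial>lborel) \<partial>lborel) \<longlonglongrightarrow> 0"
    by (rule tendsto_eventually)
  ultimately have "(\<integral>y. v y * u y \<partial>lborel) = 0" using LIMSEQ_unique by blast
  moreover have eq: "v y * u y = \<bar>u y\<bar> * indicator K y" for y by (simp add: v_def abs_sgn mult_ac)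
  ultimately have "(\<integral>y. \<bar>u y\<bar> * indicator K y \<partial>lborel) = 0" by simp
  moreover have "integrable lborel (\<lambda>y. \<bar>u y\<bar> * indicator K y)"
    by (rule integrable_bounded_mult[of _ _ _ 1]) (use u in \<open>auto simp: indicator_def\<close>)
  ultimately have "AE y in lborel. \<bar>u y\<bar> * indicator K y = 0"
    by (subst (asm) integral_nonneg_eq_0_iff_AE) auto
  then show ?thesis by eventually_elim (auto simp: indicator_def split: if_splits)
qed

section \<open>Weak derivatives\<close>

text \<open>Local integrability refers to the completed measure on compact sets, whereas convolution
  and Fubini work with Borel functions integrable on the whole space. Such an \<open>a\<close>
  stands in for \<open>f\<close> cut off outside \<open>K\<close>.\<close>

definition L1_representative :: "(real^'n::finite) set \<Rightarrow> (real^'n \<Rightarrow> real) \<Rightarrow> (real^'n \<Rightarrow> real) \<Rightarrow> bool" where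
  "L1_representative K f a \<longleftrightarrow> integrable lborel a \<and> (AE x in lborel. a x = indicator K x * f x)"

text \<open>Essential boundedness on compact sets, so that the notion is invariant under changes on
  null sets.\<close>

definition locally_bounded :: "(real^'n::finite) set \<Rightarrow> (real^'n \<Rightarrow> real) \<Rightarrow> bool" where
  "locally_bounded \<Omega> f \<longleftrightarrow> (\<forall>K. compact K \<and> K \<subseteq> \<Omega> \<longrightarrow> (\<exists>M. AE x in lborel. x \<in> K \<longrightarrow> \<bar>f x\<bar> \<le> M))"

lemma compact_sets_lebesgue: "compact K \<Longrightarrow> K \<in> sets lebesgue"
  by (simp add: borel_compact)

lemma integrable_lebesgue_on_iff:
  fixes f :: "real^'n::finite \<Rightarrow> real"
  assumes "S \<in> sets lebesgue"
  shows "integrable (lebesgue_on S) f \<longleftrightarrow> integrable lebesgue (\<lambda>x. indicator S x * f x)"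
  using integrable_restrict_space[of S lebesgue f] assms by simp

lemma AE_lebesgue_on_iff:
  assumes "S \<in> sets lebesgue"
  shows "(AE x in lebesgue_on S. P x) \<longleftrightarrow> (AE x in lborel. x \<in> S \<longrightarrow> P x)"
  using AE_restrict_space_iff[of S lebesgue P] assms by (simp add: AE_completion_iff)

lemma loc_integrable_representative:
  assumes "loc_integrable \<Omega> f" "compact K" "K \<subseteq> \<Omega>"
  obtains a where "L1_representative K f a"
proof -
  have i: "integrable lebesgue (\<lambda>x. indicator K x * f x)"
    using assms by (simp add: loc_integrable_def integrable_lebesgue_on_iff compact_sets_lebesgue)
  then obtain a where a: "a \<in> borel_measurable lborel" "AE x in lborel. indicator K x * f x = a x"
    using completion_ex_borel_measurable_real[of "\<lambda>x. indicator K x * f x" lborel] by auto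
  have "integrable lebesgue a"
    by (rule integrable_cong_AE_imp[OF i]) (use a in \<open>auto simp: AE_completion_iff intro: measurable_completion\<close>)
  then have "integrable lborel a" using a(1) integrable_completion by blast
  with a(2) have "L1_representative K f a" by (auto simp: L1_representative_def)
  then show thesis by (rule that)
qed

lemma loc_integrable_bounded_representative:
  assumes "loc_integrable \<Omega> f" "locally_bounded \<Omega> f" "compact K" "K \<subseteq> \<Omega>"
  obtains a M where "L1_representative K f a" "\<And>x. \<bar>a x\<bar> \<le> M"
proof -
  obtain a where a: "L1_representative K f a"
    using loc_integrable_representative[OF assms(1,3,4)] .
  obtain M where M: "AE x in lborel. x \<in> K \<longrightarrow> \<bar>f x\<bar> \<le> M"
    using assms unfolding locally_bounded_def by blast
  \<comment> \<open>Truncation makes the bound hold everywhere and alters the representative only on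
    a null set: outside \<open>K\<close> the representative is almost everywhere zero, a value that
    lies between the two truncation levels.\<close>
  let ?b = "\<lambda>x. max (- \<bar>M\<bar>) (min \<bar>M\<bar> (a x))"
  have [measurable]: "a \<in> borel_measurable borel" using a by (auto simp: L1_representative_def)
  have "AE x in lborel. ?b x = indicator K x * f x"
    using a M unfolding L1_representative_def
    by (auto elim!: AE_mp simp: indicator_def)
  moreover have "integrable lborel ?b"
    by (rule Bochner_Integration.integrable_bound[of _ a]) (use a in \<open>auto simp: L1_representative_def\<close>)
  ultimately have "L1_representative K f ?b" by (simp add: L1_representative_def)
  then show thesis by (rule that[of _ "\<bar>M\<bar>"]) auto
qed

text \<open>As \<open>\<phi>\<close> vanishes off \<open>K\<close>, the integral over the domain
  only involves the values of \<open>f\<close> on \<open>K\<close>, where \<open>a\<close> agrees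
  with them almost everywhere.\<close>

lemma lebesgue_on_integral_representative:
  fixes \<phi> :: "real^'n::finite \<Rightarrow> real"
  assumes "open \<Omega>" "compact K" "K \<subseteq> \<Omega>" "L1_representative K f a" "loc_integrable \<Omega> f"
    and \<phi>: "continuous_on UNIV \<phi>" "\<And>x. x \<notin> K \<Longrightarrow> \<phi> x = 0"
  shows "(LINT x|lebesgue_on \<Omega>. \<phi> x * f x) = (\<integral>x. \<phi> x * a x \<partial>lborel)"
proof -
  have [measurable]: "\<phi> \<in> borel_measurable borel" using \<phi>(1) by (rule borel_measurable_continuous_onI)
  have [measurable]: "a \<in> borel_measurable borel" using assms by (auto simp: L1_representative_def)
  have m: "(\<lambda>x. indicator K x * f x) \<in> borel_measurable lebesgue"
    using assms by (simp add: loc_integrable_def integrable_lebesgue_on_iff compact_sets_lebesgue borel_measurable_integrable)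
  have "(\<lambda>x. \<phi> x * (indicator K x * f x)) \<in> borel_measurable lebesgue"
    by (rule borel_measurable_times[OF _ m]) (auto intro: measurable_completion)
  also have "(\<lambda>x. \<phi> x * (indicator K x * f x)) = (\<lambda>x. indicator \<Omega> x * (\<phi> x * f x))"
    using \<phi>(2) assms(3) by (auto simp: indicator_def fun_eq_iff)
  finally have m': "(\<lambda>x. indicator \<Omega> x * (\<phi> x * f x)) \<in> borel_measurable lebesgue" .
  have "(LINT x|lebesgue_on \<Omega>. \<phi> x * f x) = (\<integral>x. indicator \<Omega> x * (\<phi> x * f x) \<partial>lebesgue)"
    using assms(1) by (subst integral_restrict_space) auto
  also have "\<dots> = (\<integral>x. \<phi> x * a x \<partial>lebesgue)"
  proof (rule integral_cong_AE[OF m'])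
    show "(\<lambda>x. \<phi> x * a x) \<in> borel_measurable lebesgue" by (intro measurable_completion) simp
    have "AE x in lborel. a x = indicator K x * f x" using assms by (simp add: L1_representative_def)
    then show "AE x in lebesgue. indicator \<Omega> x * (\<phi> x * f x) = \<phi> x * a x"
      unfolding AE_completion_iff
      by eventually_elim (use \<phi>(2) assms(3) in \<open>auto simp: indicator_def\<close>)
  qed
  also have "\<dots> = (\<integral>x. \<phi> x * a x \<partial>lborel)" by (rule integral_completion) simp
  finally show ?thesis .
qed

lemma pd_smooth_on: "smooth_on U \<phi> \<Longrightarrow> smooth_on U (pd i \<phi>)"
  using smooth_on_frechet_derivative[of U \<phi> "axis i 1"] by (simp add: pd_def[abs_def])

lemma pd_eq_0_outside:
  assumes "closed K" "\<And>x. x \<notin> K \<Longrightarrow> \<phi> x = 0" "x \<notin> K"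
  shows "pd i \<phi> x = 0"
proof -
  have "(\<phi> has_derivative (\<lambda>h. 0)) (at x)"
    by (rule has_derivative_transform_within_open[of "\<lambda>x. 0" _ x UNIV "- K"]) (use assms in auto)
  then show ?thesis unfolding pd_def by (metis frechet_derivative_at)
qed

text \<open>Any compact subset of the domain outside which the function vanishes may replace the
  closed support. This spares the computation of supports of products, translates and
  derivatives.\<close>

lemma test_function_iff:
  "test_function \<Omega> \<phi> \<longleftrightarrow> smooth_on UNIV \<phi> \<and> (\<exists>K. compact K \<and> K \<subseteq> \<Omega> \<and> (\<forall>x. x \<notin> K \<longrightarrow> \<phi> x = 0))"
proof
  assume "test_function \<Omega> \<phi>"
  then show "smooth_on UNIV \<phi> \<and> (\<exists>K. compact K \<and> K \<subseteq> \<Omega> \<and> (\<forall>x. x \<notin> K \<longrightarrow> \<phi> x = 0))"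
    using closure_subset[of "{x. \<phi> x \<noteq> 0}"] unfolding test_function_def
    by (intro conjI exI[of _ "closure {x. \<phi> x \<noteq> 0}"]) blast+
next
  assume *: "smooth_on UNIV \<phi> \<and> (\<exists>K. compact K \<and> K \<subseteq> \<Omega> \<and> (\<forall>x. x \<notin> K \<longrightarrow> \<phi> x = 0))"
  then obtain K where K: "compact K" "K \<subseteq> \<Omega>" "\<And>x. x \<notin> K \<Longrightarrow> \<phi> x = 0" by blast
  then have "closure {x. \<phi> x \<noteq> 0} \<subseteq> K"
    by (intro closure_minimal) (auto simp: compact_imp_closed)
  moreover from this have "compact (closure {x. \<phi> x \<noteq> 0})"
    using K(1) by (metis closed_closure compact_Int_closed inf.absorb_iff2)
  ultimately show "test_function \<Omega> \<phi>"
    using * K(2) unfolding test_function_def by blast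
qed

lemma has_weak_pd_lborel:
  fixes f g :: "real^'n::finite \<Rightarrow> real"
  assumes "open \<Omega>" "has_weak_pd \<Omega> i f g" "compact K" "K \<subseteq> \<Omega>" "L1_representative K f a" "L1_representative K g b"
    and \<phi>: "smooth_on UNIV \<phi>" "\<And>x. x \<notin> K \<Longrightarrow> \<phi> x = 0"
  shows "(\<integral>x. pd i \<phi> x * a x \<partial>lborel) = - (\<integral>x. \<phi> x * b x \<partial>lborel)"
proof -
  have "test_function \<Omega> \<phi>" using assms by (auto simp: test_function_iff)
  then have "(LINT x|lebesgue_on \<Omega>. pd i \<phi> x * f x) = - (LINT x|lebesgue_on \<Omega>. \<phi> x * g x)"
    using assms(2) by (simp add: has_weak_pd_def)
  moreover have "(LINT x|lebesgue_on \<Omega>. pd i \<phi> x * f x) = (\<integral>x. pd i \<phi> x * a x \<partial>lborel)"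
    using assms pd_eq_0_outside[of K \<phi>] smooth_on_continuous_on[OF pd_smooth_on[OF \<phi>(1)]]
    by (intro lebesgue_on_integral_representative) (auto simp: has_weak_pd_def compact_imp_closed)
  moreover have "(LINT x|lebesgue_on \<Omega>. \<phi> x * g x) = (\<integral>x. \<phi> x * b x \<partial>lborel)"
    using assms smooth_on_continuous_on[OF \<phi>(1)]
    by (intro lebesgue_on_integral_representative) (auto simp: has_weak_pd_def)
  ultimately show ?thesis by simp
qed

text \<open>The representatives may be chosen for each test function separately, on a compact set
  that contains its support.\<close>

lemma has_weak_pdI_lborel:
  fixes f g :: "real^'n::finite \<Rightarrow> real"
  assumes "open \<Omega>" "loc_integrable \<Omega> f" "loc_integrable \<Omega> g"
    and *: "\<And>K \<phi>. compact K \<Longrightarrow> K \<subseteq> \<Omega> \<Longrightarrow> smooth_on UNIV \<phi> \<Longrightarrow> (\<And>x. x \<notin> K \<Longrightarrow> \<phi> x = 0) \<Longrightarrow>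
      \<exists>a b. L1_representative K f a \<and> L1_representative K g b \<and>
        (\<integral>x. pd i \<phi> x * a x \<partial>lborel) = - (\<integral>x. \<phi> x * b x \<partial>lborel)"
  shows "has_weak_pd \<Omega> i f g"
  unfolding has_weak_pd_def
proof (intro conjI allI impI assms(2,3))
  fix \<phi> assume "test_function \<Omega> \<phi>"
  then obtain K where K: "compact K" "K \<subseteq> \<Omega>" "\<And>x. x \<notin> K \<Longrightarrow> \<phi> x = 0" and \<phi>: "smooth_on UNIV \<phi>"
    by (auto simp: test_function_iff)
  obtain a b where ab: "L1_representative K f a" "L1_representative K g b"
     "(\<integral>x. pd i \<phi> x * a x \<partial>lborel) = - (\<integral>x. \<phi> x * b x \<partial>lborel)"
    using *[OF K(1,2) \<phi> K(3)] by blast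
  have "(LINT x|lebesgue_on \<Omega>. pd i \<phi> x * f x) = (\<integral>x. pd i \<phi> x * a x \<partial>lborel)"
    using assms K ab pd_eq_0_outside[of K \<phi>] smooth_on_continuous_on[OF pd_smooth_on[OF \<phi>(1)]]
    by (intro lebesgue_on_integral_representative) (auto simp: compact_imp_closed)
  moreover have "(LINT x|lebesgue_on \<Omega>. \<phi> x * g x) = (\<integral>x. \<phi> x * b x \<partial>lborel)"
    using assms K ab smooth_on_continuous_on[OF \<phi>(1)]
    by (intro lebesgue_on_integral_representative) auto
  ultimately show "(LINT x|lebesgue_on \<Omega>. pd i \<phi> x *\<^sub>R f x) = - (LINT x|lebesgue_on \<Omega>. \<phi> x *\<^sub>R g x)"
    using ab(3) by simp
qed

text \<open>In a complete measure space a set that differs from a measurable one by a null set is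
  measurable; this is applied to preimages.\<close>

lemma measurable_completion_cong_AE:
  fixes a f :: "'a \<Rightarrow> real"
  assumes "integrable (completion M) a" "AE x in completion M. a x = f x"
  shows "f \<in> borel_measurable (completion M)"
proof (rule measurableI)
  fix A :: "real set" assume A: "A \<in> sets borel"
  have "AE x in completion M. x \<in> a -` A \<inter> space (completion M) \<longleftrightarrow> x \<in> f -` A \<inter> space (completion M)"
    using assms(2) by eventually_elim simp
  moreover have "a -` A \<inter> space (completion M) \<in> sets (completion M)"
    using assms(1) A by (intro measurable_sets[OF borel_measurable_integrable])
  ultimately show "f -` A \<inter> space (completion M) \<in> sets (completion M)"
    by (rule completion.in_sets_AE) auto
qed simp

lemma loc_integrable_of_representatives:
  fixes f :: "real^'n::finite \<Rightarrow> real"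
  assumes "\<And>K. compact K \<Longrightarrow> K \<subseteq> \<Omega> \<Longrightarrow> \<exists>a. L1_representative K f a"
  shows "loc_integrable \<Omega> f"
  unfolding loc_integrable_def
proof (intro allI impI)
  fix K assume K: "compact K \<and> K \<subseteq> \<Omega>"
  then obtain a where a: "L1_representative K f a" using assms by blast
  then have "integrable lborel a" "a \<in> borel_measurable lborel" by (auto simp: L1_representative_def)
  then have ia: "integrable lebesgue a"
    using integrable_completion by blast
  have eq: "AE x in lebesgue. a x = indicator K x * f x"
    using a by (simp add: L1_representative_def AE_completion_iff)
  have "(\<lambda>x. indicator K x * f x) \<in> borel_measurable lebesgue"
    using measurable_completion_cong_AE[OF ia eq] .
  then have "integrable lebesgue (\<lambda>x. indicator K x * f x)"
    using integrable_cong_AE_imp[OF ia _ eq] by blast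
  then show "integrable (lebesgue_on K) f"
    using K by (simp add: integrable_lebesgue_on_iff compact_sets_lebesgue)
qed

text \<open>An open set is a countable union of compact boxes, so only countably many exceptional
  null sets arise.\<close>

lemma AE_open_of_compact:
  assumes "open \<Omega>" "\<And>K. compact K \<Longrightarrow> K \<subseteq> \<Omega> \<Longrightarrow> AE x in lborel. x \<in> K \<longrightarrow> P (x::'a::euclidean_space)"
  shows "AE x in lborel. x \<in> \<Omega> \<longrightarrow> P x"
proof -
  obtain \<D> where \<D>: "countable \<D>" "\<D> \<subseteq> Pow \<Omega>" "\<And>X. X \<in> \<D> \<Longrightarrow> \<exists>a b. X = cbox a b" "\<Union>\<D> = \<Omega>"
    using open_countable_Union_open_cbox[OF assms(1)] by metis
  have "AE x in lborel. \<forall>X\<in>\<D>. x \<in> X \<longrightarrow> P x"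
    using \<D> assms(2) by (subst AE_ball_countable) (auto, metis compact_cbox Pow_iff in_mono)
  then show ?thesis by eventually_elim (use \<D>(4) in auto)
qed

lemma continuous_compact_support_bounded:
  fixes \<phi> :: "'a::euclidean_space \<Rightarrow> real"
  assumes "continuous_on UNIV \<phi>" "compact K" "\<And>x. x \<notin> K \<Longrightarrow> \<phi> x = 0"
  obtains B where "\<And>x. \<bar>\<phi> x\<bar> \<le> B"
proof -
  have "bounded (\<phi> ` K)"
    using assms by (intro compact_imp_bounded compact_continuous_image) (auto intro: continuous_on_subset)
  then obtain B where "\<And>x. x \<in> K \<Longrightarrow> \<bar>\<phi> x\<bar> \<le> B" by (auto simp: bounded_iff)
  then have "\<bar>\<phi> x\<bar> \<le> \<bar>B\<bar>" for x using assms(3)[of x] by (cases "x \<in> K") fastforce+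
  then show thesis by (rule that)
qed

text \<open>\<open>K'\<close> is a closed neighbourhood of \<open>K\<close> of some radius
  \<open>e\<close>, inside the domain, and from \<open>N\<close> on the supports of the mollifiers
  are smaller than \<open>e\<close>. Mollifiers centred at points of \<open>K\<close> are then test
  functions.\<close>

lemma compact_neighbourhood:
  fixes K :: "'a::euclidean_space set"
  assumes "open \<Omega>" "compact K" "K \<subseteq> \<Omega>"
  obtains K' N where "compact K'" "K \<subseteq> K'" "K' \<subseteq> \<Omega>"
    "\<And>n x y. n \<ge> N \<Longrightarrow> y \<in> K \<Longrightarrow> x \<notin> K' \<Longrightarrow> mollifier n (x - y) = 0"
proof -
  obtain e where e: "e > 0" "(\<Union>x\<in>K. cball x e) \<subseteq> \<Omega>"
    using compact_subset_open_imp_cball_epsilon_subset[OF assms(2,1,3)] by blast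
  define K' where "K' = {x + z |x z. x \<in> K \<and> z \<in> cball 0 e}"
  obtain N where N: "inverse (real (Suc N)) < e" using reals_Archimedean[OF e(1)] by blast
  show thesis
  proof (rule that)
    show "compact K'" unfolding K'_def by (intro compact_sums assms compact_cball)
    show "K \<subseteq> K'" using e(1) by (force simp: K'_def)
    show "K' \<subseteq> \<Omega>" using e(2) by (force simp: K'_def dist_norm)
    fix n x y assume *: "n \<ge> N" "y \<in> K" "x \<notin> K'"
    have "norm (x - y) > e"
    proof (rule ccontr)
      assume "\<not> ?thesis"
      then have "y + (x - y) \<in> K'" unfolding K'_def using *(2)
        by (intro CollectI exI[of _ y] exI[of _ "x - y"]) auto
      then show False using *(3) by simp
    qed
    moreover have "inverse (real (Suc n)) \<le> inverse (real (Suc N))" using *(1) by (intro le_imp_inverse_le) auto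
    ultimately show "mollifier n (x - y) = 0" using N mollifier_nonzero_iff[of n "x - y"] by linarith
  qed
qed

lemma smooth_on_mollifier_shift: "smooth_on UNIV (\<lambda>x. mollifier n (x - y))"
  using smooth_on_affine[OF bounded_linear_ident smooth_on_mollifier, where a = "- y"] by simp

lemma smooth_on_mollifier_reflect: "smooth_on UNIV (\<lambda>y. mollifier n (x - y))"
  using smooth_on_affine[OF bounded_linear_minus[OF bounded_linear_ident] smooth_on_mollifier, where a = x] by simp

text \<open>Translates of the mollifiers are test functions, so the mollifications of the two
  candidates agree on compact sets, and hence so do the candidates.\<close>

lemma weak_pd_zero_unique:
  fixes f g g' :: "real^'n::finite \<Rightarrow> real"
  assumes "open \<Omega>" "has_weak_pd \<Omega> i f g" "has_weak_pd \<Omega> i f g'"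
  shows "AE x in lborel. x \<in> \<Omega> \<longrightarrow> g x = g' x"
proof (rule AE_open_of_compact[OF assms(1)])
  fix K assume K: "compact K" "K \<subseteq> \<Omega>"
  obtain K' N where K': "compact K'" "K \<subseteq> K'" "K' \<subseteq> \<Omega>"
    "\<And>n x y. n \<ge> N \<Longrightarrow> y \<in> K \<Longrightarrow> x \<notin> K' \<Longrightarrow> mollifier n (x - y) = 0"
    using compact_neighbourhood[OF assms(1) K] by blast
  obtain a b b' where r: "L1_representative K' f a" "L1_representative K' g b" "L1_representative K' g' b'"
    using assms K' loc_integrable_representative unfolding has_weak_pd_def by metis
  have i: "integrable lborel b" "integrable lborel b'" using r by (auto simp: L1_representative_def)
  have "AE y in lborel. y \<in> K \<longrightarrow> b y - b' y = 0"
  proof (rule AE_zero_of_mollification[where N = N])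
    fix n and y :: "real^'n" assume n: "n \<ge> N" and y: "y \<in> K"
    obtain B where B: "\<And>z. \<bar>mollifier n (z::real^'n)\<bar> \<le> B" using mollifier_bounded by blast
    have "integrable lborel (\<lambda>x. b x * mollifier n (x - y))" "integrable lborel (\<lambda>x. b' x * mollifier n (x - y))"
      using i B by (auto intro!: integrable_bounded_mult[of _ _ _ B])
    moreover have "(\<integral>x. mollifier n (x - y) * b x \<partial>lborel) = (\<integral>x. mollifier n (x - y) * b' x \<partial>lborel)"
      using has_weak_pd_lborel[OF assms(1,2) K'(1,3) r(1,2) smooth_on_mollifier_shift K'(4)[OF n y]]
        has_weak_pd_lborel[OF assms(1,3) K'(1,3) r(1,3) smooth_on_mollifier_shift K'(4)[OF n y]] by simp
    ultimately show "(\<integral>x. (b x - b' x) * mollifier n (x - y) \<partial>lborel) = 0"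
      by (simp add: left_diff_distrib mult.commute)
  qed (use i K in \<open>auto simp: borel_compact\<close>)
  moreover have "AE x in lborel. b x = indicator K' x * g x" "AE x in lborel. b' x = indicator K' x * g' x"
    using r(2,3) by (auto simp: L1_representative_def)
  ultimately show "AE x in lborel. x \<in> K \<longrightarrow> g x = g' x"
    by eventually_elim (use K'(2) in \<open>auto simp: indicator_def split: if_splits\<close>)
qed

lemma pd_mult_reflect:
  fixes \<eta> \<phi> :: "real^'n::finite \<Rightarrow> real"
  assumes "smooth_on UNIV \<eta>" "smooth_on UNIV \<phi>"
  shows "pd i (\<lambda>y. \<eta> (x - y) * \<phi> y) y = \<eta> (x - y) * pd i \<phi> y - pd i \<eta> (x - y) * \<phi> y"
proof -
  have 1: "(\<phi> has_derivative frechet_derivative \<phi> (at y)) (at y)"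
    by (rule smooth_on_has_derivative[OF assms(2) UNIV_I])
  have 2: "(\<eta> has_derivative frechet_derivative \<eta> (at (x - y))) (at (x - y))"
    by (rule smooth_on_has_derivative[OF assms(1) UNIV_I])
  interpret l: linear "frechet_derivative \<eta> (at (x - y))" using 2 by (rule has_derivative_linear)
  have "((\<lambda>y. x - y) has_derivative (\<lambda>h. - h)) (at y)" by (auto intro!: derivative_eq_intros)
  from has_derivative_mult[OF has_derivative_compose[OF this 2] 1]
  show ?thesis unfolding pd_def by (simp add: frechet_derivative_at[symmetric] l.neg)
qed

text \<open>The mollifier serves as a kernel in two variables: for fixed \<open>x\<close>,
  \<open>\<eta> (x - y) * \<phi> y\<close> is a test function for \<open>g\<close>, and for fixed
  \<open>y\<close>, \<open>\<eta> (x - y)\<close> is one for \<open>f\<close>. Fubini combines the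
  two integrations by parts into an identity that is free of derivatives of the kernel, and only
  this identity is passed to the limit. Boundedness of both factors makes each of its three pairings
  one of an integrable function with a bounded one.\<close>

lemma has_weak_pd_mult:
  fixes f g :: "real^'n::finite \<Rightarrow> real"
  assumes \<Omega>: "open \<Omega>" and f: "has_weak_pd \<Omega> i f f'" "locally_bounded \<Omega> f"
    and g: "has_weak_pd \<Omega> i g g'" "locally_bounded \<Omega> g"
  shows "has_weak_pd \<Omega> i (\<lambda>x. f x * g x) (\<lambda>x. f' x * g x + f x * g' x)"
proof -
  have reps: "\<exists>a a' c c' M. L1_representative K f a \<and> L1_representative K f' a' \<and> L1_representative K g c \<and> L1_representative K g' c'
      \<and> (\<forall>x. \<bar>a x\<bar> \<le> M) \<and> (\<forall>x. \<bar>c x\<bar> \<le> M)" if K: "compact K" "K \<subseteq> \<Omega>" for K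
  proof -
    obtain a M1 where "L1_representative K f a" "\<And>x. \<bar>a x\<bar> \<le> M1"
      using loc_integrable_bounded_representative[OF _ f(2) K] f(1) by (auto simp: has_weak_pd_def)
    moreover obtain c M2 where "L1_representative K g c" "\<And>x. \<bar>c x\<bar> \<le> M2"
      using loc_integrable_bounded_representative[OF _ g(2) K] g(1) by (auto simp: has_weak_pd_def)
    moreover obtain a' where "L1_representative K f' a'"
      using loc_integrable_representative[OF _ K] f(1) by (auto simp: has_weak_pd_def)
    moreover obtain c' where "L1_representative K g' c'"
      using loc_integrable_representative[OF _ K] g(1) by (auto simp: has_weak_pd_def)
    ultimately show ?thesis
      by (intro exI[of _ a] exI[of _ a'] exI[of _ c] exI[of _ c'] exI[of _ "max M1 M2"]) (auto simp: le_max_iff_disj)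
  qed
  \<comment> \<open>Representatives on the larger set are cut down to \<open>K\<close>; the bounds
    \<open>M\<close> are what makes the products integrable.\<close>
  have rmult: "L1_representative K (\<lambda>x. f x * g x) (\<lambda>x. indicator K x * (a x * c x)) \<and>
     L1_representative K (\<lambda>x. f' x * g x + f x * g' x) (\<lambda>x. indicator K x * (a' x * c x + a x * c' x))"
    if K: "compact K" "K \<subseteq> K'" and r: "L1_representative K' f a" "L1_representative K' f' a'" "L1_representative K' g c" "L1_representative K' g' c'"
      and M: "\<And>x. \<bar>a x\<bar> \<le> M" "\<And>x. \<bar>c x\<bar> \<le> M" for K K' a a' c c' M
  proof -
    have [measurable]: "a \<in> borel_measurable borel" "a' \<in> borel_measurable borel" "c \<in> borel_measurable borel" "c' \<in> borel_measurable borel"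
      using r by (auto simp: L1_representative_def)
    have [measurable]: "K \<in> sets borel" using K by (simp add: borel_compact)
    have i: "integrable lborel (\<lambda>x. a x * c x)" "integrable lborel (\<lambda>x. a' x * c x)" "integrable lborel (\<lambda>x. c' x * a x)"
      by (rule integrable_bounded_mult[of _ _ _ M]; use r M in \<open>auto simp: L1_representative_def\<close>)+
    have "integrable lborel (\<lambda>x. (a x * c x) * indicator K x)" "integrable lborel (\<lambda>x. (a' x * c x + c' x * a x) * indicator K x)"
      by (rule integrable_bounded_mult[of _ _ _ 1]; use i in \<open>auto simp: indicator_def\<close>)+
    moreover have "AE x in lborel. indicator K x * (a x * c x) = indicator K x * (f x * g x)
        \<and> indicator K x * (a' x * c x + a x * c' x) = indicator K x * (f' x * g x + f x * g' x)"
    proof -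
      have "AE x in lborel. a x = indicator K' x * f x" "AE x in lborel. a' x = indicator K' x * f' x"
        "AE x in lborel. c x = indicator K' x * g x" "AE x in lborel. c' x = indicator K' x * g' x"
        using r by (auto simp: L1_representative_def)
      then show ?thesis
        by eventually_elim (use K(2) in \<open>auto simp: indicator_def\<close>)
    qed
    ultimately show ?thesis
      unfolding L1_representative_def by (simp add: algebra_simps)
  qed
  show ?thesis
  proof (rule has_weak_pdI_lborel[OF \<Omega>])
    show "loc_integrable \<Omega> (\<lambda>x. f x * g x)" "loc_integrable \<Omega> (\<lambda>x. f' x * g x + f x * g' x)"
    proof -
      have "(\<exists>r. L1_representative K (\<lambda>x. f x * g x) r) \<and> (\<exists>r. L1_representative K (\<lambda>x. f' x * g x + f x * g' x) r)"
        if K: "compact K" "K \<subseteq> \<Omega>" for K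
        using reps[OF K] rmult[OF K(1) order_refl] by blast
      then show "loc_integrable \<Omega> (\<lambda>x. f x * g x)" "loc_integrable \<Omega> (\<lambda>x. f' x * g x + f x * g' x)"
        by (auto intro: loc_integrable_of_representatives)
    qed
  next
    fix K and \<phi> :: "real^'n \<Rightarrow> real" assume K: "compact K" "K \<subseteq> \<Omega>" and \<phi>: "smooth_on UNIV \<phi>" "\<And>x. x \<notin> K \<Longrightarrow> \<phi> x = 0"
    obtain K' N where K': "compact K'" "K \<subseteq> K'" "K' \<subseteq> \<Omega>"
      "\<And>n x y. n \<ge> N \<Longrightarrow> y \<in> K \<Longrightarrow> x \<notin> K' \<Longrightarrow> mollifier n (x - y) = 0"
      using compact_neighbourhood[OF \<Omega> K] by blast
    obtain a a' c c' M where r: "L1_representative K' f a" "L1_representative K' f' a'" "L1_representative K' g c" "L1_representative K' g' c'"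
      and M: "\<And>x. \<bar>a x\<bar> \<le> M" "\<And>x. \<bar>c x\<bar> \<le> M" using reps[OF K'(1,3)] by blast
    have [measurable]: "a \<in> borel_measurable borel" "a' \<in> borel_measurable borel" "c \<in> borel_measurable borel" "c' \<in> borel_measurable borel"
      and ia: "integrable lborel a" "integrable lborel a'" "integrable lborel c" "integrable lborel c'"
      using r by (auto simp: L1_representative_def)
    have d\<phi>: "continuous_on UNIV (pd i \<phi>)" "\<And>x. x \<notin> K \<Longrightarrow> pd i \<phi> x = 0"
      using smooth_on_continuous_on[OF pd_smooth_on[OF \<phi>(1)]] pd_eq_0_outside[OF compact_imp_closed[OF K(1)] \<phi>(2)] by auto
    obtain B0 where B0: "\<And>x. \<bar>\<phi> x\<bar> \<le> B0"
      using continuous_compact_support_bounded[OF smooth_on_continuous_on[OF \<phi>(1)] K(1) \<phi>(2)] by blast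
    obtain B1 where B1: "\<And>x. \<bar>pd i \<phi> x\<bar> \<le> B1"
      using continuous_compact_support_bounded[OF d\<phi>(1) K(1) d\<phi>(2)] by blast
    have [measurable]: "\<phi> \<in> borel_measurable borel" "pd i \<phi> \<in> borel_measurable borel"
      using smooth_on_continuous_on[OF \<phi>(1)] d\<phi>(1) by (auto intro: borel_measurable_continuous_onI)
    have i1: "integrable lborel (\<lambda>y. c y * pd i \<phi> y)" by (rule integrable_bounded_mult[of _ _ _ B1]) (use ia B1 in auto)
    have i2: "integrable lborel (\<lambda>y. c y * \<phi> y)" by (rule integrable_bounded_mult[of _ _ _ B0]) (use ia B0 in auto)
    have i3: "integrable lborel (\<lambda>y. c' y * \<phi> y)" by (rule integrable_bounded_mult[of _ _ _ B0]) (use ia B0 in auto)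
    have b1: "\<bar>c y * pd i \<phi> y\<bar> \<le> M * B1" for y
      unfolding abs_mult by (rule mult_mono[OF M(2) B1]) (use M(2)[of y] in auto)
    have b2: "\<bar>c y * \<phi> y\<bar> \<le> M * B0" for y
      unfolding abs_mult by (rule mult_mono[OF M(2) B0]) (use M(2)[of y] in auto)
    define F where "F u v n = (\<integral>y. v y * (\<integral>x. u x * mollifier n (x - y) \<partial>lborel) \<partial>lborel)" for u v :: "real^'n \<Rightarrow> real" and n
    have main: "F a (\<lambda>y. c y * pd i \<phi> y) n + F a' (\<lambda>y. c y * \<phi> y) n = - F (\<lambda>y. c' y * \<phi> y) a n" if n: "n \<ge> N" for n
    proof -
      define \<eta> where "\<eta> = (mollifier n :: real^'n \<Rightarrow> real)"
      have \<eta>: "smooth_on UNIV \<eta>" and \<eta>m: "\<eta> (- z) = \<eta> z" for z by (auto simp: \<eta>_def smooth_on_mollifier mollifier_uminus)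
      \<comment> \<open>The unit ball contains the support whatever \<open>n\<close> is; this serves
        to bound the kernel and its derivative.\<close>
      have \<eta>0: "\<eta> z = 0" if "z \<notin> cball 0 1" for z
      proof -
        have "inverse (real (Suc n)) \<le> 1" by (simp add: inverse_le_1_iff)
        then show ?thesis using that mollifier_nonzero_iff[of n z] by (auto simp: \<eta>_def)
      qed
      have d\<eta>0: "pd i \<eta> z = 0" if "z \<notin> cball 0 1" for z using pd_eq_0_outside[OF closed_cball \<eta>0 that] .
      have c\<eta>: "continuous_on UNIV \<eta>" "continuous_on UNIV (pd i \<eta>)"
        using smooth_on_continuous_on[OF \<eta>] smooth_on_continuous_on[OF pd_smooth_on[OF \<eta>]] by auto
      have [measurable]: "\<eta> \<in> borel_measurable borel" "pd i \<eta> \<in> borel_measurable borel"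
        using c\<eta> by (auto intro: borel_measurable_continuous_onI)
      obtain E0 where E0: "\<And>x. \<bar>\<eta> x\<bar> \<le> E0" using continuous_compact_support_bounded[OF c\<eta>(1) compact_cball \<eta>0] by blast
      obtain E1 where E1: "\<And>x. \<bar>pd i \<eta> x\<bar> \<le> E1" using continuous_compact_support_bounded[OF c\<eta>(2) compact_cball d\<eta>0] by blast
      have sh: "pd i (\<lambda>x. \<eta> (x - y)) x = pd i \<eta> (x - y)" for x y
      proof -
        have 2: "(\<eta> has_derivative frechet_derivative \<eta> (at (x - y))) (at (x - y))"
          by (rule smooth_on_has_derivative[OF \<eta> UNIV_I])
        have "((\<lambda>x. x - y) has_derivative (\<lambda>h. h)) (at x)" by (auto intro!: derivative_eq_intros)
        from has_derivative_compose[OF this 2] show ?thesis unfolding pd_def by (simp add: frechet_derivative_at[symmetric])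
      qed
      \<comment> \<open>Integration by parts for \<open>g\<close> in the variable \<open>y\<close>,
        with \<open>x\<close> as a parameter.\<close>
      have A: "(\<integral>y. (c y * pd i \<phi> y) * \<eta> (x - y) \<partial>lborel) - (\<integral>y. (c y * \<phi> y) * pd i \<eta> (x - y) \<partial>lborel)
          = - (\<integral>y. (c' y * \<phi> y) * \<eta> (x - y) \<partial>lborel)" for x
      proof -
        have "(\<integral>y. pd i (\<lambda>y. \<eta> (x - y) * \<phi> y) y * c y \<partial>lborel) = - (\<integral>y. (\<eta> (x - y) * \<phi> y) * c' y \<partial>lborel)"
          by (rule has_weak_pd_lborel[OF \<Omega> g(1) K'(1,3) r(3,4)])
            (use \<phi> K'(2) smooth_on_mollifier_reflect[of n x] in \<open>auto intro!: smooth_on_mult simp: \<eta>_def\<close>)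
        moreover have "pd i (\<lambda>y. \<eta> (x - y) * \<phi> y) y * c y = (c y * pd i \<phi> y) * \<eta> (x - y) - (c y * \<phi> y) * pd i \<eta> (x - y)" for y
          unfolding pd_mult_reflect[OF \<eta> \<phi>(1)] by (simp add: algebra_simps)
        moreover have "integrable lborel (\<lambda>y. (c y * pd i \<phi> y) * \<eta> (x - y))"
          by (rule integrable_bounded_mult[OF i1, of _ E0]) (use E0 in auto)
        moreover have "integrable lborel (\<lambda>y. (c y * \<phi> y) * pd i \<eta> (x - y))"
          by (rule integrable_bounded_mult[OF i2, of _ E1]) (use E1 in auto)
        ultimately show ?thesis by (simp add: mult_ac)
      qed
      have X: "integrable lborel (\<lambda>x. u x * (\<integral>y. v y * k (x - y) \<partial>lborel))"
        if "integrable lborel u" "integrable lborel v" "k \<in> borel_measurable borel" "\<And>z. \<bar>k z\<bar> \<le> E" for u v k :: "real^'n \<Rightarrow> real" and E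
      proof -
        have [measurable]: "k \<in> borel_measurable borel" by fact
        show ?thesis using fubini_kernel(2)[OF that(2,1), of "\<lambda>z. k (- z)" E] that(4) by simp
      qed
      \<comment> \<open>Integration by parts for \<open>f\<close> in the variable \<open>x\<close>.
        It is available for \<open>y\<close> in \<open>K\<close>; elsewhere the factor
        \<open>\<phi> y\<close> vanishes.\<close>
      have B: "(\<integral>y. (c y * \<phi> y) * (\<integral>x. a x * pd i \<eta> (x - y) \<partial>lborel) \<partial>lborel) = - F a' (\<lambda>y. c y * \<phi> y) n"
      proof -
        have "(c y * \<phi> y) * (\<integral>x. a x * pd i \<eta> (x - y) \<partial>lborel) = - ((c y * \<phi> y) * (\<integral>x. a' x * \<eta> (x - y) \<partial>lborel))" for y
        proof (cases "y \<in> K")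
          case True
          have "(\<integral>x. pd i (\<lambda>x. \<eta> (x - y)) x * a x \<partial>lborel) = - (\<integral>x. \<eta> (x - y) * a' x \<partial>lborel)"
            by (rule has_weak_pd_lborel[OF \<Omega> f(1) K'(1,3) r(1,2)])
              (use K'(4)[OF n True] smooth_on_mollifier_shift[of n y] in \<open>auto simp: \<eta>_def\<close>)
          then show ?thesis by (simp add: sh mult.commute)
        qed (use \<phi>(2) in auto)
        then show ?thesis unfolding F_def \<eta>_def[symmetric] by simp
      qed
      have "F a (\<lambda>y. c y * pd i \<phi> y) n - (\<integral>y. (c y * \<phi> y) * (\<integral>x. a x * pd i \<eta> (x - y) \<partial>lborel) \<partial>lborel)
         = (\<integral>x. a x * (\<integral>y. (c y * pd i \<phi> y) * \<eta> (x - y) \<partial>lborel) \<partial>lborel) - (\<integral>x. a x * (\<integral>y. (c y * \<phi> y) * pd i \<eta> (x - y) \<partial>lborel) \<partial>lborel)"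
        unfolding F_def \<eta>_def[symmetric]
        by (subst fubini_kernel(1)[OF ia(1) i1 _ E0], simp, subst fubini_kernel(1)[OF ia(1) i2 _ E1], simp, rule refl)
      also have "\<dots> = (\<integral>x. a x * ((\<integral>y. (c y * pd i \<phi> y) * \<eta> (x - y) \<partial>lborel) - (\<integral>y. (c y * \<phi> y) * pd i \<eta> (x - y) \<partial>lborel)) \<partial>lborel)"
        unfolding right_diff_distrib using X[where k = \<eta>, OF ia(1) i1 \<open>\<eta> \<in> borel_measurable borel\<close> E0]
          X[where k = "pd i \<eta>", OF ia(1) i2 \<open>pd i \<eta> \<in> borel_measurable borel\<close> E1] by simp
      also have "\<dots> = - (\<integral>x. a x * (\<integral>y. (c' y * \<phi> y) * \<eta> (x - y) \<partial>lborel) \<partial>lborel)"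
        unfolding A by simp
      \<comment> \<open>The kernel is even, so \<open>x\<close> and \<open>y\<close> can be
        exchanged: now the product of \<open>c'\<close> and \<open>\<phi>\<close> is the mollified
        function and \<open>a\<close> the bounded one.\<close>
      also have "\<dots> = - F (\<lambda>y. c' y * \<phi> y) a n"
      proof -
        have "\<eta> (x - y) = \<eta> (y - x)" for x y using \<eta>m[of "y - x"] by simp
        then show ?thesis unfolding F_def \<eta>_def[symmetric] by simp
      qed
      finally show ?thesis unfolding B by simp
    qed
    have l1: "(\<lambda>n. F a (\<lambda>y. c y * pd i \<phi> y) n + F a' (\<lambda>y. c y * \<phi> y) n) \<longlonglongrightarrow>
        (\<integral>y. (c y * pd i \<phi> y) * a y \<partial>lborel) + (\<integral>y. (c y * \<phi> y) * a' y \<partial>lborel)"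
      unfolding F_def
      by (intro tendsto_add mollification_pairing_tendsto[OF ia(1) _ b1] mollification_pairing_tendsto[OF ia(2) _ b2]) measurable
    have l2: "(\<lambda>n. - F (\<lambda>y. c' y * \<phi> y) a n) \<longlonglongrightarrow> - (\<integral>y. a y * (c' y * \<phi> y) \<partial>lborel)"
      unfolding F_def by (intro tendsto_minus mollification_pairing_tendsto[OF i3 _ M(1)]) measurable
    have "(\<lambda>n. F a (\<lambda>y. c y * pd i \<phi> y) n + F a' (\<lambda>y. c y * \<phi> y) n) \<longlonglongrightarrow> - (\<integral>y. a y * (c' y * \<phi> y) \<partial>lborel)"
      by (rule Lim_transform_eventually[OF l2]) (rule eventually_sequentiallyI[of N], simp only: main)
    with l1 have lim: "(\<integral>y. (c y * pd i \<phi> y) * a y \<partial>lborel) + (\<integral>y. (c y * \<phi> y) * a' y \<partial>lborel) = - (\<integral>y. a y * (c' y * \<phi> y) \<partial>lborel)"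
      using LIMSEQ_unique by blast
    have e1: "pd i \<phi> x * (indicator K x * (a x * c x)) = (c x * pd i \<phi> x) * a x" for x
      using d\<phi>(2)[of x] by (cases "x \<in> K") (auto simp: mult_ac)
    have e2: "\<phi> x * (indicator K x * (a' x * c x + a x * c' x)) = (c x * \<phi> x) * a' x + a x * (c' x * \<phi> x)" for x
      using \<phi>(2)[of x] by (cases "x \<in> K") (auto simp: algebra_simps)
    have "integrable lborel (\<lambda>x. a' x * (c x * \<phi> x))"
      by (rule integrable_bounded_mult[OF ia(2), of _ "M * B0"]) (use b2 in auto)
    moreover have "integrable lborel (\<lambda>x. (c' x * \<phi> x) * a x)"
      by (rule integrable_bounded_mult[OF i3, of _ M]) (use M in auto)
    ultimately have "(\<integral>x. pd i \<phi> x * (indicator K x * (a x * c x)) \<partial>lborel) = - (\<integral>x. \<phi> x * (indicator K x * (a' x * c x + a x * c' x)) \<partial>lborel)"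
      unfolding e1 e2 using lim by (simp add: mult.commute[of "a _"] mult.commute[of "a' _"])
    then show "\<exists>a b. L1_representative K (\<lambda>x. f x * g x) a \<and> L1_representative K (\<lambda>x. f' x * g x + f x * g' x) b \<and>
        (\<integral>x. pd i \<phi> x * a x \<partial>lborel) = - (\<integral>x. \<phi> x * b x \<partial>lborel)"
      using rmult[OF K(1) K'(2) r M] by blast
  qed
qed

lemma L1_representative_cong:
  assumes "L1_representative K f a" "K \<subseteq> \<Omega>" "AE x in lborel. x \<in> \<Omega> \<longrightarrow> f x = g x"
  shows "L1_representative K g a"
proof -
  have "AE x in lborel. a x = indicator K x * f x" "integrable lborel a"
    using assms(1) by (auto simp: L1_representative_def)
  moreover have "AE x in lborel. a x = indicator K x * g x"
    using calculation(1) assms(3) by eventually_elim (use assms(2) in \<open>auto simp: indicator_def\<close>)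
  ultimately show ?thesis by (simp add: L1_representative_def)
qed

lemma has_weak_pd_cong_AE:
  fixes f g :: "real^'n::finite \<Rightarrow> real"
  assumes \<Omega>: "open \<Omega>" and "has_weak_pd \<Omega> i f g"
    and "AE x in lborel. x \<in> \<Omega> \<longrightarrow> f x = f' x" "AE x in lborel. x \<in> \<Omega> \<longrightarrow> g x = g' x"
  shows "has_weak_pd \<Omega> i f' g'"
proof -
  have r: "\<exists>a b. L1_representative K f a \<and> L1_representative K g b \<and> L1_representative K f' a \<and> L1_representative K g' b"
    if K: "compact K" "K \<subseteq> \<Omega>" for K
  proof -
    obtain a b where "L1_representative K f a" "L1_representative K g b"
      using assms(2) K loc_integrable_representative unfolding has_weak_pd_def by metis
    then show ?thesis using L1_representative_cong K assms(3,4) by blast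
  qed
  show ?thesis
  proof (rule has_weak_pdI_lborel[OF \<Omega>])
    show "loc_integrable \<Omega> f'" "loc_integrable \<Omega> g'"
      using r by (auto intro!: loc_integrable_of_representatives)
  next
    fix K and \<phi> :: "real^'n \<Rightarrow> real" assume K: "compact K" "K \<subseteq> \<Omega>" and \<phi>: "smooth_on UNIV \<phi>" "\<And>x. x \<notin> K \<Longrightarrow> \<phi> x = 0"
    obtain a b where ab: "L1_representative K f a" "L1_representative K g b" "L1_representative K f' a" "L1_representative K g' b"
      using r[OF K] by blast
    show "\<exists>a b. L1_representative K f' a \<and> L1_representative K g' b \<and> (\<integral>x. pd i \<phi> x * a x \<partial>lborel) = - (\<integral>x. \<phi> x * b x \<partial>lborel)"
      using has_weak_pd_lborel[OF \<Omega> assms(2) K ab(1,2) \<phi>] ab(3,4) by blast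
  qed
qed

lemma has_weak_pd_add:
  fixes f g :: "real^'n::finite \<Rightarrow> real"
  assumes \<Omega>: "open \<Omega>" and f: "has_weak_pd \<Omega> i f f'" and g: "has_weak_pd \<Omega> i g g'"
  shows "has_weak_pd \<Omega> i (\<lambda>x. f x + g x) (\<lambda>x. f' x + g' x)"
proof -
  have add: "L1_representative K (\<lambda>x. u x + v x) (\<lambda>x. a x + b x)"
    if "L1_representative K u a" "L1_representative K v b" for K u v a b
  proof -
    have "AE x in lborel. a x = indicator K x * u x" "AE x in lborel. b x = indicator K x * v x"
      using that by (auto simp: L1_representative_def)
    then have "AE x in lborel. a x + b x = indicator K x * (u x + v x)"
      by eventually_elim (simp add: algebra_simps)
    then show ?thesis using that by (auto simp: L1_representative_def)
  qed
  have r: "\<exists>a a' b b'. L1_representative K f a \<and> L1_representative K f' a' \<and> L1_representative K g b \<and> L1_representative K g' b'"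
    if K: "compact K" "K \<subseteq> \<Omega>" for K
    using f g K loc_integrable_representative unfolding has_weak_pd_def by metis
  show ?thesis
  proof (rule has_weak_pdI_lborel[OF \<Omega>])
    show "loc_integrable \<Omega> (\<lambda>x. f x + g x)" "loc_integrable \<Omega> (\<lambda>x. f' x + g' x)"
    proof -
      have "(\<exists>a. L1_representative K (\<lambda>x. f x + g x) a) \<and> (\<exists>a. L1_representative K (\<lambda>x. f' x + g' x) a)"
        if "compact K" "K \<subseteq> \<Omega>" for K
        using r[OF that] add by blast
      then show "loc_integrable \<Omega> (\<lambda>x. f x + g x)" "loc_integrable \<Omega> (\<lambda>x. f' x + g' x)"
        by (auto intro: loc_integrable_of_representatives)
    qed
  next
    fix K and \<phi> :: "real^'n \<Rightarrow> real" assume K: "compact K" "K \<subseteq> \<Omega>" and \<phi>: "smooth_on UNIV \<phi>" "\<And>x. x \<notin> K \<Longrightarrow> \<phi> x = 0"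
    obtain a a' b b' where ab: "L1_representative K f a" "L1_representative K f' a'" "L1_representative K g b" "L1_representative K g' b'"
      using r[OF K] by blast
    have c: "continuous_on UNIV \<phi>" "continuous_on UNIV (pd i \<phi>)"
      using smooth_on_continuous_on[OF \<phi>(1)] smooth_on_continuous_on[OF pd_smooth_on[OF \<phi>(1)]] by auto
    have z: "pd i \<phi> x = 0" if "x \<notin> K" for x using pd_eq_0_outside[OF compact_imp_closed[OF K(1)] \<phi>(2) that] .
    obtain B0 where B0: "\<And>x. \<bar>\<phi> x\<bar> \<le> B0" using continuous_compact_support_bounded[OF c(1) K(1) \<phi>(2)] by blast
    obtain B1 where B1: "\<And>x. \<bar>pd i \<phi> x\<bar> \<le> B1" using continuous_compact_support_bounded[OF c(2) K(1) z] by blast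
    have ia: "integrable lborel a" "integrable lborel b" "integrable lborel a'" "integrable lborel b'"
      using ab by (auto simp: L1_representative_def)
    have m: "\<phi> \<in> borel_measurable lborel" "pd i \<phi> \<in> borel_measurable lborel"
      using c by (auto intro: borel_measurable_continuous_onI)
    note i = integrable_bounded_mult[OF ia(1) m(2) AE_I2[OF B1]] integrable_bounded_mult[OF ia(2) m(2) AE_I2[OF B1]]
      integrable_bounded_mult[OF ia(3) m(1) AE_I2[OF B0]] integrable_bounded_mult[OF ia(4) m(1) AE_I2[OF B0]]
    have "(\<integral>x. pd i \<phi> x * (a x + b x) \<partial>lborel) = - (\<integral>x. \<phi> x * (a' x + b' x) \<partial>lborel)"
      using has_weak_pd_lborel[OF \<Omega> f K ab(1,2) \<phi>] has_weak_pd_lborel[OF \<Omega> g K ab(3,4) \<phi>] i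
      by (simp add: distrib_left mult.commute)
    then show "\<exists>a b. L1_representative K (\<lambda>x. f x + g x) a \<and> L1_representative K (\<lambda>x. f' x + g' x) b \<and> (\<integral>x. pd i \<phi> x * a x \<partial>lborel) = - (\<integral>x. \<phi> x * b x \<partial>lborel)"
      using add[OF ab(1,3)] add[OF ab(2,4)] by blast
  qed
qed

section \<open>Local boundedness and classical derivatives\<close>

lemma locally_bounded_continuous:
  assumes "continuous_on \<Omega> f"
  shows "locally_bounded \<Omega> f"
  unfolding locally_bounded_def
proof (intro allI impI)
  fix K assume "compact K \<and> K \<subseteq> \<Omega>"
  then have "bounded (f ` K)" using assms by (metis compact_continuous_image compact_imp_bounded continuous_on_subset)
  then obtain M where "\<forall>y\<in>f ` K. \<bar>y\<bar> \<le> M" by (auto simp: bounded_iff)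
  then show "\<exists>M. AE x in lborel. x \<in> K \<longrightarrow> \<bar>f x\<bar> \<le> M" by (intro exI[of _ M] AE_I2) auto
qed

lemma L1_representative_continuous:
  assumes "continuous_on \<Omega> f" "compact K" "K \<subseteq> \<Omega>"
  shows "L1_representative K f (\<lambda>x. indicator K x * f x)"
  using borel_integrable_compact[OF assms(2) continuous_on_subset[OF assms(1,3)]]
  by (auto simp: L1_representative_def)

lemma loc_integrable_continuous:
  fixes f :: "real^'n::finite \<Rightarrow> real"
  assumes "continuous_on \<Omega> f"
  shows "loc_integrable \<Omega> f"
  using L1_representative_continuous[OF assms] loc_integrable_of_representatives by blast

lemma locally_bounded_mult:
  assumes "locally_bounded \<Omega> f" "locally_bounded \<Omega> g"
  shows "locally_bounded \<Omega> (\<lambda>x. f x * g x)"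
  unfolding locally_bounded_def
proof (intro allI impI)
  fix K assume "compact K \<and> K \<subseteq> \<Omega>"
  then obtain M1 M2 where "AE x in lborel. x \<in> K \<longrightarrow> \<bar>f x\<bar> \<le> M1" "AE x in lborel. x \<in> K \<longrightarrow> \<bar>g x\<bar> \<le> M2"
    using assms unfolding locally_bounded_def by blast
  then have "AE x in lborel. x \<in> K \<longrightarrow> \<bar>f x * g x\<bar> \<le> \<bar>M1\<bar> * \<bar>M2\<bar>"
    by eventually_elim (auto simp: abs_mult intro!: mult_mono)
  then show "\<exists>M. AE x in lborel. x \<in> K \<longrightarrow> \<bar>f x * g x\<bar> \<le> M" by blast
qed

lemma locally_bounded_add:
  assumes "locally_bounded \<Omega> f" "locally_bounded \<Omega> g"
  shows "locally_bounded \<Omega> (\<lambda>x. f x + g x)"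
  unfolding locally_bounded_def
proof (intro allI impI)
  fix K assume "compact K \<and> K \<subseteq> \<Omega>"
  then obtain M1 M2 where "AE x in lborel. x \<in> K \<longrightarrow> \<bar>f x\<bar> \<le> M1" "AE x in lborel. x \<in> K \<longrightarrow> \<bar>g x\<bar> \<le> M2"
    using assms unfolding locally_bounded_def by blast
  then have "AE x in lborel. x \<in> K \<longrightarrow> \<bar>f x + g x\<bar> \<le> M1 + M2"
    by eventually_elim (intro impI order_trans[OF abs_triangle_ineq add_mono]; simp)
  then show "\<exists>M. AE x in lborel. x \<in> K \<longrightarrow> \<bar>f x + g x\<bar> \<le> M" by blast
qed

lemma locally_bounded_mono:
  assumes "locally_bounded \<Omega> g" "AE x in lborel. x \<in> \<Omega> \<longrightarrow> \<bar>f x\<bar> \<le> \<bar>g x\<bar>"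
  shows "locally_bounded \<Omega> f"
  unfolding locally_bounded_def
proof (intro allI impI)
  fix K assume K: "compact K \<and> K \<subseteq> \<Omega>"
  then obtain M where "AE x in lborel. x \<in> K \<longrightarrow> \<bar>g x\<bar> \<le> M"
    using assms unfolding locally_bounded_def by blast
  then have "AE x in lborel. x \<in> K \<longrightarrow> \<bar>f x\<bar> \<le> M"
    using assms(2) by eventually_elim (use K in auto)
  then show "\<exists>M. AE x in lborel. x \<in> K \<longrightarrow> \<bar>f x\<bar> \<le> M" by blast
qed

text \<open>The difference quotients in direction \<open>e\<close> have integral zero by translation
  invariance. The mean value theorem bounds them by a bound of \<open>D\<close>, and for steps of at
  most 1 they live on the fixed compact set \<open>K'\<close>, so dominated convergence
  applies.\<close>

lemma integral_directional_derivative_eq_0: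
  fixes F D :: "'a::euclidean_space \<Rightarrow> real"
  assumes F: "continuous_on UNIV F" and D: "continuous_on UNIV D" and K: "compact K"
    and F0: "\<And>x. x \<notin> K \<Longrightarrow> F x = 0" and D0: "\<And>x. x \<notin> K \<Longrightarrow> D x = 0"
    and d: "\<And>x. ((\<lambda>t. F (x + t *\<^sub>R e)) has_real_derivative D x) (at 0)"
  shows "(\<integral>x. D x \<partial>lborel) = 0"
proof -
  define h where "h m = inverse (real (Suc m))" for m
  have h: "h m > 0" "h m \<le> 1" for m by (auto simp: h_def inverse_le_1_iff)
  define q where "q m x = (F (x + h m *\<^sub>R e) - F x) / h m" for m x
  have [measurable]: "F \<in> borel_measurable borel" "D \<in> borel_measurable borel"
    using F D by (auto intro: borel_measurable_continuous_onI)
  obtain B where B: "\<And>x. \<bar>D x\<bar> \<le> B" using continuous_compact_support_bounded[OF D K D0] by blast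
  define K' where "K' = {x + z |x z. x \<in> K \<and> z \<in> cball 0 (norm e)}"
  have K': "compact K'" unfolding K'_def by (intro compact_sums K compact_cball)
  have dt: "((\<lambda>t. F (x + t *\<^sub>R e)) has_real_derivative D (x + s *\<^sub>R e)) (at s)" for x s
    using d[of "x + s *\<^sub>R e"] DERIV_shift[of "\<lambda>t. F (x + t *\<^sub>R e)" "D (x + s *\<^sub>R e)" 0 s]
    by (simp add: algebra_simps)
  have Fi: "integrable lborel F"
  proof -
    have "integrable lborel (\<lambda>x. indicator K x *\<^sub>R F x)"
      by (intro borel_integrable_compact K continuous_on_subset[OF F]) auto
    also have "(\<lambda>x. indicator K x *\<^sub>R F x) = F" using F0 by (force simp: indicator_def)
    finally show ?thesis .
  qed
  have q0: "(\<integral>x. q m x \<partial>lborel) = 0" for m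
    using integral_lborel_translation[of F "h m *\<^sub>R e"] integrable_lborel_translation[OF Fi, of "h m *\<^sub>R e"] Fi
    by (simp add: q_def add.commute)
  have qb: "\<bar>q m x\<bar> \<le> B * indicator K' x" for m x
  proof (cases "x \<in> K'")
    case True
    have "\<exists>s. 0 < s \<and> s < h m \<and> F (x + h m *\<^sub>R e) - F (x + 0 *\<^sub>R e) = (h m - 0) * D (x + s *\<^sub>R e)"
      by (rule MVT2[OF h(1)]) (rule dt)
    then show ?thesis using h(1)[of m] B True by (auto simp: q_def abs_mult)
  next
    case False
    have "x \<notin> K"
    proof
      assume "x \<in> K" then have "x + 0 \<in> K'" unfolding K'_def by force
      with False show False by simp
    qed
    moreover have "x + h m *\<^sub>R e \<notin> K"
    proof
      assume "x + h m *\<^sub>R e \<in> K"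
      moreover have "norm (h m *\<^sub>R e) \<le> norm e" using h[of m] by (simp add: mult_left_le_one_le)
      ultimately have "(x + h m *\<^sub>R e) + (- (h m *\<^sub>R e)) \<in> K'"
        unfolding K'_def by (intro CollectI exI[of _ "x + h m *\<^sub>R e"] exI[of _ "- (h m *\<^sub>R e)"] conjI refl) auto
      with False show False by simp
    qed
    ultimately show ?thesis using False F0 by (simp add: q_def)
  qed
  have "(\<lambda>m. \<integral>x. q m x \<partial>lborel) \<longlonglongrightarrow> (\<integral>x. D x \<partial>lborel)"
  proof (rule integral_dominated_convergence)
    show "integrable lborel (\<lambda>x. B * indicator K' x)"
      using K' emeasure_lborel_cbox_finite compact_imp_bounded[OF K'] emeasure_bounded_finite[OF compact_imp_bounded[OF K']]
      by (intro integrable_mult_right integrable_real_indicator) (auto simp: borel_compact)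
    show "AE x in lborel. (\<lambda>m. q m x) \<longlonglongrightarrow> D x"
    proof (intro AE_I2)
      fix x
      have "((\<lambda>t. (F (x + (0 + t) *\<^sub>R e) - F (x + 0 *\<^sub>R e)) / t) \<longlongrightarrow> D x) (at 0)"
        using d[of x] unfolding DERIV_def .
      moreover have "filterlim h (at 0) sequentially"
        unfolding filterlim_at h_def using LIMSEQ_inverse_real_of_nat by auto
      ultimately have "(\<lambda>m. (F (x + (0 + h m) *\<^sub>R e) - F (x + 0 *\<^sub>R e)) / h m) \<longlonglongrightarrow> D x"
        by (rule filterlim_compose)
      then show "(\<lambda>m. q m x) \<longlonglongrightarrow> D x" by (simp add: q_def)
    qed
    show "AE x in lborel. norm (q m x) \<le> B * indicator K' x" for m using qb by auto
  qed (simp_all add: q_def)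
  then show ?thesis using q0 LIMSEQ_unique[OF tendsto_const, of 0] by simp
qed

text \<open>The product of \<open>f\<close> with a test function, extended by zero, is continuous on
  the whole space, and the integral of its derivative along a coordinate axis is zero.\<close>

lemma has_weak_pd_classical:
  fixes f :: "real^'n::finite \<Rightarrow> real"
  assumes \<Omega>: "open \<Omega>" and f: "\<And>x. x \<in> \<Omega> \<Longrightarrow> (f has_derivative f' x) (at x)"
    and c: "continuous_on \<Omega> (\<lambda>x. f' x (axis i 1))"
  shows "has_weak_pd \<Omega> i f (\<lambda>x. f' x (axis i 1))"
proof (rule has_weak_pdI_lborel[OF \<Omega>])
  have cf: "continuous_on \<Omega> f"
    using f by (auto intro!: continuous_at_imp_continuous_on has_derivative_continuous)
  show "loc_integrable \<Omega> f" "loc_integrable \<Omega> (\<lambda>x. f' x (axis i 1))"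
    using cf c loc_integrable_continuous by auto
  fix K and \<phi> :: "real^'n \<Rightarrow> real" assume K: "compact K" "K \<subseteq> \<Omega>" and \<phi>: "smooth_on UNIV \<phi>" "\<And>x. x \<notin> K \<Longrightarrow> \<phi> x = 0"
  let ?a = "\<lambda>x. indicator K x * f x" and ?b = "\<lambda>x. indicator K x * f' x (axis i 1)"
  have z: "pd i \<phi> x = 0" if "x \<notin> K" for x using pd_eq_0_outside[OF compact_imp_closed[OF K(1)] \<phi>(2) that] .
  have c\<phi>: "continuous_on S \<phi>" "continuous_on S (pd i \<phi>)" for S
    using smooth_on_continuous_on[OF \<phi>(1)] smooth_on_continuous_on[OF pd_smooth_on[OF \<phi>(1)]] continuous_on_subset by blast+
  define F where "F x = \<phi> x * f x" for x
  define D where "D x = pd i \<phi> x * f x + \<phi> x * f' x (axis i 1)" for x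
  \<comment> \<open>Continuity is checked on two open sets that cover the space: the domain, and the
    complement of the compact set, where everything vanishes.\<close>
  have U: "UNIV = \<Omega> \<union> - K" using K by auto
  have oK: "open (- K)" by (rule open_Compl[OF compact_imp_closed[OF K(1)]])
  have F0: "F x = 0" "D x = 0" if "x \<notin> K" for x using \<phi>(2)[OF that] z[OF that] by (auto simp: F_def D_def)
  have cF: "continuous_on UNIV F" "continuous_on UNIV D"
    unfolding U
  proof (safe intro!: continuous_on_open_Un \<Omega> oK)
    show "continuous_on \<Omega> F" "continuous_on \<Omega> D"
      unfolding F_def D_def by (intro continuous_intros c\<phi> cf c)+
    show "continuous_on (- K) F" "continuous_on (- K) D"
      using F0 continuous_on_cong[of "- K" "- K" _ "\<lambda>x. 0"] by auto
  qed
  have d: "((\<lambda>t. F (x + t *\<^sub>R axis i 1)) has_real_derivative D x) (at 0)" for x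
  proof -
    have "\<exists>F'. (F has_derivative F') (at x) \<and> F' (axis i 1) = D x"
    proof (cases "x \<in> K")
      case True
      then have "(f has_derivative f' x) (at x)" using f K by auto
      from has_derivative_mult[OF smooth_on_has_derivative[OF \<phi>(1) UNIV_I] this]
      show ?thesis unfolding F_def[abs_def] by (intro exI conjI, assumption) (simp add: D_def pd_def)
    next
      case False
      have "(F has_derivative (\<lambda>h. 0)) (at x)"
        by (rule has_derivative_transform_within_open[of "\<lambda>x. 0" _ x UNIV "- K"]) (use F0 oK False in auto)
      then show ?thesis using F0(2)[OF False] by auto
    qed
    then obtain F' where F': "(F has_derivative F') (at x)" "F' (axis i 1) = D x" by blast
    interpret l: linear F' using F'(1) by (rule has_derivative_linear)
    have 1: "((\<lambda>t. x + t *\<^sub>R axis i 1) has_derivative (\<lambda>t. t *\<^sub>R axis i 1)) (at 0)"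
      by (auto intro!: derivative_eq_intros)
    have 2: "(F has_derivative F') (at (x + 0 *\<^sub>R axis i 1))" using F'(1) by simp
    show ?thesis using has_derivative_compose[OF 1 2]
      by (simp add: has_field_derivative_def l.scaleR F'(2) mult.commute[of _ "D x"])
  qed
  have "(\<integral>x. D x \<partial>lborel) = 0"
    by (rule integral_directional_derivative_eq_0[OF cF K(1) F0 d])
  moreover have i: "integrable lborel (\<lambda>x. indicator K x *\<^sub>R (pd i \<phi> x * f x))" "integrable lborel (\<lambda>x. indicator K x *\<^sub>R (\<phi> x * f' x (axis i 1)))"
    by (intro borel_integrable_compact K continuous_intros c\<phi> continuous_on_subset[OF cf] continuous_on_subset[OF c])+
  moreover have "D x = indicator K x *\<^sub>R (pd i \<phi> x * f x) + indicator K x *\<^sub>R (\<phi> x * f' x (axis i 1))" for x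
    using F0(2)[of x] by (cases "x \<in> K") (auto simp: D_def)
  ultimately have "(\<integral>x. indicator K x *\<^sub>R (pd i \<phi> x * f x) \<partial>lborel) + (\<integral>x. indicator K x *\<^sub>R (\<phi> x * f' x (axis i 1)) \<partial>lborel) = 0"
    by simp
  then have "(\<integral>x. pd i \<phi> x * ?a x \<partial>lborel) = - (\<integral>x. \<phi> x * ?b x \<partial>lborel)"
    by (simp add: mult_ac)
  then show "\<exists>a b. L1_representative K f a \<and> L1_representative K (\<lambda>x. f' x (axis i 1)) b \<and> (\<integral>x. pd i \<phi> x * a x \<partial>lborel) = - (\<integral>x. \<phi> x * b x \<partial>lborel)"
    using L1_representative_continuous[OF cf K] L1_representative_continuous[OF c K] by blast
qed

lemma pd_commute_smooth:
  fixes \<phi> :: "real^'n::finite \<Rightarrow> real"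
  assumes "smooth_on UNIV \<phi>"
  shows "pd i (pd j \<phi>) = pd j (pd i \<phi>)"
proof
  fix x
  have d: "smooth_on UNIV (\<lambda>x. frechet_derivative \<phi> (at x) v)" for v
    by (rule smooth_on_frechet_derivative[OF assms])
  show "pd i (pd j \<phi>) x = pd j (pd i \<phi>) x"
    unfolding pd_def[abs_def]
    by (rule mixed_derivatives_commute[where U = UNIV and f = \<phi> and f' = "\<lambda>x. frechet_derivative \<phi> (at x)"])
      (auto intro: smooth_on_has_derivative[OF assms] smooth_on_has_derivative[OF d]
        smooth_on_continuous_on[OF smooth_on_frechet_derivative[OF d]])
qed

lemma test_function_pd:
  assumes "test_function \<Omega> \<phi>"
  shows "test_function \<Omega> (pd i \<phi>)"
  using assms pd_eq_0_outside[OF compact_imp_closed] pd_smooth_on unfolding test_function_iff by blast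

text \<open>Both candidates, tested against \<open>\<phi>\<close>, equal the integral of
  \<open>f\<close> against a second derivative of \<open>\<phi>\<close>, for which the order is
  immaterial. Uniqueness of the weak derivative does the rest.\<close>

lemma weak_pd_commute:
  fixes f :: "real^'n::finite \<Rightarrow> real"
  assumes \<Omega>: "open \<Omega>" and f: "has_weak_pd \<Omega> i f fi" "has_weak_pd \<Omega> j f fj"
    and fij: "has_weak_pd \<Omega> j fi fij" and fji: "has_weak_pd \<Omega> i fj fji"
  shows "AE x in lborel. x \<in> \<Omega> \<longrightarrow> fij x = fji x"
proof (rule weak_pd_zero_unique[OF \<Omega> fij])
  show "has_weak_pd \<Omega> j fi fji"
    unfolding has_weak_pd_def
  proof (intro conjI allI impI)
    show "loc_integrable \<Omega> fi" "loc_integrable \<Omega> fji" using f fji by (auto simp: has_weak_pd_def)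
    fix \<phi> assume \<phi>: "test_function \<Omega> \<phi>"
    have "(LINT x|lebesgue_on \<Omega>. pd j \<phi> x *\<^sub>R fi x) = - (LINT x|lebesgue_on \<Omega>. pd i (pd j \<phi>) x *\<^sub>R f x)"
      using f(1) test_function_pd[OF \<phi>, of j] by (simp add: has_weak_pd_def)
    also have "\<dots> = - (LINT x|lebesgue_on \<Omega>. pd j (pd i \<phi>) x *\<^sub>R f x)"
      using \<phi> by (simp add: pd_commute_smooth[of \<phi> i j] test_function_def)
    also have "\<dots> = (LINT x|lebesgue_on \<Omega>. pd i \<phi> x *\<^sub>R fj x)"
      using f(2) test_function_pd[OF \<phi>, of i] by (simp add: has_weak_pd_def)
    also have "\<dots> = - (LINT x|lebesgue_on \<Omega>. \<phi> x *\<^sub>R fji x)"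
      using fji \<phi> by (simp add: has_weak_pd_def)
    finally show "(LINT x|lebesgue_on \<Omega>. pd j \<phi> x *\<^sub>R fi x) = - (LINT x|lebesgue_on \<Omega>. \<phi> x *\<^sub>R fji x)" .
  qed
qed

section \<open>Vector-valued functions\<close>

lemma integrable_vec_iff:
  fixes f :: "'a \<Rightarrow> real^'m::finite"
  shows "integrable M f \<longleftrightarrow> (\<forall>k. integrable M (\<lambda>x. f x $ k))"
proof safe
  fix k assume "integrable M f"
  then show "integrable M (\<lambda>x. f x $ k)" by (rule integrable_bounded_linear[OF bounded_linear_vec_nth])
next
  assume *: "\<forall>k. integrable M (\<lambda>x. f x $ k)"
  have "integrable M (\<lambda>x. \<Sum>k\<in>UNIV. f x $ k *\<^sub>R axis k (1::real))"
    using * by (intro Bochner_Integration.integrable_sum integrable_scaleR_left) auto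
  moreover have "(\<Sum>k\<in>UNIV. f x $ k *\<^sub>R axis k (1::real)) = f x" for x
    by (simp add: vec_eq_iff axis_def if_distrib sum.If_cases cong: if_cong)
  ultimately show "integrable M f" by simp
qed

lemma integral_vec_nth:
  fixes f :: "'a \<Rightarrow> real^'m::finite"
  assumes "integrable M f"
  shows "integral\<^sup>L M f $ k = (\<integral>x. f x $ k \<partial>M)"
  using integral_bounded_linear[OF bounded_linear_vec_nth assms] by metis

lemma loc_integrable_vec_iff:
  fixes f :: "real^'n::finite \<Rightarrow> real^'m::finite"
  shows "loc_integrable \<Omega> f \<longleftrightarrow> (\<forall>k. loc_integrable \<Omega> (\<lambda>x. f x $ k))"
  unfolding loc_integrable_def using integrable_vec_iff[of _ f] by blast

lemma integrable_test_mult: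
  fixes f :: "real^'n::finite \<Rightarrow> real"
  assumes "open \<Omega>" "loc_integrable \<Omega> f" "compact K" "K \<subseteq> \<Omega>" "continuous_on UNIV \<phi>" "\<And>x. x \<notin> K \<Longrightarrow> \<phi> x = 0"
  shows "integrable (lebesgue_on \<Omega>) (\<lambda>x. \<phi> x * f x)"
proof -
  have i: "integrable lebesgue (\<lambda>x. indicator K x * f x)"
    using assms by (simp add: loc_integrable_def integrable_lebesgue_on_iff compact_sets_lebesgue)
  obtain B where B: "\<And>x. \<bar>\<phi> x\<bar> \<le> B" using continuous_compact_support_bounded[OF assms(5,3,6)] by blast
  have "integrable lebesgue (\<lambda>x. (indicator K x * f x) * \<phi> x)"
    by (rule integrable_bounded_mult[OF i, of _ B])
      (use B assms(5) in \<open>auto intro!: measurable_completion borel_measurable_continuous_onI\<close>)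
  also have "(\<lambda>x. (indicator K x * f x) * \<phi> x) = (\<lambda>x. indicator \<Omega> x * (\<phi> x * f x))"
    using assms(4,6) by (auto simp: indicator_def fun_eq_iff)
  finally show ?thesis using assms(1) by (simp add: integrable_lebesgue_on_iff)
qed

lemma has_weak_pd_vec_iff:
  fixes f g :: "real^'n::finite \<Rightarrow> real^'m::finite"
  assumes \<Omega>: "open \<Omega>"
  shows "has_weak_pd \<Omega> i f g \<longleftrightarrow> (\<forall>k. has_weak_pd \<Omega> i (\<lambda>x. f x $ k) (\<lambda>x. g x $ k))"
proof -
  have "(\<forall>\<phi>. test_function \<Omega> \<phi> \<longrightarrow> (LINT x|lebesgue_on \<Omega>. pd i \<phi> x *\<^sub>R f x) = - (LINT x|lebesgue_on \<Omega>. \<phi> x *\<^sub>R g x))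
    \<longleftrightarrow> (\<forall>k \<phi>. test_function \<Omega> \<phi> \<longrightarrow> (LINT x|lebesgue_on \<Omega>. pd i \<phi> x *\<^sub>R f x $ k) = - (LINT x|lebesgue_on \<Omega>. \<phi> x *\<^sub>R g x $ k))"
    if l: "\<And>k. loc_integrable \<Omega> (\<lambda>x. f x $ k)" "\<And>k. loc_integrable \<Omega> (\<lambda>x. g x $ k)"
  proof -
    \<comment> \<open>A component is taken under the integral by linearity, which asks for
      integrability; the compact support of the test function provides it.\<close>
    have comp: "(LINT x|lebesgue_on \<Omega>. \<psi> x *\<^sub>R u x) $ k = (LINT x|lebesgue_on \<Omega>. \<psi> x *\<^sub>R u x $ k)"
      if \<psi>: "test_function \<Omega> \<psi>" and u: "\<And>k. loc_integrable \<Omega> (\<lambda>x. u x $ k)" for \<psi> and u :: "real^'n \<Rightarrow> real^'m" and k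
    proof -
      obtain K where K: "compact K" "K \<subseteq> \<Omega>" "\<And>x. x \<notin> K \<Longrightarrow> \<psi> x = 0" and s: "smooth_on UNIV \<psi>"
        using \<psi> unfolding test_function_iff by blast
      have "integrable (lebesgue_on \<Omega>) (\<lambda>x. \<psi> x *\<^sub>R u x)"
        unfolding integrable_vec_iff
        using integrable_test_mult[OF \<Omega> u K(1,2) smooth_on_continuous_on[OF s] K(3)] by simp
      from integral_vec_nth[OF this] show ?thesis by simp
    qed
    have c: "(LINT x|lebesgue_on \<Omega>. pd i \<phi> x *\<^sub>R f x) $ k = (LINT x|lebesgue_on \<Omega>. pd i \<phi> x *\<^sub>R f x $ k)"
      "(LINT x|lebesgue_on \<Omega>. \<phi> x *\<^sub>R g x) $ k = (LINT x|lebesgue_on \<Omega>. \<phi> x *\<^sub>R g x $ k)"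
      if "test_function \<Omega> \<phi>" for \<phi> k
      using comp[OF test_function_pd[OF that] l(1)] comp[OF that l(2)] by auto
    show ?thesis
      unfolding vec_eq_iff vector_uminus_component by (metis (no_types, lifting) c)
  qed
  then show ?thesis unfolding has_weak_pd_def loc_integrable_vec_iff[of _ f] loc_integrable_vec_iff[of _ g] by blast
qed

lemma weak_pd_has_weak_pd:
  assumes "has_weak_pd \<Omega> i f g"
  shows "has_weak_pd \<Omega> i f (weak_pd \<Omega> i f)"
  using assms unfolding weak_pd_def by (rule someI[of "has_weak_pd \<Omega> i f"])

text \<open>\<open>weak_pd\<close> is an arbitrary choice among weak derivatives, so identities
  about it are obtained almost everywhere, by comparison with a derivative that is known.\<close>

lemma weak_pd_AE_eq:
  fixes f g :: "real^'n::finite \<Rightarrow> real^'m::finite"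
  assumes "open \<Omega>" "has_weak_pd \<Omega> i f g"
  shows "AE x in lborel. x \<in> \<Omega> \<longrightarrow> weak_pd \<Omega> i f x = g x"
proof -
  have "\<forall>k. AE x in lborel. x \<in> \<Omega> \<longrightarrow> weak_pd \<Omega> i f x $ k = g x $ k"
    using weak_pd_zero_unique[OF assms(1)] assms(2) weak_pd_has_weak_pd[OF assms(2)]
    unfolding has_weak_pd_vec_iff[OF assms(1)] by blast
  then have "AE x in lborel. \<forall>k. x \<in> \<Omega> \<longrightarrow> weak_pd \<Omega> i f x $ k = g x $ k"
    using AE_finite_allI[where S = UNIV and M = lborel and Q = "\<lambda>k x. x \<in> \<Omega> \<longrightarrow> weak_pd \<Omega> i f x $ k = g x $ k"] by simp
  then show ?thesis by eventually_elim (auto simp: vec_eq_iff)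
qed

lemma has_weak_pd_vec_cong_AE:
  fixes f g :: "real^'n::finite \<Rightarrow> real^'m::finite"
  assumes \<Omega>: "open \<Omega>" and "has_weak_pd \<Omega> i f g"
    and "AE x in lborel. x \<in> \<Omega> \<longrightarrow> f x = f' x" "AE x in lborel. x \<in> \<Omega> \<longrightarrow> g x = g' x"
  shows "has_weak_pd \<Omega> i f' g'"
  unfolding has_weak_pd_vec_iff[OF \<Omega>]
proof
  fix k
  have "has_weak_pd \<Omega> i (\<lambda>x. f x $ k) (\<lambda>x. g x $ k)" using assms(2) has_weak_pd_vec_iff[OF \<Omega>] by blast
  then show "has_weak_pd \<Omega> i (\<lambda>x. f' x $ k) (\<lambda>x. g' x $ k)"
  proof (rule has_weak_pd_cong_AE[OF \<Omega>])
    show "AE x in lborel. x \<in> \<Omega> \<longrightarrow> f x $ k = f' x $ k" using assms(3) by eventually_elim simp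
    show "AE x in lborel. x \<in> \<Omega> \<longrightarrow> g x $ k = g' x $ k" using assms(4) by eventually_elim simp
  qed
qed

section \<open>Integrable linear systems\<close>

text \<open>Picard iteration as a series: the terms are iterated integrals bounded by a constant
  times \<open>(M t)^n / n!\<close>, so the series converges uniformly on the whole interval at
  once.\<close>

lemma linear_ode_exists:
  fixes A :: "real \<Rightarrow> 'a::banach \<Rightarrow>\<^sub>L 'a"
  assumes A: "continuous_on {0..1} A"
  shows "\<exists>X. X 0 = x0 \<and> (\<forall>t\<in>{0..1}. (X has_vector_derivative A t (X t)) (at t within {0..1}))"
proof -
  obtain M where "\<forall>y\<in>A ` {0..1}. norm y \<le> M"
    using compact_imp_bounded[OF compact_continuous_image[OF A compact_Icc]] by (auto simp: bounded_iff)
  then have M: "\<And>t. t \<in> {0..1} \<Longrightarrow> norm (A t) \<le> M" by blast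
  have M0: "M \<ge> 0" using order_trans[OF norm_ge_zero M[of 0]] by simp
  define u where "u = rec_nat (\<lambda>t. x0) (\<lambda>n v t. integral {0..t} (\<lambda>s. A s (v s)))"
  have u0: "u 0 t = x0" and uS: "u (Suc n) t = integral {0..t} (\<lambda>s. A s (u n s))" for n t
    by (auto simp: u_def)
  have cont: "continuous_on {0..1} (u n)" for n
  proof (induction n)
    case 0 then show ?case by (simp add: u0)
  next
    case (Suc n)
    have "continuous_on {0..1} (\<lambda>s. A s (u n s))" by (intro continuous_intros A Suc)
    then have "continuous_on {0..1} (\<lambda>t. integral {0..t} (\<lambda>s. A s (u n s)))"
      by (intro indefinite_integral_continuous_1 integrable_continuous_real)
    then show ?case by (simp add: uS[abs_def])
  qed
  have bound: "norm (u n t) \<le> norm x0 * (M * t) ^ n / fact n" if "t \<in> {0..1}" for n t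
    using that
  proof (induction n arbitrary: t)
    case 0 then show ?case by (simp add: u0)
  next
    case (Suc n)
    have sub: "{0..t} \<subseteq> {0..1}" using Suc.prems by auto
    have d: "((\<lambda>s. norm x0 * (M * s) ^ Suc n / fact (Suc n)) has_vector_derivative M * (norm x0 * (M * s) ^ n / fact n)) (at s within {0..t})" for s
    proof -
      have "((\<lambda>s. norm x0 / fact (Suc n) * (M * s) ^ Suc n) has_real_derivative
          norm x0 / fact (Suc n) * (of_nat (Suc n) * (M * (M * s) ^ (Suc n - Suc 0)))) (at s within {0..t})"
        by (rule DERIV_cmult[OF DERIV_power[OF DERIV_cmult_Id]])
      also have "norm x0 / fact (Suc n) * (of_nat (Suc n) * (M * (M * s) ^ (Suc n - Suc 0))) = M * (norm x0 * (M * s) ^ n / fact n)"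
        by (simp add: divide_simps del: of_nat_Suc)
      finally have "((\<lambda>s. norm x0 * (M * s) ^ Suc n / fact (Suc n)) has_real_derivative M * (norm x0 * (M * s) ^ n / fact n)) (at s within {0..t})"
        by simp
      then show ?thesis by (simp add: has_real_derivative_iff_has_vector_derivative)
    qed
    have I: "((\<lambda>s. M * (norm x0 * (M * s) ^ n / fact n)) has_integral norm x0 * (M * t) ^ Suc n / fact (Suc n)) {0..t}"
      using fundamental_theorem_of_calculus[OF _ d] Suc.prems by simp
    have "norm (integral {0..t} (\<lambda>s. A s (u n s))) \<le> integral {0..t} (\<lambda>s. M * (norm x0 * (M * s) ^ n / fact n))"
    proof (rule integral_norm_bound_integral)
      show "(\<lambda>s. A s (u n s)) integrable_on {0..t}"
        by (intro integrable_continuous_real continuous_intros continuous_on_subset[OF A sub] continuous_on_subset[OF cont sub])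
      show "(\<lambda>s. M * (norm x0 * (M * s) ^ n / fact n)) integrable_on {0..t}" using I by blast
      fix s assume "s \<in> {0..t}"
      then have s: "s \<in> {0..1}" using sub by auto
      have "norm (A s (u n s)) \<le> norm (A s) * norm (u n s)" by (rule norm_blinfun)
      also have "\<dots> \<le> M * (norm x0 * (M * s) ^ n / fact n)"
        by (intro mult_mono M s Suc.IH M0) auto
      finally show "norm (A s (u n s)) \<le> M * (norm x0 * (M * s) ^ n / fact n)" .
    qed
    also have "\<dots> = norm x0 * (M * t) ^ Suc n / fact (Suc n)" using I by (rule integral_unique)
    finally show ?case by (simp add: uS)
  qed
  define S where "S n t = (\<Sum>i<n. u i t)" for n t
  define X where "X t = (\<Sum>i. u i t)" for t
  have uni: "uniform_limit {0..1} S X sequentially"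
    unfolding S_def X_def
  proof (rule Weierstrass_m_test)
    fix n :: nat and t :: real assume t: "t \<in> {0..1}"
    have "(M * t) ^ n \<le> M ^ n" using t M0 by (intro power_mono) (auto simp: mult_left_le)
    then have "norm x0 * (M * t) ^ n / fact n \<le> norm x0 * M ^ n / fact n"
      by (intro divide_right_mono mult_left_mono) auto
    then show "norm (u n t) \<le> norm x0 * (inverse (fact n) * M ^ n)"
      using bound[OF t, of n] by (simp add: field_simps)
  qed (intro summable_mult summable_exp)
  have contS: "continuous_on {0..1} (S n)" for n
    unfolding S_def by (intro continuous_intros cont)
  have contX: "continuous_on {0..1} X"
    by (rule uniform_limit_theorem[OF _ uni]) (auto simp: contS)
  \<comment> \<open>The partial sums satisfy the integral equation with a shift of the index by one,
    which disappears in the limit.\<close>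
  have Sint: "S (Suc n) t = x0 + integral {0..t} (\<lambda>s. A s (S n s))" if t: "t \<in> {0..1}" for n t
  proof -
    have sub: "{0..t} \<subseteq> {0..1}" using t by auto
    have "S (Suc n) t = x0 + (\<Sum>i<n. integral {0..t} (\<lambda>s. A s (u i s)))"
      unfolding S_def by (subst sum.lessThan_Suc_shift) (simp add: u0 uS)
    also have "(\<Sum>i<n. integral {0..t} (\<lambda>s. A s (u i s))) = integral {0..t} (\<lambda>s. \<Sum>i<n. A s (u i s))"
      by (intro integral_sum[symmetric] integrable_continuous_real continuous_intros continuous_on_subset[OF A sub] continuous_on_subset[OF cont sub]) auto
    also have "(\<lambda>s. \<Sum>i<n. A s (u i s)) = (\<lambda>s. A s (S n s))"
      by (simp add: S_def blinfun.sum_right)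
    finally show ?thesis .
  qed
  have Xint: "X t = x0 + integral {0..t} (\<lambda>s. A s (X s))" if t: "t \<in> {0..1}" for t
  proof -
    have sub: "{0..t} \<subseteq> {0..1}" using t by auto
    have "uniform_limit {0..t} (\<lambda>n s. A s (S n s)) (\<lambda>s. A s (X s)) sequentially"
      using compact_imp_bounded[OF compact_continuous_image[OF contX compact_Icc]]
        compact_imp_bounded[OF compact_continuous_image[OF A compact_Icc]]
      by (intro uniform_limit_on_subset[OF bounded_bilinear.bounded_uniform_limit[OF bounded_bilinear_blinfun_apply _ uni] sub])
        (auto intro: uniform_limit_const)
    then obtain I J where IJ: "\<And>n. ((\<lambda>s. A s (S n s)) has_integral I n) {0..t}" "((\<lambda>s. A s (X s)) has_integral J) {0..t}" "I \<longlonglongrightarrow> J"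
      by (rule uniform_limit_integral)
        (intro continuous_intros continuous_on_subset[OF A sub] continuous_on_subset[OF contS sub], auto)
    have "(\<lambda>n. S (Suc n) t) \<longlonglongrightarrow> X t"
      using tendsto_uniform_limitI[OF uni t] by (rule LIMSEQ_Suc)
    moreover have "(\<lambda>n. S (Suc n) t) \<longlonglongrightarrow> x0 + J"
      unfolding Sint[OF t] using IJ(1)[THEN integral_unique] IJ(3) by (auto intro!: tendsto_intros)
    ultimately have "X t = x0 + J" by (rule LIMSEQ_unique)
    then show ?thesis using integral_unique[OF IJ(2)] by simp
  qed
  have "(X has_vector_derivative A t (X t)) (at t within {0..1})" if t: "t \<in> {0..1}" for t
  proof -
    have "((\<lambda>t. integral {0..t} (\<lambda>s. A s (X s))) has_vector_derivative A t (X t)) (at t within {0..1})"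
      by (rule integral_has_vector_derivative[OF _ t]) (intro continuous_intros A contX)
    then have "((\<lambda>t. x0 + integral {0..t} (\<lambda>s. A s (X s))) has_vector_derivative A t (X t)) (at t within {0..1})"
      by (auto intro!: derivative_eq_intros)
    then show ?thesis
      by (rule has_vector_derivative_transform[OF t, rotated]) (simp add: Xint)
  qed
  moreover have "X 0 = x0" using Xint[of 0] by simp
  ultimately show ?thesis by blast
qed

text \<open>Squared norms avoid the missing derivative of the norm at zero. The summand e^2 in
  \<open>\<psi>\<close> absorbs the source: the mixed term satisfies 2 |Y| e \<le> |Y|^2 + e^2,
  which accounts for the exponent \<open>2 * M + 1\<close>. The argument yields the square root of
  the exponential as a factor; the exponential itself is a coarser one without a root.\<close>

lemma gronwall_bound:
  fixes Y :: "real \<Rightarrow> 'a::real_inner"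
  assumes Y: "\<And>t. t \<in> {0..1} \<Longrightarrow> (Y has_vector_derivative Y' t) (at t within {0..1})" and Y0: "Y 0 = 0"
    and b: "\<And>t. t \<in> {0..1} \<Longrightarrow> norm (Y' t) \<le> M * norm (Y t) + e" and "M \<ge> 0" "e \<ge> 0"
  shows "norm (Y 1) \<le> exp (2 * M + 1) * e"
proof -
  define L where "L = 2 * M + 1"
  define \<psi> where "\<psi> t = exp (- L * t) * (Y t \<bullet> Y t + e\<^sup>2)" for t
  have d: "(\<psi> has_derivative (\<lambda>h. h * (exp (- L * t) * (2 * (Y t \<bullet> Y' t) - L * (Y t \<bullet> Y t + e\<^sup>2))))) (at t within {0..1})"
    if t: "t \<in> {0..1}" for t
  proof -
    have 1: "(Y has_derivative (\<lambda>h. h *\<^sub>R Y' t)) (at t within {0..1})"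
      using Y[OF t] by (simp add: has_vector_derivative_def)
    have 2: "((\<lambda>t. Y t \<bullet> Y t + e\<^sup>2) has_derivative (\<lambda>h. Y t \<bullet> (h *\<^sub>R Y' t) + (h *\<^sub>R Y' t) \<bullet> Y t)) (at t within {0..1})"
      using has_derivative_add[OF has_derivative_inner[OF 1 1] has_derivative_const[of "e\<^sup>2"]] by simp
    have 3: "((\<lambda>t. exp (- L * t)) has_derivative (\<lambda>h. h * (- L * exp (- L * t)))) (at t within {0..1})"
      by (auto intro!: derivative_eq_intros)
    show ?thesis unfolding \<psi>_def[abs_def]
      by (rule has_derivative_eq_rhs[OF has_derivative_mult[OF 3 2]])
        (auto simp: fun_eq_iff inner_commute algebra_simps)
  qed
  obtain t where t: "t \<in> {0<..<1}" "\<psi> 1 - \<psi> 0 = (1 - 0) * (exp (- L * t) * (2 * (Y t \<bullet> Y' t) - L * (Y t \<bullet> Y t + e\<^sup>2)))"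
    using mvt_simple[of 0 1 \<psi>, OF _ d] by auto
  have "2 * (Y t \<bullet> Y' t) \<le> 2 * (norm (Y t) * norm (Y' t))"
    using norm_cauchy_schwarz[of "Y t" "Y' t"] by simp
  also have "\<dots> \<le> 2 * (norm (Y t) * (M * norm (Y t) + e))"
    using b[of t] t(1) by (intro mult_left_mono) auto
  also have "\<dots> = 2 * M * (norm (Y t))\<^sup>2 + 2 * norm (Y t) * e" by (simp add: algebra_simps power2_eq_square)
  also have "\<dots> \<le> 2 * M * (norm (Y t))\<^sup>2 + ((norm (Y t))\<^sup>2 + e\<^sup>2)"
    using sum_squares_bound[of "norm (Y t)" e] by simp
  also have "\<dots> \<le> L * (Y t \<bullet> Y t + e\<^sup>2)"
    using \<open>M \<ge> 0\<close> by (simp add: L_def algebra_simps flip: power2_norm_eq_inner)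
  finally have "\<psi> 1 \<le> \<psi> 0" using t(2) by (smt (verit) exp_gt_zero mult_nonneg_nonpos2 mult_1 mult.commute diff_zero)
  then have "exp (- L) * (Y 1 \<bullet> Y 1 + e\<^sup>2) \<le> e\<^sup>2" by (simp add: \<psi>_def Y0)
  then have "Y 1 \<bullet> Y 1 + e\<^sup>2 \<le> exp L * e\<^sup>2" by (simp add: exp_minus field_simps)
  then have "(norm (Y 1))\<^sup>2 \<le> exp L * e\<^sup>2" by (simp add: power2_norm_eq_inner) (smt (verit) zero_le_power2)
  also have "\<dots> \<le> (exp L * exp L) * e\<^sup>2"
    using \<open>M \<ge> 0\<close> by (intro mult_right_mono) (auto simp: L_def)
  also have "\<dots> = (exp L * e)\<^sup>2" by (simp add: power2_eq_square)
  finally show ?thesis using \<open>e \<ge> 0\<close> by (simp add: L_def power2_le_iff_abs_le)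
qed

text \<open>Moving the endpoint of a ray moves every point of the ray, so one \<open>d\<close> is
  required for all base points of a compact set. It comes from uniform continuity of the derivative
  on a closed neighbourhood of \<open>K\<close>.\<close>

lemma C1_uniform_linearization:
  fixes f :: "'e::euclidean_space \<Rightarrow> 'b::real_normed_vector"
  assumes D: "open D" and K: "compact K" "K \<subseteq> D"
    and f: "\<And>x. x \<in> D \<Longrightarrow> (f has_derivative blinfun_apply (f' x)) (at x)" and c: "continuous_on D f'" and e: "e > 0"
  shows "\<exists>d>0. \<forall>y\<in>K. \<forall>h. norm h \<le> d \<longrightarrow> y + h \<in> D \<and> norm (f (y + h) - f y - f' y h) \<le> e * norm h"
proof -
  obtain r where r: "r > 0" "(\<Union>x\<in>K. cball x r) \<subseteq> D"
    using compact_subset_open_imp_cball_epsilon_subset[OF K(1) D K(2)] by blast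
  define K' where "K' = {x + z |x z. x \<in> K \<and> z \<in> cball 0 r}"
  have K': "compact K'" unfolding K'_def by (intro compact_sums K compact_cball)
  have K'D: "K' \<subseteq> D" using r(2) by (force simp: K'_def dist_norm)
  have inK': "y + h \<in> K'" if "y \<in> K" "norm h \<le> r" for y h unfolding K'_def using that by force
  have "uniformly_continuous_on K' f'"
    using compact_uniformly_continuous[OF continuous_on_subset[OF c K'D] K'] .
  then obtain d where d: "d > 0" "\<And>x x'. x \<in> K' \<Longrightarrow> x' \<in> K' \<Longrightarrow> dist x' x < d \<Longrightarrow> dist (f' x') (f' x) < e"
    using e unfolding uniformly_continuous_on_def by metis
  define d' where "d' = min r (d / 2)"
  have "norm (f (y + h) - f y - f' y h) \<le> e * norm h" if y: "y \<in> K" and h: "norm h \<le> d'" for y h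
  proof -
    have seg: "y + t *\<^sub>R h \<in> K' \<and> dist (y + t *\<^sub>R h) y < d" if "t \<in> {0..1}" for t
    proof -
      have "norm (t *\<^sub>R h) \<le> norm h" using that by (simp add: mult_left_le_one_le)
      then show ?thesis using h inK'[OF y] d(1) by (auto simp: d'_def dist_norm)
    qed
    have "norm (f (y + h) - f y - f' y ((y + h) - y)) \<le> norm ((y + h) - y) * e"
    proof (rule differentiable_bound_linearization[where f' = "\<lambda>x. blinfun_apply (f' x)" and ?x0.0 = y and S = "(\<lambda>t. y + t *\<^sub>R h) ` {0..1}"])
      fix x assume "x \<in> (\<lambda>t. y + t *\<^sub>R h) ` {0..1}"
      then have x: "x \<in> K'" "dist x y < d" using seg by auto
      then show "(f has_derivative blinfun_apply (f' x)) (at x within (\<lambda>t. y + t *\<^sub>R h) ` {0..1})"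
        using f K'D has_derivative_at_withinI by blast
      have "y \<in> K'" using seg[of 0] by simp
      have "onorm (blinfun_apply (f' x) - blinfun_apply (f' y)) = norm (f' x - f' y)"
        by (simp add: norm_blinfun.rep_eq minus_blinfun.rep_eq fun_diff_def)
      then show "onorm (blinfun_apply (f' x) - blinfun_apply (f' y)) \<le> e"
        using d(2)[OF \<open>y \<in> K'\<close> x] by (simp add: dist_norm)
    next
      show "y \<in> (\<lambda>t. y + t *\<^sub>R h) ` {0..1}" by (rule image_eqI[of _ _ 0]) auto
    next
      fix t :: real assume "t \<in> {0..1}"
      then show "y + t *\<^sub>R (y + h - y) \<in> (\<lambda>t. y + t *\<^sub>R h) ` {0..1}" by (auto simp del: atLeastAtMost_iff)
    qed
    then show ?thesis by (simp add: mult.commute)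
  qed
  moreover have "y + h \<in> D" if "y \<in> K" "norm h \<le> d'" for y h using inK'[OF that(1), of h] that(2) K'D by (auto simp: d'_def)
  moreover have "d' > 0" using r d by (simp add: d'_def)
  ultimately show ?thesis by blast
qed

text \<open>The value at \<open>x\<close> is the endpoint of the solution of the linear equation
  along the ray from 0 to \<open>x\<close>. If the claim holds, then at time \<open>t\<close> the
  solution on the ray to \<open>x + v\<close> differs from that on the ray to \<open>x\<close> by
  \<open>t *\<^sub>R \<omega> (t *\<^sub>R x) v (X x t)\<close> to first order. The hypothesis
  \<open>flat\<close>, the Frobenius condition, makes this guess solve the linearised equation. The
  remainder then obeys a linear equation whose source is o(v), and Gronwall's inequality
  concludes.\<close>

lemma pfaff_starlike:
  fixes \<omega> :: "'e::euclidean_space \<Rightarrow> 'e \<Rightarrow>\<^sub>L ('a::euclidean_space \<Rightarrow>\<^sub>L 'a)"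
  assumes D: "open D" "0 \<in> D" "\<And>x t. x \<in> D \<Longrightarrow> t \<in> {0..1} \<Longrightarrow> t *\<^sub>R x \<in> D"
    and \<omega>: "\<And>x. x \<in> D \<Longrightarrow> (\<omega> has_derivative blinfun_apply (\<omega>' x)) (at x)" and c: "continuous_on D \<omega>'"
    and flat: "\<And>x u v q. x \<in> D \<Longrightarrow> \<omega>' x u v q + \<omega> x v (\<omega> x u q) = \<omega>' x v u q + \<omega> x u (\<omega> x v q)"
  shows "\<exists>q. q 0 = q0 \<and> (\<forall>x\<in>D. (q has_derivative (\<lambda>v. \<omega> x v (q x))) (at x))"
proof -
  have c\<omega>: "continuous_on D \<omega>"
    using \<omega> by (auto intro!: continuous_at_imp_continuous_on has_derivative_continuous)
  have ray: "continuous_on {0..1} (\<lambda>t. \<omega> (t *\<^sub>R x) x)" if x: "x \<in> D" for x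
  proof -
    have "continuous_on {0..1} (\<lambda>t. \<omega> (t *\<^sub>R x))"
      by (rule continuous_on_compose2[OF c\<omega>]) (use D(3)[OF x] in \<open>auto intro!: continuous_intros\<close>)
    then show ?thesis by (intro continuous_intros)
  qed
  have "\<forall>x\<in>D. \<exists>X. X 0 = q0 \<and> (\<forall>t\<in>{0..1}. (X has_vector_derivative \<omega> (t *\<^sub>R x) x (X t)) (at t within {0..1}))"
    using linear_ode_exists[OF ray] by blast
  then obtain X where X0: "\<And>x. x \<in> D \<Longrightarrow> X x 0 = q0" and
    X: "\<And>x t. x \<in> D \<Longrightarrow> t \<in> {0..1} \<Longrightarrow> (X x has_vector_derivative \<omega> (t *\<^sub>R x) x (X x t)) (at t within {0..1})"
    by metis
  define q where "q x = X x 1" for x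
  have "(q has_derivative (\<lambda>v. \<omega> x v (q x))) (at x)" if x: "x \<in> D" for x
  proof -
    define K where "K = (\<lambda>t. t *\<^sub>R x) ` {0..1::real}"
    have K: "compact K" unfolding K_def by (intro compact_continuous_image continuous_intros compact_Icc)
    have KD: "K \<subseteq> D" using D(3)[OF x] by (auto simp: K_def)
    have bdd: "\<exists>B\<ge>0. \<forall>y\<in>S. norm (f y) \<le> B" if "compact S" "continuous_on S f" for S and f :: "'c::topological_space \<Rightarrow> 'd::real_normed_vector"
    proof -
      have "bounded (f ` S)" using that by (intro compact_imp_bounded compact_continuous_image)
      then obtain B where "\<forall>y\<in>f ` S. norm y \<le> B" by (auto simp: bounded_iff)
      then show ?thesis by (intro exI[of _ "max B 0"]) auto
    qed
    obtain M1 where M1: "M1 \<ge> 0" "\<And>y. y \<in> K \<Longrightarrow> norm (\<omega> y) \<le> M1"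
      using bdd[OF K continuous_on_subset[OF c\<omega> KD]] by blast
    obtain M2 where M2: "M2 \<ge> 0" "\<And>y. y \<in> K \<Longrightarrow> norm (\<omega>' y) \<le> M2"
      using bdd[OF K continuous_on_subset[OF c KD]] by blast
    have "continuous_on {0..1} (X x)"
      unfolding continuous_on_eq_continuous_within using X[OF x] has_vector_derivative_continuous by blast
    then obtain C where C: "C \<ge> 0" "\<And>t. t \<in> {0..1} \<Longrightarrow> norm (X x t) \<le> C"
      using bdd[OF compact_Icc] by blast
    define M where "M = M1 + M2"
    have M: "M \<ge> 0" "\<And>y. y \<in> K \<Longrightarrow> norm (\<omega> y) \<le> M" "\<And>y. y \<in> K \<Longrightarrow> norm (\<omega>' y) \<le> M"
      using M1 M2 by (auto simp: M_def add_increasing add_increasing2)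
    \<comment> \<open>The constants anticipate the estimate of the source. \<open>N\<close> bounds
      \<open>x + v\<close> for \<open>v\<close> of norm at most 1, \<open>L\<close> bounds the
      coefficient along the perturbed ray, and \<open>C\<close> bounds the unperturbed solution;
      \<open>C2\<close> collects the terms quadratic in \<open>v\<close>, and \<open>C3\<close> is
      the factor of the linearisation error.\<close>
    define N where "N = norm x + 1"
    define L where "L = (M + M + 1) * N"
    define C2 where "C2 = M * M * C + M * N * (M * C) + M * (C + M * C)"
    define C3 where "C3 = N * (C + M * C)"
    have nn: "N \<ge> 1" "L \<ge> 0" "C2 \<ge> 0" "C3 \<ge> 0"
      using M(1) C(1) by (auto simp: N_def L_def C2_def C3_def intro!: add_nonneg_nonneg mult_nonneg_nonneg)
    have lin: "bounded_linear (\<lambda>v. \<omega> x v (q x))"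
      by (rule bounded_linear_compose[OF blinfun.bounded_linear_left blinfun.bounded_linear_right])
    show ?thesis
      unfolding has_derivative_at_alt
    proof (intro conjI lin allI impI)
      fix \<epsilon> :: real assume \<epsilon>: "\<epsilon> > 0"
      \<comment> \<open>The bound by 1 keeps the linearisation error \<open>R\<close> below 1 in the
        estimate by \<open>L\<close>; the other bound makes the Gronwall factor times the source at
        most \<open>\<epsilon>\<close> times the norm of \<open>v\<close>.\<close>
      define e where "e = min 1 (\<epsilon> / (exp (2 * L + 1) * (1 + C3)))"
      have epos: "exp (2 * L + 1) * (1 + C3) > 0" using nn by (intro mult_pos_pos) auto
      have e: "e > 0" "e \<le> 1" using \<epsilon> epos by (auto simp: e_def)
      have e': "exp (2 * L + 1) * (1 + C3) * e \<le> \<epsilon>"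
      proof -
        have "exp (2 * L + 1) * (1 + C3) * e \<le> exp (2 * L + 1) * (1 + C3) * (\<epsilon> / (exp (2 * L + 1) * (1 + C3)))"
          using epos by (intro mult_left_mono) (auto simp: e_def)
        then show ?thesis using epos nn(4) by (simp split: if_splits)
      qed
      obtain d where d: "d > 0" "\<And>y h. y \<in> K \<Longrightarrow> norm h \<le> d \<Longrightarrow> y + h \<in> D \<and> norm (\<omega> (y + h) - \<omega> y - \<omega>' y h) \<le> e * norm h"
        using C1_uniform_linearization[OF D(1) K KD \<omega> c e(1)] by blast
      define d' where "d' = min d (min 1 (e / (C2 + 1)))"
      have d': "d' > 0" using d(1) e(1) nn by (auto simp: d'_def)
      have bd: "norm (q (x + v) - q x - \<omega> x v (q x)) \<le> \<epsilon> * norm v" if v: "norm v < d'" for v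
      proof -
        have v1: "norm v \<le> d" "norm v \<le> 1" and v2: "C2 * norm v \<le> e"
        proof -
          show "norm v \<le> d" "norm v \<le> 1" using v by (auto simp: d'_def)
          have "C2 * norm v \<le> (C2 + 1) * (e / (C2 + 1))"
            using v nn by (intro mult_mono) (auto simp: d'_def)
          then show "C2 * norm v \<le> e" using nn by simp
        qed
        have xv: "x + v \<in> D" 
        proof -
          have "x \<in> K" unfolding K_def by (rule image_eqI[of _ _ 1]) auto
          then show ?thesis using d(2) v1 by blast
        qed
        \<comment> \<open>The difference of the two solutions minus its conjectured first-order
          part; \<open>Y 1\<close> is the remainder in the definition of the derivative.\<close>
        define Y where "Y t = X (x + v) t - X x t - t *\<^sub>R \<omega> (t *\<^sub>R x) v (X x t)" for t
        define Y' where "Y' t = \<omega> (t *\<^sub>R (x + v)) (x + v) (X (x + v) t) - \<omega> (t *\<^sub>R x) x (X x t)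
            - (t *\<^sub>R (\<omega> (t *\<^sub>R x) v (\<omega> (t *\<^sub>R x) x (X x t)) + \<omega>' (t *\<^sub>R x) x v (X x t)) + \<omega> (t *\<^sub>R x) v (X x t))" for t
        have "norm (Y 1) \<le> exp (2 * L + 1) * ((1 + C3) * e * norm v)"
        proof (rule gronwall_bound[where Y' = Y'])
          show "Y 0 = 0" using X0 x xv by (simp add: Y_def)
          show "0 \<le> L" "0 \<le> (1 + C3) * e * norm v" using nn e by auto
          fix t :: real assume t: "t \<in> {0..1}"
          have tx: "t *\<^sub>R x \<in> K" "t *\<^sub>R x \<in> D" using D(3)[OF x t] imageI[OF t] by (auto simp only: K_def)
          let ?S = "{0..1::real}"
          have dX: "(X x has_derivative (\<lambda>h. h *\<^sub>R \<omega> (t *\<^sub>R x) x (X x t))) (at t within ?S)"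
            using X[OF x t] by (simp add: has_vector_derivative_def)
          have dray: "((\<lambda>t. t *\<^sub>R x) has_derivative (\<lambda>h. h *\<^sub>R x)) (at t within ?S)"
            by (auto intro!: derivative_eq_intros)
          have d\<omega>: "((\<lambda>t. \<omega> (t *\<^sub>R x)) has_derivative (\<lambda>h. \<omega>' (t *\<^sub>R x) (h *\<^sub>R x))) (at t within ?S)"
            using has_derivative_compose[OF dray \<omega>[OF tx(2)]] .
          have d\<omega>v: "((\<lambda>t. \<omega> (t *\<^sub>R x) v) has_derivative (\<lambda>h. \<omega>' (t *\<^sub>R x) (h *\<^sub>R x) v)) (at t within ?S)"
            by (rule bounded_linear.has_derivative[OF blinfun.bounded_linear_left d\<omega>])
          have d3: "((\<lambda>t. \<omega> (t *\<^sub>R x) v (X x t)) has_derivative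
              (\<lambda>h. \<omega> (t *\<^sub>R x) v (h *\<^sub>R \<omega> (t *\<^sub>R x) x (X x t)) + \<omega>' (t *\<^sub>R x) (h *\<^sub>R x) v (X x t))) (at t within ?S)"
            by (rule bounded_bilinear.FDERIV[OF bounded_bilinear_blinfun_apply d\<omega>v dX])
          have d4: "((\<lambda>t. t *\<^sub>R \<omega> (t *\<^sub>R x) v (X x t)) has_derivative
              (\<lambda>h. t *\<^sub>R (\<omega> (t *\<^sub>R x) v (h *\<^sub>R \<omega> (t *\<^sub>R x) x (X x t)) + \<omega>' (t *\<^sub>R x) (h *\<^sub>R x) v (X x t)) + h *\<^sub>R \<omega> (t *\<^sub>R x) v (X x t))) (at t within ?S)"
            by (rule has_derivative_scaleR[OF has_derivative_ident d3])
          have dXv: "(X (x + v) has_derivative (\<lambda>h. h *\<^sub>R \<omega> (t *\<^sub>R (x + v)) (x + v) (X (x + v) t))) (at t within ?S)"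
            using X[OF xv t] by (simp add: has_vector_derivative_def)
          show "(Y has_vector_derivative Y' t) (at t within ?S)"
            unfolding has_vector_derivative_def Y_def[abs_def]
            by (rule has_derivative_eq_rhs[OF has_derivative_diff[OF has_derivative_diff[OF dXv dX] d4]])
              (simp add: fun_eq_iff Y'_def algebra_simps blinfun.scaleR_left blinfun.scaleR_right)
          define y where "y = t *\<^sub>R x"
          define P where "P = X x t"
          define V where "V = \<omega> y v P"
          define R where "R = \<omega> (t *\<^sub>R (x + v)) - \<omega> y - \<omega>' y (t *\<^sub>R v)"
          have y: "y \<in> K" "y \<in> D" using tx by (auto simp: y_def)
          have tv: "norm (t *\<^sub>R v) \<le> norm v" using t by (simp add: mult_left_le_one_le)
          have R: "norm R \<le> e * norm v"
          proof -
            have "norm R \<le> e * norm (t *\<^sub>R v)"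
              using d(2)[OF y(1), of "t *\<^sub>R v"] tv v1 unfolding R_def y_def by (simp add: scaleR_add_right)
            also have "\<dots> \<le> e * norm v" using tv e by (intro mult_left_mono) auto
            finally show ?thesis .
          qed
          have \<omega>eq: "\<omega> (t *\<^sub>R (x + v)) = \<omega> y + t *\<^sub>R \<omega>' y v + R"
            by (simp add: R_def blinfun.scaleR_right)
          have ap: "norm (blinfun_apply f z) \<le> a * b" if "norm f \<le> a" "norm z \<le> b" for f :: "'x::real_normed_vector \<Rightarrow>\<^sub>L 'y::real_normed_vector" and z a b
            using order_trans[OF norm_blinfun mult_mono[OF that order_trans[OF norm_ge_zero that(1)] norm_ge_zero]] .
          have nxv: "norm (x + v) \<le> N" using norm_triangle_ineq[of x v] v1 by (simp add: N_def)
          have nP: "norm P \<le> C" using C(2)[OF t] by (simp add: P_def)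
          have nV: "norm V \<le> M * norm v * C" unfolding V_def by (intro ap M y nP order_refl)
          have nV': "norm V \<le> M * C"
          proof -
            have "M * norm v * C \<le> M * 1 * C" using v1 M C by (intro mult_right_mono mult_left_mono) auto
            then show ?thesis using nV by simp
          qed
          have nPV: "norm (P + t *\<^sub>R V) \<le> C + M * C"
          proof -
            have "norm (t *\<^sub>R V) \<le> norm V" using t by (simp add: mult_left_le_one_le)
            then show ?thesis using norm_triangle_ineq[of P "t *\<^sub>R V"] nP nV' by linarith
          qed
          have n\<Omega>: "norm (\<omega> (t *\<^sub>R (x + v)) (x + v)) \<le> L"
            unfolding L_def
          proof (rule ap[OF _ nxv])
            have "norm (t *\<^sub>R \<omega>' y v) \<le> norm (\<omega>' y v)" using t by (simp add: mult_left_le_one_le)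
            also have "\<dots> \<le> M * 1" by (intro ap M y v1)
            finally have a: "norm (t *\<^sub>R \<omega>' y v) \<le> M" by simp
            have b: "norm R \<le> 1" using R e v1 by (smt (verit) mult_le_one norm_ge_zero)
            show "norm (\<omega> (t *\<^sub>R (x + v))) \<le> M + M + 1"
              unfolding \<omega>eq using norm_triangle_ineq[of "\<omega> y + t *\<^sub>R \<omega>' y v" R] norm_triangle_ineq[of "\<omega> y" "t *\<^sub>R \<omega>' y v"] a b M(2)[OF y(1)]
              by linarith
          qed
          have Yeq: "X (x + v) t = Y t + (P + t *\<^sub>R V)" by (simp add: Y_def P_def V_def y_def)
          have fl: "\<omega>' y x v P + \<omega> y v (\<omega> y x P) = \<omega>' y v x P + \<omega> y x (\<omega> y v P)" using flat[OF y(2)] .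
          have "Y' t = \<omega> (t *\<^sub>R (x + v)) (x + v) (Y t)
            + (t *\<^sub>R \<omega> y v V + (t * t) *\<^sub>R \<omega>' y v x V + t *\<^sub>R \<omega>' y v v (P + t *\<^sub>R V) + R (x + v) (P + t *\<^sub>R V))"
          proof -
            have "\<omega> (t *\<^sub>R (x + v)) (x + v) (P + t *\<^sub>R V) = \<omega> y x P + \<omega> y v P + t *\<^sub>R \<omega> y x V + t *\<^sub>R \<omega> y v V
               + t *\<^sub>R \<omega>' y v x P + (t * t) *\<^sub>R \<omega>' y v x V + t *\<^sub>R \<omega>' y v v (P + t *\<^sub>R V) + R (x + v) (P + t *\<^sub>R V)"
              unfolding \<omega>eq by (simp add: blinfun.add_left blinfun.add_right blinfun.scaleR_left blinfun.scaleR_right algebra_simps)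
            \<comment> \<open>Here flatness enters: it trades the terms from differentiating the
              guess for those from expanding the equation on the perturbed ray.\<close>
            moreover have "t *\<^sub>R (\<omega> y v (\<omega> y x P) + \<omega>' y x v P) = t *\<^sub>R \<omega>' y v x P + t *\<^sub>R \<omega> y x V"
              using fl by (simp add: V_def add.commute flip: scaleR_add_right)
            ultimately show ?thesis
              unfolding Y'_def Yeq P_def[symmetric] y_def[symmetric] V_def[symmetric]
              by (simp add: blinfun.add_right)
          qed
          moreover have "norm (t *\<^sub>R \<omega> y v V) \<le> M * norm v * (M * norm v * C)"
          proof -
            have "norm (t *\<^sub>R \<omega> y v V) \<le> norm (\<omega> y v V)" using t by (simp add: mult_left_le_one_le)
            also have "\<dots> \<le> M * norm v * (M * norm v * C)" by (intro ap M y nV order_refl)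
            finally show ?thesis .
          qed
          moreover have "norm ((t * t) *\<^sub>R \<omega>' y v x V) \<le> M * norm v * N * (M * norm v * C)"
          proof -
            have "t * t \<le> 1" using t by (simp add: mult_le_one)
            then have "norm ((t * t) *\<^sub>R \<omega>' y v x V) \<le> norm (\<omega>' y v x V)" by (simp add: mult_left_le_one_le)
            also have "\<dots> \<le> M * norm v * N * (M * norm v * C)" by (intro ap M y nV order_refl) (simp add: N_def)
            finally show ?thesis .
          qed
          moreover have "norm (t *\<^sub>R \<omega>' y v v (P + t *\<^sub>R V)) \<le> M * norm v * norm v * (C + M * C)"
          proof -
            have "norm (t *\<^sub>R \<omega>' y v v (P + t *\<^sub>R V)) \<le> norm (\<omega>' y v v (P + t *\<^sub>R V))" using t by (simp add: mult_left_le_one_le)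
            also have "\<dots> \<le> M * norm v * norm v * (C + M * C)" by (intro ap M y nPV order_refl)
            finally show ?thesis .
          qed
          moreover have "norm (R (x + v) (P + t *\<^sub>R V)) \<le> e * norm v * N * (C + M * C)"
            by (intro ap R nPV nxv)
          moreover have "norm (\<omega> (t *\<^sub>R (x + v)) (x + v) (Y t)) \<le> L * norm (Y t)"
            by (intro ap n\<Omega> order_refl)
          ultimately have "norm (Y' t) \<le> L * norm (Y t) + (M * norm v * (M * norm v * C) + M * norm v * N * (M * norm v * C)
              + M * norm v * norm v * (C + M * C) + e * norm v * N * (C + M * C))"
            by (simp only:) (intro order_trans[OF norm_triangle_ineq] add_mono; assumption)
          also have "M * norm v * (M * norm v * C) + M * norm v * N * (M * norm v * C)
              + M * norm v * norm v * (C + M * C) + e * norm v * N * (C + M * C) = (C2 * norm v) * norm v + C3 * e * norm v"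
            by (simp add: C2_def C3_def algebra_simps)
          also have "\<dots> \<le> e * norm v + C3 * e * norm v"
            by (intro add_mono order_refl mult_right_mono[OF v2 norm_ge_zero])
          finally show "norm (Y' t) \<le> L * norm (Y t) + (1 + C3) * e * norm v" by (simp add: algebra_simps)
        qed
        also have "\<dots> = (exp (2 * L + 1) * (1 + C3) * e) * norm v" by simp
        also have "\<dots> \<le> \<epsilon> * norm v" using e' by (intro mult_right_mono) auto
        finally show ?thesis by (simp add: Y_def q_def)
      qed
      show "\<exists>d>0. \<forall>y. norm (y - x) < d \<longrightarrow> norm (q y - q x - \<omega> x (y - x) (q x)) \<le> \<epsilon> * norm (y - x)"
      proof (intro exI[of _ d'] conjI d' allI impI)
        fix y assume "norm (y - x) < d'"
        from bd[OF this] show "norm (q y - q x - \<omega> x (y - x) (q x)) \<le> \<epsilon> * norm (y - x)" by simp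
      qed
    qed
  qed
  \<comment> \<open>At the centre the ray is constant and the equation reads X' = 0; Gronwall with
    zero source says that its solution keeps the initial value.\<close>
  moreover have "q 0 = q0"
  proof -
    have "norm (X 0 1 - q0) \<le> exp (2 * 0 + 1) * 0"
    proof (rule gronwall_bound[where Y = "\<lambda>t. X 0 t - q0" and Y' = "\<lambda>t. 0"])
      fix t :: real assume t: "t \<in> {0..1}"
      show "((\<lambda>t. X 0 t - q0) has_vector_derivative 0) (at t within {0..1})"
        using X[OF D(2) t] by (auto intro!: derivative_eq_intros simp: blinfun.zero_right)
    qed (use X0[OF D(2)] in auto)
    then show ?thesis by (simp add: q_def)
  qed
  ultimately show ?thesis by blast
qed

text \<open>The derivative of the pulled-back coefficients has an extra term with
  \<open>\<psi>''\<close>, which cancels in the integrability condition because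
  \<open>\<psi>''\<close> is symmetric. The solution is carried back by the inverse
  \<open>\<phi>\<close> and the chain rule.\<close>

lemma pfaff_pullback:
  fixes \<omega> :: "'f::euclidean_space \<Rightarrow> 'f \<Rightarrow>\<^sub>L ('a::euclidean_space \<Rightarrow>\<^sub>L 'a)" and \<psi> :: "'e::euclidean_space \<Rightarrow> 'f"
  assumes D: "open D" "0 \<in> D" "\<And>x t. x \<in> D \<Longrightarrow> t \<in> {0..1} \<Longrightarrow> t *\<^sub>R x \<in> D"
    and \<psi>: "\<And>z. z \<in> D \<Longrightarrow> \<psi> z \<in> S" "\<And>z. z \<in> D \<Longrightarrow> (\<psi> has_derivative blinfun_apply (\<psi>' z)) (at z)"
      "\<And>z. z \<in> D \<Longrightarrow> (\<psi>' has_derivative blinfun_apply (\<psi>'' z)) (at z)" "continuous_on D \<psi>''"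
      "\<And>z u v. z \<in> D \<Longrightarrow> \<psi>'' z u v = \<psi>'' z v u"
    and \<phi>: "\<And>x. x \<in> S \<Longrightarrow> \<phi> x \<in> D" "\<And>x. x \<in> S \<Longrightarrow> \<psi> (\<phi> x) = x" "\<phi> (\<psi> 0) = 0"
      "\<And>x. x \<in> S \<Longrightarrow> (\<phi> has_derivative \<phi>' x) (at x)" "\<And>x v. x \<in> S \<Longrightarrow> \<psi>' (\<phi> x) (\<phi>' x v) = v"
    and \<omega>: "\<And>x. x \<in> S \<Longrightarrow> (\<omega> has_derivative blinfun_apply (\<omega>' x)) (at x)" and c: "continuous_on S \<omega>'"
    and flat: "\<And>x u v q. x \<in> S \<Longrightarrow> \<omega>' x u v q + \<omega> x v (\<omega> x u q) = \<omega>' x v u q + \<omega> x u (\<omega> x v q)"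
  shows "\<exists>q. q (\<psi> 0) = q0 \<and> (\<forall>x\<in>S. (q has_derivative (\<lambda>v. \<omega> x v (q x))) (at x))"
proof -
  have c\<omega>: "continuous_on S \<omega>"
    using \<omega> by (auto intro!: continuous_at_imp_continuous_on has_derivative_continuous)
  have c\<psi>: "continuous_on D \<psi>" "continuous_on D \<psi>'"
    using \<psi>(2,3) by (auto intro!: continuous_at_imp_continuous_on has_derivative_continuous)
  define \<Omega> where "\<Omega> z = \<omega> (\<psi> z) o\<^sub>L \<psi>' z" for z
  define \<Omega>' where "\<Omega>' z = Blinfun (\<lambda>u. (\<omega> (\<psi> z) o\<^sub>L \<psi>'' z u) + (\<omega>' (\<psi> z) (\<psi>' z u) o\<^sub>L \<psi>' z))" for z
  have d0: "(\<Omega> has_derivative (\<lambda>u. (\<omega> (\<psi> z) o\<^sub>L \<psi>'' z u) + (\<omega>' (\<psi> z) (\<psi>' z u) o\<^sub>L \<psi>' z))) (at z)" if z: "z \<in> D" for z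
    unfolding \<Omega>_def[abs_def]
    by (rule bounded_bilinear.FDERIV[OF bounded_bilinear_blinfun_compose has_derivative_compose[OF \<psi>(2)[OF z] \<omega>[OF \<psi>(1)[OF z]]] \<psi>(3)[OF z]])
  have ap: "blinfun_apply (\<Omega>' z) = (\<lambda>u. (\<omega> (\<psi> z) o\<^sub>L \<psi>'' z u) + (\<omega>' (\<psi> z) (\<psi>' z u) o\<^sub>L \<psi>' z))" if z: "z \<in> D" for z
    unfolding \<Omega>'_def using has_derivative_bounded_linear[OF d0[OF z]] by (rule bounded_linear_Blinfun_apply)
  have "\<exists>Q. Q 0 = q0 \<and> (\<forall>z\<in>D. (Q has_derivative (\<lambda>v. \<Omega> z v (Q z))) (at z))"
  proof (rule pfaff_starlike[OF D, where \<omega>' = \<Omega>'])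
    show "(\<Omega> has_derivative blinfun_apply (\<Omega>' z)) (at z)" if "z \<in> D" for z
      using d0[OF that] ap[OF that] by simp
    show "continuous_on D \<Omega>'"
    proof (rule continuous_on_blinfun_componentwise)
      fix i :: 'e
      have "continuous_on D (\<lambda>z. (\<omega> (\<psi> z) o\<^sub>L \<psi>'' z i) + (\<omega>' (\<psi> z) (\<psi>' z i) o\<^sub>L \<psi>' z))"
        by (intro continuous_intros bounded_bilinear.continuous_on[OF bounded_bilinear_blinfun_compose]
            continuous_on_compose2[OF c\<omega> c\<psi>(1)] continuous_on_compose2[OF c c\<psi>(1)] c\<psi> \<psi>(4)) (use \<psi>(1) in auto)
      then show "continuous_on D (\<lambda>z. \<Omega>' z i)" by (simp add: ap cong: continuous_on_cong)
    qed
    fix z u v q assume z: "z \<in> D"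
    show "\<Omega>' z u v q + \<Omega> z v (\<Omega> z u q) = \<Omega>' z v u q + \<Omega> z u (\<Omega> z v q)"
      using flat[OF \<psi>(1)[OF z], of "\<psi>' z u" "\<psi>' z v" q] \<psi>(5)[OF z, of u v]
      by (simp add: ap[OF z] \<Omega>_def blinfun.add_left add.assoc)
  qed
  then obtain Q where Q: "Q 0 = q0" "\<And>z. z \<in> D \<Longrightarrow> (Q has_derivative (\<lambda>v. \<Omega> z v (Q z))) (at z)" by blast
  show ?thesis
  proof (intro exI[of _ "\<lambda>x. Q (\<phi> x)"] conjI ballI)
    show "Q (\<phi> (\<psi> 0)) = q0" using Q(1) \<phi>(3) by simp
    fix x assume x: "x \<in> S"
    have "((\<lambda>x. Q (\<phi> x)) has_derivative (\<lambda>v. \<Omega> (\<phi> x) (\<phi>' x v) (Q (\<phi> x)))) (at x)"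
      by (rule has_derivative_compose[OF \<phi>(4)[OF x] Q(2)[OF \<phi>(1)[OF x]]])
    then show "((\<lambda>x. Q (\<phi> x)) has_derivative (\<lambda>v. \<omega> x v (Q (\<phi> x)))) (at x)"
      by (simp add: \<Omega>_def \<phi>(2)[OF x] \<phi>(5)[OF x])
  qed
qed

section \<open>Simply connected plane domains\<close>

definition vec_of_complex :: "complex \<Rightarrow> real^2" where
  "vec_of_complex z = vector [Re z, Im z]"

definition complex_of_vec :: "real^2 \<Rightarrow> complex" where
  "complex_of_vec x = Complex (x $ 1) (x $ 2)"

lemma complex_vec_inverse [simp]:
  "vec_of_complex (complex_of_vec x) = x" "complex_of_vec (vec_of_complex z) = z"
  by (auto simp: vec_of_complex_def complex_of_vec_def vec_eq_iff forall_2)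

lemma bounded_linear_vec_of_complex: "bounded_linear vec_of_complex"
  by (rule linear_conv_bounded_linear[THEN iffD1])
    (auto intro!: linearI simp: vec_of_complex_def vec_eq_iff forall_2)

lemma bounded_linear_complex_of_vec: "bounded_linear complex_of_vec"
  by (rule linear_conv_bounded_linear[THEN iffD1])
    (auto intro!: linearI simp: complex_of_vec_def complex_eq_iff)

text \<open>The inverse of the Riemann map parametrises a proper simply connected domain by the
  disc, which is star-shaped about 0. The base point is the image of 0 and is fixed before the
  initial value, so that several solutions can start at one point.\<close>

lemma pfaff_simply_connected:
  fixes \<omega> :: "real^2 \<Rightarrow> (real^2) \<Rightarrow>\<^sub>L ('a::euclidean_space \<Rightarrow>\<^sub>L 'a)"
  assumes S: "open S" "simply_connected S" "S \<noteq> {}" "S \<noteq> UNIV"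
    and \<omega>: "\<And>x. x \<in> S \<Longrightarrow> (\<omega> has_derivative blinfun_apply (\<omega>' x)) (at x)" and c: "continuous_on S \<omega>'"
    and flat: "\<And>x u v q. x \<in> S \<Longrightarrow> \<omega>' x u v q + \<omega> x v (\<omega> x u q) = \<omega>' x v u q + \<omega> x u (\<omega> x v q)"
  shows "\<exists>x0\<in>S. \<forall>q0. \<exists>q. q x0 = q0 \<and> (\<forall>x\<in>S. (q has_derivative (\<lambda>v. \<omega> x v (q x))) (at x))"
proof -
  define T where "T = vec_of_complex -` S"
  have TS: "T = complex_of_vec ` S"
    unfolding T_def by (auto simp: image_iff) (metis complex_vec_inverse(2))
  have oT: "open T" unfolding T_def
    by (rule open_vimage[OF S(1)]) (rule linear_continuous_on[OF bounded_linear_vec_of_complex])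
  have "homeomorphism S T complex_of_vec vec_of_complex"
    unfolding homeomorphism_def TS
    by (auto simp: image_comp intro!: linear_continuous_on bounded_linear_vec_of_complex bounded_linear_complex_of_vec)
  then have "simply_connected T"
    using homeomorphic_simply_connected S(2) unfolding homeomorphic_def by blast
  moreover have "T \<noteq> {}" using S(3) TS by simp
  moreover have "T \<noteq> UNIV"
  proof
    assume "T = UNIV"
    then have "S = UNIV" unfolding T_def by (metis UNIV_I UNIV_eq_I complex_vec_inverse(1) vimage_eq)
    with S(4) show False by simp
  qed
  ultimately have "\<exists>f g. f holomorphic_on T \<and> g holomorphic_on ball 0 1 \<and>
      (\<forall>z\<in>T. f z \<in> ball 0 1 \<and> g (f z) = z) \<and> (\<forall>z\<in>ball 0 1. g z \<in> T \<and> f (g z) = z)"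
    using Riemann_mapping_theorem[of T] oT by blast
  then obtain f g where fg: "f holomorphic_on T" "g holomorphic_on ball 0 1"
    "\<And>z. z \<in> T \<Longrightarrow> f z \<in> ball 0 1" "\<And>z. z \<in> T \<Longrightarrow> g (f z) = z"
    "\<And>z. z \<in> ball 0 1 \<Longrightarrow> g z \<in> T" "\<And>z. z \<in> ball 0 1 \<Longrightarrow> f (g z) = z"
    by blast
  have hol: "deriv g holomorphic_on ball 0 1" "deriv (deriv g) holomorphic_on ball 0 1"
    using fg(2) by (auto intro!: holomorphic_deriv)
  define V where "V = Blinfun vec_of_complex"
  have V: "blinfun_apply V = vec_of_complex" unfolding V_def by (rule bounded_linear_Blinfun_apply[OF bounded_linear_vec_of_complex])
  define \<psi> where "\<psi> z = vec_of_complex (g z)" for z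
  define \<psi>' where "\<psi>' z = V o\<^sub>L blinfun_mult_right (deriv g z)" for z
  \<comment> \<open>Multiplication by the second complex derivative; symmetric in its two arguments
    because complex multiplication commutes.\<close>
  define \<psi>'' where "\<psi>'' z = Blinfun (\<lambda>u. V o\<^sub>L blinfun_mult_right (deriv (deriv g) z * u))" for z
  have bl: "bounded_linear (\<lambda>c. V o\<^sub>L blinfun_mult_right (c :: complex))"
    by (rule bounded_linear_compose[OF bounded_bilinear.bounded_linear_right[OF bounded_bilinear_blinfun_compose] bounded_linear_blinfun_mult_right])
  have ap'': "blinfun_apply (\<psi>'' z) = (\<lambda>u. V o\<^sub>L blinfun_mult_right (deriv (deriv g) z * u))" for z
    unfolding \<psi>''_def by (rule bounded_linear_Blinfun_apply[OF bounded_linear_compose[OF bl bounded_linear_mult_right]])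
  have dg: "(g has_derivative (\<lambda>h. deriv g z * h)) (at z)" "(deriv g has_derivative (\<lambda>h. deriv (deriv g) z * h)) (at z)"
    if "z \<in> ball 0 1" for z
    using holomorphic_derivI[OF fg(2) open_ball that] holomorphic_derivI[OF hol(1) open_ball that]
    by (simp_all add: has_field_derivative_def)
  define \<phi> where "\<phi> x = f (complex_of_vec x)" for x
  have cT: "complex_of_vec x \<in> T" if "x \<in> S" for x using that TS by blast
  have main: "\<exists>q. q (\<psi> 0) = q0 \<and> (\<forall>x\<in>S. (q has_derivative (\<lambda>v. \<omega> x v (q x))) (at x))" for q0
  proof (rule pfaff_pullback[where D = "ball 0 1" and \<psi> = \<psi> and \<psi>' = \<psi>' and \<psi>'' = \<psi>'' and \<phi> = \<phi>
        and \<phi>' = "\<lambda>x v. deriv f (complex_of_vec x) * complex_of_vec v" and \<omega>' = \<omega>'])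
    show "t *\<^sub>R x \<in> ball 0 1" if "x \<in> ball 0 1" "t \<in> {0..1}" for x :: complex and t
      using that mult_left_le_one_le[of "norm x" t] by (auto intro: le_less_trans)
    fix z :: complex assume z: "z \<in> ball 0 1"
    show "\<psi> z \<in> S" using fg(5)[OF z] by (simp add: T_def \<psi>_def)
    show "(\<psi> has_derivative blinfun_apply (\<psi>' z)) (at z)"
    proof -
      have "blinfun_apply (\<psi>' z) = (\<lambda>h. vec_of_complex (deriv g z * h))"
        by (rule ext) (simp add: \<psi>'_def V blinfun_mult_right.rep_eq)
      then show ?thesis
        using bounded_linear.has_derivative[OF bounded_linear_vec_of_complex dg(1)[OF z]]
        by (simp add: \<psi>_def[abs_def])
    qed
    show "(\<psi>' has_derivative blinfun_apply (\<psi>'' z)) (at z)"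
      using bounded_linear.has_derivative[OF bl dg(2)[OF z]] by (simp add: \<psi>'_def[abs_def] ap'')
    show "\<psi>'' z u v = \<psi>'' z v u" for u v
      by (simp add: ap'' V blinfun_mult_right.rep_eq mult_ac)
  next
    show "continuous_on (ball 0 1) \<psi>''"
    proof (rule continuous_on_blinfun_componentwise)
      fix i :: complex
      show "continuous_on (ball 0 1) (\<lambda>x. \<psi>'' x i)"
        unfolding ap''
        by (rule continuous_on_compose2[OF linear_continuous_on[OF bl, of UNIV]
              continuous_on_mult[OF holomorphic_on_imp_continuous_on[OF hol(2)] continuous_on_const]]) simp
    qed
    show "\<phi> (\<psi> 0) = 0" by (simp add: \<phi>_def \<psi>_def fg)
    fix x assume x: "x \<in> S"
    show "\<phi> x \<in> ball 0 1" "\<psi> (\<phi> x) = x" using fg(3,4)[OF cT[OF x]] by (simp_all add: \<phi>_def \<psi>_def)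
    have "(f has_derivative (\<lambda>h. deriv f (complex_of_vec x) * h)) (at (complex_of_vec x))"
      using holomorphic_derivI[OF fg(1) oT cT[OF x]] by (simp add: has_field_derivative_def)
    then show "(\<phi> has_derivative (\<lambda>v. deriv f (complex_of_vec x) * complex_of_vec v)) (at x)"
      unfolding \<phi>_def[abs_def]
      using has_derivative_compose[OF bounded_linear_imp_has_derivative[OF bounded_linear_complex_of_vec]] by blast
    have "deriv f (complex_of_vec x) * deriv g (f (complex_of_vec x)) = 1"
      by (rule deriv_left_inverse[OF fg(1,2) oT open_ball]) (use fg cT[OF x] in auto)
    then show "\<psi>' (\<phi> x) (deriv f (complex_of_vec x) * complex_of_vec v) = v" for v
      by (simp add: \<psi>'_def V \<phi>_def blinfun_mult_right.rep_eq mult_ac flip: mult.assoc)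
  qed (use \<omega> c flat in auto)
  moreover have "\<psi> 0 \<in> S" using fg(5)[of 0] by (simp add: \<psi>_def T_def)
  ultimately show ?thesis by blast
qed

text \<open>Coordinate form: \<open>a i m j\<close> is the coefficient of component \<open>m\<close>
  in the derivative of component \<open>i\<close> along axis \<open>j\<close>. The integrability
  condition is bilinear and antisymmetric in the two directions, so in the plane its instance for
  the two axes implies all others.\<close>

lemma pfaff_plane:
  fixes a :: "'b::finite \<Rightarrow> 'b \<Rightarrow> 2 \<Rightarrow> real^2 \<Rightarrow> real"
  assumes S: "open S" "simply_connected S" "S \<noteq> {}" "S \<noteq> UNIV"
    and a: "\<And>i m j x. x \<in> S \<Longrightarrow> (a i m j has_derivative a' i m j x) (at x)"
    and c: "\<And>i m j k. continuous_on S (\<lambda>x. a' i m j x (axis k 1))"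
    and flat: "\<And>i m x. x \<in> S \<Longrightarrow> a' i m 2 x (axis 1 1) + (\<Sum>l\<in>UNIV. a i l 2 x * a l m 1 x)
        = a' i m 1 x (axis 2 1) + (\<Sum>l\<in>UNIV. a i l 1 x * a l m 2 x)"
  shows "\<exists>x0\<in>S. \<forall>q0. \<exists>q :: real^2 \<Rightarrow> real^'b. q x0 = q0 \<and>
    (\<forall>x\<in>S. (q has_derivative (\<lambda>v. \<chi> i. \<Sum>m\<in>UNIV. (v $ 1 * a i m 1 x + v $ 2 * a i m 2 x) * q x $ m)) (at x))"
proof -
  define E :: "'b \<Rightarrow> 'b \<Rightarrow> (real^'b) \<Rightarrow>\<^sub>L (real^'b)" where "E i m = Blinfun (\<lambda>q. (q $ m) *\<^sub>R axis i 1)" for i m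
  have E: "blinfun_apply (E i m) = (\<lambda>q. (q $ m) *\<^sub>R axis i 1)" for i m
    unfolding E_def by (rule bounded_linear_Blinfun_apply[OF bounded_linear_compose[OF bounded_linear_scaleR_left bounded_linear_vec_nth]])
  \<comment> \<open>Elementary operators: \<open>F (i, m, j)\<close> multiplies coordinate
    \<open>j\<close> of the direction by component \<open>m\<close> of the value and puts the
    product in place \<open>i\<close>. The system becomes a combination of fixed operators,
    differentiated coefficient by coefficient.\<close>
  define F :: "'b \<times> 'b \<times> 2 \<Rightarrow> (real^2) \<Rightarrow>\<^sub>L ((real^'b) \<Rightarrow>\<^sub>L (real^'b))"
    where "F p = (case p of (i, m, j) \<Rightarrow> blinfun_scaleR_left (E i m) o\<^sub>L Blinfun (\<lambda>v. v $ j))" for p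
  have F: "F (i, m, j) v q = (v $ j * q $ m) *\<^sub>R axis i 1" for i m j v q
    by (simp add: F_def bounded_linear_Blinfun_apply[OF bounded_linear_vec_nth] blinfun_scaleR_left.rep_eq E blinfun.scaleR_left)
  define b where "b p = (case p of (i, m, j) \<Rightarrow> a i m j)" for p
  define b' where "b' p = (case p of (i, m, j) \<Rightarrow> a' i m j)" for p
  have b: "(b p has_derivative b' p x) (at x)" if "x \<in> S" for p x
    using a[OF that] by (cases p) (simp add: b_def b'_def)
  define \<omega> where "\<omega> x = (\<Sum>p\<in>UNIV. b p x *\<^sub>R F p)" for x
  define \<omega>' where "\<omega>' x = Blinfun (\<lambda>u. \<Sum>p\<in>UNIV. b' p x u *\<^sub>R F p)" for x
  have d: "(\<omega> has_derivative (\<lambda>u. \<Sum>p\<in>UNIV. b' p x u *\<^sub>R F p)) (at x)" if "x \<in> S" for x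
    unfolding \<omega>_def[abs_def] by (intro has_derivative_sum has_derivative_scaleR_left b that)
  have ap: "blinfun_apply (\<omega>' x) = (\<lambda>u. \<Sum>p\<in>UNIV. b' p x u *\<^sub>R F p)" if "x \<in> S" for x
    unfolding \<omega>'_def by (rule bounded_linear_Blinfun_apply[OF has_derivative_bounded_linear[OF d[OF that]]])
  have sum3: "(\<Sum>p\<in>UNIV. h p) = (\<Sum>i\<in>UNIV. \<Sum>m\<in>UNIV. h (i, m, 1) + h (i, m, 2))" for h :: "'b \<times> 'b \<times> 2 \<Rightarrow> real"
  proof -
    have "(\<Sum>i\<in>UNIV. \<Sum>m\<in>UNIV. \<Sum>j\<in>UNIV. h (i, m, j)) = (\<Sum>p\<in>UNIV. h p)"
      by (simp only: sum.cartesian_product UNIV_Times_UNIV case_prod_unfold prod.collapse)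
    then show ?thesis by (simp add: sum_2)
  qed
  have comp: "(\<Sum>p\<in>UNIV. r p *\<^sub>R F p) v q $ i = (\<Sum>m\<in>UNIV. (v $ 1 * r (i, m, 1) + v $ 2 * r (i, m, 2)) * q $ m)"
    for r :: "'b \<times> 'b \<times> 2 \<Rightarrow> real" and v q i
  proof -
    have "(\<Sum>p\<in>UNIV. r p *\<^sub>R F p) v q $ i = (\<Sum>p\<in>UNIV. r p * (F p v q $ i))"
      by (simp add: blinfun.sum_left blinfun.scaleR_left sum_component)
    also have "\<dots> = (\<Sum>k\<in>UNIV. \<Sum>m\<in>UNIV. (if k = i then (v $ 1 * r (i, m, 1) + v $ 2 * r (i, m, 2)) * q $ m else 0))"
      unfolding sum3 F by (intro sum.cong refl) (auto simp: axis_def algebra_simps)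
    also have "\<dots> = (\<Sum>m\<in>UNIV. (v $ 1 * r (i, m, 1) + v $ 2 * r (i, m, 2)) * q $ m)"
      by (subst sum.swap) (simp add: sum.delta)
    finally show ?thesis .
  qed
  have "\<exists>x0\<in>S. \<forall>q0. \<exists>q. q x0 = q0 \<and> (\<forall>x\<in>S. (q has_derivative (\<lambda>v. \<omega> x v (q x))) (at x))"
  proof (rule pfaff_simply_connected[OF S, where \<omega>' = \<omega>'])
    show "(\<omega> has_derivative blinfun_apply (\<omega>' x)) (at x)" if "x \<in> S" for x
      using d[OF that] ap[OF that] by simp
    show "continuous_on S \<omega>'"
    proof (rule continuous_on_blinfun_componentwise)
      fix e :: "real^2" assume "e \<in> Basis"
      then obtain k where e: "e = axis k 1" by (auto simp: Basis_vec_def)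
      have "continuous_on S (\<lambda>x. \<Sum>p\<in>UNIV. b' p x e *\<^sub>R F p)"
        unfolding e b'_def by (intro continuous_intros) (auto split: prod.splits intro: c)
      then show "continuous_on S (\<lambda>x. \<omega>' x e)" by (simp add: ap cong: continuous_on_cong)
    qed
    fix x u v q assume x: "x \<in> S"
    have da: "a' i m j x w = w $ 1 * a' i m j x (axis 1 1) + w $ 2 * a' i m j x (axis 2 1)" for i m j and w :: "real^2"
    proof -
      interpret l: linear "a' i m j x" using a[OF x] by (rule has_derivative_linear)
      have w: "w = w $ 1 *\<^sub>R axis 1 1 + w $ 2 *\<^sub>R axis 2 1" by (simp add: vec_eq_iff forall_2 axis_def)
      show ?thesis by (subst w, simp only: l.add l.scaleR real_scaleR_def)
    qed
    define s where "s i m = (\<Sum>l\<in>UNIV. a i l 2 x * a l m 1 x)" for i m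
    define s' where "s' i m = (\<Sum>l\<in>UNIV. a i l 1 x * a l m 2 x)" for i m
    have comp2: "\<omega> x v (\<omega> x u q) $ i = (\<Sum>m\<in>UNIV. (v $ 1 * u $ 1 * (\<Sum>l\<in>UNIV. a i l 1 x * a l m 1 x) + v $ 2 * u $ 2 * (\<Sum>l\<in>UNIV. a i l 2 x * a l m 2 x)
        + v $ 1 * u $ 2 * s' i m + v $ 2 * u $ 1 * s i m) * q $ m)" for u v i
    proof -
      have "\<omega> x v (\<omega> x u q) $ i = (\<Sum>l\<in>UNIV. (v $ 1 * a i l 1 x + v $ 2 * a i l 2 x) * (\<Sum>m\<in>UNIV. (u $ 1 * a l m 1 x + u $ 2 * a l m 2 x) * q $ m))"
        unfolding \<omega>_def comp by (simp add: b_def)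
      also have "\<dots> = (\<Sum>m\<in>UNIV. \<Sum>l\<in>UNIV. (v $ 1 * a i l 1 x + v $ 2 * a i l 2 x) * ((u $ 1 * a l m 1 x + u $ 2 * a l m 2 x) * q $ m))"
        by (subst sum.swap) (simp add: sum_distrib_left)
      also have "\<dots> = (\<Sum>m\<in>UNIV. (v $ 1 * u $ 1 * (\<Sum>l\<in>UNIV. a i l 1 x * a l m 1 x) + v $ 2 * u $ 2 * (\<Sum>l\<in>UNIV. a i l 2 x * a l m 2 x)
        + v $ 1 * u $ 2 * s' i m + v $ 2 * u $ 1 * s i m) * q $ m)"
        unfolding s_def s'_def sum_distrib_left sum_distrib_right sum.distrib[symmetric]
        by (intro sum.cong refl) (simp add: algebra_simps)
      finally show ?thesis .
    qed
    have comp1: "\<omega>' x u v q $ i = (\<Sum>m\<in>UNIV. (v $ 1 * a' i m 1 x u + v $ 2 * a' i m 2 x u) * q $ m)" for u v i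
      unfolding ap[OF x] comp by (simp add: b'_def)
    show "\<omega>' x u v q + \<omega> x v (\<omega> x u q) = \<omega>' x v u q + \<omega> x u (\<omega> x v q)"
      unfolding vec_eq_iff
    proof
      fix i
      have fl: "a' i m 2 x (axis 1 1) = a' i m 1 x (axis 2 1) + s' i m - s i m" for m
        using flat[OF x, of i m] by (simp add: s_def s'_def)
      show "(\<omega>' x u v q + \<omega> x v (\<omega> x u q)) $ i = (\<omega>' x v u q + \<omega> x u (\<omega> x v q)) $ i"
        unfolding vector_add_component comp1 comp2 sum.distrib[symmetric]
        by (intro sum.cong refl) (simp add: da[of i _ 1 u] da[of i _ 2 u] da[of i _ 1 v] da[of i _ 2 v] fl algebra_simps)
    qed
  qed
  moreover have "\<omega> x v z = (\<chi> i. \<Sum>m\<in>UNIV. (v $ 1 * a i m 1 x + v $ 2 * a i m 2 x) * z $ m)" for x v z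
    unfolding vec_eq_iff \<omega>_def comp by (simp add: b_def)
  ultimately show ?thesis by simp
qed

text \<open>The zero set is closed by continuity. It is open because, along a radius of a small
  ball, the differential is bounded by \<open>E\<close> itself, so Gronwall with zero source keeps
  \<open>E\<close> at zero.\<close>

lemma linear_differential_vanish:
  fixes E :: "'e::euclidean_space \<Rightarrow> 'a::real_inner"
  assumes S: "open S" "connected S" and x0: "x0 \<in> S" "E x0 = 0"
    and E: "\<And>x. x \<in> S \<Longrightarrow> (E has_derivative E' x) (at x)"
    and b: "\<And>x. x \<in> S \<Longrightarrow> \<exists>r>0. \<exists>M\<ge>0. ball x r \<subseteq> S \<and> (\<forall>y\<in>ball x r. \<forall>v. norm (E' y v) \<le> M * norm v * norm (E y))"
    and x: "x \<in> S"
  shows "E x = 0"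
proof -
  let ?Z = "{x\<in>S. E x = 0}"
  have cE: "continuous_on S E" using E by (auto intro!: continuous_at_imp_continuous_on has_derivative_continuous)
  have "openin (top_of_set S) ?Z"
  proof -
    have "open ?Z"
      unfolding open_contains_ball
    proof
      fix x assume "x \<in> ?Z"
      then have x: "x \<in> S" "E x = 0" by auto
      obtain r M where r: "r > 0" "M \<ge> 0" "ball x r \<subseteq> S" "\<And>y v. y \<in> ball x r \<Longrightarrow> norm (E' y v) \<le> M * norm v * norm (E y)"
        using b[OF x(1)] by blast
      have "E y = 0" if y: "y \<in> ball x r" for y
      proof -
        let ?p = "\<lambda>t. x + t *\<^sub>R (y - x)"
        have p: "?p t \<in> ball x r" if "t \<in> {0..1}" for t
        proof -
          have "norm (t *\<^sub>R (y - x)) \<le> norm (y - x)" using that by (simp add: mult_left_le_one_le)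
          then show ?thesis using y by (simp add: dist_norm norm_minus_commute del: norm_scaleR)
        qed
        have "norm (E (?p 1)) \<le> exp (2 * (M * norm (y - x)) + 1) * 0"
        proof (rule gronwall_bound[where Y = "\<lambda>t. E (?p t)" and Y' = "\<lambda>t. E' (?p t) (y - x)"])
          fix t :: real assume t: "t \<in> {0..1}"
          have "?p t \<in> S" using p[OF t] r(3) by blast
          from E[OF this] interpret l: linear "E' (?p t)" by (rule has_derivative_linear)
          have "(?p has_derivative (\<lambda>h. h *\<^sub>R (y - x))) (at t within {0..1})" by (auto intro!: derivative_eq_intros)
          from has_derivative_compose[OF this E[OF \<open>?p t \<in> S\<close>]]
          show "((\<lambda>t. E (?p t)) has_vector_derivative E' (?p t) (y - x)) (at t within {0..1})"
            by (simp add: has_vector_derivative_def l.scaleR)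
          show "norm (E' (?p t) (y - x)) \<le> M * norm (y - x) * norm (E (?p t)) + 0"
            using r(4)[OF p[OF t]] by simp
        qed (use x r in auto)
        then show ?thesis by simp
      qed
      then show "\<exists>e>0. ball x e \<subseteq> ?Z" using r(1,3) by auto
    qed
    then show ?thesis by (auto simp: openin_open_eq S(1))
  qed
  moreover have "closedin (top_of_set S) ?Z"
    using continuous_closedin_preimage_constant[OF cE, of 0] by simp
  ultimately have "?Z = {} \<or> ?Z = S" using S(2) unfolding connected_clopen by blast
  then show ?thesis using x0 x by blast
qed

section \<open>Symmetric positive definite matrices\<close>

text \<open>A maximiser \<open>e\<close> of the quadratic form on the unit sphere of
  \<open>V\<close> is an eigenvector: otherwise the component \<open>u\<close> of \<open>f e\<close>
  orthogonal to \<open>e\<close> is a direction in which the Rayleigh quotient increases.\<close>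

lemma selfadjoint_eigenvector:
  fixes f :: "'a::euclidean_space \<Rightarrow> 'a"
  assumes f: "linear f" "\<And>x y. x \<bullet> f y = f x \<bullet> y" and V: "subspace V" "V \<noteq> {0}" "\<And>x. x \<in> V \<Longrightarrow> f x \<in> V"
  obtains e l where "e \<in> V" "norm e = 1" "f e = l *\<^sub>R e"
proof -
  interpret f: linear f by fact
  obtain v where v: "v \<in> V" "v \<noteq> 0" using V(1,2) subspace_0 by blast
  have "compact (sphere 0 1 \<inter> V)" by (intro compact_Int_closed closed_subspace V) auto
  moreover have "v /\<^sub>R norm v \<in> sphere 0 1 \<inter> V" using v V(1) by (simp add: subspace_scale)
  moreover have "continuous_on (sphere 0 1 \<inter> V) (\<lambda>x. x \<bullet> f x)"
    by (intro continuous_intros linear_continuous_on linear_linear[THEN iffD2] f)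
  ultimately obtain e where e: "e \<in> sphere 0 1 \<inter> V" "\<And>x. x \<in> sphere 0 1 \<inter> V \<Longrightarrow> x \<bullet> f x \<le> e \<bullet> f e"
    using continuous_attains_sup by (metis empty_iff)
  define l where "l = e \<bullet> f e"
  have ee: "e \<bullet> e = 1" using e(1) by (simp add: dist_norm norm_eq_1)
  have q: "x \<bullet> f x \<le> l * (x \<bullet> x)" if "x \<in> V" for x
  proof (cases "x = 0")
    case False
    have "x /\<^sub>R norm x \<in> sphere 0 1 \<inter> V" using that False V(1) by (simp add: subspace_scale)
    from e(2)[OF this] have "(x \<bullet> f x) / (norm x)\<^sup>2 \<le> l"
      by (simp add: f.scaleR l_def power2_eq_square divide_inverse mult_ac)
    then show ?thesis using False by (simp add: divide_le_eq power2_norm_eq_inner)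
  qed (simp add: f.zero)
  define u where "u = f e - l *\<^sub>R e"
  have uV: "u \<in> V" using e(1) V by (auto simp: u_def intro!: subspace_diff subspace_scale)
  have ue: "u \<bullet> e = 0" by (simp add: u_def inner_diff_left inner_commute[of "f e"] l_def ee)
  have fe: "f e \<bullet> u = u \<bullet> u" using ue by (simp add: u_def inner_diff_left inner_diff_right inner_commute)
  have "u = 0"
  proof (rule ccontr)
    assume "u \<noteq> 0"
    then have uu: "u \<bullet> u > 0" by simp
    \<comment> \<open>\<open>c\<close> dominates the second-order coefficient. With
      \<open>t = (u \<bullet> u) / c\<close> the second-order loss, divided by \<open>t\<close>, is
      at most \<open>u \<bullet> u\<close>, while the first-order gain is twice that.\<close>
    define c where "c = \<bar>l * (u \<bullet> u) - u \<bullet> f u\<bar> + 1"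
    define t where "t = (u \<bullet> u) / c"
    have c: "c > 0" by (simp add: c_def add_nonneg_pos)
    have t: "t > 0" using uu c by (simp add: t_def)
    have "(e + t *\<^sub>R u) \<in> V" using e(1) uV V(1) by (auto intro!: subspace_add subspace_scale)
    have "l + 2 * t * (u \<bullet> u) + t * t * (u \<bullet> f u) \<le> l + t * t * l * (u \<bullet> u)"
    proof -
      have 1: "e \<bullet> f u = u \<bullet> u" "u \<bullet> f e = u \<bullet> u" "e \<bullet> u = 0" "u \<bullet> e = 0"
        using fe f(2)[of e u] ue by (simp_all only: inner_commute)
      have "(e + t *\<^sub>R u) \<bullet> f (e + t *\<^sub>R u) = l + 2 * t * (u \<bullet> u) + t * t * (u \<bullet> f u)"
        unfolding f.add f.scaleR inner_add_left inner_add_right inner_scaleR_left inner_scaleR_right 1 l_def[symmetric]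
        by (simp add: algebra_simps)
      moreover have "l * ((e + t *\<^sub>R u) \<bullet> (e + t *\<^sub>R u)) = l + t * t * l * (u \<bullet> u)"
        unfolding inner_add_left inner_add_right inner_scaleR_left inner_scaleR_right 1 ee
        by (simp add: algebra_simps)
      ultimately show ?thesis using q[OF \<open>e + t *\<^sub>R u \<in> V\<close>] by simp
    qed
    then have "t * (2 * (u \<bullet> u)) \<le> t * (t * (l * (u \<bullet> u) - u \<bullet> f u))" by (simp add: algebra_simps)
    then have "2 * (u \<bullet> u) \<le> t * (l * (u \<bullet> u) - u \<bullet> f u)" using t by simp
    also have "\<dots> \<le> t * c" using t by (intro mult_left_mono) (auto simp: c_def)
    also have "\<dots> = u \<bullet> u" using c by (simp add: t_def)
    finally show False using uu by simp
  qed
  then have "f e = l *\<^sub>R e" by (simp add: u_def)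
  then show thesis using that e(1) by (auto simp: dist_norm)
qed

text \<open>Induction on the dimension: the orthogonal complement of an eigenvector inside
  \<open>V\<close> is again invariant, by self-adjointness.\<close>

lemma selfadjoint_eigenbasis:
  fixes f :: "'a::euclidean_space \<Rightarrow> 'a"
  assumes f: "linear f" "\<And>x y. x \<bullet> f y = f x \<bullet> y"
  shows "subspace V \<Longrightarrow> (\<And>x. x \<in> V \<Longrightarrow> f x \<in> V) \<Longrightarrow>
    \<exists>B. finite B \<and> pairwise orthogonal B \<and> (\<forall>b\<in>B. norm b = 1 \<and> (\<exists>l. f b = l *\<^sub>R b)) \<and> span B = V"
proof (induction "dim V" arbitrary: V rule: less_induct)
  case less
  show ?case
  proof (cases "V = {0}")
    case True
    then show ?thesis by (intro exI[of _ "{}"]) auto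
  next
    case False
    obtain e l where e: "e \<in> V" "norm e = 1" "f e = l *\<^sub>R e"
      using selfadjoint_eigenvector[OF f less.prems(1) False less.prems(2)] by metis
    define V' where "V' = {v \<in> V. v \<bullet> e = 0}"
    have sV': "subspace V'" using less.prems(1) unfolding V'_def subspace_def by (auto simp: inner_add_left)
    have ee: "e \<bullet> e = 1" using e(2) by (simp add: norm_eq_1)
    have "e \<notin> V'" by (simp add: V'_def ee)
    moreover have "V' \<subseteq> V" by (auto simp: V'_def)
    ultimately have "V' \<subset> V" using e(1) by blast
    then have "dim V' < dim V" using sV' less.prems(1) by (metis dim_psubset span_eq_iff)
    moreover have "f x \<in> V'" if "x \<in> V'" for x
      using that less.prems(2) f(2)[of x e] e(3) by (auto simp: V'_def)
    ultimately obtain B where B: "finite B" "pairwise orthogonal B" "\<forall>b\<in>B. norm b = 1 \<and> (\<exists>l. f b = l *\<^sub>R b)" "span B = V'"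
      using less.hyps[OF _ sV'] by blast
    have BV': "b \<in> V'" if "b \<in> B" for b using that B(4) span_base by blast
    have "span (insert e B) = V"
    proof
      show "span (insert e B) \<subseteq> V"
        using e(1) BV' less.prems(1) by (intro span_minimal) (auto simp: V'_def)
      show "V \<subseteq> span (insert e B)"
      proof
        fix v assume v: "v \<in> V"
        have "v - (v \<bullet> e) *\<^sub>R e \<in> V'"
          using v e(1) less.prems(1) by (auto simp: V'_def inner_diff_left ee intro!: subspace_diff subspace_scale)
        then have "v - (v \<bullet> e) *\<^sub>R e \<in> span B" using B(4) by simp
        then show "v \<in> span (insert e B)" unfolding span_insert by blast
      qed
    qed
    moreover have "pairwise orthogonal (insert e B)"
      using B(2) BV' unfolding pairwise_insert by (auto simp: orthogonal_def V'_def inner_commute)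
    ultimately show ?thesis using B e by (intro exI[of _ "insert e B"]) auto
  qed
qed

lemma spd_inner_commute:
  fixes M :: "real^'n::finite^'n"
  assumes "transpose M = M"
  shows "x \<bullet> (M *v y) = (M *v x) \<bullet> y"
  using dot_lmul_matrix[of x M y] transpose_matrix_vector[of M x] unfolding assms by simp

text \<open>Square roots of the eigenvalues on an orthonormal basis of eigenvectors.\<close>

lemma spd_sqrt_exists:
  fixes M :: "real^'n::finite^'n"
  assumes M: "spd M"
  shows "\<exists>A. spd A \<and> A ** A = M"
proof -
  have sym: "x \<bullet> (M *v y) = (M *v x) \<bullet> y" for x y using M spd_inner_commute by (auto simp: spd_def)
  have "\<exists>B. finite B \<and> pairwise orthogonal B \<and> (\<forall>b\<in>B. norm b = 1 \<and> (\<exists>l. M *v b = l *\<^sub>R b)) \<and> span B = UNIV"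
    by (rule selfadjoint_eigenbasis[OF matrix_vector_mul_linear sym]) auto
  then obtain B where B: "finite B" "pairwise orthogonal B" "\<And>b. b \<in> B \<Longrightarrow> norm b = 1" "\<forall>b\<in>B. \<exists>l. M *v b = l *\<^sub>R b" "span B = UNIV"
    by blast
  then obtain l where l: "\<And>b. b \<in> B \<Longrightarrow> M *v b = l b *\<^sub>R b" by metis
  have bb: "b \<bullet> b = 1" if "b \<in> B" for b using B(3)[OF that] by (simp add: norm_eq_1)
  have bc: "b \<bullet> c = 0" if "b \<in> B" "c \<in> B" "b \<noteq> c" for b c
    using B(2) that by (auto simp: pairwise_def orthogonal_def)
  have lpos: "l b > 0" if "b \<in> B" for b
  proof -
    have "b \<noteq> 0" using bb[OF that] by auto
    then have "b \<bullet> (M *v b) > 0" using M by (simp add: spd_def)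
    then show ?thesis using l[OF that] bb[OF that] by simp
  qed
  define F where "F x = (\<Sum>b\<in>B. (sqrt (l b) * (b \<bullet> x)) *\<^sub>R b)" for x
  have linF: "linear F"
    unfolding F_def by (intro linearI) (simp_all add: inner_add_right algebra_simps sum.distrib scaleR_sum_right)
  define A where "A = matrix F"
  have A: "A *v x = F x" for x unfolding A_def using matrix_works[of F x] linF by (simp add: linear_matrix_vector_mul_eq)
  have Fb: "F b = sqrt (l b) *\<^sub>R b" if b: "b \<in> B" for b
  proof -
    have "F b = (\<Sum>c\<in>B. if c = b then sqrt (l b) *\<^sub>R b else 0)"
      unfolding F_def by (intro sum.cong refl) (use bb bc b in auto)
    then show ?thesis using b B(1) by (simp add: sum.delta)
  qed
  have FF: "F (F x) = M *v x" for x
  proof (rule linear_eq_on[of "\<lambda>x. F (F x)" "\<lambda>x. M *v x" x B])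
    show "linear (\<lambda>x. F (F x))" using linear_compose[OF linF linF] by (simp add: o_def)
    show "F (F b) = M *v b" if "b \<in> B" for b
      using lpos[OF that] by (simp add: Fb that linear_scale[OF linF] l)
  qed (use B(5) in auto)
  have symF: "x \<bullet> F y = F x \<bullet> y" for x y
    by (simp add: F_def inner_sum_left inner_sum_right inner_commute mult_ac)
  have "transpose A = A"
  proof -
    have "(transpose A *v x) \<bullet> y = (A *v x) \<bullet> y" for x y
      by (simp add: dot_lmul_matrix A symF)
    then have "transpose A *v x = A *v x" for x by (metis vector_eq_rdot)
    then show ?thesis unfolding matrix_eq by blast
  qed
  moreover have "v \<bullet> (A *v v) > 0" if v: "v \<noteq> 0" for v
  proof -
    have "v \<bullet> F v = (\<Sum>b\<in>B. sqrt (l b) * (b \<bullet> v)\<^sup>2)"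
      by (simp add: F_def inner_sum_right inner_commute power2_eq_square mult_ac)
    moreover have "(\<Sum>b\<in>B. sqrt (l b) * (b \<bullet> v)\<^sup>2) > 0"
    proof (rule ccontr)
      assume "\<not> ?thesis"
      moreover have nn: "sqrt (l b) * (b \<bullet> v)\<^sup>2 \<ge> 0" if "b \<in> B" for b using lpos[OF that] by simp
      ultimately have "(\<Sum>b\<in>B. sqrt (l b) * (b \<bullet> v)\<^sup>2) = 0"
        using sum_nonneg[of B "\<lambda>b. sqrt (l b) * (b \<bullet> v)\<^sup>2"] by force
      then have "\<forall>b\<in>B. sqrt (l b) * (b \<bullet> v)\<^sup>2 = 0" using sum_nonneg_eq_0_iff[OF B(1), of "\<lambda>b. sqrt (l b) * (b \<bullet> v)\<^sup>2"] nn by blast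
      then have "orthogonal v b" if "b \<in> B" for b
        using that lpos[OF that] by (auto simp: orthogonal_def inner_commute)
      then have "orthogonal v v" using orthogonal_to_span[of v B v] B(5) by auto
      then show False using v by (simp add: orthogonal_def)
    qed
    ultimately show ?thesis by (simp add: A)
  qed
  ultimately have "spd A" by (simp add: spd_def)
  moreover have "A ** A = M"
    by (simp only: matrix_eq matrix_vector_mul_assoc[symmetric] A FF) simp
  ultimately show ?thesis by blast
qed

text \<open>With \<open>D = A - C\<close>, the identity \<open>A D + D C = 0\<close> exhibits a sum of nonnegative terms that vanishes.\<close>

lemma spd_sqrt_unique:
  fixes A C :: "real^'n::finite^'n"
  assumes A: "spd A" and C: "spd C" and eq: "A ** A = C ** C"
  shows "A = C"
proof -
  define D where "D = A - C"
  have "A *v (A *v x) = C *v (C *v x)" for x using eq by (simp add: matrix_vector_mul_assoc)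
  then have AD: "A *v (D *v x) = - (D *v (C *v x))" for x
    by (simp add: D_def matrix_vector_mult_diff_rdistrib matrix_vector_mult_diff_distrib)
  have symD: "x \<bullet> (D *v y) = (D *v x) \<bullet> y" for x y
    using A C spd_inner_commute[of A x y] spd_inner_commute[of C x y]
    by (simp add: spd_def D_def matrix_vector_mult_diff_rdistrib inner_diff_left inner_diff_right)
  have "\<exists>B. finite B \<and> pairwise orthogonal B \<and> (\<forall>b\<in>B. norm b = 1 \<and> (\<exists>l. D *v b = l *\<^sub>R b)) \<and> span B = UNIV"
    by (rule selfadjoint_eigenbasis[OF matrix_vector_mul_linear symD]) auto
  then obtain B where B: "\<And>b. b \<in> B \<Longrightarrow> norm b = 1 \<and> (\<exists>l. D *v b = l *\<^sub>R b)" "span B = UNIV" by blast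
  have "D *v b = 0" if b: "b \<in> B" for b
  proof -
    obtain l where l: "D *v b = l *\<^sub>R b" using B(1)[OF b] by blast
    have b0: "b \<noteq> 0" using B(1)[OF b] by auto
    have "b \<bullet> (A *v (D *v b)) = - ((D *v b) \<bullet> (C *v b))" by (simp add: AD symD)
    then have "l * (b \<bullet> (A *v b) + b \<bullet> (C *v b)) = 0"
      by (simp add: l matrix_vector_mult_scaleR algebra_simps)
    moreover have "b \<bullet> (A *v b) + b \<bullet> (C *v b) > 0" using A C b0 by (auto simp: spd_def intro: add_pos_pos)
    ultimately show ?thesis using l by simp
  qed
  then have "D *v x = 0" for x
    using linear_eq_on[of "\<lambda>x. D *v x" "\<lambda>x. 0" x B] B(2) by (auto simp: module_hom_zero)
  then have "A *v x = C *v x" for x by (simp add: D_def matrix_vector_mult_diff_rdistrib)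
  then show ?thesis unfolding matrix_eq by blast
qed

lemma spd_sqrt_works:
  assumes "spd M"
  shows "spd (spd_sqrt M)" "spd_sqrt M ** spd_sqrt M = M"
proof -
  have "\<exists>!A. spd A \<and> A ** A = M"
    using spd_sqrt_exists[OF assms] spd_sqrt_unique by (metis (no_types))
  from theI'[OF this] show "spd (spd_sqrt M)" "spd_sqrt M ** spd_sqrt M = M"
    by (auto simp: spd_sqrt_def)
qed

lemma spd_invertible:
  assumes "spd (M :: real^'n::finite^'n)"
  shows "invertible M"
proof -
  have "x = 0" if "M *v x = 0" for x using assms that by (auto simp: spd_def)
  then have "\<exists>B. B ** M = mat 1" using matrix_left_invertible_ker by blast
  then show ?thesis unfolding invertible_def by (metis matrix_left_right_inverse)
qed

lemma matrix_inv_inverse: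
  fixes M :: "real^'n::finite^'n"
  assumes "invertible M"
  shows "M ** matrix_inv M = mat 1" "matrix_inv M ** M = mat 1"
  using someI_ex[OF assms[unfolded invertible_def]] by (auto simp: matrix_inv_def)

lemma transpose_matrix_inv:
  fixes M :: "real^'n::finite^'n"
  assumes "invertible M" "transpose M = M"
  shows "transpose (matrix_inv M) = matrix_inv M"
proof -
  have "transpose (matrix_inv M) ** M = mat 1"
    using matrix_inv_inverse(1)[OF assms(1)] assms(2) by (metis matrix_transpose_mul transpose_mat)
  then show ?thesis
    using matrix_inv_inverse(1)[OF assms(1)] by (metis matrix_mul_assoc matrix_mul_lid matrix_mul_rid)
qed

section \<open>The quadratic forms of the energy\<close>

lemma bounded_bilinear_matrix_mult: "bounded_bilinear ((**) :: real^'n::finite^'n \<Rightarrow> real^'n^'n \<Rightarrow> real^'n^'n)"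
proof -
  have "bilinear ((**) :: real^'n^'n \<Rightarrow> real^'n^'n \<Rightarrow> real^'n^'n)"
    unfolding bilinear_def
    by (auto intro!: linearI simp: vec_eq_iff matrix_matrix_mult_def sum_distrib_left sum.distrib algebra_simps)
  then show ?thesis by (simp add: bilinear_conv_bounded_bilinear)
qed

lemma bounded_linear_transpose: "bounded_linear (transpose :: real^'n::finite^'m::finite \<Rightarrow> real^'m^'n)"
  by (rule linear_conv_bounded_linear[THEN iffD1]) (auto intro!: linearI simp: transpose_def vec_eq_iff)

lemma sym_part_nth: "sym_part F $ i $ j = (F $ i $ j + F $ j $ i) / 2"
  by (simp add: sym_part_def transpose_def)

lemma bounded_linear_sym_part: "bounded_linear (sym_part :: real^'n::finite^'n \<Rightarrow> real^'n^'n)"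
  by (rule linear_conv_bounded_linear[THEN iffD1])
    (auto intro!: linearI simp: sym_part_nth vec_eq_iff algebra_simps add_divide_distrib)

lemma sym_part_idem: "sym_part (sym_part F) = sym_part F"
  by (simp add: sym_part_nth vec_eq_iff field_simps)

lemma sym_part_skew: "sym_part (F - sym_part F) = 0"
  using linear_diff[OF bounded_linear.linear[OF bounded_linear_sym_part], of F "sym_part F"]
  by (simp add: sym_part_idem)

lemma sym_part_congruence:
  assumes "transpose A = A"
  shows "sym_part (A ** F ** A) = A ** sym_part F ** A"
proof -
  have "transpose (A ** F ** A) = A ** transpose F ** A"
    by (simp add: matrix_transpose_mul assms matrix_mul_assoc)
  then show ?thesis
    unfolding sym_part_def
    by (simp add: bounded_bilinear.scaleR_left[OF bounded_bilinear_matrix_mult] bounded_bilinear.scaleR_right[OF bounded_bilinear_matrix_mult]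
        bounded_bilinear.add_left[OF bounded_bilinear_matrix_mult] bounded_bilinear.add_right[OF bounded_bilinear_matrix_mult])
qed

section \<open>Rotations and infinitesimal rotations\<close>

lemma norm_matrix_power2:
  "(norm (A :: real^'n::finite^'m::finite))\<^sup>2 = (\<Sum>i\<in>UNIV. \<Sum>j\<in>UNIV. (A $ i $ j)\<^sup>2)"
  unfolding power2_norm_eq_inner inner_vec_def by (simp add: power2_eq_square)

lemma SO3_orthogonal:
  assumes "R \<in> SO3"
  shows "transpose R ** R = mat 1" "R ** transpose R = mat 1"
  using assms by (auto simp: SO3_def rotation_matrix_def orthogonal_matrix_def)

lemma norm_SO3_le:
  assumes "R \<in> SO3"
  shows "norm R \<le> 2"
proof -
  have "(\<Sum>j\<in>UNIV. (R $ i $ j)\<^sup>2) = (R ** transpose R) $ i $ i" for i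
    by (simp add: matrix_matrix_mult_def transpose_def power2_eq_square)
  then have "(norm R)\<^sup>2 = 3"
    unfolding norm_matrix_power2 by (simp add: SO3_orthogonal[OF assms] mat_def sum_3)
  also have "\<dots> \<le> 2\<^sup>2" by simp
  finally show ?thesis by (rule power2_le_imp_le) simp
qed

lemma mat_1_SO3: "mat 1 \<in> SO3"
  by (simp add: SO3_def rotation_matrix_def orthogonal_matrix_id)

text \<open>The matrix of the cross product with the unit vector \<open>k\<close>; the three of them
  span the skew-symmetric matrices, the tangent space of the rotation group at the identity.\<close>

definition skew_generator :: "3 \<Rightarrow> real^3^3" where
  "skew_generator k = (if k = 1 then vector [vector [0, 0, 0], vector [0, 0, -1], vector [0, 1, 0]]
    else if k = 2 then vector [vector [0, 0, 1], vector [0, 0, 0], vector [-1, 0, 0]]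
    else vector [vector [0, -1, 0], vector [1, 0, 0], vector [0, 0, 0]])"

text \<open>Rodrigues' formula for the rotation about axis \<open>k\<close> by the angle
  \<open>t\<close>; its velocity at 0 is \<open>skew_generator k\<close>.\<close>

definition rotation_curve :: "3 \<Rightarrow> real \<Rightarrow> real^3^3" where
  "rotation_curve k t = mat 1 + sin t *\<^sub>R skew_generator k + (1 - cos t) *\<^sub>R (skew_generator k ** skew_generator k)"

lemma rotation_curve_eq:
  "rotation_curve 1 t = vector [vector [1, 0, 0], vector [0, cos t, - sin t], vector [0, sin t, cos t]]"
  "rotation_curve 2 t = vector [vector [cos t, 0, sin t], vector [0, 1, 0], vector [- sin t, 0, cos t]]"
  "rotation_curve 3 t = vector [vector [cos t, - sin t, 0], vector [sin t, cos t, 0], vector [0, 0, 1]]"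
  by (simp_all add: rotation_curve_def skew_generator_def vec_eq_iff forall_3 matrix_matrix_mult_def sum_3 mat_def)

lemma rotation_curve_SO3: "rotation_curve k t \<in> SO3"
proof -
  have sc: "sin t * sin t + cos t * cos t = 1" "cos t * cos t + sin t * sin t = 1"
    using sin_cos_squared_add[of t] by (simp_all add: power2_eq_square)
  have "rotation_curve l t \<in> SO3" if "l \<in> {1, 2, 3}" for l
    using that
    by (elim insertE; simp add: SO3_def rotation_matrix_def orthogonal_matrix rotation_curve_eq det_3 vec_eq_iff forall_3
        matrix_matrix_mult_def sum_3 transpose_def mat_def sc)
  then show ?thesis using exhaust_3[of k] by blast
qed

lemma skew_decomposition:
  fixes F :: "real^3^3"
  assumes "sym_part F = 0"
  shows "F = F $ 3 $ 2 *\<^sub>R skew_generator 1 + F $ 1 $ 3 *\<^sub>R skew_generator 2 + F $ 2 $ 1 *\<^sub>R skew_generator 3"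
proof -
  have "F $ j $ i = - F $ i $ j" for i j
    using arg_cong[OF assms, of "\<lambda>M. M $ i $ j"] by (simp add: sym_part_nth)
  from this[of 1 1] this[of 2 2] this[of 3 3] this[of 2 3] this[of 3 1] this[of 1 2]
  show ?thesis by (simp add: vec_eq_iff forall_3 skew_generator_def)
qed

lemma matrix_mult_norm_bound: "\<exists>K>0. \<forall>(A :: real^'n::finite^'n) (B :: real^'n^'n). norm (A ** B) \<le> norm A * norm B * K"
  by (rule bounded_bilinear.pos_bounded[OF bounded_bilinear_matrix_mult])

lemma transpose_norm_bound: "\<exists>K>0. \<forall>A :: real^'n::finite^'n. norm (transpose A) \<le> norm A * K"
  by (rule bounded_linear.pos_bounded[OF bounded_linear_transpose])

text \<open>For every rotation R, X^T X - 1 = X^T (X - R) + (X - R)^T R. So the strain of X is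
  controlled by the distance to any rotation, and no polar decomposition enters.\<close>

lemma infdist_SO3_lower:
  obtains C where "C > 0" "\<And>X :: real^3^3. norm X \<le> norm (mat 1 :: real^3^3) + 1 \<Longrightarrow> norm (transpose X ** X - mat 1) \<le> C * infdist X SO3"
proof -
  obtain K where K: "K > 0" "\<And>(A :: real^3^3) (B :: real^3^3). norm (A ** B) \<le> norm A * norm B * K"
    using matrix_mult_norm_bound[where 'n = 3] by blast
  obtain T where T: "T > 0" "\<And>A :: real^3^3. norm (transpose A) \<le> norm A * T"
    using transpose_norm_bound[where 'n = 3] by blast
  define m where "m = norm (mat 1 :: real^3^3) + 1"
  \<comment> \<open>\<open>K\<close> and \<open>T\<close> are the norm constants of product and
    transposition, \<open>m\<close> bounds \<open>X\<close>, and 2 bounds the norm of a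
    rotation.\<close>
  define C where "C = K * T * (m + 2)"
  have m: "m > 0" by (simp add: m_def add_nonneg_pos)
  have C: "C > 0" using K T m by (simp add: C_def)
  show thesis
  proof (rule that[OF C])
    fix X :: "real^3^3" assume X: "norm X \<le> norm (mat 1 :: real^3^3) + 1"
    have "norm (transpose X ** X - mat 1) / C \<le> dist X R" if R: "R \<in> SO3" for R
    proof -
      have "transpose X ** X - mat 1 = transpose X ** (X - R) + transpose (X - R) ** R"
        using SO3_orthogonal(1)[OF R]
        by (simp add: bounded_bilinear.diff_left[OF bounded_bilinear_matrix_mult] bounded_bilinear.diff_right[OF bounded_bilinear_matrix_mult]
            linear_diff[OF bounded_linear.linear[OF bounded_linear_transpose]])
      then have "norm (transpose X ** X - mat 1) \<le> norm (transpose X ** (X - R)) + norm (transpose (X - R) ** R)"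
        by (simp add: norm_triangle_ineq)
      also have "\<dots> \<le> norm (transpose X) * norm (X - R) * K + norm (transpose (X - R)) * norm R * K"
        by (intro add_mono K)
      also have "\<dots> \<le> (m * T) * norm (X - R) * K + (norm (X - R) * T) * 2 * K"
      proof (intro add_mono mult_right_mono mult_mono)
        show "norm (transpose X) \<le> m * T" using T(2)[of X] X T(1) by (smt (verit) m_def mult_right_mono)
      qed (use T K m norm_SO3_le[OF R] in auto)
      also have "\<dots> = C * norm (X - R)" by (simp add: C_def algebra_simps)
      finally show ?thesis using C by (simp add: dist_norm divide_le_eq mult.commute)
    qed
    then have "norm (transpose X ** X - mat 1) / C \<le> infdist X SO3"
      using mat_1_SO3 by (subst infdist_notempty) (auto intro!: cINF_greatest)
    then show "norm (transpose X ** X - mat 1) \<le> C * infdist X SO3"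
      using C by (simp add: divide_le_eq mult.commute)
  qed
qed

text \<open>All rotations minimise the density, so its differential vanishes on the rotation group;
  differentiating this along one-parameter rotations shows that the second derivative at the
  identity annihilates skew-symmetric directions. The lower bound comes from comparing the density
  with the squared distance to the rotations on the ray from the identity in direction
  \<open>F\<close>.\<close>

lemma Q3_properties:
  assumes "stored_energy W"
  shows "\<exists>B k. bounded_bilinear B \<and> (\<forall>F. Q3 W F = B F F) \<and> k > 0 \<and>
    (\<forall>F. Q3 W F = Q3 W (sym_part F)) \<and> (\<forall>F. Q3 W F \<ge> k * (norm (sym_part F))\<^sup>2)"
proof -
  obtain U c where U: "open U" "SO3 \<subseteq> U" "\<And>F. F \<in> U \<Longrightarrow> W F < \<infinity>" and Ck: "Ck_on 2 U (\<lambda>F. enn2real (W F))"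
    and c: "c > 0" and W: "\<And>F R. R \<in> SO3 \<Longrightarrow> W R = 0" "\<And>F. W F \<ge> ennreal (c * (infdist F SO3)\<^sup>2)"
    using assms mat_1_SO3 unfolding stored_energy_def by blast
  define w where "w F = enn2real (W F)" for F
  define w' where "w' Z F = frechet_derivative w (at Z) F" for Z F
  define w'' where "w'' Z F H = frechet_derivative (\<lambda>Z. w' Z F) (at Z) H" for Z F H
  have Ck': "Ck_on (Suc (Suc 0)) U w" using Ck by (simp add: w_def[abs_def] numeral_2_eq_2)
  have d1: "(w has_derivative w' Z) (at Z)" if "Z \<in> U" for Z
    using Ck_on_has_derivative[OF Ck' that] by (simp add: w'_def[abs_def])
  have Ck1: "Ck_on (Suc 0) U (\<lambda>Z. w' Z F)" for F
    using Ck_on_frechet_derivative[OF Ck'] by (simp only: w'_def)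
  have d2: "((\<lambda>Z. w' Z F) has_derivative w'' Z F) (at Z)" if "Z \<in> U" for Z F
    using Ck_on_has_derivative[OF Ck1 that] by (simp add: w''_def[abs_def])
  have c2: "continuous_on U (\<lambda>Z. w'' Z F H)" for F H
    using Ck_on_frechet_derivative[OF Ck1] by (simp add: w''_def)
  define I where "I = (mat 1 :: real^3^3)"
  have I: "I \<in> U" using mat_1_SO3 U by (auto simp: I_def)
  define B where "B F H = w'' I F H" for F H
  have Q3: "Q3 W F = B F F" for F
    by (simp add: Q3_def B_def w''_def w'_def w_def[abs_def] I_def)
  have lin': "linear (w' Z)" if "Z \<in> U" for Z using d1[OF that] by (rule has_derivative_linear)
  have linB2: "linear (B F)" for F using d2[OF I] unfolding B_def by (rule has_derivative_linear)
  have B_eq: "B F = D" if "((\<lambda>Z. w' Z F) has_derivative D) (at I)" for F D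
    using has_derivative_unique[OF d2[OF I] that] by (auto simp: B_def)
  have "bilinear B"
    unfolding bilinear_def
  proof (intro conjI allI linB2 linearI)
    fix H F G :: "real^3^3" and r :: real
    have "((\<lambda>Z. w' Z (F + G)) has_derivative (\<lambda>H. B F H + B G H)) (at I)"
      unfolding B_def
      by (rule has_derivative_transform_within_open[OF has_derivative_add[OF d2[OF I] d2[OF I]] U(1) I])
        (simp add: linear_add[OF lin'])
    from B_eq[OF this] show "B (F + G) H = B F H + B G H" by simp
    have "((\<lambda>Z. w' Z (r *\<^sub>R F)) has_derivative (\<lambda>H. r *\<^sub>R B F H)) (at I)"
      unfolding B_def
      by (rule has_derivative_transform_within_open[OF has_derivative_scaleR_right[OF d2[OF I]] U(1) I])
        (simp add: linear_scale[OF lin'])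
    from B_eq[OF this] show "B (r *\<^sub>R F) H = r *\<^sub>R B F H" by simp
  qed
  then have bb: "bounded_bilinear B" by (simp add: bilinear_conv_bounded_bilinear)
  interpret B: bounded_bilinear B by fact
  have symB: "B F H = B H F" for F H
    unfolding B_def by (rule mixed_derivatives_commute[OF U(1) I d1 d2 d2 c2 c2])
  have w0: "w R = 0" if "R \<in> SO3" for R using W(1)[OF that] by (simp add: w_def)
  have crit: "w' R = (\<lambda>v. 0)" if R: "R \<in> SO3" for R
    by (rule differential_zero_maxmin[OF _ U(1) d1]) (use R U(2) w0[OF R] in \<open>auto simp: w_def\<close>)
  have BF: "B F = w'' I F" for F by (simp add: B_def[abs_def])
  have Bgen: "B F (skew_generator k) = 0" for F k
  proof -
    have "((\<lambda>t. rotation_curve k t) has_derivative (\<lambda>h. h *\<^sub>R skew_generator k)) (at 0)"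
      unfolding rotation_curve_def by (auto intro!: derivative_eq_intros)
    moreover have "((\<lambda>Z. w' Z F) has_derivative B F) (at (rotation_curve k 0))"
      using d2[OF I, of F] BF[of F] by (simp add: rotation_curve_def I_def)
    ultimately have "((\<lambda>t. w' (rotation_curve k t) F) has_derivative (\<lambda>h. B F (h *\<^sub>R skew_generator k))) (at 0)"
      by (rule has_derivative_compose)
    then have "((\<lambda>t. 0) has_derivative (\<lambda>h. B F (h *\<^sub>R skew_generator k))) (at (0::real))"
      by (simp add: crit[OF rotation_curve_SO3])
    then have "(\<lambda>h::real. B F (h *\<^sub>R skew_generator k)) = (\<lambda>h. 0)"
      by (rule has_derivative_unique[OF _ has_derivative_const])
    from fun_cong[OF this, of 1] show ?thesis by simp
  qed
  have Bskew: "B F S = 0" if "sym_part S = 0" for F S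
    by (subst skew_decomposition[OF that]) (simp add: B.add_right B.scaleR_right Bgen)
  have Qsym: "Q3 W F = Q3 W (sym_part F)" for F
  proof -
    define S where "S = F - sym_part F"
    have F: "F = sym_part F + S" by (simp add: S_def)
    have "B F F = B (sym_part F + S) (sym_part F + S)" using F by simp
    also have "\<dots> = B (sym_part F) (sym_part F)"
      using Bskew[OF sym_part_skew[of F]] symB[of S "sym_part F"] by (simp add: B.add_left B.add_right S_def[symmetric])
    finally show ?thesis by (simp add: Q3)
  qed
  obtain C where C: "C > 0" "\<And>X :: real^3^3. norm X \<le> norm (mat 1 :: real^3^3) + 1 \<Longrightarrow> norm (transpose X ** X - mat 1) \<le> C * infdist X SO3"
    using infdist_SO3_lower by blast
  define k where "k = c / C\<^sup>2"
  have k: "k > 0" using c C by (simp add: k_def)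
  have "Q3 W F \<ge> k * (norm (sym_part F))\<^sup>2" for F
  proof (cases "sym_part F = 0")
    case True
    then show ?thesis using Qsym[of F] Q3[of 0] by (simp add: B.zero_left)
  next
    case False
    define s where "s = norm (sym_part F)"
    have s: "s > 0" using False by (simp add: s_def)
    define h where "h t = w' (I + t *\<^sub>R F) F" for t
    obtain r where r: "r > 0" "ball I r \<subseteq> U" using U(1) I open_contains_ball by blast
    \<comment> \<open>Three restrictions on \<open>t\<close>: the point stays in the ball inside
      \<open>U\<close>; its norm exceeds that of the identity by at most 1, as the distance estimate
      demands; and the quadratic part of the strain is at most half of the linear part
      \<open>2 * t * s\<close>.\<close>
    define \<delta> where "\<delta> = min (r / (norm F + 1)) (min (1 / (norm F + 1)) (s / (norm (transpose F ** F) + 1)))"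
    have \<delta>: "\<delta> > 0" using r s by (auto simp: \<delta>_def intro!: divide_pos_pos add_nonneg_pos)
    have dU: "I + t *\<^sub>R F \<in> U" if "0 \<le> t" "t < \<delta>" for t
    proof -
      have "t * norm F \<le> t * (norm F + 1)" using that by (intro mult_left_mono) auto
      also have "\<dots> < (r / (norm F + 1)) * (norm F + 1)"
        using that by (intro mult_strict_right_mono) (auto simp: \<delta>_def add_nonneg_pos)
      also have "\<dots> = r" by (simp add: add_nonneg_eq_0_iff)
      finally have "dist I (I + t *\<^sub>R F) < r" using that by (simp add: dist_norm)
      then show ?thesis using r(2) by auto
    qed
    have low: "w (I + t *\<^sub>R F) \<ge> k * s\<^sup>2 * t\<^sup>2" if t: "0 < t" "t < \<delta>" for t
    proof -
      let ?X = "I + t *\<^sub>R F"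
      have "t * norm F \<le> 1"
      proof -
        have "t * norm F \<le> t * (norm F + 1)" using t by (intro mult_left_mono) auto
        also have "\<dots> \<le> (1 / (norm F + 1)) * (norm F + 1)" using t by (intro mult_right_mono) (auto simp: \<delta>_def)
        also have "\<dots> \<le> 1" by simp
        finally show ?thesis .
      qed
      then have nX: "norm ?X \<le> norm (mat 1 :: real^3^3) + 1"
        using norm_triangle_ineq[of I "t *\<^sub>R F"] t by (simp add: I_def)
      have tF: "t * norm (transpose F ** F) \<le> s"
      proof -
        have "t * norm (transpose F ** F) \<le> t * (norm (transpose F ** F) + 1)" using t by (intro mult_left_mono) auto
        also have "\<dots> \<le> (s / (norm (transpose F ** F) + 1)) * (norm (transpose F ** F) + 1)" using t by (intro mult_right_mono) (auto simp: \<delta>_def)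
        also have "\<dots> \<le> s" using s by simp
        finally show ?thesis .
      qed
      have "transpose ?X ** ?X - mat 1 = (2 * t) *\<^sub>R sym_part F + (t * t) *\<^sub>R (transpose F ** F)"
      proof -
        have "transpose ?X = I + t *\<^sub>R transpose F"
          using linear_add[OF bounded_linear.linear[OF bounded_linear_transpose], of I "t *\<^sub>R F"]
          by (simp add: transpose_scalar I_def)
        then have "transpose ?X ** ?X = I + t *\<^sub>R F + t *\<^sub>R transpose F + (t * t) *\<^sub>R (transpose F ** F)"
          by (simp add: bounded_bilinear.add_left[OF bounded_bilinear_matrix_mult] bounded_bilinear.add_right[OF bounded_bilinear_matrix_mult] bounded_bilinear.scaleR_left[OF bounded_bilinear_matrix_mult]
              bounded_bilinear.scaleR_right[OF bounded_bilinear_matrix_mult] I_def algebra_simps)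
        moreover have "(2 * t) *\<^sub>R sym_part F = t *\<^sub>R F + t *\<^sub>R transpose F" by (simp add: sym_part_def scaleR_add_right)
        ultimately show ?thesis by (simp add: I_def)
      qed
      then have "norm (transpose ?X ** ?X - mat 1) \<ge> norm ((2 * t) *\<^sub>R sym_part F) - norm ((t * t) *\<^sub>R (transpose F ** F))"
        using norm_diff_ineq[of "(2 * t) *\<^sub>R sym_part F" "(t * t) *\<^sub>R (transpose F ** F)"] by simp
      then have "norm (transpose ?X ** ?X - mat 1) \<ge> 2 * t * s - t * (t * norm (transpose F ** F))"
        using t by (simp add: s_def)
      moreover have "t * (t * norm (transpose F ** F)) \<le> t * s" using tF t by (intro mult_left_mono) auto
      ultimately have "t * s \<le> C * infdist ?X SO3" using C(2)[OF nX] by linarith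
      then have "t * s / C \<le> infdist ?X SO3" using C(1) by (simp add: divide_le_eq mult.commute)
      then have "c * (t * s / C)\<^sup>2 \<le> c * (infdist ?X SO3)\<^sup>2"
        using c t s C(1) by (intro mult_left_mono power_mono) auto
      also have "\<dots> \<le> w ?X"
        unfolding w_def using W(2)[of ?X] U(3)[OF dU, of t] t c
        by (metis enn2real_ennreal enn2real_mono infinity_ennreal_def less_imp_le mult_nonneg_nonneg zero_le_power2)
      finally show ?thesis by (simp add: k_def power_divide power_mult_distrib mult_ac)
    qed
    have dh: "(h has_real_derivative B F F) (at 0)"
    proof -
      have "((\<lambda>t. I + t *\<^sub>R F) has_derivative (\<lambda>t. t *\<^sub>R F)) (at 0)" by (auto intro!: derivative_eq_intros)
      moreover have "((\<lambda>Z. w' Z F) has_derivative B F) (at (I + 0 *\<^sub>R F))" using d2[OF I, of F] BF[of F] by simp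
      ultimately have "(h has_derivative (\<lambda>t. B F (t *\<^sub>R F))) (at 0)" unfolding h_def by (rule has_derivative_compose)
      then show ?thesis by (simp add: has_field_derivative_def B.scaleR_right mult.commute[of _ "B F F"])
    qed
    have h0: "h 0 = 0" using crit[OF mat_1_SO3] by (simp add: h_def I_def)
    \<comment> \<open>The mean value theorem turns the quadratic lower bound on the density into a
      linear one on its derivative \<open>h\<close> at some \<open>\<xi>\<close> below
      \<open>t\<close>. Since \<open>h 0 = 0\<close>, the quotients \<open>h \<xi> / \<xi>\<close>
      tend to the second derivative.\<close>
    have hlow: "\<exists>\<xi>. 0 < \<xi> \<and> \<xi> < t \<and> h \<xi> / \<xi> \<ge> k * s\<^sup>2" if t: "0 < t" "t < \<delta>" for t
    proof -
      have dw: "((\<lambda>t. w (I + t *\<^sub>R F)) has_real_derivative h x) (at x)" if "0 \<le> x" "x \<le> t" for x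
      proof -
        have xU: "I + x *\<^sub>R F \<in> U" using dU that t by simp
        have "((\<lambda>t. I + t *\<^sub>R F) has_derivative (\<lambda>t. t *\<^sub>R F)) (at x)" by (auto intro!: derivative_eq_intros)
        from has_derivative_compose[OF this d1[OF xU]]
        show ?thesis by (simp add: has_field_derivative_def h_def linear_scale[OF lin'[OF xU]] mult.commute[of _ "w' _ F"])
      qed
      obtain \<xi> where \<xi>: "0 < \<xi>" "\<xi> < t" "w (I + t *\<^sub>R F) - w (I + 0 *\<^sub>R F) = (t - 0) * h \<xi>"
        using MVT2[OF t(1) dw] by blast
      have "w I = 0" using w0[OF mat_1_SO3] by (simp add: I_def)
      then have "t * (k * s\<^sup>2 * t) \<le> t * h \<xi>" using \<xi>(3) low[OF t] by (simp add: power2_eq_square mult_ac)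
      then have "k * s\<^sup>2 * t \<le> h \<xi>" using t by simp
      moreover have "k * s\<^sup>2 * \<xi> \<le> k * s\<^sup>2 * t" using \<xi> k by (intro mult_left_mono) auto
      ultimately show ?thesis using \<xi> by (intro exI[of _ \<xi>]) (simp add: le_divide_eq)
    qed
    have "B F F \<ge> k * s\<^sup>2"
    proof (rule ccontr)
      assume "\<not> ?thesis"
      then have lt: "B F F < k * s\<^sup>2" by simp
      have "((\<lambda>t. h t / t) \<longlongrightarrow> B F F) (at 0)" using dh h0 by (simp add: DERIV_def)
      then have "eventually (\<lambda>t. h t / t < k * s\<^sup>2) (at 0)" using lt by (rule order_tendstoD)
      then obtain d where d: "d > 0" "\<And>t. t \<noteq> 0 \<Longrightarrow> dist t 0 < d \<Longrightarrow> h t / t < k * s\<^sup>2"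
        by (auto simp: eventually_at)
      have "0 < min d \<delta> / 2" "min d \<delta> / 2 < \<delta>" using d(1) \<delta> by (auto simp: min_def)
      from hlow[OF this] obtain \<xi> where "0 < \<xi>" "\<xi> < min d \<delta> / 2" "h \<xi> / \<xi> \<ge> k * s\<^sup>2"
        by blast
      then show False using d(2)[of \<xi>] by (auto simp: min_def split: if_splits)
    qed
    then show ?thesis by (simp add: Q3 s_def)
  qed
  then show ?thesis using bb Q3 k Qsym by blast
qed

section \<open>The relaxed form on two by two blocks\<close>

lemma block22_nth [simp]:
  "block22 F $ 1 $ 1 = F $ 1 $ 1" "block22 F $ 1 $ 2 = F $ 1 $ 2" "block22 F $ 2 $ 1 = F $ 2 $ 1" "block22 F $ 2 $ 2 = F $ 2 $ 2"
  by (simp_all add: block22_def)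

lemma bounded_linear_block22: "bounded_linear block22"
  by (rule linear_conv_bounded_linear[THEN iffD1])
    (auto intro!: linearI simp: vec_eq_iff forall_2)

definition extend33 :: "real^2^2 \<Rightarrow> real^3^3" where
  "extend33 F = vector [vector [F$1$1, F$1$2, 0], vector [F$2$1, F$2$2, 0], 0]"

lemma block22_extend33: "block22 (extend33 F) = F"
  by (simp add: vec_eq_iff forall_2 extend33_def)

lemma sym_part_extend33: "sym_part (extend33 F) = extend33 (sym_part F)"
  by (simp add: vec_eq_iff forall_3 sym_part_nth extend33_def)

lemma sym_part_block22: "sym_part (block22 F) = block22 (sym_part F)"
  by (simp add: vec_eq_iff forall_2 sym_part_nth)

text \<open>The reason why the trace measures the size of the metric in the lower bound for
  \<open>Q2\<close>.\<close>

lemma norm_spd_sqrt: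
  fixes M :: "real^'n::finite^'n"
  assumes "spd M"
  shows "(norm (spd_sqrt M))\<^sup>2 = trace M"
proof -
  let ?A = "spd_sqrt M"
  have A: "spd ?A" "?A ** ?A = M" using spd_sqrt_works[OF assms] by auto
  have "?A $ i $ j = ?A $ j $ i" for i j
  proof -
    have "transpose ?A $ j $ i = ?A $ j $ i" using A(1) by (simp add: spd_def)
    then show ?thesis by (simp add: transpose_def)
  qed
  then have "(norm ?A)\<^sup>2 = (\<Sum>i\<in>UNIV. (?A ** ?A) $ i $ i)"
    unfolding norm_matrix_power2 by (simp add: matrix_matrix_mult_def power2_eq_square)
  then show ?thesis by (simp add: A(2) trace_def)
qed

text \<open>\<open>Q2\<close> is a least element, so it has the intended value only if the minimum
  is attained. The form depends on the symmetric part alone. On the closed set \<open>T\<close> of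
  symmetric matrices with the prescribed symmetric block it is coercive, so a minimum over a large
  ball is global.\<close>

lemma Q2_attained:
  assumes W: "stored_energy W" and G: "spd (G x)"
  shows "\<exists>H. sym_part H = H \<and> block22 H = sym_part F \<and>
    Q2 W G x F = Q3 W (matrix_inv (spd_sqrt (G x)) ** H ** matrix_inv (spd_sqrt (G x)))
    \<and> (sym_part F = 0 \<longrightarrow> Q2 W G x F = 0)"
proof -
  obtain B k where bb: "bounded_bilinear B" and Q3: "\<And>F. Q3 W F = B F F" and k: "k > 0" and
    Qsym: "\<And>F. Q3 W F = Q3 W (sym_part F)" and Qlow: "\<And>F. Q3 W F \<ge> k * (norm (sym_part F))\<^sup>2"
    using Q3_properties[OF W] by blast
  interpret B: bounded_bilinear B by fact
  define A where "A = spd_sqrt (G x)"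
  define P where "P = matrix_inv A"
  have A: "spd A" using spd_sqrt_works[OF G] by (simp add: A_def)
  have inv: "invertible A" using spd_invertible[OF A] .
  have PA: "A ** P = mat 1" "P ** A = mat 1" using matrix_inv_inverse[OF inv] by (auto simp: P_def)
  have symP: "transpose P = P" unfolding P_def using transpose_matrix_inv[OF inv] A by (simp add: spd_def)
  define \<phi> where "\<phi> H = Q3 W (P ** H ** P)" for H
  have \<phi>sym: "\<phi> H = \<phi> (sym_part H)" for H
    unfolding \<phi>_def by (subst Qsym) (simp add: sym_part_congruence[OF symP])
  have lin: "bounded_linear (\<lambda>H. P ** H ** P)"
    by (rule bounded_linear_compose[OF bounded_bilinear.bounded_linear_left[OF bounded_bilinear_matrix_mult] bounded_bilinear.bounded_linear_right[OF bounded_bilinear_matrix_mult]])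
  have cont: "continuous_on UNIV \<phi>"
    unfolding \<phi>_def Q3 by (intro B.continuous_on linear_continuous_on lin)
  obtain K where K: "K > 0" "\<And>(A :: real^3^3) (B :: real^3^3). norm (A ** B) \<le> norm A * norm B * K"
    using matrix_mult_norm_bound[where 'n = 3] by blast
  \<comment> \<open>From writing \<open>H\<close> as \<open>P ** H ** P\<close> multiplied by
    \<open>A\<close> on both sides; the summand 1 keeps \<open>L\<close> positive.\<close>
  define L where "L = K * K * (norm A)\<^sup>2 + 1"
  have L: "L > 0" using K by (simp add: L_def add_nonneg_pos)
  have bnd: "norm H \<le> L * norm (P ** H ** P)" for H
  proof -
    have "H = A ** (P ** H ** P) ** A"
    proof -
      have "A ** (P ** H ** P) ** A = (A ** P) ** H ** (P ** A)" by (simp add: matrix_mul_assoc)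
      then show ?thesis by (simp add: PA)
    qed
    then have "norm H \<le> norm (A ** (P ** H ** P)) * norm A * K" by (metis K(2))
    also have "\<dots> \<le> (norm A * norm (P ** H ** P) * K) * norm A * K"
      using K by (intro mult_right_mono K(2)) auto
    also have "\<dots> = K * K * (norm A)\<^sup>2 * norm (P ** H ** P)" by (simp add: power2_eq_square)
    also have "\<dots> \<le> L * norm (P ** H ** P)" by (intro mult_right_mono) (auto simp: L_def)
    finally show ?thesis .
  qed
  have coercive: "\<phi> H \<ge> k / L\<^sup>2 * (norm H)\<^sup>2" if "sym_part H = H" for H
  proof -
    have "(norm H / L)\<^sup>2 \<le> (norm (P ** H ** P))\<^sup>2"
      using bnd[of H] L by (intro power_mono) (auto simp: divide_le_eq mult.commute)
    then have "k * (norm H / L)\<^sup>2 \<le> k * (norm (P ** H ** P))\<^sup>2" using k by (intro mult_left_mono) auto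
    also have "\<dots> \<le> \<phi> H"
      using Qlow[of "P ** H ** P"] that by (simp add: \<phi>_def sym_part_congruence[OF symP])
    finally show ?thesis by (simp add: power_divide)
  qed
  define T where "T = {S. sym_part S = S \<and> block22 S = sym_part F}"
  have T0: "extend33 (sym_part F) \<in> T" by (simp add: T_def sym_part_extend33 sym_part_idem block22_extend33)
  have "closed T"
  proof -
    have "closed {S :: real^3^3. sym_part S = S}" "closed {S. block22 S = sym_part F}"
      by (intro closed_Collect_eq linear_continuous_on bounded_linear_sym_part bounded_linear_block22 continuous_intros)+
    then show ?thesis unfolding T_def by (rule closed_Collect_conj)
  qed
  define q1 where "q1 = \<phi> (extend33 (sym_part F))"
  \<comment> \<open>Outside the ball of radius \<open>r\<close> coercivity gives at least
    \<open>q1\<close>, the value at one admissible matrix. The summand 1 makes the ratio of the norm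
    to \<open>L\<close> at least 1, so that it is bounded by its square.\<close>
  define r where "r = L * (\<bar>q1\<bar> / k + 1)"
  have kL: "k / L\<^sup>2 > 0" using k L by simp
  have far: "\<phi> S \<ge> q1" if "S \<in> T" "norm S > r" for S
  proof -
    have "\<bar>q1\<bar> / k + 1 \<le> norm S / L" using that(2) L by (simp add: r_def le_divide_eq mult.commute)
    moreover have "\<bar>q1\<bar> / k \<ge> 0" using k by simp
    ultimately have "\<bar>q1\<bar> / k + 1 \<le> (norm S / L)\<^sup>2"
      by (smt (verit) power2_eq_square mult_le_cancel_right1 mult_left_mono)
    then have "k * (\<bar>q1\<bar> / k) \<le> k * (norm S / L)\<^sup>2" using k by (intro mult_left_mono) auto
    then have "\<bar>q1\<bar> \<le> k / L\<^sup>2 * (norm S)\<^sup>2" using k by (simp add: power_divide)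
    also have "\<dots> \<le> \<phi> S" using coercive that(1) by (simp add: T_def)
    finally show ?thesis by simp
  qed
  obtain S where S: "S \<in> T" "\<And>S'. S' \<in> T \<Longrightarrow> \<phi> S \<le> \<phi> S'"
  proof (cases "\<exists>S\<in>T. norm S \<le> r")
    case True
    then have "T \<inter> cball 0 r \<noteq> {}" by auto
    moreover have "compact (T \<inter> cball 0 r)" using \<open>closed T\<close> by (simp add: closed_Int_compact)
    ultimately obtain S where S: "S \<in> T \<inter> cball 0 r" "\<And>S'. S' \<in> T \<inter> cball 0 r \<Longrightarrow> \<phi> S \<le> \<phi> S'"
      using continuous_attains_inf[of "T \<inter> cball 0 r" \<phi>] continuous_on_subset[OF cont] by (metis subset_UNIV)
    show ?thesis
    proof (cases "\<phi> S \<le> q1")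
      case True
      have "\<phi> S \<le> \<phi> S'" if "S' \<in> T" for S'
      proof (cases "norm S' \<le> r")
        case nr: True
        then show ?thesis using S(2)[of S'] that by auto
      next
        case False
        then have "q1 \<le> \<phi> S'" using far[OF that] by simp
        then show ?thesis using True by simp
      qed
      moreover have "S \<in> T" using S(1) by simp
      ultimately show ?thesis using that by blast
    next
      case False
      have "\<phi> (extend33 (sym_part F)) \<le> \<phi> S'" if "S' \<in> T" for S'
      proof (cases "norm S' \<le> r")
        case True
        then have "\<phi> S \<le> \<phi> S'" using S(2) that by auto
        then show ?thesis using False by (simp add: q1_def)
      qed (use far[OF that] in \<open>auto simp: q1_def\<close>)
      then show ?thesis using that T0 by blast
    qed
  next
    case False
    have "\<phi> (extend33 (sym_part F)) \<le> \<phi> S'" if "S' \<in> T" for S'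
      using far[OF that] False that by (auto simp: q1_def not_le)
    then show ?thesis using that[OF T0] by blast
  qed
  have Q2: "Q2 W G x F = \<phi> S"
    unfolding Q2_def A_def[symmetric] P_def[symmetric] \<phi>_def[symmetric]
  proof (rule Least_equality)
    \<comment> \<open>The skew part of \<open>F\<close> restores the prescribed block without
      changing the symmetric part, so the minimiser among symmetric matrices yields one among
      all.\<close>
    have "block22 (S + extend33 (F - sym_part F)) = F"
      using S(1) linear_add[OF bounded_linear.linear[OF bounded_linear_block22], of S "extend33 (F - sym_part F)"]
      by (simp add: T_def block22_extend33)
    moreover have "\<phi> (S + extend33 (F - sym_part F)) = \<phi> S"
    proof -
      have "extend33 0 = 0" by (simp add: extend33_def vec_eq_iff forall_3)
      then have "sym_part (S + extend33 (F - sym_part F)) = S"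
        using S(1) linear_add[OF bounded_linear.linear[OF bounded_linear_sym_part], of S "extend33 (F - sym_part F)"]
        by (simp add: T_def sym_part_extend33 sym_part_skew)
      then show ?thesis using \<phi>sym by metis
    qed
    ultimately show "\<phi> S \<in> {\<phi> H |H. block22 H = F}"
      by (intro CollectI exI[of _ "S + extend33 (F - sym_part F)"]) simp
    fix q assume "q \<in> {\<phi> H |H. block22 H = F}"
    then obtain H where H: "q = \<phi> H" "block22 H = F" by blast
    then have "sym_part H \<in> T" by (auto simp: T_def sym_part_idem sym_part_block22)
    then show "\<phi> S \<le> q" using S(2) H(1) \<phi>sym[of H] by metis
  qed
  have "Q2 W G x F = 0" if "sym_part F = 0"
  proof -
    have "0 \<in> T"
      using linear_0[OF bounded_linear.linear[OF bounded_linear_block22]] linear_0[OF bounded_linear.linear[OF bounded_linear_sym_part]] that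
      by (simp add: T_def)
    then have "\<phi> S \<le> \<phi> 0" by (rule S(2))
    moreover have "\<phi> 0 = 0" unfolding \<phi>_def Q3
      using linear_0[OF bounded_linear.linear[OF lin]] by (simp add: B.zero_left)
    moreover have "\<phi> S \<ge> 0" unfolding \<phi>_def using Qlow[of "P ** S ** P"] k by (meson less_imp_le mult_nonneg_nonneg order_trans zero_le_power2)
    ultimately show ?thesis using Q2 by simp
  qed
  then show ?thesis using S(1) Q2 by (intro exI[of _ S]) (auto simp: T_def \<phi>_def P_def A_def)
qed

text \<open>The constant is uniform over all metrics with trace at most \<open>t\<close>: the
  estimate involves the metric only through the norm of its square root, and the square of this norm
  is the trace.\<close>

lemma Q2_lower_bound:
  assumes W: "stored_energy W" and t: "t > 0"
  shows "\<exists>k>0. \<forall>G x F. spd (G x) \<longrightarrow> trace (G x) \<le> t \<longrightarrow> Q2 W G x F \<ge> k * (norm (sym_part F))\<^sup>2"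
proof -
  obtain k where k: "k > 0" and Qlow: "\<And>F. Q3 W F \<ge> k * (norm (sym_part F))\<^sup>2"
    using Q3_properties[OF W] by blast
  obtain K where K: "K > 0" "\<And>(A :: real^3^3) (B :: real^3^3). norm (A ** B) \<le> norm A * norm B * K"
    using matrix_mult_norm_bound[where 'n = 3] by blast
  obtain b where b: "b > 0" "\<And>H. norm (block22 H) \<le> norm H * b"
    using bounded_linear.pos_bounded[OF bounded_linear_block22] by blast
  define L where "L = b * (K * K * t)"
  have L: "L > 0" using K b t by (simp add: L_def)
  have "Q2 W G x F \<ge> k / L\<^sup>2 * (norm (sym_part F))\<^sup>2" if G: "spd (G x)" and tr: "trace (G x) \<le> t" for G x F
  proof -
    obtain H where H: "sym_part H = H" "block22 H = sym_part F"
      "Q2 W G x F = Q3 W (matrix_inv (spd_sqrt (G x)) ** H ** matrix_inv (spd_sqrt (G x)))"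
      using Q2_attained[where G = G and x = x, OF W G] by blast
    define A where "A = spd_sqrt (G x)"
    define P where "P = matrix_inv A"
    have A: "spd A" using spd_sqrt_works[OF G] by (simp add: A_def)
    have inv: "invertible A" using spd_invertible[OF A] .
    have PA: "A ** P = mat 1" "P ** A = mat 1" using matrix_inv_inverse[OF inv] by (auto simp: P_def)
    have symP: "transpose P = P" unfolding P_def using transpose_matrix_inv[OF inv] A by (simp add: spd_def)
    have "A ** (P ** H ** P) ** A = (A ** P) ** H ** (P ** A)" by (simp add: matrix_mul_assoc)
    then have "H = A ** (P ** H ** P) ** A" by (simp add: PA)
    then have "norm H \<le> norm (A ** (P ** H ** P)) * norm A * K" by (metis K(2))
    also have "\<dots> \<le> (norm A * norm (P ** H ** P) * K) * norm A * K"
      using K by (intro mult_right_mono K(2)) auto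
    also have "\<dots> = K * K * trace (G x) * norm (P ** H ** P)"
      using norm_spd_sqrt[OF G] by (simp add: power2_eq_square A_def[symmetric])
    also have "\<dots> \<le> K * K * t * norm (P ** H ** P)"
      using tr K by (intro mult_right_mono mult_left_mono) auto
    finally have "norm H * b \<le> L * norm (P ** H ** P)" using b(1) by (simp add: L_def mult.commute mult.left_commute)
    then have "norm (sym_part F) \<le> L * norm (P ** H ** P)" using b(2)[of H] H(2) by simp
    then have "(norm (sym_part F) / L)\<^sup>2 \<le> (norm (P ** H ** P))\<^sup>2"
      using L by (intro power_mono) (auto simp: divide_le_eq mult.commute)
    then have "k * (norm (sym_part F) / L)\<^sup>2 \<le> k * (norm (P ** H ** P))\<^sup>2" using k by (intro mult_left_mono) auto
    also have "\<dots> \<le> Q2 W G x F"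
      using Qlow[of "P ** H ** P"] H(1,3) unfolding A_def[symmetric] P_def[symmetric]
      by (simp add: sym_part_congruence[OF symP])
    finally show ?thesis by (simp add: power_divide)
  qed
  moreover have "k / L\<^sup>2 > 0" using k L by simp
  ultimately show ?thesis by blast
qed

section \<open>Metrics independent of the third variable\<close>

lemma Ck_on_subset: "Ck_on k U f \<Longrightarrow> S \<subseteq> U \<Longrightarrow> Ck_on k S f"
  by (induction k arbitrary: f) (auto intro: continuous_on_subset)

lemma smooth_on_subset: "smooth_on U f \<Longrightarrow> S \<subseteq> U \<Longrightarrow> smooth_on S f"
  unfolding smooth_on_def using Ck_on_subset by blast

lemma smooth_on_cong:
  assumes "open U" "smooth_on U f" "\<And>x. x \<in> U \<Longrightarrow> f x = g x"
  shows "smooth_on U g"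
  using assms Ck_on_cong[OF assms(1)] unfolding smooth_on_def by blast

lemma smooth_on_add: "open U \<Longrightarrow> smooth_on U f \<Longrightarrow> smooth_on U g \<Longrightarrow> smooth_on U (\<lambda>x. f x + g x)"
  unfolding smooth_on_def using Ck_on_add by blast

lemma smooth_on_bounded_linear: "open U \<Longrightarrow> bounded_linear L \<Longrightarrow> smooth_on U f \<Longrightarrow> smooth_on U (\<lambda>x. L (f x))"
  unfolding smooth_on_def using Ck_on_bounded_linear by blast

lemma smooth_on_uminus: "open U \<Longrightarrow> smooth_on U f \<Longrightarrow> smooth_on U (\<lambda>x. - f x)"
  by (rule smooth_on_bounded_linear[OF _ bounded_linear_minus[OF bounded_linear_ident]])

lemma smooth_on_diff: "open U \<Longrightarrow> smooth_on U f \<Longrightarrow> smooth_on U g \<Longrightarrow> smooth_on U (\<lambda>x. f x - g x)"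
  using smooth_on_add[OF _ _ smooth_on_uminus, of U f g] by simp

lemma smooth_on_sum:
  assumes "open U" "\<And>i. i \<in> I \<Longrightarrow> smooth_on U (f i)"
  shows "smooth_on U (\<lambda>x. \<Sum>i\<in>I. f i x)"
  using assms(2) by (induction I rule: infinite_finite_induct) (auto intro: smooth_on_const smooth_on_add[OF assms(1)])

lemma smooth_on_vec_nth: "open U \<Longrightarrow> smooth_on U F \<Longrightarrow> smooth_on U (\<lambda>x. F x $ i)"
  by (rule smooth_on_bounded_linear[OF _ bounded_linear_vec_nth])

text \<open>The exponent is general in the induction because differentiation lowers it by one. Real
  powers provide reciprocals and square roots alike.\<close>

lemma Ck_on_powr:
  fixes f :: "'a::euclidean_space \<Rightarrow> real"
  assumes "open U" "\<And>x. x \<in> U \<Longrightarrow> f x > 0" "Ck_on k U f"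
  shows "Ck_on k U (\<lambda>x. f x powr a)"
  using assms(3)
proof (induction k arbitrary: a)
  case 0
  then show ?case using assms(2) by (fastforce intro!: continuous_intros)
next
  case (Suc k)
  show ?case
  proof (rule Ck_on_SucI[OF assms(1)])
    fix x assume x: "x \<in> U"
    have "((\<lambda>t. t powr a) has_real_derivative a * f x powr (a - 1)) (at (f x))"
      using assms(2)[OF x] by (auto intro!: derivative_eq_intros simp: powr_diff)
    then show "((\<lambda>x. f x powr a) has_derivative (\<lambda>v. (a * f x powr (a - 1)) * frechet_derivative f (at x) v)) (at x)"
      using has_derivative_compose[OF Ck_on_has_derivative[OF Suc.prems x]] by (simp add: has_field_derivative_def)
  next
    fix v
    show "Ck_on k U (\<lambda>x. (a * f x powr (a - 1)) * frechet_derivative f (at x) v)"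
      by (rule Ck_on_mult[OF assms(1) Ck_on_mult[OF assms(1) Ck_on_const Suc.IH[OF Ck_on_SucD[OF Suc.prems]]]
            Ck_on_frechet_derivative[OF Suc.prems]])
  qed
qed

lemma smooth_on_powr:
  fixes f :: "'a::euclidean_space \<Rightarrow> real"
  shows "open U \<Longrightarrow> (\<And>x. x \<in> U \<Longrightarrow> f x > 0) \<Longrightarrow> smooth_on U f \<Longrightarrow> smooth_on U (\<lambda>x. f x powr a)"
  unfolding smooth_on_def using Ck_on_powr by blast

text \<open>Written as \<open>f\<close> times the power -1 of its square, since real powers want a
  positive base.\<close>

lemma smooth_on_inverse:
  fixes f :: "'a::euclidean_space \<Rightarrow> real"
  assumes "open U" "\<And>x. x \<in> U \<Longrightarrow> f x \<noteq> 0" "smooth_on U f"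
  shows "smooth_on U (\<lambda>x. inverse (f x))"
proof -
  have "0 < f x * f x" if "x \<in> U" for x
    using assms(2)[OF that] not_real_square_gt_zero[of "f x"] by blast
  then have "smooth_on U (\<lambda>x. f x * (f x * f x) powr (-1))"
    using assms by (intro smooth_on_mult smooth_on_powr)
  then show ?thesis
    by (rule smooth_on_cong[OF assms(1)]) (use assms(2) in \<open>auto simp: powr_minus field_simps\<close>)
qed

lemma has_weak_pd_smooth:
  fixes f :: "real^'n::finite \<Rightarrow> real"
  assumes "open U" "smooth_on U f"
  shows "has_weak_pd U i f (pd i f)"
  using has_weak_pd_classical[OF assms(1) smooth_on_has_derivative[OF assms(2)]
      smooth_on_continuous_on[OF smooth_on_frechet_derivative[OF assms(2)]]]
  by (simp add: pd_def[abs_def])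

text \<open>A partial derivative in space of a function on the plane: the third axis projects to the
  zero vector. The three-dimensional formulas can thus be evaluated on the plane with all three
  indices.\<close>

definition pderiv3 :: "3 \<Rightarrow> (real^2 \<Rightarrow> real) \<Rightarrow> real^2 \<Rightarrow> real" where
  "pderiv3 k f x = frechet_derivative f (at x) (planar (axis k 1))"

definition index3 :: "2 \<Rightarrow> 3" where
  "index3 j = (if j = 1 then 1 else 2)"

lemma index3_simps [simp]: "index3 1 = 1" "index3 2 = 2"
  by (auto simp: index3_def)

lemma planar_axis [simp]:
  "planar (axis 1 1) = axis 1 1" "planar (axis 2 1) = axis 2 1" "planar (axis 3 1) = 0"
  by (auto simp: planar_def vec_eq_iff forall_2 axis_def)

lemma planar_index3: "planar (axis (index3 j) 1) = axis j 1"
  using exhaust_2[of j] by auto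

lemma pderiv3_index3: "pderiv3 (index3 j) f = pd j f"
  by (simp add: pderiv3_def[abs_def] pd_def[abs_def] planar_index3)

lemma smooth_on_pderiv3: "smooth_on U f \<Longrightarrow> smooth_on U (pderiv3 k f)"
  unfolding pderiv3_def[abs_def] by (rule smooth_on_frechet_derivative)

lemma pderiv3_eqI: "(f has_derivative f') (at x) \<Longrightarrow> pderiv3 k f x = f' (planar (axis k 1))"
  unfolding pderiv3_def by (metis frechet_derivative_at)

lemma pderiv3_3: "smooth_on U f \<Longrightarrow> x \<in> U \<Longrightarrow> pderiv3 3 f x = 0"
  using linear_0[OF has_derivative_linear[OF smooth_on_has_derivative[of U f x]]] by (simp add: pderiv3_def)

lemma pderiv3_mult:
  assumes "smooth_on U f" "smooth_on U g" "x \<in> U"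
  shows "pderiv3 k (\<lambda>x. f x * g x) x = pderiv3 k f x * g x + f x * pderiv3 k g x"
  by (subst pderiv3_eqI[OF has_derivative_mult[OF smooth_on_has_derivative[OF assms(1,3)] smooth_on_has_derivative[OF assms(2,3)]]])
    (simp add: pderiv3_def)

lemma pderiv3_add:
  assumes "smooth_on U f" "smooth_on U g" "x \<in> U"
  shows "pderiv3 k (\<lambda>x. f x + g x) x = pderiv3 k f x + pderiv3 k g x"
  by (subst pderiv3_eqI[OF has_derivative_add[OF smooth_on_has_derivative[OF assms(1,3)] smooth_on_has_derivative[OF assms(2,3)]]])
    (simp add: pderiv3_def)

lemma pderiv3_sum:
  assumes "\<And>i. i \<in> I \<Longrightarrow> smooth_on U (f i)" "x \<in> U"
  shows "pderiv3 k (\<lambda>x. \<Sum>i\<in>I. f i x) x = (\<Sum>i\<in>I. pderiv3 k (f i) x)"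
  by (subst pderiv3_eqI[OF has_derivative_sum[OF smooth_on_has_derivative[OF assms(1) assms(2)]]])
    (simp_all add: pderiv3_def)

lemma pderiv3_cong:
  assumes "open U" "x \<in> U" "smooth_on U f" "\<And>x. x \<in> U \<Longrightarrow> f x = g x"
  shows "pderiv3 k f x = pderiv3 k g x"
proof -
  have "(g has_derivative frechet_derivative f (at x)) (at x)"
    by (rule has_derivative_transform_within_open[OF smooth_on_has_derivative[OF assms(3,2)] assms(1,2)]) (simp add: assms(4))
  then show ?thesis unfolding pderiv3_def by (metis frechet_derivative_at)
qed

lemma pderiv3_commute:
  assumes "open U" "smooth_on U f" "x \<in> U"
  shows "pderiv3 k (pderiv3 l f) x = pderiv3 l (pderiv3 k f) x"
proof -
  have d: "smooth_on U (\<lambda>x. frechet_derivative f (at x) v)" for v by (rule smooth_on_frechet_derivative[OF assms(2)])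
  show ?thesis
    unfolding pderiv3_def[abs_def]
    by (rule mixed_derivatives_commute[OF assms(1,3), where f = f and f' = "\<lambda>x. frechet_derivative f (at x)"])
      (auto intro: smooth_on_has_derivative[OF assms(2)] smooth_on_has_derivative[OF d]
        smooth_on_continuous_on[OF smooth_on_frechet_derivative[OF d]])
qed

lemma bounded_linear_planar: "bounded_linear planar"
  by (rule linear_conv_bounded_linear[THEN iffD1])
    (auto intro!: linearI simp: planar_def vec_eq_iff forall_2)

lemma pd_cylinder:
  assumes "open U" "smooth_on U f" "planar z \<in> U" "\<And>w. planar w \<in> U \<Longrightarrow> F w = f (planar w)"
  shows "pd k F z = pderiv3 k f (planar z)"
proof -
  have "open (planar -` U)"
    by (rule open_vimage[OF assms(1) linear_continuous_on[OF bounded_linear_planar]])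
  moreover have "((\<lambda>w. f (planar w)) has_derivative (\<lambda>h. frechet_derivative f (at (planar z)) (planar h))) (at z)"
    by (rule has_derivative_compose[OF bounded_linear_imp_has_derivative[OF bounded_linear_planar] smooth_on_has_derivative[OF assms(2,3)]])
  ultimately have "(F has_derivative (\<lambda>h. frechet_derivative f (at (planar z)) (planar h))) (at z)"
    using has_derivative_transform_within_open[of "\<lambda>w. f (planar w)" _ z UNIV "planar -` U" F] assms(3,4) by simp
  then show ?thesis unfolding pd_def pderiv3_def by (simp add: frechet_derivative_at[symmetric])
qed

definition chr :: "(real^2 \<Rightarrow> real^3^3) \<Rightarrow> 3 \<Rightarrow> 3 \<Rightarrow> 3 \<Rightarrow> real^2 \<Rightarrow> real" where
  "chr G i k l x = 1/2 * (\<Sum>m\<in>UNIV. matrix_inv (G x) $ i $ m *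
     (pderiv3 l (\<lambda>z. G z $ m $ k) x + pderiv3 k (\<lambda>z. G z $ m $ l) x - pderiv3 m (\<lambda>z. G z $ k $ l) x))"

text \<open>The Christoffel symbol of the first kind, with the lowered index \<open>a\<close> in
  front.\<close>

definition lowchr :: "(real^2 \<Rightarrow> real^3^3) \<Rightarrow> 3 \<Rightarrow> 3 \<Rightarrow> 3 \<Rightarrow> real^2 \<Rightarrow> real" where
  "lowchr G a i j x = (pderiv3 j (\<lambda>z. G z $ a $ i) x + pderiv3 i (\<lambda>z. G z $ a $ j) x - pderiv3 a (\<lambda>z. G z $ i $ j) x) / 2"

text \<open>The curvature components \<open>R\<^sup>s\<^sub>i\<^sub>1\<^sub>2\<close>; the metric being independent of \<open>x\<^sub>3\<close>, they are functions on the plane.\<close>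

definition curv :: "(real^2 \<Rightarrow> real^3^3) \<Rightarrow> 3 \<Rightarrow> 3 \<Rightarrow> real^2 \<Rightarrow> real" where
  "curv G s i x = pderiv3 1 (chr G s i 2) x - pderiv3 2 (chr G s i 1) x
     + (\<Sum>m\<in>UNIV. chr G s 1 m x * chr G m i 2 x) - (\<Sum>m\<in>UNIV. chr G s 2 m x * chr G m i 1 x)"

lemma smooth_on_det3:
  assumes "open U" "\<And>a b. smooth_on U (\<lambda>x. M x $ a $ b)"
  shows "smooth_on U (\<lambda>x. det (M x :: real^3^3))"
  unfolding det_3 by (intro smooth_on_add smooth_on_diff smooth_on_mult assms)

text \<open>Exhibits the entries of the inverse as quotients of polynomials in the entries of
  \<open>A\<close>, hence as smooth functions of them.\<close>

lemma matrix_inv_cramer: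
  fixes A :: "real^'n::finite^'n"
  assumes "det A \<noteq> 0"
  shows "matrix_inv A $ i $ j = det (\<chi> a b. if b = i then axis j 1 $ a else A $ a $ b) / det A"
proof -
  have "A *v (matrix_inv A *v axis j 1) = axis j 1"
    using matrix_inv_inverse(1)[of A] assms by (simp add: matrix_vector_mul_assoc invertible_det_nz)
  then have "matrix_inv A *v axis j 1 = (\<chi> k. det (\<chi> a b. if b = k then axis j 1 $ a else A $ a $ b) / det A)"
    using cramer[OF assms] by blast
  then have "(matrix_inv A *v axis j 1) $ i = det (\<chi> a b. if b = i then axis j 1 $ a else A $ a $ b) / det A"
    by simp
  moreover have "(matrix_inv A *v axis j 1) $ i = matrix_inv A $ i $ j"
    by (simp add: matrix_vector_mult_def axis_def if_distrib cong: if_cong)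
  ultimately show ?thesis by simp
qed

text \<open>Nondegeneracy takes the place of positivity, so that the results also apply to a
  symmetric extension of the metric beyond the closure of the domain.\<close>

locale metric_field =
  fixes \<Omega> :: "(real^2) set" and G :: "real^2 \<Rightarrow> real^3^3"
  assumes \<Omega>: "open \<Omega>" and smooth_G: "smooth_on \<Omega> G" and det_G: "\<And>x. x \<in> \<Omega> \<Longrightarrow> det (G x) \<noteq> 0"
    and sym_G: "\<And>x a b. x \<in> \<Omega> \<Longrightarrow> G x $ a $ b = G x $ b $ a"
begin

lemma smooth_entry: "smooth_on \<Omega> (\<lambda>x. G x $ a $ b)"
  by (intro smooth_on_vec_nth \<Omega> smooth_G)

lemma smooth_matrix_inv: "smooth_on \<Omega> (\<lambda>x. matrix_inv (G x) $ i $ j)"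
proof -
  have "smooth_on \<Omega> (\<lambda>x. (\<chi> a b. if b = i then axis j 1 $ a else G x $ a $ b) $ a $ b)" for a b
    using smooth_entry smooth_on_const by (cases "b = i") auto
  then have "smooth_on \<Omega> (\<lambda>x. det (\<chi> a b. if b = i then axis j 1 $ a else G x $ a $ b) * inverse (det (G x)))"
    by (intro smooth_on_mult smooth_on_inverse smooth_on_det3 \<Omega> det_G smooth_entry)
  then show ?thesis
    by (rule smooth_on_cong[OF \<Omega>]) (simp add: matrix_inv_cramer[OF det_G] divide_inverse)
qed

lemma smooth_chr: "smooth_on \<Omega> (chr G i k l)"
  unfolding chr_def[abs_def]
  by (intro smooth_on_mult smooth_on_const smooth_on_sum smooth_on_diff smooth_on_add smooth_on_pderiv3 smooth_matrix_inv smooth_entry \<Omega>)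

lemma smooth_lowchr: "smooth_on \<Omega> (lowchr G a i j)"
  unfolding lowchr_def[abs_def] divide_inverse
  by (intro smooth_on_mult smooth_on_const smooth_on_diff smooth_on_add smooth_on_pderiv3 smooth_entry \<Omega>)

lemma continuous_curv: "continuous_on \<Omega> (curv G s i)"
  unfolding curv_def[abs_def]
  by (intro smooth_on_continuous_on smooth_on_mult smooth_on_sum smooth_on_diff smooth_on_add smooth_on_pderiv3 smooth_chr \<Omega>)

lemma invertible_G: "x \<in> \<Omega> \<Longrightarrow> invertible (G x)"
  using det_G by (simp add: invertible_det_nz)

lemma pderiv3_G_sym: "x \<in> \<Omega> \<Longrightarrow> pderiv3 k (\<lambda>z. G z $ a $ b) x = pderiv3 k (\<lambda>z. G z $ b $ a) x"
  by (rule pderiv3_cong[OF \<Omega> _ smooth_entry]) (auto simp: sym_G)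

lemma chr_sym: "x \<in> \<Omega> \<Longrightarrow> chr G i k l x = chr G i l k x"
  using pderiv3_G_sym unfolding chr_def by (simp add: algebra_simps)

lemma lowchr_sym: "x \<in> \<Omega> \<Longrightarrow> lowchr G a i j x = lowchr G a j i x"
  using pderiv3_G_sym unfolding lowchr_def by (simp add: algebra_simps)

lemma chr_lowchr: "chr G i k l x = (\<Sum>m\<in>UNIV. matrix_inv (G x) $ i $ m * lowchr G m k l x)"
  unfolding chr_def lowchr_def by (simp add: sum_distrib_left)

lemma lower_chr:
  assumes "x \<in> \<Omega>"
  shows "(\<Sum>s\<in>UNIV. G x $ a $ s * chr G s i j x) = lowchr G a i j x"
proof -
  have "(\<Sum>s\<in>UNIV. G x $ a $ s * chr G s i j x) = (\<Sum>m\<in>UNIV. (\<Sum>s\<in>UNIV. G x $ a $ s * matrix_inv (G x) $ s $ m) * lowchr G m i j x)"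
    unfolding chr_lowchr sum_distrib_left sum_distrib_right by (subst sum.swap) (simp add: mult_ac)
  also have "\<dots> = (\<Sum>m\<in>UNIV. (G x ** matrix_inv (G x)) $ a $ m * lowchr G m i j x)"
    by (simp add: matrix_matrix_mult_def)
  also have "\<dots> = lowchr G a i j x"
    by (simp add: matrix_inv_inverse[OF invertible_G[OF assms]] mat_def if_distrib[of "\<lambda>c. c * _"] cong: if_cong)
  finally show ?thesis .
qed

lemma metric_derivative:
  assumes "x \<in> \<Omega>"
  shows "pderiv3 k (\<lambda>z. G z $ a $ b) x = lowchr G a b k x + lowchr G b a k x"
  using pderiv3_G_sym[OF assms] unfolding lowchr_def by (simp add: field_simps)

text \<open>The lowered curvature R_{ai12}; the last two indices are fixed because the plane has a
  single pair of directions.\<close>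

definition lowcurv :: "3 \<Rightarrow> 3 \<Rightarrow> real^2 \<Rightarrow> real" where
  "lowcurv a i x = (\<Sum>s\<in>UNIV. G x $ a $ s * curv G s i x)"

lemma lower_pderiv3_chr:
  assumes x: "x \<in> \<Omega>"
  shows "(\<Sum>s\<in>UNIV. G x $ a $ s * pderiv3 k (chr G s i j) x) =
    pderiv3 k (lowchr G a i j) x - (\<Sum>s\<in>UNIV. (lowchr G a s k x + lowchr G s a k x) * chr G s i j x)"
proof -
  have "pderiv3 k (lowchr G a i j) x = pderiv3 k (\<lambda>x. \<Sum>s\<in>UNIV. G x $ a $ s * chr G s i j x) x"
    by (rule pderiv3_cong[OF \<Omega> x smooth_lowchr]) (simp add: lower_chr)
  also have "\<dots> = (\<Sum>s\<in>UNIV. pderiv3 k (\<lambda>x. G x $ a $ s * chr G s i j x) x)"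
    by (rule pderiv3_sum[OF _ x]) (intro smooth_on_mult \<Omega> smooth_entry smooth_chr)
  also have "\<dots> = (\<Sum>s\<in>UNIV. (lowchr G a s k x + lowchr G s a k x) * chr G s i j x + G x $ a $ s * pderiv3 k (chr G s i j) x)"
    by (intro sum.cong refl) (simp add: pderiv3_mult[OF smooth_entry smooth_chr x] metric_derivative[OF x])
  finally show ?thesis by (simp add: sum.distrib)
qed

text \<open>Lowering the index of a differentiated symbol produces derivatives of the metric. By
  \<open>metric_derivative\<close> each is a sum of two symbols: one cancels the quadratic terms of
  the curvature, the other leaves quadratic terms with the free index in second place.\<close>

lemma lowcurv_eq:
  assumes x: "x \<in> \<Omega>"
  shows "lowcurv a i x = pderiv3 1 (lowchr G a i 2) x - pderiv3 2 (lowchr G a i 1) x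
    - (\<Sum>s\<in>UNIV. lowchr G s a 1 x * chr G s i 2 x) + (\<Sum>s\<in>UNIV. lowchr G s a 2 x * chr G s i 1 x)"
proof -
  have q: "(\<Sum>s\<in>UNIV. G x $ a $ s * (\<Sum>m\<in>UNIV. chr G s k m x * chr G m i l x)) = (\<Sum>m\<in>UNIV. lowchr G a m k x * chr G m i l x)" for k l
  proof -
    have "(\<Sum>s\<in>UNIV. G x $ a $ s * (\<Sum>m\<in>UNIV. chr G s k m x * chr G m i l x))
      = (\<Sum>m\<in>UNIV. (\<Sum>s\<in>UNIV. G x $ a $ s * chr G s m k x) * chr G m i l x)"
      unfolding sum_distrib_left sum_distrib_right by (subst sum.swap) (simp add: mult_ac chr_sym[OF x, of _ k])
    then show ?thesis by (simp add: lower_chr[OF x])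
  qed
  have "lowcurv a i x = (\<Sum>s\<in>UNIV. G x $ a $ s * pderiv3 1 (chr G s i 2) x) - (\<Sum>s\<in>UNIV. G x $ a $ s * pderiv3 2 (chr G s i 1) x)
     + (\<Sum>s\<in>UNIV. G x $ a $ s * (\<Sum>m\<in>UNIV. chr G s 1 m x * chr G m i 2 x)) - (\<Sum>s\<in>UNIV. G x $ a $ s * (\<Sum>m\<in>UNIV. chr G s 2 m x * chr G m i 1 x))"
    unfolding lowcurv_def curv_def by (simp add: right_diff_distrib distrib_left sum.distrib sum_subtractf)
  then show ?thesis
    unfolding q lower_pderiv3_chr[OF x] by (simp add: distrib_right sum.distrib)
qed

text \<open>The derivative terms add up to a commutator of second derivatives of one entry of the
  metric, which vanishes. The quadratic terms are exchanged by the symmetry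
  \<open>sw\<close>.\<close>

lemma lowcurv_antisym:
  assumes x: "x \<in> \<Omega>"
  shows "lowcurv a i x = - lowcurv i a x"
proof -
  have sw: "(\<Sum>s\<in>UNIV. lowchr G s a k x * chr G s i l x) = (\<Sum>s\<in>UNIV. lowchr G s i l x * chr G s a k x)" for k l a i
  proof -
    have "(\<Sum>s\<in>UNIV. lowchr G s a k x * chr G s i l x) = (\<Sum>s\<in>UNIV. \<Sum>t\<in>UNIV. G x $ s $ t * chr G t a k x * chr G s i l x)"
      by (simp add: lower_chr[OF x, symmetric] sum_distrib_right)
    also have "\<dots> = (\<Sum>t\<in>UNIV. \<Sum>s\<in>UNIV. G x $ t $ s * chr G s i l x * chr G t a k x)"
      by (subst sum.swap) (simp add: mult_ac sym_G[OF x])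
    also have "\<dots> = (\<Sum>s\<in>UNIV. lowchr G s i l x * chr G s a k x)"
      by (simp add: lower_chr[OF x, symmetric] sum_distrib_right)
    finally show ?thesis .
  qed
  have d: "pderiv3 k (lowchr G a i l) x + pderiv3 k (lowchr G i a l) x = pderiv3 k (pderiv3 l (\<lambda>z. G z $ a $ i)) x" for k l
  proof -
    have "pderiv3 k (pderiv3 l (\<lambda>z. G z $ a $ i)) x = pderiv3 k (\<lambda>x. lowchr G a i l x + lowchr G i a l x) x"
      by (rule pderiv3_cong[OF \<Omega> x smooth_on_pderiv3[OF smooth_entry]]) (rule metric_derivative)
    then show ?thesis by (simp add: pderiv3_add[OF smooth_lowchr smooth_lowchr x])
  qed
  show ?thesis
    unfolding lowcurv_eq[OF x]
    using d[of 1 2] d[of 2 1] pderiv3_commute[OF \<Omega> smooth_entry[of a i] x, of 1 2] sw[of a 1 i 2] sw[of a 2 i 1] by linarith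
qed

lemma curv_eq_0_iff:
  assumes x: "x \<in> \<Omega>" and 33: "matrix_inv (G x) $ 3 $ 3 \<noteq> 0"
  shows "(\<forall>s i. curv G s i x = 0) \<longleftrightarrow> curv G 3 1 x = 0 \<and> curv G 3 2 x = 0 \<and> lowcurv 1 2 x = 0"
proof
  assume *: "curv G 3 1 x = 0 \<and> curv G 3 2 x = 0 \<and> lowcurv 1 2 x = 0"
  have raise: "curv G s i x = (\<Sum>a\<in>UNIV. matrix_inv (G x) $ s $ a * lowcurv a i x)" for s i
  proof -
    have "(\<Sum>a\<in>UNIV. matrix_inv (G x) $ s $ a * lowcurv a i x) = (\<Sum>t\<in>UNIV. (matrix_inv (G x) ** G x) $ s $ t * curv G t i x)"
      unfolding lowcurv_def matrix_matrix_mult_def sum_distrib_left by (subst sum.swap) (simp add: sum_distrib_left sum_distrib_right mult_ac)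
    then show ?thesis
      by (simp add: matrix_inv_inverse[OF invertible_G[OF x]] mat_def if_distrib[of "\<lambda>c. c * _"] cong: if_cong)
  qed
  have z: "lowcurv a a x = 0" for a using lowcurv_antisym[OF x, of a a] by simp
  have z12: "lowcurv 1 2 x = 0" "lowcurv 2 1 x = 0" using * lowcurv_antisym[OF x, of 1 2] by auto
  show "\<forall>s i. curv G s i x = 0"
  proof -
    have "lowcurv 3 1 x = 0" "lowcurv 3 2 x = 0"
      using * raise[of 3 1] raise[of 3 2] z z12 33 by (simp_all add: sum_3)
    then have "lowcurv a i x = 0" for a i
      using z z12 lowcurv_antisym[OF x, of 3 1] lowcurv_antisym[OF x, of 3 2] exhaust_3[of a] exhaust_3[of i] by auto
    then show ?thesis by (simp add: raise)
  qed
qed (simp add: lowcurv_def)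

end

section \<open>Weak calculus of frames\<close>

definition locally_bounded_vec :: "(real^'n::finite) set \<Rightarrow> (real^'n \<Rightarrow> real^'m::finite) \<Rightarrow> bool" where
  "locally_bounded_vec \<Omega> F \<longleftrightarrow> (\<forall>k. locally_bounded \<Omega> (\<lambda>x. F x $ k))"

lemma locally_bounded_smooth: "smooth_on \<Omega> f \<Longrightarrow> locally_bounded \<Omega> f"
  by (rule locally_bounded_continuous[OF smooth_on_continuous_on])

lemma locally_bounded_cong_AE:
  assumes "locally_bounded \<Omega> f" "AE x in lborel. x \<in> \<Omega> \<longrightarrow> f x = g x"
  shows "locally_bounded \<Omega> g"
  by (rule locally_bounded_mono[OF assms(1)]) (use assms(2) in \<open>eventually_elim; simp\<close>)

lemma locally_bounded_vec_cong_AE: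
  assumes "locally_bounded_vec \<Omega> f" "AE x in lborel. x \<in> \<Omega> \<longrightarrow> f x = g x"
  shows "locally_bounded_vec \<Omega> g"
  unfolding locally_bounded_vec_def
proof
  fix k
  show "locally_bounded \<Omega> (\<lambda>x. g x $ k)"
    by (rule locally_bounded_cong_AE[of _ "\<lambda>x. f x $ k"])
      (use assms in \<open>auto simp: locally_bounded_vec_def elim!: eventually_mono\<close>)
qed

lemma has_weak_pd_vec_add:
  fixes F H :: "real^'n::finite \<Rightarrow> real^'m::finite"
  assumes "open \<Omega>" "has_weak_pd \<Omega> i F F'" "has_weak_pd \<Omega> i H H'"
  shows "has_weak_pd \<Omega> i (\<lambda>x. F x + H x) (\<lambda>x. F' x + H' x)"
  using assms(2,3) has_weak_pd_add[OF assms(1)] unfolding has_weak_pd_vec_iff[OF assms(1)] by simp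

lemma has_weak_pd_scaleR:
  fixes F :: "real^'n::finite \<Rightarrow> real^'m::finite"
  assumes "open \<Omega>" "has_weak_pd \<Omega> i f f'" "locally_bounded \<Omega> f" "has_weak_pd \<Omega> i F F'" "locally_bounded_vec \<Omega> F"
  shows "has_weak_pd \<Omega> i (\<lambda>x. f x *\<^sub>R F x) (\<lambda>x. f' x *\<^sub>R F x + f x *\<^sub>R F' x)"
  using assms(4,5) has_weak_pd_mult[OF assms(1-3)]
  unfolding has_weak_pd_vec_iff[OF assms(1)] locally_bounded_vec_def by simp

lemma locally_bounded_vec_scaleR:
  "locally_bounded \<Omega> f \<Longrightarrow> locally_bounded_vec \<Omega> F \<Longrightarrow> locally_bounded_vec \<Omega> (\<lambda>x. f x *\<^sub>R F x)"
  unfolding locally_bounded_vec_def by (simp add: locally_bounded_mult)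

lemma locally_bounded_vec_add:
  "locally_bounded_vec \<Omega> F \<Longrightarrow> locally_bounded_vec \<Omega> H \<Longrightarrow> locally_bounded_vec \<Omega> (\<lambda>x. F x + H x)"
  unfolding locally_bounded_vec_def by (simp add: locally_bounded_add)

lemma inner_3: "(x :: real^3) \<bullet> y = x $ 1 * y $ 1 + x $ 2 * y $ 2 + x $ 3 * y $ 3"
  by (simp add: inner_vec_def sum_3)

lemma has_weak_pd_inner:
  fixes F H :: "real^'n::finite \<Rightarrow> real^3"
  assumes \<Omega>: "open \<Omega>" and F: "has_weak_pd \<Omega> i F F'" "locally_bounded_vec \<Omega> F" and H: "has_weak_pd \<Omega> i H H'" "locally_bounded_vec \<Omega> H"
  shows "has_weak_pd \<Omega> i (\<lambda>x. F x \<bullet> H x) (\<lambda>x. F' x \<bullet> H x + F x \<bullet> H' x)"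
proof -
  have m: "has_weak_pd \<Omega> i (\<lambda>x. F x $ k * H x $ k) (\<lambda>x. F' x $ k * H x $ k + F x $ k * H' x $ k)" for k
    using F H unfolding has_weak_pd_vec_iff[OF \<Omega>] locally_bounded_vec_def by (intro has_weak_pd_mult[OF \<Omega>]) auto
  show ?thesis
    using has_weak_pd_add[OF \<Omega> has_weak_pd_add[OF \<Omega> m[of 1] m[of 2]] m[of 3]]
    by (simp add: inner_3 algebra_simps)
qed

lemma has_weak_pd_cross3:
  fixes F H :: "real^'n::finite \<Rightarrow> real^3"
  assumes \<Omega>: "open \<Omega>" and F: "has_weak_pd \<Omega> i F F'" "locally_bounded_vec \<Omega> F" and H: "has_weak_pd \<Omega> i H H'" "locally_bounded_vec \<Omega> H"
  shows "has_weak_pd \<Omega> i (\<lambda>x. cross3 (F x) (H x)) (\<lambda>x. cross3 (F' x) (H x) + cross3 (F x) (H' x))"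
    and "locally_bounded_vec \<Omega> (\<lambda>x. cross3 (F x) (H x))"
proof -
  have m: "has_weak_pd \<Omega> i (\<lambda>x. F x $ k * H x $ l) (\<lambda>x. F' x $ k * H x $ l + F x $ k * H' x $ l)" for k l
    using F H unfolding has_weak_pd_vec_iff[OF \<Omega>] locally_bounded_vec_def by (intro has_weak_pd_mult[OF \<Omega>]) auto
  have c: "has_weak_pd \<Omega> i (\<lambda>x::real^'n. -1 :: real) (\<lambda>x. 0)"
    using has_weak_pd_smooth[OF \<Omega> smooth_on_const, of i "-1 :: real"] by (simp add: pd_def[abs_def])
  have lb: "locally_bounded \<Omega> (\<lambda>x. F x $ k * H x $ l)" for k l
    using F H by (simp add: locally_bounded_vec_def locally_bounded_mult)
  have n: "has_weak_pd \<Omega> i (\<lambda>x. - (F x $ k * H x $ l)) (\<lambda>x. - (F' x $ k * H x $ l + F x $ k * H' x $ l))" for k l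
    using has_weak_pd_mult[OF \<Omega> c locally_bounded_smooth[OF smooth_on_const] m lb] by simp
  have d: "has_weak_pd \<Omega> i (\<lambda>x. F x $ k * H x $ l - F x $ l * H x $ k)
     (\<lambda>x. (F' x $ k * H x $ l - F' x $ l * H x $ k) + (F x $ k * H' x $ l - F x $ l * H' x $ k))" for k l
    using has_weak_pd_add[OF \<Omega> m[of k l] n[of l k]] by (simp add: algebra_simps)
  show "has_weak_pd \<Omega> i (\<lambda>x. cross3 (F x) (H x)) (\<lambda>x. cross3 (F' x) (H x) + cross3 (F x) (H' x))"
    unfolding has_weak_pd_vec_iff[OF \<Omega>] forall_3 using d[of 2 3] d[of 3 1] d[of 1 2] by (simp add: cross3_def)
  have "locally_bounded \<Omega> (\<lambda>x. F x $ k * H x $ l + (-1) * (F x $ l * H x $ k))" for k l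
    by (intro locally_bounded_add lb locally_bounded_mult[OF locally_bounded_smooth[OF smooth_on_const]])
  then show "locally_bounded_vec \<Omega> (\<lambda>x. cross3 (F x) (H x))"
    unfolding locally_bounded_vec_def forall_3 by (simp add: cross3_def)
qed

lemma weak_pd_commute_vec:
  fixes f :: "real^'n::finite \<Rightarrow> real^'m::finite"
  assumes \<Omega>: "open \<Omega>" and "has_weak_pd \<Omega> i f fi" "has_weak_pd \<Omega> j f fj" "has_weak_pd \<Omega> j fi fij" "has_weak_pd \<Omega> i fj fji"
  shows "AE x in lborel. x \<in> \<Omega> \<longrightarrow> fij x = fji x"
proof -
  have "AE x in lborel. x \<in> \<Omega> \<longrightarrow> fij x $ k = fji x $ k" for k
    using assms(2-) weak_pd_commute[OF \<Omega>] unfolding has_weak_pd_vec_iff[OF \<Omega>] by blast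
  then have "AE x in lborel. \<forall>k\<in>UNIV. x \<in> \<Omega> \<longrightarrow> fij x $ k = fji x $ k"
    by (intro AE_finite_allI) auto
  then show ?thesis by eventually_elim (auto simp: vec_eq_iff)
qed

text \<open>The product rule on the left, the classical derivative on the right, and uniqueness of
  the weak derivative.\<close>

lemma weak_inner_relation:
  fixes F H :: "real^'n::finite \<Rightarrow> real^3"
  assumes \<Omega>: "open \<Omega>" and F: "has_weak_pd \<Omega> i F F'" "locally_bounded_vec \<Omega> F" and H: "has_weak_pd \<Omega> i H H'" "locally_bounded_vec \<Omega> H"
    and g: "smooth_on \<Omega> g" "AE x in lborel. x \<in> \<Omega> \<longrightarrow> F x \<bullet> H x = g x"
  shows "AE x in lborel. x \<in> \<Omega> \<longrightarrow> F' x \<bullet> H x + F x \<bullet> H' x = pd i g x"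
  by (rule weak_pd_zero_unique[OF \<Omega> has_weak_pd_cong_AE[OF \<Omega> has_weak_pd_inner[OF \<Omega> F H] g(2)] has_weak_pd_smooth[OF \<Omega> g(1)]]) simp

text \<open>The set where \<open>f\<close> is nonzero is open, and a nonempty open set is not
  null.\<close>

lemma AE_zero_imp_zero:
  fixes f :: "'a::euclidean_space \<Rightarrow> real"
  assumes "open \<Omega>" "continuous_on \<Omega> f" "AE x in lborel. x \<in> \<Omega> \<longrightarrow> f x = 0" "x \<in> \<Omega>"
  shows "f x = 0"
proof (rule ccontr)
  assume "f x \<noteq> 0"
  let ?S = "\<Omega> \<inter> f -` (- {0})"
  have o: "open ?S" using continuous_on_open_vimage[OF assms(1)] assms(2) by (metis open_Compl closed_singleton inf_commute)
  have "AE x in lborel. x \<notin> ?S" using assms(3) by eventually_elim auto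
  then have "emeasure lborel ?S = 0"
    using o by (subst AE_iff_measurable[symmetric, where P = "\<lambda>x. x \<notin> ?S"]) auto
  then have "?S \<in> null_sets lebesgue" using o by (auto simp: null_sets_def)
  then have "negligible ?S" by (simp add: negligible_iff_null_sets)
  then show False using open_not_negligible[OF o] assms(4) \<open>f x \<noteq> 0\<close> by auto
qed

text \<open>The Gram matrix is \<open>Q\<close> times its transpose, so its nondegeneracy makes the
  three vectors a basis.\<close>

lemma gram_orthogonal_zero:
  fixes q :: "3 \<Rightarrow> real^3" and M :: "real^3^3"
  assumes q: "\<And>a b. q a \<bullet> q b = M $ a $ b" and M: "det M \<noteq> 0" and w: "\<And>k. q k \<bullet> w = 0"
  shows "w = 0"
proof -
  define Q :: "real^3^3" where "Q = (\<chi> i j. q i $ j)"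
  have "Q ** transpose Q = M"
    by (simp add: vec_eq_iff matrix_matrix_mult_def transpose_def Q_def q[symmetric] inner_vec_def)
  then have "det Q \<noteq> 0" using M by (metis det_mul mult_zero_left)
  then have inv: "invertible Q" by (simp add: invertible_det_nz)
  have "Q *v w = 0"
    using w by (simp add: vec_eq_iff matrix_vector_mult_def Q_def inner_vec_def)
  then have "matrix_inv Q *v (Q *v w) = 0" by simp
  then show ?thesis by (simp add: matrix_vector_mul_assoc matrix_inv_inverse[OF inv])
qed

text \<open>A vector is recovered from its products with the frame. This is what converts symbols of
  the first kind into those of the second.\<close>

lemma gram_combination:
  fixes q :: "3 \<Rightarrow> real^3" and M :: "real^3^3"
  assumes q: "\<And>a b. q a \<bullet> q b = M $ a $ b" and M: "det M \<noteq> 0"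
    and v: "\<And>k. q k \<bullet> v = (\<Sum>m\<in>UNIV. M $ k $ m * c m)"
  shows "v = (\<Sum>m\<in>UNIV. c m *\<^sub>R q m)"
proof -
  have "q k \<bullet> (v - (\<Sum>m\<in>UNIV. c m *\<^sub>R q m)) = 0" for k
    by (simp add: inner_diff_right v inner_sum_right q mult.commute)
  from gram_orthogonal_zero[OF q M this] show ?thesis by simp
qed

lemma gram_independent:
  fixes q :: "3 \<Rightarrow> real^3" and M :: "real^3^3"
  assumes q: "\<And>a b. q a \<bullet> q b = M $ a $ b" and M: "det M \<noteq> 0" and z: "(\<Sum>m\<in>UNIV. c m *\<^sub>R q m) = 0"
  shows "c k = 0"
proof -
  have "(M *v (\<chi> m. c m)) $ a = 0" for a
  proof -
    have "(M *v (\<chi> m. c m)) $ a = q a \<bullet> (\<Sum>m\<in>UNIV. c m *\<^sub>R q m)"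
      by (simp add: matrix_vector_mult_def inner_sum_right q mult.commute)
    then show ?thesis using z by simp
  qed
  then have "M *v (\<chi> m. c m) = 0" by (simp add: vec_eq_iff)
  then have "matrix_inv M *v (M *v (\<chi> m. c m)) = 0" by simp
  then have "(\<chi> m. c m) = 0" using M by (simp add: matrix_vector_mul_assoc matrix_inv_inverse invertible_det_nz)
  then show ?thesis by (simp add: vec_eq_iff)
qed

text \<open>The determinant is the square of that of the square root.\<close>

lemma spd_det_pos:
  fixes M :: "real^'n::finite^'n"
  assumes "spd M"
  shows "det M > 0"
proof -
  have "det M = det (spd_sqrt M) * det (spd_sqrt M)"
    using spd_sqrt_works(2)[OF assms] by (metis det_mul)
  moreover have "det (spd_sqrt M) \<noteq> 0"
    using spd_invertible[OF spd_sqrt_works(1)[OF assms]] by (simp add: invertible_det_nz)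
  ultimately show ?thesis by (metis not_real_square_gt_zero)
qed

lemma spd_sym: "spd M \<Longrightarrow> M $ a $ b = M $ b $ a"
  unfolding spd_def transpose_def by (metis vec_lambda_beta)

lemma spd_block22:
  assumes "spd M"
  shows "spd (block22 M)"
  unfolding spd_def
proof (intro conjI allI impI)
  show "transpose (block22 M) = block22 M"
    using spd_sym[OF assms, of 1 2] by (simp add: vec_eq_iff forall_2 transpose_def)
  fix v :: "real^2" assume v: "v \<noteq> 0"
  define w :: "real^3" where "w = vector [v $ 1, v $ 2, 0]"
  have "w \<noteq> 0" using v by (auto simp: w_def vec_eq_iff forall_2 forall_3)
  then have "w \<bullet> (M *v w) > 0" using assms by (simp add: spd_def)
  also have "w \<bullet> (M *v w) = v \<bullet> (block22 M *v v)"
    by (simp add: w_def inner_vec_def sum_2 sum_3 matrix_vector_mult_def)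
  finally show "v \<bullet> (block22 M *v v) > 0" .
qed

lemma spd_matrix_inv_33_pos:
  fixes M :: "real^3^3"
  assumes "spd M"
  shows "matrix_inv M $ 3 $ 3 > 0"
proof -
  define u where "u = matrix_inv M *v axis 3 1"
  have Mu: "M *v u = axis 3 1"
    by (simp add: u_def matrix_vector_mul_assoc matrix_inv_inverse[OF spd_invertible[OF assms]])
  have "u \<noteq> 0"
  proof
    assume "u = 0"
    then have "axis 3 1 = (0 :: real^3)" using Mu by simp
    then show False by (simp add: axis_eq_0_iff)
  qed
  then have "u \<bullet> (M *v u) > 0" using assms by (simp add: spd_def)
  then have "u $ 3 > 0" by (simp add: Mu inner_axis)
  then show ?thesis
    by (simp add: u_def matrix_vector_mult_def axis_def if_distrib cong: if_cong)
qed

text \<open>Cramer's rule for the entry 3, 3 of the inverse.\<close>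

lemma det_block22: 
  assumes "spd M"
  shows "det (block22 M) = det M * matrix_inv M $ 3 $ 3"
proof -
  have "det M \<noteq> 0" using spd_det_pos[OF assms] by simp
  then have "det M * matrix_inv M $ 3 $ 3 = det (\<chi> a b. if b = 3 then axis 3 1 $ a else M $ a $ b)"
    by (simp add: matrix_inv_cramer)
  also have "\<dots> = det (block22 M)" by (simp add: det_3 det_2 axis_def)
  finally show ?thesis by simp
qed

text \<open>The coefficients of the shear vector, in a form that is visibly smooth in \<open>M\<close>.\<close>

definition shear_coeff :: "real^3^3 \<Rightarrow> 3 \<Rightarrow> real" where
  "shear_coeff M k = - matrix_inv M $ k $ 3 * inverse (matrix_inv M $ 3 $ 3)"

text \<open>The two equations are the first two rows in the third column of
  \<open>M ** matrix_inv M = mat 1\<close>, divided by the entry 3, 3 of the inverse.\<close>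

lemma shear_coeff:
  assumes "spd M"
  shows "matrix_inv (block22 M) *v vector [M $ 1 $ 3, M $ 2 $ 3] = vector [shear_coeff M 1, shear_coeff M 2]" (is ?A)
    and "M $ 1 $ 1 * shear_coeff M 1 + M $ 1 $ 2 * shear_coeff M 2 = M $ 1 $ 3" (is ?B)
    and "M $ 2 $ 1 * shear_coeff M 1 + M $ 2 $ 2 * shear_coeff M 2 = M $ 2 $ 3" (is ?C)
proof -
  have p: "matrix_inv M $ 3 $ 3 > 0" by (rule spd_matrix_inv_33_pos[OF assms])
  have e: "(M ** matrix_inv M) $ i $ 3 = mat 1 $ i $ 3" for i
    using matrix_inv_inverse(1)[OF spd_invertible[OF assms]] by simp
  show B: ?B and C: ?C
    using e[of 1] e[of 2] p by (simp_all add: shear_coeff_def matrix_matrix_mult_def sum_3 mat_def divide_simps)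
  have "block22 M *v vector [shear_coeff M 1, shear_coeff M 2] = vector [M $ 1 $ 3, M $ 2 $ 3]"
    using B C by (simp add: vec_eq_iff forall_2 matrix_vector_mult_def sum_2)
  then have "matrix_inv (block22 M) *v (block22 M *v vector [shear_coeff M 1, shear_coeff M 2]) = matrix_inv (block22 M) *v vector [M $ 1 $ 3, M $ 2 $ 3]"
    by simp
  then show ?A by (simp add: matrix_vector_mul_assoc matrix_inv_inverse[OF spd_invertible[OF spd_block22[OF assms]]])
qed

text \<open>Linear algebra at one point. The products of \<open>b\<close> with \<open>p1\<close>,
  \<open>p2\<close> and itself, together with positive orientation, determine \<open>b\<close>; this
  last claim will identify the third vector of a solution of the linear system with the field
  defined from the immersion.\<close>

lemma normal_frame:
  fixes p1 p2 :: "real^3" and M :: "real^3^3"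
  assumes M: "spd M" and p: "p1 \<bullet> p1 = M $ 1 $ 1" "p1 \<bullet> p2 = M $ 1 $ 2" "p2 \<bullet> p2 = M $ 2 $ 2"
  defines "n \<equiv> cross3 p1 p2"
  defines "N \<equiv> n /\<^sub>R norm n"
  defines "s \<equiv> sqrt (det M) / sqrt (det (block22 M))"
  defines "b \<equiv> shear_coeff M 1 *\<^sub>R p1 + shear_coeff M 2 *\<^sub>R p2 + s *\<^sub>R N"
  defines "q \<equiv> (\<lambda>k::3. if k = 1 then p1 else if k = 2 then p2 else b)"
  shows "(norm n)\<^sup>2 = det (block22 M)" "norm n > 0" "N \<bullet> N = 1" "N \<bullet> p1 = 0" "N \<bullet> p2 = 0"
    and "s = 1 / sqrt (matrix_inv M $ 3 $ 3)" "s > 0"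
    and "q a \<bullet> q c = M $ a $ c"
    and "N = (\<Sum>m\<in>UNIV. (s * matrix_inv M $ m $ 3) *\<^sub>R q m)"
    and "\<And>r. r \<bullet> p1 = M $ 1 $ 3 \<Longrightarrow> r \<bullet> p2 = M $ 2 $ 3 \<Longrightarrow> r \<bullet> r = M $ 3 $ 3 \<Longrightarrow> n \<bullet> r > 0 \<Longrightarrow> r = b"
proof -
  have sym: "M $ a $ b = M $ b $ a" for a b by (rule spd_sym[OF M])
  have dB: "det (block22 M) > 0" by (rule spd_det_pos[OF spd_block22[OF M]])
  have dM: "det M > 0" by (rule spd_det_pos[OF M])
  have p33: "matrix_inv M $ 3 $ 3 > 0" by (rule spd_matrix_inv_33_pos[OF M])
  \<comment> \<open>Lagrange's identity for the cross product.\<close>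
  have "(norm n)\<^sup>2 = (p1 \<bullet> p1) * (p2 \<bullet> p2) - (p1 \<bullet> p2)\<^sup>2"
    unfolding n_def power2_norm_eq_inner by (simp add: inner_3 cross3_def power2_eq_square algebra_simps)
  then show nn: "(norm n)\<^sup>2 = det (block22 M)" by (simp add: p det_2 sym[of 2 1] power2_eq_square)
  then show n0: "norm n > 0" using dB by (metis norm_ge_zero less_eq_real_def power2_eq_iff_nonneg zero_power2 less_irrefl)
  show NN: "N \<bullet> N = 1" using n0 by (simp add: N_def power2_norm_eq_inner[symmetric] power2_eq_square)
  show Np: "N \<bullet> p1 = 0" "N \<bullet> p2 = 0" by (simp_all add: N_def n_def dot_cross_self)
  show s_eq: "s = 1 / sqrt (matrix_inv M $ 3 $ 3)"
    unfolding s_def det_block22[OF M] using dM p33 by (simp add: real_sqrt_mult)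
  show s0: "s > 0" unfolding s_def using dM dB by simp
  let ?c1 = "shear_coeff M 1" and ?c2 = "shear_coeff M 2"
  have c: "M $ 1 $ 1 * ?c1 + M $ 1 $ 2 * ?c2 = M $ 1 $ 3" "M $ 1 $ 2 * ?c1 + M $ 2 $ 2 * ?c2 = M $ 2 $ 3"
    using shear_coeff(2,3)[OF M] by (simp_all add: sym[of 2 1])
  have bp: "b \<bullet> p1 = M $ 1 $ 3" "b \<bullet> p2 = M $ 2 $ 3"
    using c Np p by (simp_all add: b_def inner_add_left inner_commute[of p2 p1] mult.commute add.commute)
  have bN: "b \<bullet> N = s" using Np NN by (simp add: b_def inner_add_left inner_commute[of p1] inner_commute[of p2])
  have bb: "b \<bullet> b = M $ 3 $ 3"
  proof -
    have "b \<bullet> b = ?c1 * (b \<bullet> p1) + ?c2 * (b \<bullet> p2) + s * (b \<bullet> N)"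
      by (subst (2) b_def) (simp add: inner_add_right)
    also have "s * (b \<bullet> N) = det M / det (block22 M)"
      using dM dB by (simp add: bN s_def power2_eq_square[symmetric] power_divide)
    finally have "b \<bullet> b = ?c1 * M $ 1 $ 3 + ?c2 * M $ 2 $ 3 + det M / det (block22 M)" by (simp add: bp)
    \<comment> \<open>Subtracting the combination of the first two columns from the third leaves the
      Schur complement.\<close>
    moreover have "det M = det (block22 M) * (M $ 3 $ 3 - ?c1 * M $ 1 $ 3 - ?c2 * M $ 2 $ 3)"
      unfolding det_3 det_2 block22_nth sym[of 3 1] sym[of 3 2] sym[of 2 1] c[symmetric] by (simp add: algebra_simps)
    ultimately show ?thesis using dB by simp
  qed
  have gram: "q a \<bullet> q c = M $ a $ c" for a c
    using exhaust_3[of a] exhaust_3[of c] p bp bb sym[of 2 1] sym[of 3 1] sym[of 3 2]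
    by (auto simp: q_def inner_commute)
  then show "q a \<bullet> q c = M $ a $ c" .
  show "N = (\<Sum>m\<in>UNIV. (s * matrix_inv M $ m $ 3) *\<^sub>R q m)"
  \<comment> \<open>\<open>N\<close> is orthogonal to \<open>p1\<close> and \<open>p2\<close> and
    has product \<open>s\<close> with \<open>b\<close>, so its coefficients are \<open>s\<close>
    times the third column of the inverse metric.\<close>
  proof (rule gram_combination[OF gram])
    show "det M \<noteq> 0" using dM by simp
    fix k
    have "(\<Sum>m\<in>UNIV. M $ k $ m * (s * matrix_inv M $ m $ 3)) = s * (M ** matrix_inv M) $ k $ 3"
      by (simp add: matrix_matrix_mult_def sum_distrib_left mult_ac)
    also have "\<dots> = (if k = 3 then s else 0)"
      by (simp add: matrix_inv_inverse[OF spd_invertible[OF M]] mat_def)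
    also have "\<dots> = q k \<bullet> N"
      using exhaust_3[of k] Np bN by (auto simp: q_def inner_commute)
    finally show "q k \<bullet> N = (\<Sum>m\<in>UNIV. M $ k $ m * (s * matrix_inv M $ m $ 3))" by simp
  qed
  show "r = b" if r: "r \<bullet> p1 = M $ 1 $ 3" "r \<bullet> p2 = M $ 2 $ 3" "r \<bullet> r = M $ 3 $ 3" "n \<bullet> r > 0" for r
  proof -
    \<comment> \<open>\<open>r\<close> and \<open>b\<close> have the same products with
      \<open>p1\<close> and \<open>p2\<close>, and therefore differ by a multiple \<open>l\<close>
      of the normal. Equal length leaves \<open>l = 0\<close> or \<open>l = - 2 * s\<close>, and the
      orientation excludes the latter.\<close>
    define l where "l = (r - b) \<bullet> N"
    have "r - b - l *\<^sub>R N = 0"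
    proof (rule gram_orthogonal_zero[OF gram])
      show "det M \<noteq> 0" using dM by simp
      have a: "p1 \<bullet> (r - b - l *\<^sub>R N) = 0" "p2 \<bullet> (r - b - l *\<^sub>R N) = 0" "N \<bullet> (r - b - l *\<^sub>R N) = 0"
        using r bp Np NN by (simp_all add: inner_diff_right inner_commute l_def inner_diff_left)
      then have "b \<bullet> (r - b - l *\<^sub>R N) = 0" unfolding b_def by (simp add: inner_add_left)
      with a show "q k \<bullet> (r - b - l *\<^sub>R N) = 0" for k using exhaust_3[of k] by (auto simp: q_def)
    qed
    then have rb: "r = b + l *\<^sub>R N" by (simp add: algebra_simps)
    have "r \<bullet> r = b \<bullet> b + 2 * l * s + l * l"
      using bN NN by (simp add: rb algebra_simps inner_add_left inner_add_right inner_commute[of N b])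
    then have "l * (2 * s + l) = 0" using r(3) bb by (simp add: algebra_simps)
    moreover have "s + l > 0"
    proof -
      have "n = norm n *\<^sub>R N" using n0 by (simp add: N_def)
      then have "n \<bullet> r = norm n * (N \<bullet> r)" by (metis inner_scaleR_left)
      also have "N \<bullet> r = s + l" using bN NN by (simp add: rb inner_add_right inner_commute[of N b])
      finally show ?thesis using r(4) n0 by (simp add: zero_less_mult_iff)
    qed
    ultimately have "l = 0" using s0 by auto
    then show ?thesis using rb by simp
  qed
qed

section \<open>Isometric immersions\<close>

locale spd_field =
  fixes \<Omega> :: "(real^2) set" and G :: "real^2 \<Rightarrow> real^3^3"
  assumes \<Omega>: "open \<Omega>" and smooth_G: "smooth_on \<Omega> G" and spd_G: "\<And>x. x \<in> \<Omega> \<Longrightarrow> spd (G x)"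

sublocale spd_field \<subseteq> metric_field \<Omega> G
proof
  show "det (G x) \<noteq> 0" if "x \<in> \<Omega>" for x using spd_det_pos[OF spd_G[OF that]] by simp
qed (use \<Omega> smooth_G spd_sym[OF spd_G] in auto)

context spd_field
begin

abbreviation normal_part :: "real^2 \<Rightarrow> real" where
  "normal_part x \<equiv> sqrt (det (G x)) / sqrt (det (block22 (G x)))"

lemma smooth_det_block22: "smooth_on \<Omega> (\<lambda>x. det (block22 (G x)))"
  unfolding det_2 block22_nth by (intro smooth_on_diff smooth_on_mult \<Omega> smooth_entry)

lemma det_block22_pos: "x \<in> \<Omega> \<Longrightarrow> det (block22 (G x)) > 0"
  by (rule spd_det_pos[OF spd_block22[OF spd_G]])

lemma smooth_normal_part: "smooth_on \<Omega> normal_part"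
proof -
  have 1: "smooth_on \<Omega> (\<lambda>x. det (G x))" by (rule smooth_on_det3[OF \<Omega> smooth_entry])
  have 2: "smooth_on \<Omega> (\<lambda>x. det (G x) powr (1/2))"
    by (rule smooth_on_powr[OF \<Omega> _ 1]) (rule spd_det_pos[OF spd_G])
  have 3: "smooth_on \<Omega> (\<lambda>x. det (block22 (G x)) powr (-1/2))"
    by (rule smooth_on_powr[OF \<Omega> _ smooth_det_block22]) (rule det_block22_pos)
  have 4: "det (G x) powr (1/2) * det (block22 (G x)) powr (-1/2) = normal_part x" if "x \<in> \<Omega>" for x
  proof -
    have "det (block22 (G x)) powr (-1/2) = inverse (sqrt (det (block22 (G x))))"
      using det_block22_pos[OF that] by (simp add: powr_minus powr_half_sqrt)
    moreover have "det (G x) powr (1/2) = sqrt (det (G x))"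
      using spd_det_pos[OF spd_G[OF that]] by (simp add: powr_half_sqrt)
    ultimately show ?thesis by (simp only: divide_inverse)
  qed
  show ?thesis by (rule smooth_on_cong[OF \<Omega> smooth_on_mult[OF \<Omega> 2 3] 4])
qed

lemma smooth_shear_coeff: "smooth_on \<Omega> (\<lambda>x. shear_coeff (G x) k)"
  unfolding shear_coeff_def
  by (intro smooth_on_mult smooth_on_uminus smooth_on_inverse smooth_matrix_inv \<Omega>)
    (use spd_matrix_inv_33_pos[OF spd_G] in force)

lemma matrix_inv_G_sym:
  assumes "x \<in> \<Omega>"
  shows "matrix_inv (G x) $ a $ b = matrix_inv (G x) $ b $ a"
proof -
  have "transpose (G x) = G x" using spd_G[OF assms] by (simp add: spd_def)
  from transpose_matrix_inv[OF invertible_G[OF assms] this]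
  have "transpose (matrix_inv (G x)) $ b $ a = matrix_inv (G x) $ b $ a" by simp
  then show ?thesis by (simp add: transpose_def)
qed

lemma christoffel_cylindrical:
  assumes "planar z \<in> \<Omega>"
  shows "christoffel (cylindrical G) i k l z = chr G i k l (planar z)"
proof -
  have "pd m (\<lambda>z. cylindrical G z $ a $ b) z = pderiv3 m (\<lambda>x. G x $ a $ b) (planar z)" for m a b
    by (rule pd_cylinder[OF \<Omega> smooth_entry assms]) (simp add: cylindrical_def)
  then show ?thesis by (simp add: christoffel_def chr_def cylindrical_def)
qed

lemma riemann_cylindrical:
  assumes "planar z \<in> \<Omega>"
  shows "riemann (cylindrical G) s i 1 2 z = curv G s i (planar z)"
    and "riemann (cylindrical G) s i 2 1 z = - curv G s i (planar z)"
proof -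
  have "pd m (christoffel (cylindrical G) a b c) z = pderiv3 m (chr G a b c) (planar z)" for m a b c
    by (rule pd_cylinder[OF \<Omega> smooth_chr assms]) (rule christoffel_cylindrical)
  then show "riemann (cylindrical G) s i 1 2 z = curv G s i (planar z)"
    and "riemann (cylindrical G) s i 2 1 z = - curv G s i (planar z)"
    by (simp_all add: riemann_def curv_def christoffel_cylindrical[OF assms])
qed

lemma planar_midplane [simp]: "planar (midplane x) = x"
  by (simp add: planar_def midplane_def vec_eq_iff forall_2)

text \<open>Of the three given curvatures, the second is \<open>curv G 3 2\<close> up to sign and
  the third is \<open>lowcurv 1 2\<close>. The section \<open>midplane\<close> lets points of the
  plane be tested inside the cylinder.\<close>

lemma curvatures_vanish_iff:
  "(\<forall>x. planar x \<in> \<Omega> \<longrightarrow> riemann (cylindrical G) 3 1 1 2 x = 0 \<and> riemann (cylindrical G) 3 2 2 1 x = 0 \<and>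
      riemann_low (cylindrical G) 1 2 1 2 x = 0) \<longleftrightarrow> (\<forall>x\<in>\<Omega>. \<forall>s i. curv G s i x = 0)" (is "?L \<longleftrightarrow> ?R")
proof -
  have e: "(riemann (cylindrical G) 3 1 1 2 z = 0 \<and> riemann (cylindrical G) 3 2 2 1 z = 0 \<and>
      riemann_low (cylindrical G) 1 2 1 2 z = 0) \<longleftrightarrow> (\<forall>s i. curv G s i (planar z) = 0)" if z: "planar z \<in> \<Omega>" for z
  proof -
    have "riemann_low (cylindrical G) 1 2 1 2 z = lowcurv 1 2 (planar z)"
      by (simp add: riemann_low_def lowcurv_def cylindrical_def[of G] riemann_cylindrical(1)[OF z, unfolded cylindrical_def])
    then show ?thesis
      using spd_matrix_inv_33_pos[OF spd_G[OF z]] by (simp add: curv_eq_0_iff[OF z] riemann_cylindrical[OF z])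
  qed
  show ?thesis
  proof
    assume L: ?L
    show ?R
    proof
      fix x assume x: "x \<in> \<Omega>"
      show "\<forall>s i. curv G s i x = 0" using e[of "midplane x"] L x by simp
    qed
  qed (use e in blast)
qed

end

section \<open>The frame of an isometric immersion\<close>

locale immersion = spd_field +
  fixes y :: "real^2 \<Rightarrow> real^3"
  assumes y: "y \<in> iso_immersions \<Omega> G"
begin

abbreviation "tang i \<equiv> weak_pd \<Omega> i y"
abbreviation "tang_d i j \<equiv> weak_pd \<Omega> j (tang i)"
abbreviation "nrm \<equiv> unit_normal \<Omega> y"
abbreviation "nrm_d j \<equiv> weak_pd \<Omega> j nrm"
abbreviation "dir \<equiv> cosserat \<Omega> G y"

definition frame :: "3 \<Rightarrow> real^2 \<Rightarrow> real^3" where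
  "frame a = (if a = 1 then tang 1 else if a = 2 then tang 2 else dir)"

abbreviation "frame_d a j \<equiv> weak_pd \<Omega> j (frame a)"

lemma frame_simps [simp]: "frame 1 = tang 1" "frame 2 = tang 2" "frame 3 = dir" "frame (index3 i) = tang i"
  using exhaust_2[of i] by (auto simp: frame_def)

lemma weak_y: "has_weak_pd \<Omega> i y (tang i)" and weak_tang: "has_weak_pd \<Omega> j (tang i) (tang_d i j)"
proof -
  have "\<forall>i. \<exists>g. has_weak_pd \<Omega> i y g \<and> (\<forall>j. \<exists>h. has_weak_pd \<Omega> j g h)"
    using y unfolding iso_immersions_def by (simp add: numeral_2_eq_2) blast
  then obtain g h where g: "has_weak_pd \<Omega> i y g" and h: "has_weak_pd \<Omega> j g h" by blast
  show "has_weak_pd \<Omega> i y (tang i)" by (rule weak_pd_has_weak_pd[OF g])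
  have "AE x in lborel. x \<in> \<Omega> \<longrightarrow> g x = tang i x"
    using weak_pd_AE_eq[OF \<Omega> g] by eventually_elim simp
  from has_weak_pd_vec_cong_AE[OF \<Omega> h this] have "has_weak_pd \<Omega> j (tang i) h" by simp
  then show "has_weak_pd \<Omega> j (tang i) (tang_d i j)" by (rule weak_pd_has_weak_pd)
qed

lemma tang_gram: "AE x in lborel. x \<in> \<Omega> \<longrightarrow> (\<forall>i j. tang i x \<bullet> tang j x = G x $ index3 i $ index3 j)"
proof -
  have "AE x in lborel. x \<in> \<Omega> \<longrightarrow> transpose (weak_grad \<Omega> y x) ** weak_grad \<Omega> y x = block22 (G x)"
    using y AE_lebesgue_on_iff[of \<Omega>] \<Omega> unfolding iso_immersions_def by simp
  then show ?thesis
  proof eventually_elim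
    case (elim x)
    show ?case
    proof (intro impI allI)
      fix i j assume "x \<in> \<Omega>"
      then have "(transpose (weak_grad \<Omega> y x) ** weak_grad \<Omega> y x) $ i $ j = block22 (G x) $ i $ j" using elim by simp
      then show "tang i x \<bullet> tang j x = G x $ index3 i $ index3 j"
        using exhaust_2[of i] exhaust_2[of j]
        by (auto simp: matrix_matrix_mult_def transpose_def weak_grad_def inner_vec_def)
    qed
  qed
qed

lemma dir_eq:
  assumes "x \<in> \<Omega>"
  shows "dir x = shear_coeff (G x) 1 *\<^sub>R tang 1 x + shear_coeff (G x) 2 *\<^sub>R tang 2 x + normal_part x *\<^sub>R nrm x"
  unfolding cosserat_def shear_coeff(1)[OF spd_G[OF assms]]
  by (simp add: vec_eq_iff matrix_vector_mult_def weak_grad_def sum_2 algebra_simps)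

text \<open>The normal is written with a smooth power of \<open>det (block22 (G x))\<close> in place
  of the norm of a cross product of weak derivatives; in this form the product rule applies to
  it.\<close>

lemma frame_AE: "AE x in lborel. x \<in> \<Omega> \<longrightarrow> (\<forall>a c. frame a x \<bullet> frame c x = G x $ a $ c) \<and>
    nrm x = (\<Sum>m\<in>UNIV. (normal_part x * matrix_inv (G x) $ m $ 3) *\<^sub>R frame m x) \<and> (\<forall>i. nrm x \<bullet> tang i x = 0) \<and>
    nrm x = det (block22 (G x)) powr (-1/2) *\<^sub>R cross3 (tang 1 x) (tang 2 x) \<and> nrm x \<bullet> nrm x = 1"
  using tang_gram
proof eventually_elim
  case (elim x)
  show ?case
  proof
    assume x: "x \<in> \<Omega>"
    have N: "nrm x = cross3 (tang 1 x) (tang 2 x) /\<^sub>R norm (cross3 (tang 1 x) (tang 2 x))"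
      by (simp add: unit_normal_def Let_def)
    have f: "frame m x = (if m = 1 then tang 1 x else if m = 2 then tang 2 x else
       shear_coeff (G x) 1 *\<^sub>R tang 1 x + shear_coeff (G x) 2 *\<^sub>R tang 2 x + normal_part x *\<^sub>R nrm x)" for m
      using dir_eq[OF x] by (simp add: frame_def)
    have g: "tang 1 x \<bullet> tang 1 x = G x $ 1 $ 1" "tang 1 x \<bullet> tang 2 x = G x $ 1 $ 2" "tang 2 x \<bullet> tang 2 x = G x $ 2 $ 2"
      using elim x by simp_all
    note nf = normal_frame[OF spd_G[OF x] g, folded N, folded f]
    have "norm (cross3 (tang 1 x) (tang 2 x)) = sqrt (det (block22 (G x)))"
      using nf(1) by (metis norm_ge_zero real_sqrt_unique)
    then have "nrm x = det (block22 (G x)) powr (-1/2) *\<^sub>R cross3 (tang 1 x) (tang 2 x)"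
      using det_block22_pos[OF x] by (simp add: N powr_minus powr_half_sqrt)
    moreover have "nrm x \<bullet> tang i x = 0" for i using nf(4,5) exhaust_2[of i] by auto
    ultimately show "(\<forall>a c. frame a x \<bullet> frame c x = G x $ a $ c) \<and>
    nrm x = (\<Sum>m\<in>UNIV. (normal_part x * matrix_inv (G x) $ m $ 3) *\<^sub>R frame m x) \<and> (\<forall>i. nrm x \<bullet> tang i x = 0) \<and>
    nrm x = det (block22 (G x)) powr (-1/2) *\<^sub>R cross3 (tang 1 x) (tang 2 x) \<and> nrm x \<bullet> nrm x = 1"
      using nf(3,8,9) by blast
  qed
qed

text \<open>The isometry supplies the local boundedness that the product rule asks for: the squared
  length of \<open>tang i\<close> is a diagonal entry of the metric.\<close>

lemma lb_tang: "locally_bounded_vec \<Omega> (tang i)"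
  unfolding locally_bounded_vec_def
proof
  fix k
  \<comment> \<open>Via |t| \<le> 1 + t^2 a smooth bound is obtained without taking a root.\<close>
  have s: "smooth_on \<Omega> (\<lambda>x. 1 + G x $ index3 i $ index3 i)"
    by (intro smooth_on_add \<Omega> smooth_on_const smooth_entry)
  show "locally_bounded \<Omega> (\<lambda>x. tang i x $ k)"
    apply (rule locally_bounded_mono[OF locally_bounded_smooth[OF s]])
    using tang_gram
  proof eventually_elim
    case (elim x)
    show ?case
    proof
      assume "x \<in> \<Omega>"
      then have "(norm (tang i x))\<^sup>2 = G x $ index3 i $ index3 i" using elim by (simp add: power2_norm_eq_inner)
      moreover have "\<bar>tang i x $ k\<bar>\<^sup>2 \<le> (norm (tang i x))\<^sup>2" by (intro power_mono component_le_norm_cart) simp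
      moreover have "\<bar>t\<bar> \<le> 1 + \<bar>t\<bar>\<^sup>2" for t :: real
        using zero_le_power2[of "\<bar>t\<bar> - 1/2"] by (simp add: power2_eq_square algebra_simps)
      ultimately show "\<bar>tang i x $ k\<bar> \<le> \<bar>1 + G x $ index3 i $ index3 i\<bar>"
        by (smt (verit))
    qed
  qed
qed

lemma weak_nrm: "has_weak_pd \<Omega> j nrm (nrm_d j)" and lb_nrm: "locally_bounded_vec \<Omega> nrm"
proof -
  have s: "smooth_on \<Omega> (\<lambda>x. det (block22 (G x)) powr (-1/2))"
    by (intro smooth_on_powr \<Omega> smooth_det_block22 det_block22_pos)
  note c = has_weak_pd_cross3[OF \<Omega> weak_tang lb_tang weak_tang lb_tang]
  have e: "AE x in lborel. x \<in> \<Omega> \<longrightarrow> det (block22 (G x)) powr (-1/2) *\<^sub>R cross3 (tang 1 x) (tang 2 x) = nrm x"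
    using frame_AE by eventually_elim metis
  show "has_weak_pd \<Omega> j nrm (nrm_d j)"
    by (rule weak_pd_has_weak_pd, rule has_weak_pd_vec_cong_AE[OF \<Omega> _ e AE_I2],
        rule has_weak_pd_scaleR[OF \<Omega> has_weak_pd_smooth[OF \<Omega> s] locally_bounded_smooth[OF s] c(1)[of j 1 2] c(2)]) (rule impI, rule refl)
  show "locally_bounded_vec \<Omega> nrm"
    by (rule locally_bounded_vec_cong_AE[OF locally_bounded_vec_scaleR[OF locally_bounded_smooth[OF s] c(2)] e])
qed

lemma weak_dir: "has_weak_pd \<Omega> j dir (weak_pd \<Omega> j dir)" and lb_dir: "locally_bounded_vec \<Omega> dir"
proof -
  let ?b = "\<lambda>x. shear_coeff (G x) 1 *\<^sub>R tang 1 x + shear_coeff (G x) 2 *\<^sub>R tang 2 x + normal_part x *\<^sub>R nrm x"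
  have e: "AE x in lborel. x \<in> \<Omega> \<longrightarrow> ?b x = dir x" by (simp add: dir_eq)
  note w = has_weak_pd_scaleR[OF \<Omega> has_weak_pd_smooth[OF \<Omega> smooth_shear_coeff] locally_bounded_smooth[OF smooth_shear_coeff] weak_tang lb_tang]
    and n = has_weak_pd_scaleR[OF \<Omega> has_weak_pd_smooth[OF \<Omega> smooth_normal_part] locally_bounded_smooth[OF smooth_normal_part] weak_nrm lb_nrm]
  show "has_weak_pd \<Omega> j dir (weak_pd \<Omega> j dir)"
    by (rule weak_pd_has_weak_pd, rule has_weak_pd_vec_cong_AE[OF \<Omega> _ e AE_I2],
        rule has_weak_pd_vec_add[OF \<Omega> has_weak_pd_vec_add[OF \<Omega> w[of j 1 1] w[of j 2 2]] n[of j]]) (rule impI, rule refl)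
  show "locally_bounded_vec \<Omega> dir"
    by (rule locally_bounded_vec_cong_AE[OF _ e])
      (intro locally_bounded_vec_add locally_bounded_vec_scaleR locally_bounded_smooth smooth_shear_coeff smooth_normal_part lb_tang lb_nrm)
qed

lemma weak_frame: "has_weak_pd \<Omega> j (frame a) (frame_d a j)" and lb_frame: "locally_bounded_vec \<Omega> (frame a)"
  using weak_tang weak_dir lb_tang lb_dir by (simp_all add: frame_def)

end

section \<open>First-order identities and the structure equations\<close>

context immersion
begin

lemma frame_derivative: "AE x in lborel. x \<in> \<Omega> \<longrightarrow>
    (\<forall>a c j. frame_d a j x \<bullet> frame c x + frame a x \<bullet> frame_d c j x = pderiv3 (index3 j) (\<lambda>z. G z $ a $ c) x)"
proof -
  have "AE x in lborel. x \<in> \<Omega> \<longrightarrow> frame_d a j x \<bullet> frame c x + frame a x \<bullet> frame_d c j x = pderiv3 (index3 j) (\<lambda>z. G z $ a $ c) x" for a c j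
  proof -
    have "AE x in lborel. x \<in> \<Omega> \<longrightarrow> frame a x \<bullet> frame c x = G x $ a $ c"
      using frame_AE by eventually_elim blast
    from weak_inner_relation[OF \<Omega> weak_frame lb_frame weak_frame lb_frame smooth_entry this]
    show ?thesis by (simp add: pderiv3_index3)
  qed
  then have "AE x in lborel. \<forall>a\<in>UNIV. \<forall>c\<in>UNIV. \<forall>j\<in>UNIV. x \<in> \<Omega> \<longrightarrow> frame_d a j x \<bullet> frame c x + frame a x \<bullet> frame_d c j x = pderiv3 (index3 j) (\<lambda>z. G z $ a $ c) x"
    by (intro AE_finite_allI finite)
  then show ?thesis by eventually_elim blast
qed

lemma tang_d_sym: "AE x in lborel. x \<in> \<Omega> \<longrightarrow> (\<forall>i j. tang_d i j x = tang_d j i x)"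
proof -
  have "AE x in lborel. \<forall>i\<in>UNIV. \<forall>j\<in>UNIV. x \<in> \<Omega> \<longrightarrow> tang_d i j x = tang_d j i x"
    by (intro AE_finite_allI finite weak_pd_commute_vec[OF \<Omega> weak_y weak_y weak_tang weak_tang])
  then show ?thesis by eventually_elim blast
qed

lemma nrm_d_tang: "AE x in lborel. x \<in> \<Omega> \<longrightarrow> (\<forall>i j. tang i x \<bullet> nrm_d j x = - (nrm x \<bullet> tang_d i j x))"
proof -
  have "AE x in lborel. x \<in> \<Omega> \<longrightarrow> tang i x \<bullet> nrm_d j x = - (nrm x \<bullet> tang_d i j x)" for i j
  proof -
    have "AE x in lborel. x \<in> \<Omega> \<longrightarrow> tang i x \<bullet> nrm x = 0"
      using frame_AE by eventually_elim (metis inner_commute)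
    from weak_inner_relation[OF \<Omega> weak_tang lb_tang weak_nrm lb_nrm smooth_on_const this]
    have "AE x in lborel. x \<in> \<Omega> \<longrightarrow> tang_d i j x \<bullet> nrm x + tang i x \<bullet> nrm_d j x = 0"
      by (simp add: pd_def)
    then show ?thesis by eventually_elim (simp add: inner_commute[of "nrm _"] add_eq_0_iff)
  qed
  then have "AE x in lborel. \<forall>i\<in>UNIV. \<forall>j\<in>UNIV. x \<in> \<Omega> \<longrightarrow> tang i x \<bullet> nrm_d j x = - (nrm x \<bullet> tang_d i j x)"
    by (intro AE_finite_allI finite)
  then show ?thesis by eventually_elim blast
qed

text \<open>The Koszul formula: three instances of the differentiated tangential Gram matrix, and
  the symmetry of second derivatives.\<close>

lemma koszul: "AE x in lborel. x \<in> \<Omega> \<longrightarrow>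
    (\<forall>i j k. tang k x \<bullet> tang_d i j x = lowchr G (index3 k) (index3 i) (index3 j) x)"
  using frame_derivative tang_d_sym
proof eventually_elim
  case (elim x)
  show ?case
  proof (intro impI allI)
    fix i j k assume x: "x \<in> \<Omega>"
    have r: "tang_d i j x \<bullet> tang k x + tang i x \<bullet> tang_d k j x = pderiv3 (index3 j) (\<lambda>z. G z $ index3 i $ index3 k) x" for i j k
      using elim(1)[rule_format, OF x, where a = "index3 i" and j = j and c = "index3 k"] by simp
    have s: "tang_d i j x = tang_d j i x" for i j using elim(2) x by blast
    show "tang k x \<bullet> tang_d i j x = lowchr G (index3 k) (index3 i) (index3 j) x"
      unfolding lowchr_def r[symmetric]
      using s[of i j] s[of i k] s[of j k] by (simp add: inner_commute[of "tang_d _ _ x"] field_simps)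
  qed
qed

lemma lowchr_3: "x \<in> \<Omega> \<Longrightarrow> lowchr G 3 i j x = (pderiv3 j (\<lambda>z. G z $ 3 $ i) x + pderiv3 i (\<lambda>z. G z $ 3 $ j) x) / 2"
  by (simp add: lowchr_def pderiv3_3[OF smooth_entry])

text \<open>Differentiating \<open>dir \<bullet> tang i\<close> moves the derivative from the
  direction field to the tangent vector. Since nothing depends on the third variable, the
  symmetrised derivatives of the entries in row 3 of the metric give the symbol with first index
  3.\<close>

lemma sym_bending: "AE x in lborel. x \<in> \<Omega> \<longrightarrow>
    (\<forall>i j. sym_part (bending_tensor \<Omega> G y x) $ i $ j = lowchr G 3 (index3 i) (index3 j) x - dir x \<bullet> tang_d i j x)"
  using frame_derivative tang_d_sym
proof eventually_elim
  case (elim x)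
  show ?case
  proof (intro impI allI)
    fix i j assume x: "x \<in> \<Omega>"
    have r: "weak_pd \<Omega> j dir x \<bullet> tang i x + dir x \<bullet> tang_d i j x = pderiv3 (index3 j) (\<lambda>z. G z $ 3 $ index3 i) x" for i j
      using elim(1)[rule_format, OF x, where a = 3 and j = j and c = "index3 i"] by simp
    have s: "tang_d i j x = tang_d j i x" using elim(2) x by blast
    have b: "bending_tensor \<Omega> G y x $ i $ j = tang i x \<bullet> weak_pd \<Omega> j dir x" for i j
      by (simp add: bending_tensor_def matrix_matrix_mult_def transpose_def weak_grad_def inner_vec_def)
    show "sym_part (bending_tensor \<Omega> G y x) $ i $ j = lowchr G 3 (index3 i) (index3 j) x - dir x \<bullet> tang_d i j x"
      unfolding lowchr_3[OF x] r[symmetric]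
      using s by (simp add: sym_part_def transpose_def b inner_commute[of "tang _ x"] field_simps)
  qed
qed

text \<open>The normal is expanded in the frame. The products of \<open>tang_d i j\<close> with the
  tangent vectors are known symbols, so the result is the prescribed value plus a multiple of the
  deviation of the one unknown product, that with \<open>dir\<close>.\<close>

lemma second_ff_eq: "AE x in lborel. x \<in> \<Omega> \<longrightarrow> (\<forall>i j. second_ff \<Omega> y i j x = - (1 / sqrt (matrix_inv (G x) $ 3 $ 3)) *
    (chr G 3 (index3 i) (index3 j) x + matrix_inv (G x) $ 3 $ 3 * (dir x \<bullet> tang_d i j x - lowchr G 3 (index3 i) (index3 j) x)))"
  using frame_AE nrm_d_tang koszul
proof eventually_elim
  case (elim x)
  show ?case
  proof (intro impI allI)
    fix i j assume x: "x \<in> \<Omega>"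
    have np: "normal_part x = 1 / sqrt (matrix_inv (G x) $ 3 $ 3)"
      unfolding det_block22[OF spd_G[OF x]] using spd_det_pos[OF spd_G[OF x]] by (simp add: real_sqrt_mult)
    have k: "tang k x \<bullet> tang_d i j x = lowchr G (index3 k) (index3 i) (index3 j) x" for k using elim(3) x by blast
    have N: "nrm x = (\<Sum>m\<in>UNIV. (normal_part x * matrix_inv (G x) $ m $ 3) *\<^sub>R frame m x)" using elim(1) x by blast
    have "nrm x \<bullet> tang_d i j x = (\<Sum>m\<in>UNIV. normal_part x * matrix_inv (G x) $ m $ 3 * (frame m x \<bullet> tang_d i j x))"
      by (subst N) (simp add: inner_sum_left)
    also have "\<dots> = normal_part x * (chr G 3 (index3 i) (index3 j) x + matrix_inv (G x) $ 3 $ 3 * (dir x \<bullet> tang_d i j x - lowchr G 3 (index3 i) (index3 j) x))"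
      using k[of 1] k[of 2] matrix_inv_G_sym[OF x, of 1 3] matrix_inv_G_sym[OF x, of 2 3]
      by (simp add: sum_3 chr_lowchr algebra_simps)
    finally have "nrm x \<bullet> tang_d i j x = normal_part x * (chr G 3 (index3 i) (index3 j) x + matrix_inv (G x) $ 3 $ 3 * (dir x \<bullet> tang_d i j x - lowchr G 3 (index3 i) (index3 j) x))" .
    moreover have "second_ff \<Omega> y i j x = - (nrm x \<bullet> tang_d i j x)"
      using elim(2) x unfolding second_ff_def by blast
    ultimately show "second_ff \<Omega> y i j x = - (1 / sqrt (matrix_inv (G x) $ 3 $ 3)) *
      (chr G 3 (index3 i) (index3 j) x + matrix_inv (G x) $ 3 $ 3 * (dir x \<bullet> tang_d i j x - lowchr G 3 (index3 i) (index3 j) x))"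
      by (simp only: np minus_mult_left)
  qed
qed

definition compatible :: bool where
  "compatible \<longleftrightarrow> (AE x in lborel. x \<in> \<Omega> \<longrightarrow> (\<forall>i j. dir x \<bullet> tang_d i j x = lowchr G 3 (index3 i) (index3 j) x))"

lemma sym_bending_zero_iff: "(AE x in lebesgue_on \<Omega>. sym_part (bending_tensor \<Omega> G y x) = 0) \<longleftrightarrow> compatible"
proof -
  have L: "\<Omega> \<in> sets lebesgue" using \<Omega> by simp
  have "AE x in lborel. (x \<in> \<Omega> \<longrightarrow> sym_part (bending_tensor \<Omega> G y x) = 0) \<longleftrightarrow>
      (x \<in> \<Omega> \<longrightarrow> (\<forall>i j. dir x \<bullet> tang_d i j x = lowchr G 3 (index3 i) (index3 j) x))"
    using sym_bending
  proof eventually_elim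
    case (elim x)
    show ?case
    proof (cases "x \<in> \<Omega>")
      case True
      then have "sym_part (bending_tensor \<Omega> G y x) $ i $ j = lowchr G 3 (index3 i) (index3 j) x - dir x \<bullet> tang_d i j x" for i j
        using elim by blast
      then have "sym_part (bending_tensor \<Omega> G y x) = 0 \<longleftrightarrow> (\<forall>i j. lowchr G 3 (index3 i) (index3 j) x - dir x \<bullet> tang_d i j x = 0)"
        by (simp add: vec_eq_iff)
      then show ?thesis by (metis eq_iff_diff_eq_0)
    qed simp
  qed
  from eventually_subst[OF this] show ?thesis
    unfolding AE_lebesgue_on_iff[OF L] compatible_def .
qed

lemma second_ff_iff: "(AE x in lebesgue_on \<Omega>.
    second_ff \<Omega> y 1 1 x = - (1 / sqrt (matrix_inv (G x) $ 3 $ 3)) * christoffel (cylindrical G) 3 1 1 (midplane x) \<and>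
    second_ff \<Omega> y 1 2 x = - (1 / sqrt (matrix_inv (G x) $ 3 $ 3)) * christoffel (cylindrical G) 3 1 2 (midplane x) \<and>
    second_ff \<Omega> y 2 2 x = - (1 / sqrt (matrix_inv (G x) $ 3 $ 3)) * christoffel (cylindrical G) 3 2 2 (midplane x))
  \<longleftrightarrow> compatible" (is "(AE x in _. ?P x) \<longleftrightarrow> _")
proof -
  have L: "\<Omega> \<in> sets lebesgue" using \<Omega> by simp
  have "AE x in lborel. (x \<in> \<Omega> \<longrightarrow> ?P x) \<longleftrightarrow>
      (x \<in> \<Omega> \<longrightarrow> (\<forall>i j. dir x \<bullet> tang_d i j x = lowchr G 3 (index3 i) (index3 j) x))"
    using second_ff_eq tang_d_sym
  proof eventually_elim
    case (elim x)
    show ?case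
    proof (cases "x \<in> \<Omega>")
      case True
      have p: "matrix_inv (G x) $ 3 $ 3 > 0" by (rule spd_matrix_inv_33_pos[OF spd_G[OF True]])
      have "second_ff \<Omega> y i j x = - (1 / sqrt (matrix_inv (G x) $ 3 $ 3)) *
        (chr G 3 (index3 i) (index3 j) x + matrix_inv (G x) $ 3 $ 3 * (dir x \<bullet> tang_d i j x - lowchr G 3 (index3 i) (index3 j) x))" for i j
        using elim(1) True by blast
      then have e: "second_ff \<Omega> y i j x = - (1 / sqrt (matrix_inv (G x) $ 3 $ 3)) * chr G 3 (index3 i) (index3 j) x
        \<longleftrightarrow> dir x \<bullet> tang_d i j x = lowchr G 3 (index3 i) (index3 j) x" for i j
        using p by simp
      \<comment> \<open>The index pair (2, 1), which the condition does not list, follows from (1,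
        2) by symmetry of both sides.\<close>
      have s: "tang_d 2 1 x = tang_d 1 2 x" using elim(2) True by blast
      have "?P x \<longleftrightarrow> (\<forall>i j. dir x \<bullet> tang_d i j x = lowchr G 3 (index3 i) (index3 j) x)"
        using e[of 1 1] e[of 1 2] e[of 2 2] lowchr_sym[OF True, of 3 2 1] s True
        by (auto simp: forall_2 christoffel_cylindrical)
      then show ?thesis by simp
    qed simp
  qed
  from eventually_subst[OF this] show ?thesis
    unfolding AE_lebesgue_on_iff[OF L] compatible_def .
qed

lemma structure_equations:
  assumes compatible
  shows "AE x in lborel. x \<in> \<Omega> \<longrightarrow> (\<forall>a j. frame_d a j x = (\<Sum>m\<in>UNIV. chr G m a (index3 j) x *\<^sub>R frame m x))"
  using frame_AE frame_derivative koszul assms[unfolded compatible_def]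
proof eventually_elim
  case (elim x)
  show ?case
  proof (intro impI allI)
    fix a j assume x: "x \<in> \<Omega>"
    have g: "frame a x \<bullet> frame c x = G x $ a $ c" for a c using elim(1) x by blast
    have r: "frame_d a j x \<bullet> frame c x + frame a x \<bullet> frame_d c j x = lowchr G a c (index3 j) x + lowchr G c a (index3 j) x" for a c
      using elim(2) x unfolding metric_derivative[OF x, symmetric] by blast
    have t: "frame k x \<bullet> tang_d i j x = lowchr G k (index3 i) (index3 j) x" for i k
      using elim(3,4) x exhaust_3[of k] by (metis frame_simps(1-3) index3_simps)
    \<comment> \<open>The product of the derivative of \<open>dir\<close> with \<open>dir\<close> is
      half a derivative of the entry 3, 3; its product with a tangent vector is what remains of a
      derivative of the metric after the compatibility relation is used.\<close>
    have b: "frame k x \<bullet> frame_d 3 j x = lowchr G k 3 (index3 j) x" for k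
    proof (cases "k = 3")
      case True
      moreover have "frame_d 3 j x \<bullet> frame 3 x = frame 3 x \<bullet> frame_d 3 j x" by (rule inner_commute)
      ultimately show ?thesis using r[of 3 3] by simp
    next
      case False
      then obtain i where k: "k = index3 i" using exhaust_3[of k] by (metis index3_simps)
      have "frame_d k j x \<bullet> frame 3 x = frame 3 x \<bullet> tang_d i j x"
        unfolding k frame_simps by (rule inner_commute)
      then show ?thesis using r[of k 3] t[of 3 i] k by simp
    qed
    have "frame k x \<bullet> frame_d a j x = lowchr G k a (index3 j) x" for k
      using t[of k 1] t[of k 2] b[of k] exhaust_3[of a] by auto
    then show "frame_d a j x = (\<Sum>m\<in>UNIV. chr G m a (index3 j) x *\<^sub>R frame m x)"
      by (intro gram_combination[OF g]) (auto simp: det_G x lower_chr)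
  qed
qed

text \<open>The structure equations write the derivatives of the frame as smooth coefficients times
  locally bounded, weakly differentiable vectors, so these can be differentiated once more. That the
  second derivatives commute is a linear relation among the frame vectors with the curvatures as
  coefficients, and the frame is independent.\<close>

lemma curvature_zero:
  assumes compatible and x0: "x0 \<in> \<Omega>"
  shows "curv G s a x0 = 0"
proof (rule AE_zero_imp_zero[OF \<Omega> continuous_curv _ x0])
  let ?D = "\<lambda>i j x. \<Sum>m\<in>UNIV. pderiv3 (index3 i) (chr G m a (index3 j)) x *\<^sub>R frame m x + chr G m a (index3 j) x *\<^sub>R frame_d m i x"
  have d: "has_weak_pd \<Omega> i (frame_d a j) (?D i j)" for i j
  proof -
    have m: "has_weak_pd \<Omega> i (\<lambda>x. chr G m a (index3 j) x *\<^sub>R frame m x)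
       (\<lambda>x. pderiv3 (index3 i) (chr G m a (index3 j)) x *\<^sub>R frame m x + chr G m a (index3 j) x *\<^sub>R frame_d m i x)" for m
      using has_weak_pd_scaleR[OF \<Omega> has_weak_pd_smooth[OF \<Omega> smooth_chr] locally_bounded_smooth[OF smooth_chr] weak_frame lb_frame]
      unfolding pderiv3_index3 .
    have e: "AE x in lborel. x \<in> \<Omega> \<longrightarrow> chr G 1 a (index3 j) x *\<^sub>R frame 1 x + chr G 2 a (index3 j) x *\<^sub>R frame 2 x
        + chr G 3 a (index3 j) x *\<^sub>R frame 3 x = frame_d a j x"
      using structure_equations[OF assms(1)] by eventually_elim (simp add: sum_3)
    show ?thesis
      by (rule has_weak_pd_vec_cong_AE[OF \<Omega> has_weak_pd_vec_add[OF \<Omega> has_weak_pd_vec_add[OF \<Omega> m[of 1] m[of 2]] m[of 3]] e])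
        (simp add: sum_3)
  qed
  show "AE x in lborel. x \<in> \<Omega> \<longrightarrow> curv G s a x = 0"
    using weak_pd_commute_vec[OF \<Omega> weak_frame weak_frame d d, of 2 1] structure_equations[OF assms(1)] frame_AE
  proof eventually_elim
    case (elim x)
    show ?case
    proof
      assume x: "x \<in> \<Omega>"
      have g: "frame a x \<bullet> frame c x = G x $ a $ c" for a c using elim(3) x by blast
      have f: "frame_d a j x = (\<Sum>m\<in>UNIV. chr G m a (index3 j) x *\<^sub>R frame m x)" for a j using elim(2) x by blast
      have D: "?D i j x = (\<Sum>t\<in>UNIV. (pderiv3 (index3 i) (chr G t a (index3 j)) x +
          (\<Sum>m\<in>UNIV. chr G t (index3 i) m x * chr G m a (index3 j) x)) *\<^sub>R frame t x)" for i j
      proof -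
        have "(\<Sum>m\<in>UNIV. chr G m a (index3 j) x *\<^sub>R frame_d m i x)
          = (\<Sum>t\<in>UNIV. (\<Sum>m\<in>UNIV. chr G t (index3 i) m x * chr G m a (index3 j) x) *\<^sub>R frame t x)"
          unfolding f scaleR_sum_right scaleR_sum_left
          by (subst sum.swap) (simp add: chr_sym[OF x, of _ "index3 i"] mult.commute)
        then show ?thesis by (simp add: sum.distrib scaleR_add_left)
      qed
      have "(\<Sum>t\<in>UNIV. curv G t a x *\<^sub>R frame t x) = ?D 1 2 x - ?D 2 1 x"
        unfolding D by (simp add: curv_def sum_subtractf[symmetric] algebra_simps)
      also have "\<dots> = 0" using elim(1) x by simp
      finally show "curv G s a x = 0"
        by (rule gram_independent[OF g det_G[OF x], rotated]) 
    qed
  qed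
qed

lemma bending_energy_zero_iff:
  assumes W: "stored_energy W" and t: "t > 0" "\<And>x. x \<in> \<Omega> \<Longrightarrow> trace (G x) \<le> t"
  shows "bending_energy W \<Omega> G y = 0 \<longleftrightarrow> compatible"
proof
  have L: "\<Omega> \<in> sets lebesgue" using \<Omega> by simp
  let ?S = "\<lambda>x. sym_part (bending_tensor \<Omega> G y x)"
  {
    assume compatible
    then have "AE x in lborel. x \<in> \<Omega> \<longrightarrow> ?S x = 0"
      unfolding sym_bending_zero_iff[symmetric] AE_lebesgue_on_iff[OF L] .
    then have "AE x in lborel. x \<in> \<Omega> \<longrightarrow> ennreal (Q2 W G x (bending_tensor \<Omega> G y x)) = 0"
    proof eventually_elim
      case (elim x)
      show ?case
      proof
        assume x: "x \<in> \<Omega>"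
        then have "Q2 W G x (bending_tensor \<Omega> G y x) = 0" using elim Q2_attained[where G = G, OF W spd_G[OF x]] by blast
        then show "ennreal (Q2 W G x (bending_tensor \<Omega> G y x)) = 0" by simp
      qed
    qed
    then have "(\<integral>\<^sup>+x. ennreal (Q2 W G x (bending_tensor \<Omega> G y x)) \<partial>lebesgue_on \<Omega>) = (\<integral>\<^sup>+x. 0 \<partial>lebesgue_on \<Omega>)"
      by (intro nn_integral_cong_AE) (simp only: AE_lebesgue_on_iff[OF L])
    then show "bending_energy W \<Omega> G y = 0" by (simp add: bending_energy_def)
  }
  assume "bending_energy W \<Omega> G y = 0"
  then have z: "(\<integral>\<^sup>+x. ennreal (Q2 W G x (bending_tensor \<Omega> G y x)) \<partial>lebesgue_on \<Omega>) = 0"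
    by (simp add: bending_energy_def)
  obtain k where k: "k > 0" and low: "\<And>G x F. spd (G x) \<Longrightarrow> trace (G x) \<le> t \<Longrightarrow> Q2 W G x F \<ge> k * (norm (sym_part F))\<^sup>2"
    using Q2_lower_bound[OF W t(1)] by blast
  have lowG: "k * (norm (?S x))\<^sup>2 \<le> Q2 W G x (bending_tensor \<Omega> G y x)" if "x \<in> \<Omega>" for x
    by (rule low[where G = G, OF spd_G[OF that] t(2)[OF that]])
  have "AE x in lborel. x \<in> \<Omega> \<longrightarrow> ?S x = 0"
  proof (rule AE_open_of_compact[OF \<Omega>])
    fix K assume K: "compact K" "K \<subseteq> \<Omega>"
    \<comment> \<open>The integral of the energy density dominates that of this function, which is
      measurable because \<open>k\<close> does not depend on the point. For it, zero integral means
      zero almost everywhere.\<close>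
    let ?f = "\<lambda>x. ennreal (k * (norm (?S x))\<^sup>2)"
    have m: "F \<in> borel_measurable (lebesgue_on K)" if "loc_integrable \<Omega> F" for F :: "real^2 \<Rightarrow> real^3"
    proof -
      have "integrable (lebesgue_on K) F" using that K by (simp add: loc_integrable_def)
      then show ?thesis by (rule borel_measurable_integrable)
    qed
    have b: "(\<lambda>x. bending_tensor \<Omega> G y x $ i $ j) \<in> borel_measurable (lebesgue_on K)" for i j
    proof -
      have "(\<lambda>x. tang i x \<bullet> weak_pd \<Omega> j dir x) \<in> borel_measurable (lebesgue_on K)"
        using weak_dir[of j] weak_tang[of j i] unfolding has_weak_pd_def by (intro borel_measurable_inner m) auto
      moreover have "(\<lambda>x. bending_tensor \<Omega> G y x $ i $ j) = (\<lambda>x. tang i x \<bullet> weak_pd \<Omega> j dir x)"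
        by (simp add: bending_tensor_def matrix_matrix_mult_def transpose_def weak_grad_def inner_vec_def)
      ultimately show ?thesis by simp
    qed
    have "(norm (?S x))\<^sup>2 = (\<Sum>i\<in>UNIV. \<Sum>j\<in>UNIV. ((bending_tensor \<Omega> G y x $ i $ j + bending_tensor \<Omega> G y x $ j $ i) / 2)\<^sup>2)" for x
      by (subst norm_matrix_power2) (simp add: sym_part_def transpose_def)
    then have f: "?f \<in> borel_measurable (lebesgue_on K)"
      using b by simp
    have "(\<integral>\<^sup>+x. ?f x \<partial>lebesgue_on K) = (\<integral>\<^sup>+x. ?f x * indicator K x \<partial>lebesgue)"
      using compact_sets_lebesgue[OF K(1)] by (simp add: nn_integral_restrict_space)
    also have "\<dots> \<le> (\<integral>\<^sup>+x. ennreal (Q2 W G x (bending_tensor \<Omega> G y x)) * indicator \<Omega> x \<partial>lebesgue)"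
      by (rule nn_integral_mono) (use K lowG in \<open>auto simp: indicator_def intro!: ennreal_leI\<close>)
    also have "\<dots> = 0" using L z by (simp add: nn_integral_restrict_space)
    finally have "AE x in lebesgue_on K. ?f x = 0"
      using f by (subst nn_integral_0_iff_AE[symmetric]) auto
    then have "AE x in lborel. x \<in> K \<longrightarrow> ?f x = 0" by (simp only: AE_lebesgue_on_iff[OF compact_sets_lebesgue[OF K(1)]])
    then show "AE x in lborel. x \<in> K \<longrightarrow> ?S x = 0"
    proof eventually_elim
      case (elim x)
      show ?case
      proof
        assume "x \<in> K"
        then have "k * (norm (?S x))\<^sup>2 \<le> 0" using elim by (simp add: ennreal_eq_0_iff)
        then have "(norm (?S x))\<^sup>2 \<le> 0" using k by (simp add: mult_le_0_iff)
        then show "?S x = 0" by simp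
      qed
    qed
  qed
  then show compatible
    unfolding sym_bending_zero_iff[symmetric] AE_lebesgue_on_iff[OF L] .
qed

end

section \<open>Immersions with prescribed frame\<close>

lemma has_derivative_vec_iff:
  fixes f :: "'a::real_normed_vector \<Rightarrow> real^'n::finite"
  shows "(f has_derivative f') (at x) \<longleftrightarrow> (\<forall>k. ((\<lambda>x. f x $ k) has_derivative (\<lambda>v. f' v $ k)) (at x))"
  by (subst has_derivative_componentwise_within) (auto simp: Basis_vec_def inner_axis)

lemma L2_on_bounded_continuous:
  fixes f :: "real^'n::finite \<Rightarrow> 'b::euclidean_space"
  assumes \<Omega>: "open \<Omega>" "bounded \<Omega>" and f: "continuous_on \<Omega> f" "\<And>x. x \<in> \<Omega> \<Longrightarrow> norm (f x) \<le> M"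
  shows "L2_on \<Omega> f"
proof -
  have L: "\<Omega> \<in> lmeasurable" using \<Omega> by (simp add: bounded_set_imp_lmeasurable)
  have m: "f \<in> borel_measurable (lebesgue_on \<Omega>)"
    using continuous_imp_measurable_on_sets_lebesgue[OF f(1)] L by blast
  moreover have "integrable (lebesgue_on \<Omega>) (\<lambda>x. (norm (f x))\<^sup>2)"
  proof (rule finite_measure.integrable_const_bound[where B = "M\<^sup>2"])
    show "finite_measure (lebesgue_on \<Omega>)" by (rule finite_measure_lebesgue_on[OF L])
    show "AE x in lebesgue_on \<Omega>. norm ((norm (f x))\<^sup>2) \<le> M\<^sup>2"
      using f(2) by (intro AE_I2) (auto intro!: power_mono)
    show "(\<lambda>x. (norm (f x))\<^sup>2) \<in> borel_measurable (lebesgue_on \<Omega>)" using m by simp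
  qed
  ultimately show ?thesis by (simp add: L2_on_def)
qed

text \<open>Finitely many of the local neighbourhoods cover the closure, which is compact.\<close>

lemma bounded_if_locally_bounded_on_closure:
  fixes f :: "'a::euclidean_space \<Rightarrow> 'b::real_normed_vector"
  assumes "bounded \<Omega>" and loc: "\<And>p. p \<in> closure \<Omega> \<Longrightarrow> \<exists>d>0. bounded (f ` (\<Omega> \<inter> ball p d))"
  shows "bounded (f ` \<Omega>)"
proof -
  obtain d where d: "\<And>p. p \<in> closure \<Omega> \<Longrightarrow> d p > 0 \<and> bounded (f ` (\<Omega> \<inter> ball p (d p)))" using loc by metis
  have "compact (closure \<Omega>)" using assms(1) by simp
  moreover have "closure \<Omega> \<subseteq> (\<Union>p\<in>closure \<Omega>. ball p (d p))" using d by force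
  ultimately obtain D where D: "D \<subseteq> closure \<Omega>" "finite D" "closure \<Omega> \<subseteq> (\<Union>p\<in>D. ball p (d p))"
    using compactE_image[of "closure \<Omega>" "closure \<Omega>" "\<lambda>p. ball p (d p)"] by auto
  have "bounded (\<Union>p\<in>D. f ` (\<Omega> \<inter> ball p (d p)))"
    using D d by (intro bounded_UN) auto
  moreover have "f ` \<Omega> \<subseteq> (\<Union>p\<in>D. f ` (\<Omega> \<inter> ball p (d p)))"
    using D(3) closure_subset[of \<Omega>] by force
  ultimately show ?thesis by (rule bounded_subset)
qed

text \<open>At a boundary point, a direction along which the defining function decreases leads from every
  nearby point of the domain along a segment inside the domain to a compact part of it.\<close>

lemma smooth_boundary_bounded:
  fixes f :: "'a::euclidean_space \<Rightarrow> 'b::real_normed_vector"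
  assumes \<Omega>: "open \<Omega>" "bounded \<Omega>" "smooth_boundary \<Omega>"
    and f: "\<And>x. x \<in> \<Omega> \<Longrightarrow> (f has_derivative f' x) (at x)" "\<And>x v. x \<in> \<Omega> \<Longrightarrow> norm (f' x v) \<le> L * norm v"
  shows "bounded (f ` \<Omega>)"
proof (rule bounded_if_locally_bounded_on_closure[OF \<Omega>(2)])
  have near: "\<exists>d>0. \<forall>z\<in>ball p d. z \<in> \<Omega> \<and> norm (f z) \<le> norm (f p) + 1" if p: "p \<in> \<Omega>" for p
  proof -
    have "continuous (at p) f" using f(1)[OF p] by (rule has_derivative_continuous)
    then obtain d where d: "d > 0" "\<And>z. dist z p < d \<Longrightarrow> dist (f z) (f p) < 1"
      unfolding continuous_at_eps_delta by (metis zero_less_one)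
    obtain e where e: "e > 0" "ball p e \<subseteq> \<Omega>" using \<Omega>(1) p open_contains_ball by blast
    have "z \<in> \<Omega> \<and> norm (f z) \<le> norm (f p) + 1" if "z \<in> ball p (min d e)" for z
    proof -
      have "dist (f z) (f p) < 1" using d(2)[of z] that by (simp add: dist_commute)
      then show ?thesis using e that norm_triangle_sub[of "f z" "f p"] by (auto simp: dist_norm)
    qed
    then show ?thesis using d(1) e(1) by (intro exI[of _ "min d e"]) simp
  qed
  fix p assume "p \<in> closure \<Omega>"
  show "\<exists>d>0. bounded (f ` (\<Omega> \<inter> ball p d))"
  proof (cases "p \<in> \<Omega>")
    case True
    then obtain d where "d > 0" "\<forall>z\<in>ball p d. norm (f z) \<le> norm (f p) + 1" using near by blast
    then show ?thesis by (intro exI[of _ d]) (auto intro!: boundedI[of _ "norm (f p) + 1"])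
  next
    case False
    then have "p \<in> frontier \<Omega>" using \<open>p \<in> closure \<Omega>\<close> \<Omega>(1) by (simp add: frontier_def interior_open)
    from \<Omega>(3)[unfolded smooth_boundary_def, rule_format, OF this]
    obtain U and \<rho> :: "'a \<Rightarrow> real" where *: "open U \<and> p \<in> U \<and> smooth_on U \<rho> \<and>
        (\<forall>x\<in>U. \<exists>v. frechet_derivative \<rho> (at x) v \<noteq> 0) \<and> \<Omega> \<inter> U = {x\<in>U. \<rho> x < 0}" by (elim exE)
    then have U: "open U" "p \<in> U" "smooth_on U \<rho>"
      and nz: "\<exists>v. frechet_derivative \<rho> (at p) v \<noteq> 0" and \<Omega>U: "\<Omega> \<inter> U = {x\<in>U. \<rho> x < 0}"
      by blast+
    have mem: "x \<in> \<Omega> \<longleftrightarrow> \<rho> x < 0" if "x \<in> U" for x using \<Omega>U that by blast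
    let ?\<rho>' = "\<lambda>x. frechet_derivative \<rho> (at x)"
    have d\<rho>: "(\<rho> has_derivative ?\<rho>' x) (at x)" if "x \<in> U" for x by (rule smooth_on_has_derivative[OF U(3) that])
    obtain v where v: "?\<rho>' p v < 0"
    proof -
      obtain w where w: "?\<rho>' p w \<noteq> 0" using nz by blast
      have "?\<rho>' p (- w) = - ?\<rho>' p w" using linear_neg[OF has_derivative_linear[OF d\<rho>[OF U(2)]]] .
      with w that[of w] that[of "- w"] show ?thesis by linarith
    qed
    have "continuous_on U (\<lambda>x. ?\<rho>' x v)" by (rule smooth_on_continuous_on[OF smooth_on_frechet_derivative[OF U(3)]])
    then have o: "open (U \<inter> (\<lambda>x. ?\<rho>' x v) -` {..<0})" by (rule continuous_open_preimage[OF _ U(1) open_lessThan])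
    have "p \<in> U \<inter> (\<lambda>x. ?\<rho>' x v) -` {..<0}" using U(2) v by simp
    then obtain r where "r > 0" "ball p r \<subseteq> U \<inter> (\<lambda>x. ?\<rho>' x v) -` {..<0}" by (rule openE[OF o])
    then have r: "r > 0" "\<And>x. x \<in> ball p r \<Longrightarrow> x \<in> U \<and> ?\<rho>' x v < 0" by auto
    have dec: "\<rho> (x + t *\<^sub>R v) < \<rho> x" if t0: "t > 0" and xs: "\<And>s. 0 \<le> s \<Longrightarrow> s \<le> t \<Longrightarrow> x + s *\<^sub>R v \<in> ball p r" for x t
    proof -
      have "((\<lambda>s. \<rho> (x + s *\<^sub>R v)) has_real_derivative ?\<rho>' (x + s *\<^sub>R v) v) (at s)" if s: "0 \<le> s" "s \<le> t" for s
      proof -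
        have u: "x + s *\<^sub>R v \<in> U" using xs[OF s] r(2) by blast
        have "((\<lambda>s. \<rho> (x + s *\<^sub>R v)) has_derivative (\<lambda>h. ?\<rho>' (x + s *\<^sub>R v) (h *\<^sub>R v))) (at s)"
        proof (rule has_derivative_compose[where f = "\<lambda>s. x + s *\<^sub>R v" and g = \<rho>])
          show "((\<lambda>s. x + s *\<^sub>R v) has_derivative (\<lambda>h. h *\<^sub>R v)) (at s)" by (auto intro!: derivative_eq_intros)
        qed (rule d\<rho>[OF u])
        then show ?thesis
          using linear_cmul[OF has_derivative_linear[OF d\<rho>[OF u]], of _ v] by (simp add: has_field_derivative_def mult.commute[of _ "?\<rho>' _ v"])
      qed
      then have "\<rho> (x + t *\<^sub>R v) < \<rho> (x + 0 *\<^sub>R v)"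
        using r(2) t0 xs by (intro DERIV_neg_imp_decreasing[of 0 t "\<lambda>s. \<rho> (x + s *\<^sub>R v)"]) blast+
      then show ?thesis by simp
    qed
    have v0: "norm v > 0" using v linear_0[OF has_derivative_linear[OF d\<rho>[OF U(2)]]] by auto
    \<comment> \<open>The displacement has length \<open>r / 2\<close>, so segments that start in
      the half ball remain in the ball where \<open>\<rho>\<close> decreases along
      \<open>v\<close>.\<close>
    define t where "t = r / (2 * norm v)"
    have t: "t > 0" "t * norm v = r / 2" using r v0 by (auto simp: t_def)
    have seg: "x + s *\<^sub>R v \<in> ball p r" if "x \<in> ball p (r / 2)" "0 \<le> s" "s \<le> t" for x s
    proof -
      have "s * norm v \<le> r / 2" using that t(2) v0 by (metis mult_right_mono norm_ge_zero)
      moreover have "norm (p - (x + s *\<^sub>R v)) \<le> norm (p - x) + norm (s *\<^sub>R v)" by (metis diff_diff_add norm_triangle_ineq4)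
      ultimately show ?thesis using that by (simp add: dist_norm)
    qed
    \<comment> \<open>Were \<open>\<rho>\<close> positive at \<open>p\<close>, it would be positive
      nearby, where there are points of the domain.\<close>
    have "\<rho> p \<le> 0"
    proof (rule ccontr)
      assume "\<not> \<rho> p \<le> 0"
      have "open (U \<inter> \<rho> -` {0<..})"
        by (rule continuous_open_preimage[OF smooth_on_continuous_on[OF U(3)] U(1) open_greaterThan])
      moreover have "p \<in> U \<inter> \<rho> -` {0<..}" using U(2) \<open>\<not> \<rho> p \<le> 0\<close> by simp
      ultimately have "\<Omega> \<inter> (U \<inter> \<rho> -` {0<..}) \<noteq> {}"
        using \<open>p \<in> closure \<Omega>\<close> by (metis closure_iff_nhds_not_empty inf_commute subset_refl)
      then show False using mem by force
    qed
    let ?z = "p + t *\<^sub>R v"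
    have "\<rho> ?z < 0" using dec[of t p] t(1) seg[of p] r(1) \<open>\<rho> p \<le> 0\<close> by force
    moreover have "?z \<in> U" using seg[of p t] r t(1) by simp
    ultimately have "?z \<in> \<Omega>" using mem by blast
    then obtain d where d: "d > 0" "\<And>z. z \<in> ball ?z d \<Longrightarrow> norm (f z) \<le> norm (f ?z) + 1" using near by blast
    have "norm (f x) \<le> norm (f ?z) + 1 + L * (t * norm v)" if x: "x \<in> \<Omega> \<inter> ball p (min d (r / 2))" for x
    proof -
      have x': "x \<in> \<Omega>" "x \<in> ball p (r / 2)" "dist p x < d" using x by auto
      have "x \<in> U" using seg[OF x'(2), of 0] r(2) t(1) by simp
      then have "\<rho> x < 0" using mem x'(1) by blast
      have in\<Omega>: "x + s *\<^sub>R v \<in> \<Omega>" if s: "0 \<le> s" "s \<le> t" for s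
      proof (cases "s = 0")
        case False
        then have "\<rho> (x + s *\<^sub>R v) < \<rho> x" using dec[of s x] seg[OF x'(2)] s by force
        then show ?thesis using \<open>\<rho> x < 0\<close> mem[of "x + s *\<^sub>R v"] seg[OF x'(2) s] r(2) by simp
      qed (use x' in simp)
      have "norm (f (x + t *\<^sub>R v) - f x) \<le> norm (t *\<^sub>R v) * L"
      proof (rule differentiable_bound_segment[where G = \<Omega> and f' = f'])
        show "x + s *\<^sub>R (t *\<^sub>R v) \<in> \<Omega>" if "s \<in> {0..1}" for s
          using in\<Omega>[of "s * t"] t(1) that by (simp add: mult_le_cancel_right1)
        show "(f has_derivative f' y) (at y within \<Omega>)" if "y \<in> \<Omega>" for y
          using f(1)[OF that] by (rule has_derivative_at_withinI)
        show "onorm (f' (x + s *\<^sub>R (t *\<^sub>R v))) \<le> L" if "s \<in> {0..1}" for s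
          using f(2) in\<Omega>[of "s * t"] t(1) that by (intro onorm_le) (simp add: mult_le_cancel_right1)
      qed
      then have "norm (f x) \<le> norm (f (x + t *\<^sub>R v)) + L * (t * norm v)"
        using norm_triangle_sub[of "f x" "f (x + t *\<^sub>R v)"] t(1) by (simp add: norm_minus_commute mult_ac)
      moreover have "norm (f (x + t *\<^sub>R v)) \<le> norm (f ?z) + 1"
        using x'(3) by (intro d(2)) (simp add: dist_norm)
      ultimately show ?thesis by simp
    qed
    then show ?thesis using d(1) r(1)
      by (intro exI[of _ "min d (r / 2)"]) (auto intro!: boundedI[of _ "norm (f ?z) + 1 + L * (t * norm v)"])
  qed
qed

lemma has_weak_pd_classical_vec:
  fixes f :: "real^'n::finite \<Rightarrow> real^'m::finite"
  assumes \<Omega>: "open \<Omega>" and f: "\<And>x. x \<in> \<Omega> \<Longrightarrow> (f has_derivative f' x) (at x)"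
    and c: "continuous_on \<Omega> (\<lambda>x. f' x (axis i 1))"
  shows "has_weak_pd \<Omega> i f (\<lambda>x. f' x (axis i 1))"
  unfolding has_weak_pd_vec_iff[OF \<Omega>]
proof
  fix k
  show "has_weak_pd \<Omega> i (\<lambda>x. f x $ k) (\<lambda>x. f' x (axis i 1) $ k)"
  proof (rule has_weak_pd_classical[OF \<Omega>, where f' = "\<lambda>x v. f' x v $ k"])
    show "((\<lambda>x. f x $ k) has_derivative (\<lambda>v. f' x v $ k)) (at x)" if "x \<in> \<Omega>" for x
      using f[OF that] unfolding has_derivative_vec_iff by blast
  qed (intro continuous_intros c)
qed

section \<open>From a solution of the linear system to a compatible immersion\<close>

context spd_field
begin

context
  fixes y :: "real^2 \<Rightarrow> real^3" and q :: "3 \<Rightarrow> real^2 \<Rightarrow> real^3" and B t :: real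
  assumes bd: "bounded \<Omega>" "smooth_boundary \<Omega>"
    and chr_bound: "\<And>x i k l. x \<in> \<Omega> \<Longrightarrow> \<bar>chr G i k l x\<bar> \<le> B"
    and G_bound: "\<And>x i. x \<in> \<Omega> \<Longrightarrow> G x $ i $ i \<le> t"
    and dy: "\<And>x. x \<in> \<Omega> \<Longrightarrow> (y has_derivative (\<lambda>v. v $ 1 *\<^sub>R q 1 x + v $ 2 *\<^sub>R q 2 x)) (at x)"
    and dq: "\<And>x c. x \<in> \<Omega> \<Longrightarrow>
      (q c has_derivative (\<lambda>v. \<Sum>m\<in>UNIV. (v $ 1 * chr G m c 1 x + v $ 2 * chr G m c 2 x) *\<^sub>R q m x)) (at x)"
    and gram: "\<And>x a c. x \<in> \<Omega> \<Longrightarrow> q a x \<bullet> q c x = G x $ a $ c"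
    and pos: "\<And>x. x \<in> \<Omega> \<Longrightarrow> cross3 (q 1 x) (q 2 x) \<bullet> q 3 x > 0"
begin

lemma norm_q: "x \<in> \<Omega> \<Longrightarrow> norm (q c x) \<le> sqrt t"
  by (intro real_le_rsqrt) (simp add: power2_norm_eq_inner gram G_bound)

lemma continuous_q: "continuous_on \<Omega> (q c)"
  using dq by (auto intro!: continuous_at_imp_continuous_on has_derivative_continuous)

lemma continuous_dq: "continuous_on \<Omega> (\<lambda>x. \<Sum>m\<in>UNIV. chr G m c l x *\<^sub>R q m x)"
  by (intro continuous_intros continuous_q smooth_on_continuous_on[OF smooth_chr])

lemma weak_pd_y: "has_weak_pd \<Omega> i y (q (index3 i))"
proof -
  have e: "(\<lambda>x. axis i 1 $ 1 *\<^sub>R q 1 x + axis i 1 $ 2 *\<^sub>R q 2 x) = q (index3 i)" for i :: 2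
    using exhaust_2[of i] by (auto simp: axis_def)
  show ?thesis
    using has_weak_pd_classical_vec[OF \<Omega> dy, of i] unfolding e by (simp add: continuous_q)
qed

lemma weak_pd_q: "has_weak_pd \<Omega> j (q c) (\<lambda>x. \<Sum>m\<in>UNIV. chr G m c (index3 j) x *\<^sub>R q m x)"
proof -
  have e: "(\<lambda>x. \<Sum>m\<in>UNIV. (axis j 1 $ 1 * chr G m c 1 x + axis j 1 $ 2 * chr G m c 2 x) *\<^sub>R q m x)
     = (\<lambda>x. \<Sum>m\<in>UNIV. chr G m c (index3 j) x *\<^sub>R q m x)" for j :: 2
    using exhaust_2[of j] by (auto simp: axis_def)
  show ?thesis
    using has_weak_pd_classical_vec[OF \<Omega> dq, of j c] unfolding e by (simp add: continuous_dq)
qed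

lemma weak_pd_y_eq: "AE x in lborel. x \<in> \<Omega> \<longrightarrow> (\<forall>i. weak_pd \<Omega> i y x = q (index3 i) x)"
proof -
  have "AE x in lborel. \<forall>i\<in>UNIV. x \<in> \<Omega> \<longrightarrow> weak_pd \<Omega> i y x = q (index3 i) x"
    by (intro AE_finite_allI finite weak_pd_AE_eq[OF \<Omega> weak_pd_y])
  then show ?thesis by eventually_elim blast
qed

lemma solution_isometric: "y \<in> iso_immersions \<Omega> G"
proof -
  have "bounded (y ` \<Omega>)"
  proof (rule smooth_boundary_bounded[OF \<Omega> bd dy])
    show "norm (v $ 1 *\<^sub>R q 1 x + v $ 2 *\<^sub>R q 2 x) \<le> (2 * sqrt t) * norm v" if "x \<in> \<Omega>" for x and v :: "real^2"
    proof -
      have "\<bar>v $ j\<bar> * norm (q c x) \<le> norm v * sqrt t" for j c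
        by (intro mult_mono component_le_norm_cart norm_q[OF that]) auto
      from this[of 1 1] this[of 2 2] norm_triangle_ineq[of "v $ 1 *\<^sub>R q 1 x" "v $ 2 *\<^sub>R q 2 x"] show ?thesis
        by (simp add: mult_ac)
    qed
  qed
  then obtain M where M: "\<And>x. x \<in> \<Omega> \<Longrightarrow> norm (y x) \<le> M" by (auto simp: bounded_iff)
  have cy: "continuous_on \<Omega> y"
    using dy by (auto intro!: continuous_at_imp_continuous_on has_derivative_continuous)
  have Ly: "L2_on \<Omega> y" by (rule L2_on_bounded_continuous[OF \<Omega> bd(1) cy M])
  have Lq: "L2_on \<Omega> (q c)" for c by (rule L2_on_bounded_continuous[OF \<Omega> bd(1) continuous_q norm_q])
  have Ldq: "L2_on \<Omega> (\<lambda>x. \<Sum>m\<in>UNIV. chr G m c l x *\<^sub>R q m x)" for c l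
  proof (rule L2_on_bounded_continuous[OF \<Omega> bd(1) continuous_dq])
    show "norm (\<Sum>m\<in>UNIV. chr G m c l x *\<^sub>R q m x) \<le> (\<Sum>m\<in>(UNIV::3 set). B * sqrt t)" if x: "x \<in> \<Omega>" for x
    proof (rule sum_norm_le)
      fix m :: 3
      have "0 \<le> B" using chr_bound[OF x, of m c l] by linarith
      then have "\<bar>chr G m c l x\<bar> * norm (q m x) \<le> B * sqrt t"
        by (intro mult_mono chr_bound[OF x] norm_q[OF x]) auto
      then show "norm (chr G m c l x *\<^sub>R q m x) \<le> B * sqrt t" by simp
    qed
  qed
  have "\<exists>h. has_weak_pd \<Omega> j (q c) h \<and> L2_on \<Omega> h" for j c
    by (rule exI, rule conjI[OF weak_pd_q Ldq])
  then have "sobolev2 (Suc 0) \<Omega> (q c)" for c using Lq by simp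
  then have "\<exists>g. has_weak_pd \<Omega> i y g \<and> sobolev2 (Suc 0) \<Omega> g" for i
    by (intro exI[of _ "q (index3 i)"] conjI weak_pd_y)
  then have "sobolev2 2 \<Omega> y" using Ly by (simp add: numeral_2_eq_2)
  moreover have "AE x in lebesgue_on \<Omega>. transpose (weak_grad \<Omega> y x) ** weak_grad \<Omega> y x = block22 (G x)"
  proof -
    have "AE x in lborel. x \<in> \<Omega> \<longrightarrow> transpose (weak_grad \<Omega> y x) ** weak_grad \<Omega> y x = block22 (G x)"
      using weak_pd_y_eq
    proof eventually_elim
      case (elim x)
      show ?case
      proof
        assume x: "x \<in> \<Omega>"
        have w: "weak_pd \<Omega> i y x = q (index3 i) x" for i using elim x by blast
        have "(transpose (weak_grad \<Omega> y x) ** weak_grad \<Omega> y x) $ i $ j = G x $ index3 i $ index3 j" for i j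
          by (simp add: gram[OF x, symmetric] w matrix_matrix_mult_def transpose_def weak_grad_def inner_vec_def)
        then show "transpose (weak_grad \<Omega> y x) ** weak_grad \<Omega> y x = block22 (G x)"
          by (simp add: vec_eq_iff forall_2)
      qed
    qed
    then show ?thesis using AE_lebesgue_on_iff[of \<Omega>] \<Omega> by simp
  qed
  ultimately show ?thesis by (simp add: iso_immersions_def)
qed

text \<open>The third vector of the solution has the products and the orientation that characterise
  \<open>dir\<close>, so it is \<open>dir\<close>. The derivatives of the tangent vectors prescribed
  by the system then have the required product with it.\<close>

lemma solution_compatible: "immersion \<Omega> G y" "immersion.compatible \<Omega> G y"
proof -
  show "immersion \<Omega> G y" by unfold_locales (rule solution_isometric)
  then interpret immersion \<Omega> G y .
  have t: "has_weak_pd \<Omega> j (tang i) (\<lambda>x. \<Sum>m\<in>UNIV. chr G m (index3 i) (index3 j) x *\<^sub>R q m x)" for i j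
  proof (rule has_weak_pd_vec_cong_AE[OF \<Omega> weak_pd_q])
    show "AE x in lborel. x \<in> \<Omega> \<longrightarrow> q (index3 i) x = tang i x"
      using weak_pd_y_eq by eventually_elim simp
  qed (intro AE_I2 impI refl)
  have "AE x in lborel. \<forall>i\<in>UNIV. \<forall>j\<in>UNIV. x \<in> \<Omega> \<longrightarrow> tang_d i j x = (\<Sum>m\<in>UNIV. chr G m (index3 i) (index3 j) x *\<^sub>R q m x)"
    by (intro AE_finite_allI finite weak_pd_AE_eq[OF \<Omega> t])
  then have "AE x in lborel. x \<in> \<Omega> \<longrightarrow> (\<forall>i j. dir x \<bullet> tang_d i j x = lowchr G 3 (index3 i) (index3 j) x)"
    using weak_pd_y_eq
  proof eventually_elim
    case (elim x)
    show ?case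
    proof (intro impI allI)
      fix i j assume x: "x \<in> \<Omega>"
      have w: "tang 1 x = q 1 x" "tang 2 x = q 2 x" using elim(2) x by (metis index3_simps)+
      have N: "nrm x = cross3 (q 1 x) (q 2 x) /\<^sub>R norm (cross3 (q 1 x) (q 2 x))"
        by (simp add: unit_normal_def Let_def w)
      have "q 3 x = dir x"
        unfolding dir_eq[OF x] w N
        by (rule normal_frame(10)[OF spd_G[OF x]]) (simp_all add: gram[OF x] sym_G[OF x, of 3 1] sym_G[OF x, of 3 2] pos[OF x])
      moreover have "tang_d i j x = (\<Sum>m\<in>UNIV. chr G m (index3 i) (index3 j) x *\<^sub>R q m x)" using elim(1) x by blast
      ultimately have "dir x \<bullet> tang_d i j x = (\<Sum>m\<in>UNIV. chr G m (index3 i) (index3 j) x * (q 3 x \<bullet> q m x))"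
        by (simp add: inner_sum_right)
      also have "\<dots> = lowchr G 3 (index3 i) (index3 j) x"
        by (simp add: gram[OF x] lower_chr[OF x, symmetric] mult.commute)
      finally show "dir x \<bullet> tang_d i j x = lowchr G 3 (index3 i) (index3 j) x" .
    qed
  qed
  then show compatible by (simp add: compatible_def)
qed

end

end

section \<open>Solving the linear system\<close>

lemma sum_UNIV_option:
  fixes f :: "'a::finite option \<Rightarrow> 'b::comm_monoid_add"
  shows "(\<Sum>x\<in>UNIV. f x) = f None + (\<Sum>x\<in>UNIV. f (Some x))"
  by (simp add: UNIV_option_conv sum.reindex)

context spd_field
begin

text \<open>The coefficients of the linear system satisfied by each component of an immersion
  (index \<open>None\<close>) and of its frame (indices \<open>Some c\<close>).\<close>

definition coeff :: "3 option \<Rightarrow> 3 option \<Rightarrow> 2 \<Rightarrow> real^2 \<Rightarrow> real" where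
  "coeff i m j = (case m of None \<Rightarrow> (\<lambda>x. 0) | Some m \<Rightarrow>
     (case i of None \<Rightarrow> (\<lambda>x. if m = index3 j then 1 else 0) | Some i \<Rightarrow> chr G m i (index3 j)))"

lemma coeff_simps [simp]:
  "coeff k None j = (\<lambda>x. 0)" "coeff None (Some m) j = (\<lambda>x. if m = index3 j then 1 else 0)"
  "coeff (Some i) (Some m) j = chr G m i (index3 j)"
  by (auto simp: coeff_def split: option.splits)

lemma smooth_coeff: "smooth_on \<Omega> (coeff i m j)"
  by (cases i; cases m) (simp_all add: smooth_on_const smooth_chr)

text \<open>Each component in space of \<open>y\<close> and its frame solves the same scalar system,
  which is therefore solved three times from a common base point. Integrability in the row of
  \<open>y\<close> is the symmetry of the Christoffel symbols, and in the rows of the frame it is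
  the vanishing of the curvature. The square root of the metric as initial value gives the right
  Gram matrix and positive orientation at the base point.\<close>

lemma frame_exists:
  assumes simply: "simply_connected \<Omega>" and ne: "\<Omega> \<noteq> {}" "\<Omega> \<noteq> UNIV"
    and flat: "\<And>x s i. x \<in> \<Omega> \<Longrightarrow> curv G s i x = 0"
  obtains x0 q y where "x0 \<in> \<Omega>" "\<And>k c. q c x0 $ k = spd_sqrt (G x0) $ k $ c"
    and "\<And>x. x \<in> \<Omega> \<Longrightarrow> (y has_derivative (\<lambda>v. v $ 1 *\<^sub>R q 1 x + v $ 2 *\<^sub>R q 2 x)) (at x)"
    and "\<And>x c. x \<in> \<Omega> \<Longrightarrow>
      (q c has_derivative (\<lambda>v. \<Sum>m\<in>UNIV. (v $ 1 * chr G m c 1 x + v $ 2 * chr G m c 2 x) *\<^sub>R (q m x :: real^3))) (at x)"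
proof -
  let ?a' = "\<lambda>i m j x. frechet_derivative (coeff i m j) (at x)"
  have f: "?a' i m 2 x (axis 1 1) + (\<Sum>l\<in>UNIV. coeff i l 2 x * coeff l m 1 x)
      = ?a' i m 1 x (axis 2 1) + (\<Sum>l\<in>UNIV. coeff i l 1 x * coeff l m 2 x)" if x: "x \<in> \<Omega>" for i m x
  proof (cases m)
    case None
    then show ?thesis by (simp add: sum_UNIV_option)
  next
    case (Some c)
    show ?thesis
    proof (cases i)
      case None
      then show ?thesis using Some chr_sym[OF x, of c 1 2]
        by (simp add: sum_UNIV_option if_distrib[of "\<lambda>t. t * _"] cong: if_cong)
    next
      case (Some d)
      have "curv G c d x = 0" by (rule flat[OF x])
      then show ?thesis
        unfolding Some \<open>m = Some c\<close> curv_def pderiv3_def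
        by (simp add: sum_UNIV_option chr_sym[OF x, of c 1] chr_sym[OF x, of c 2] mult.commute algebra_simps)
    qed
  qed
  have "\<exists>x0\<in>\<Omega>. \<forall>q0. \<exists>u :: real^2 \<Rightarrow> real^3 option. u x0 = q0 \<and>
    (\<forall>x\<in>\<Omega>. (u has_derivative (\<lambda>v. \<chi> i. \<Sum>m\<in>UNIV. (v $ 1 * coeff i m 1 x + v $ 2 * coeff i m 2 x) * u x $ m)) (at x))"
    by (rule pfaff_plane[where a' = ?a', OF \<Omega> simply ne])
      (auto intro: smooth_on_has_derivative[OF smooth_coeff] smooth_on_continuous_on[OF smooth_on_frechet_derivative[OF smooth_coeff]] f)
  then obtain x0 where x0: "x0 \<in> \<Omega>" and ex: "\<And>q0. \<exists>u :: real^2 \<Rightarrow> real^3 option. u x0 = q0 \<and>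
    (\<forall>x\<in>\<Omega>. (u has_derivative (\<lambda>v. \<chi> i. \<Sum>m\<in>UNIV. (v $ 1 * coeff i m 1 x + v $ 2 * coeff i m 2 x) * u x $ m)) (at x))"
    by blast
  let ?q0 = "\<lambda>k. \<chi> i. (case i of None \<Rightarrow> 0 | Some c \<Rightarrow> spd_sqrt (G x0) $ k $ c)"
  from ex have "\<forall>k. \<exists>u :: real^2 \<Rightarrow> real^3 option. u x0 = ?q0 k \<and>
    (\<forall>x\<in>\<Omega>. (u has_derivative (\<lambda>v. \<chi> i. \<Sum>m\<in>UNIV. (v $ 1 * coeff i m 1 x + v $ 2 * coeff i m 2 x) * u x $ m)) (at x))" by blast
  then obtain u :: "3 \<Rightarrow> real^2 \<Rightarrow> real^3 option" where u0: "\<And>k. u k x0 = ?q0 k"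
    and du: "\<And>k x. x \<in> \<Omega> \<Longrightarrow> (u k has_derivative (\<lambda>v. \<chi> i. \<Sum>m\<in>UNIV. (v $ 1 * coeff i m 1 x + v $ 2 * coeff i m 2 x) * u k x $ m)) (at x)"
    unfolding choice_iff by blast
  have dui: "((\<lambda>x. u k x $ i) has_derivative (\<lambda>v. \<Sum>m\<in>UNIV. (v $ 1 * coeff i m 1 x + v $ 2 * coeff i m 2 x) * u k x $ m)) (at x)"
    if "x \<in> \<Omega>" for k i x
    using du[OF that, of k] unfolding has_derivative_vec_iff by simp
  show thesis
  proof (rule that[of x0 "\<lambda>c x. \<chi> k. u k x $ Some c" "\<lambda>x. \<chi> k. u k x $ None"])
    show "((\<lambda>x. \<chi> k. u k x $ None) has_derivative (\<lambda>v. v $ 1 *\<^sub>R (\<chi> k. u k x $ Some 1) + v $ 2 *\<^sub>R (\<chi> k. u k x $ Some 2))) (at x)"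
      if "x \<in> \<Omega>" for x
      unfolding has_derivative_vec_iff using dui[OF that, of _ None] by (simp add: sum_UNIV_option sum_3)
    show "((\<lambda>x. \<chi> k. u k x $ Some c) has_derivative
        (\<lambda>v. \<Sum>m\<in>UNIV. (v $ 1 * chr G m c 1 x + v $ 2 * chr G m c 2 x) *\<^sub>R (\<chi> k. u k x $ Some m))) (at x)" if "x \<in> \<Omega>" for x c
      unfolding has_derivative_vec_iff using dui[OF that, of _ "Some c"] by (simp add: sum_UNIV_option)
  qed (use x0 u0 in simp_all)
qed

text \<open>The metric itself satisfies, by \<open>metric_derivative\<close>, the equation that the
  system imposes on the products of its solutions. The defect of the Gram matrix thus solves a
  homogeneous linear system.\<close>

lemma frame_gram:
  fixes q :: "3 \<Rightarrow> real^2 \<Rightarrow> real^3"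
  assumes conn: "connected \<Omega>" and x0: "x0 \<in> \<Omega>" "\<And>k c. q c x0 $ k = spd_sqrt (G x0) $ k $ c"
    and dq: "\<And>x c. x \<in> \<Omega> \<Longrightarrow>
      (q c has_derivative (\<lambda>v. \<Sum>m\<in>UNIV. (v $ 1 * chr G m c 1 x + v $ 2 * chr G m c 2 x) *\<^sub>R q m x)) (at x)"
    and B: "\<And>x i k l. x \<in> \<Omega> \<Longrightarrow> \<bar>chr G i k l x\<bar> \<le> B" and x: "x \<in> \<Omega>"
  shows "q a x \<bullet> q c x = G x $ a $ c"
proof -
  let ?E = "\<lambda>x. \<chi> p::3\<times>3. q (fst p) x \<bullet> q (snd p) x - G x $ fst p $ snd p"
  let ?c = "\<lambda>x (v::real^2) m a. v $ 1 * chr G m a 1 x + v $ 2 * chr G m a 2 x"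
  let ?E' = "\<lambda>x v. \<chi> p::3\<times>3. \<Sum>m\<in>UNIV. ?c x v m (fst p) * ?E x $ (m, snd p) + ?c x v m (snd p) * ?E x $ (fst p, m)"
  have B0: "0 \<le> B" using B[OF x, of 1 1 1] by linarith
  have "?E x = 0"
  proof (rule linear_differential_vanish[OF \<Omega> conn x0(1) _ _ _ x, where E' = ?E'])
    have A: "spd (spd_sqrt (G x0))" "spd_sqrt (G x0) ** spd_sqrt (G x0) = G x0"
      using spd_sqrt_works[OF spd_G[OF x0(1)]] by auto
    have "q a x0 \<bullet> q c x0 = G x0 $ a $ c" for a c
    proof -
      have "q a x0 \<bullet> q c x0 = (spd_sqrt (G x0) ** spd_sqrt (G x0)) $ a $ c"
        by (simp add: inner_vec_def x0(2) matrix_matrix_mult_def spd_sym[OF A(1), of _ a])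
      then show ?thesis by (simp only: A(2))
    qed
    then show "?E x0 = 0" by (simp add: vec_eq_iff)
  next
    fix x assume x: "x \<in> \<Omega>"
    show "(?E has_derivative ?E' x) (at x)"
      unfolding has_derivative_vec_iff
    proof
      fix p :: "3 \<times> 3"
      obtain a c where p: "p = (a, c)" by (cases p)
      let ?D = "frechet_derivative (\<lambda>x. G x $ a $ c) (at x)"
      have "((\<lambda>x. q a x \<bullet> q c x - G x $ a $ c) has_derivative
         (\<lambda>v. q a x \<bullet> (\<Sum>m\<in>UNIV. ?c x v m c *\<^sub>R q m x) + (\<Sum>m\<in>UNIV. ?c x v m a *\<^sub>R q m x) \<bullet> q c x - ?D v)) (at x)"
        by (rule has_derivative_diff[OF has_derivative_inner[OF dq[OF x] dq[OF x]] smooth_on_has_derivative[OF smooth_entry x]])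
      moreover have "q a x \<bullet> (\<Sum>m\<in>UNIV. ?c x v m c *\<^sub>R q m x) + (\<Sum>m\<in>UNIV. ?c x v m a *\<^sub>R q m x) \<bullet> q c x - ?D v
         = (\<Sum>m\<in>UNIV. ?c x v m a * (q m x \<bullet> q c x - G x $ m $ c) + ?c x v m c * (q a x \<bullet> q m x - G x $ a $ m))" for v
      proof -
        have lin: "linear ?D" by (rule has_derivative_linear[OF smooth_on_has_derivative[OF smooth_entry x]])
        have "v = v $ 1 *\<^sub>R axis 1 1 + v $ 2 *\<^sub>R axis 2 1" by (simp add: vec_eq_iff forall_2 axis_def)
        then have "?D v = ?D (v $ 1 *\<^sub>R axis 1 1 + v $ 2 *\<^sub>R axis 2 1)" by simp
        also have "\<dots> = v $ 1 * ?D (axis 1 1) + v $ 2 * ?D (axis 2 1)"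
          by (simp add: linear_add[OF lin] linear_cmul[OF lin])
        also have "\<dots> = v $ 1 * (lowchr G a c 1 x + lowchr G c a 1 x) + v $ 2 * (lowchr G a c 2 x + lowchr G c a 2 x)"
          by (simp add: metric_derivative[OF x, symmetric] pderiv3_def)
        also have "\<dots> = (\<Sum>m\<in>UNIV. ?c x v m a * G x $ m $ c + ?c x v m c * G x $ a $ m)"
          unfolding lower_chr[OF x, symmetric] by (simp add: sum_3 sym_G[OF x, of c] algebra_simps)
        finally show ?thesis
          by (simp add: inner_sum_left inner_sum_right sum_subtractf[symmetric] sum.distrib[symmetric] algebra_simps)
      qed
      ultimately show "((\<lambda>x. ?E x $ p) has_derivative (\<lambda>v. ?E' x v $ p)) (at x)" by (simp add: p)
    qed
  next
    fix x assume "x \<in> \<Omega>"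
    then obtain r where r: "r > 0" "ball x r \<subseteq> \<Omega>" using \<Omega> open_contains_ball by blast
    \<comment> \<open>Each of the nine entries is a sum over three values of \<open>m\<close> of two
      products, each at most \<open>2 * B * norm v * norm (?E y)\<close>.\<close>
    have "norm (?E' y v) \<le> (\<Sum>p\<in>(UNIV::(3\<times>3) set). \<Sum>m\<in>(UNIV::3 set). 4 * B) * norm v * norm (?E y)" if y: "y \<in> \<Omega>" for y v
    proof -
      have cb: "\<bar>?c y v m a\<bar> \<le> 2 * B * norm v" for m a
      proof -
        have "\<bar>v $ j * chr G m a l y\<bar> \<le> norm v * B" for j l
          unfolding abs_mult by (intro mult_mono component_le_norm_cart B[OF y]) auto
        from this[of 1 1] this[of 2 2] show ?thesis by (simp add: mult_ac)
      qed
      have t: "\<bar>?c y v m a * ?E y $ p\<bar> \<le> (2 * B * norm v) * norm (?E y)" for m a p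
        unfolding abs_mult by (intro mult_mono cb component_le_norm_cart) (use B0 in auto)
      have "norm (?E' y v) \<le> (\<Sum>p\<in>UNIV. \<bar>?E' y v $ p\<bar>)" by (rule norm_le_l1_cart)
      also have "\<dots> \<le> (\<Sum>p\<in>(UNIV::(3\<times>3) set). \<Sum>m\<in>(UNIV::3 set). 4 * B * norm v * norm (?E y))"
      proof (rule sum_mono)
        fix p :: "3 \<times> 3"
        have "\<bar>?E' y v $ p\<bar> \<le> (\<Sum>m\<in>UNIV. \<bar>?c y v m (fst p) * ?E y $ (m, snd p) + ?c y v m (snd p) * ?E y $ (fst p, m)\<bar>)"
          by (simp only: vec_lambda_beta) (rule sum_abs)
        also have "\<dots> \<le> (\<Sum>m\<in>(UNIV::3 set). 4 * B * norm v * norm (?E y))"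
        proof (rule sum_mono)
          fix m
          show "\<bar>?c y v m (fst p) * ?E y $ (m, snd p) + ?c y v m (snd p) * ?E y $ (fst p, m)\<bar> \<le> 4 * B * norm v * norm (?E y)"
            using t[of m "fst p" "(m, snd p)"] t[of m "snd p" "(fst p, m)"] by linarith
        qed
        finally show "\<bar>?E' y v $ p\<bar> \<le> (\<Sum>m\<in>(UNIV::3 set). 4 * B * norm v * norm (?E y))" .
      qed
      finally show ?thesis by (simp add: sum_distrib_right)
    qed
    moreover have "0 \<le> (\<Sum>p\<in>(UNIV::(3\<times>3) set). \<Sum>m\<in>(UNIV::3 set). 4 * B)" using B0 by (intro sum_nonneg) simp
    ultimately show "\<exists>r>0. \<exists>M\<ge>0. ball x r \<subseteq> \<Omega> \<and> (\<forall>y\<in>ball x r. \<forall>v. norm (?E' y v) \<le> M * norm v * norm (?E y))"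
      using r by (meson subsetD)
  qed
  then have "?E x $ (a, c) = 0" by (simp only: zero_index)
  then show ?thesis by simp
qed

text \<open>The triple product is continuous, and it cannot vanish, its square being the determinant
  of the metric; it is positive at the base point.\<close>

lemma frame_positive:
  fixes q :: "3 \<Rightarrow> real^2 \<Rightarrow> real^3"
  assumes conn: "connected \<Omega>" and x0: "x0 \<in> \<Omega>" "\<And>k c. q c x0 $ k = spd_sqrt (G x0) $ k $ c"
    and cq: "\<And>c. continuous_on \<Omega> (q c)" and gram: "\<And>x a c. x \<in> \<Omega> \<Longrightarrow> q a x \<bullet> q c x = G x $ a $ c"
    and x: "x \<in> \<Omega>"
  shows "cross3 (q 1 x) (q 2 x) \<bullet> q 3 x > 0"
proof -
  let ?D = "\<lambda>x. cross3 (q 1 x) (q 2 x) \<bullet> q 3 x"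
  let ?Q = "\<lambda>x. \<chi> i j. q i x $ j"
  have D: "?D x = det (?Q x)" for x by (simp add: det_3 cross3_def inner_3 algebra_simps)
  have nz: "?D x \<noteq> 0" if "x \<in> \<Omega>" for x
  proof
    assume "?D x = 0"
    then have "det (?Q x ** transpose (?Q x)) = 0" by (simp only: D det_mul mult_zero_left)
    moreover have "?Q x ** transpose (?Q x) = G x"
      by (simp add: vec_eq_iff matrix_matrix_mult_def transpose_def gram[OF that, symmetric] inner_vec_def)
    ultimately show False using det_G[OF that] by simp
  qed
  have "?Q x0 = spd_sqrt (G x0)"
    using spd_sym[OF spd_sqrt_works(1)[OF spd_G[OF x0(1)]]] by (simp add: vec_eq_iff x0(2))
  then have p0: "?D x0 > 0" unfolding D using spd_det_pos[OF spd_sqrt_works(1)[OF spd_G[OF x0(1)]]] by simp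
  have "continuous_on \<Omega> ?D"
    unfolding cross3_def inner_3 by (simp, intro continuous_intros cq)
  then have "connected (?D ` \<Omega>)" using conn by (rule connected_continuous_image)
  then have i: "is_interval (?D ` \<Omega>)" by (simp add: is_interval_connected_1)
  show ?thesis
  proof (rule ccontr)
    assume "\<not> ?D x > 0"
    then have "0 \<in> ?D ` \<Omega>"
      using i[unfolded is_interval_1, rule_format, of "?D x" "?D x0" 0] x x0(1) p0 by auto
    then show False using nz by auto
  qed
qed

end

text \<open>The Christoffel symbols are bounded because they extend continuously to the compact
  closure. The given extension of the metric is known to be symmetric and nondegenerate only on the
  closure, so it is replaced by its symmetric part, restricted to the open set where that is
  invertible.\<close>

lemma extended_metric_bounds:
  assumes \<Omega>: "open \<Omega>" "bounded \<Omega>" and G: "smooth_extends_on (closure \<Omega>) G" "\<forall>x\<in>closure \<Omega>. spd (G x)"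
  shows "spd_field \<Omega> G"
    and "\<exists>B. \<forall>x\<in>\<Omega>. (\<forall>i k l. \<bar>chr G i k l x\<bar> \<le> B) \<and> (\<forall>i k. \<bar>G x $ i $ k\<bar> \<le> B)"
proof -
  obtain U g where U: "open U" "closure \<Omega> \<subseteq> U" "smooth_on U g" "\<And>x. x \<in> closure \<Omega> \<Longrightarrow> g x = G x"
    using G(1) unfolding smooth_extends_on_def by blast
  define h where "h x = sym_part (g x)" for x
  have sub: "\<Omega> \<subseteq> closure \<Omega>" by (rule closure_subset)
  have hG: "h x = G x" if "x \<in> closure \<Omega>" for x
    using G(2) that by (simp add: h_def U(4) sym_part_def spd_def scaleR_2[symmetric])
  have sh: "smooth_on U h"
    unfolding h_def[abs_def] by (rule smooth_on_bounded_linear[OF U(1) bounded_linear_sym_part U(3)])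
  define V where "V = U \<inter> (\<lambda>x. det (h x)) -` (- {0})"
  have oV: "open V" unfolding V_def
  proof (rule continuous_open_preimage[OF _ U(1)])
    show "continuous_on U (\<lambda>x. det (h x))"
      by (intro smooth_on_continuous_on smooth_on_det3 smooth_on_vec_nth U(1) sh)
  qed auto
  have cV: "closure \<Omega> \<subseteq> V"
  proof
    fix x assume x: "x \<in> closure \<Omega>"
    then have "det (h x) > 0" using G(2) by (simp add: hG spd_det_pos)
    then show "x \<in> V" using x U(2) by (auto simp: V_def)
  qed
  interpret V: metric_field V h
  proof
    show "smooth_on V h" by (rule smooth_on_subset[OF sh]) (auto simp: V_def)
    show "det (h x) \<noteq> 0" if "x \<in> V" for x using that by (simp add: V_def)
    show "h x $ a $ b = h x $ b $ a" for x a b by (simp add: h_def sym_part_nth add.commute)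
  qed (rule oV)
  have s\<Omega>: "smooth_on \<Omega> h" by (rule smooth_on_subset[OF V.smooth_G]) (use sub cV in auto)
  have sG: "smooth_on \<Omega> G" by (rule smooth_on_cong[OF \<Omega>(1) s\<Omega>]) (use sub hG in auto)
  show "spd_field \<Omega> G" by unfold_locales (use \<Omega> sG G(2) sub in auto)
  have chr: "chr G i k l x = chr h i k l x" if x: "x \<in> \<Omega>" for i k l x
  proof -
    have "pderiv3 m (\<lambda>x. G x $ a $ b) x = pderiv3 m (\<lambda>x. h x $ a $ b) x" for m a b
      by (rule pderiv3_cong[OF \<Omega>(1) x]) (use sub hG in \<open>auto intro!: smooth_on_vec_nth \<Omega>(1) sG\<close>)
    moreover have "G x = h x" using x sub hG by auto
    ultimately show ?thesis by (simp add: chr_def)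
  qed
  have cl: "compact (closure \<Omega>)" using \<Omega>(2) by simp
  let ?f = "\<lambda>x. (\<chi> p::3\<times>3\<times>3. chr h (fst p) (fst (snd p)) (snd (snd p)) x)"
  have "continuous_on (closure \<Omega>) ?f"
    by (intro continuous_on_vec_lambda continuous_on_subset[OF smooth_on_continuous_on[OF V.smooth_chr] cV])
  then have "bounded (?f ` closure \<Omega>)" by (intro compact_imp_bounded compact_continuous_image cl)
  then obtain B1 where B1: "\<And>x. x \<in> closure \<Omega> \<Longrightarrow> norm (?f x) \<le> B1" by (auto simp: bounded_iff)
  have "continuous_on (closure \<Omega>) h" by (rule continuous_on_subset[OF smooth_on_continuous_on[OF V.smooth_G] cV])
  then have "bounded (h ` closure \<Omega>)" by (intro compact_imp_bounded compact_continuous_image cl)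
  then obtain B2 where B2: "\<And>x. x \<in> closure \<Omega> \<Longrightarrow> norm (h x) \<le> B2" by (auto simp: bounded_iff)
  have "\<bar>chr G i k l x\<bar> \<le> max B1 B2 \<and> \<bar>G x $ i $ k\<bar> \<le> max B1 B2" if x: "x \<in> \<Omega>" for x i k l
  proof -
    have "\<bar>chr h i k l x\<bar> \<le> norm (?f x)" using component_le_norm_cart[of "?f x" "(i, k, l)"] by simp
    moreover have "\<bar>h x $ i $ k\<bar> \<le> norm (h x)"
      using component_le_norm_cart[of "h x $ i" k] Finite_Cartesian_Product.norm_nth_le[of "h x" i] by linarith
    ultimately show ?thesis using B1[of x] B2[of x] x sub hG[of x] chr[OF x, of i k l] by force
  qed
  then show "\<exists>B. \<forall>x\<in>\<Omega>. (\<forall>i k l. \<bar>chr G i k l x\<bar> \<le> B) \<and> (\<forall>i k. \<bar>G x $ i $ k\<bar> \<le> B)" by blast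
qed

lemma (in spd_field) compatible_immersion_exists:
  assumes "bounded \<Omega>" "smooth_boundary \<Omega>" "simply_connected \<Omega>"
    and B: "\<And>x i k l. x \<in> \<Omega> \<Longrightarrow> \<bar>chr G i k l x\<bar> \<le> B" "\<And>x i k. x \<in> \<Omega> \<Longrightarrow> \<bar>G x $ i $ k\<bar> \<le> B"
    and flat: "\<forall>x\<in>\<Omega>. \<forall>s i. curv G s i x = 0"
  shows "\<exists>y\<in>iso_immersions \<Omega> G. immersion.compatible \<Omega> G y"
proof -
  have t: "G x $ i $ i \<le> B" if "x \<in> \<Omega>" for x i using B(2)[OF that, of i i] by linarith
  obtain y :: "real^2 \<Rightarrow> real^3" and q
    where dy: "\<And>x. x \<in> \<Omega> \<Longrightarrow> (y has_derivative (\<lambda>v. v $ 1 *\<^sub>R q 1 x + v $ 2 *\<^sub>R q 2 x)) (at x)"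
    and dq: "\<And>x c. x \<in> \<Omega> \<Longrightarrow>
      (q c has_derivative (\<lambda>v. \<Sum>m\<in>UNIV. (v $ 1 * chr G m c 1 x + v $ 2 * chr G m c 2 x) *\<^sub>R q m x)) (at x)"
    and gram: "\<And>x a c. x \<in> \<Omega> \<Longrightarrow> q a x \<bullet> q c x = G x $ a $ c"
    and pos: "\<And>x. x \<in> \<Omega> \<Longrightarrow> cross3 (q 1 x) (q 2 x) \<bullet> q 3 x > 0"
  \<comment> \<open>The empty set counts as simply connected, but a base point requires a nonempty
    domain; over the empty set any functions qualify.\<close>
  proof (cases "\<Omega> = {}")
    case True
    then show ?thesis using that[of "\<lambda>_. 0" "\<lambda>_ _. 0"] by simp
  next
    case False
    have U: "\<Omega> \<noteq> UNIV" using assms(1) not_bounded_UNIV by auto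
    have c0: "curv G s i x = 0" if "x \<in> \<Omega>" for x s i using flat that by blast
    show ?thesis
    proof (rule frame_exists[OF assms(3) False U c0])
      fix x0 y and q :: "3 \<Rightarrow> real^2 \<Rightarrow> real^3"
      assume x0: "x0 \<in> \<Omega>" "\<And>k c. q c x0 $ k = spd_sqrt (G x0) $ k $ c"
        and dy: "\<And>x. x \<in> \<Omega> \<Longrightarrow> (y has_derivative (\<lambda>v. v $ 1 *\<^sub>R q 1 x + v $ 2 *\<^sub>R q 2 x)) (at x)"
        and dq: "\<And>x c. x \<in> \<Omega> \<Longrightarrow>
          (q c has_derivative (\<lambda>v. \<Sum>m\<in>UNIV. (v $ 1 * chr G m c 1 x + v $ 2 * chr G m c 2 x) *\<^sub>R q m x)) (at x)"
      have conn: "connected \<Omega>" by (rule simply_connected_imp_connected[OF assms(3)])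
      have gram: "q a x \<bullet> q c x = G x $ a $ c" if "x \<in> \<Omega>" for a c x
        by (rule frame_gram[OF conn x0 dq B(1) that])
      have cq: "continuous_on \<Omega> (q c)" for c
        using dq by (auto intro!: continuous_at_imp_continuous_on has_derivative_continuous)
      show ?thesis by (rule that[OF dy dq gram frame_positive[OF conn x0 cq gram]])
    qed
  qed
  have "y \<in> iso_immersions \<Omega> G"
    by (rule solution_isometric[OF assms(1,2) B(1) t dy dq gram pos])
  moreover have "immersion.compatible \<Omega> G y"
    by (rule solution_compatible(2)[OF assms(1,2) B(1) t dy dq gram pos])
  ultimately show ?thesis by blast
qed

theorem theorem5p5:
  fixes \<Omega> :: "(real^2) set" and G :: "real^2 \<Rightarrow> real^3^3" and W :: "real^3^3 \<Rightarrow> ennreal"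
  assumes "open \<Omega>" and "bounded \<Omega>" and "smooth_boundary \<Omega>" and "simply_connected \<Omega>"
    and "smooth_extends_on (closure \<Omega>) G"
    and "\<forall>x\<in>closure \<Omega>. spd (G x)"
    and "stored_energy W"
  defines "cond_i \<equiv>
      (\<exists>y. is_arg_min (bending_energy W \<Omega> G) (\<lambda>y. y \<in> iso_immersions \<Omega> G) y \<and>
           bending_energy W \<Omega> G y = 0)"
    and "cond_ii \<equiv>
      (\<exists>y\<in>iso_immersions \<Omega> G. AE x in lebesgue_on \<Omega>. sym_part (bending_tensor \<Omega> G y x) = 0)"
    and "cond_iii \<equiv>
      (\<exists>y\<in>iso_immersions \<Omega> G. AE x in lebesgue_on \<Omega>.
         second_ff \<Omega> y 1 1 x
           = - (1 / sqrt (matrix_inv (G x) $ 3 $ 3)) * christoffel (cylindrical G) 3 1 1 (midplane x) \<and>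
         second_ff \<Omega> y 1 2 x
           = - (1 / sqrt (matrix_inv (G x) $ 3 $ 3)) * christoffel (cylindrical G) 3 1 2 (midplane x) \<and>
         second_ff \<Omega> y 2 2 x
           = - (1 / sqrt (matrix_inv (G x) $ 3 $ 3)) * christoffel (cylindrical G) 3 2 2 (midplane x))"
    and "curvatures_vanish \<equiv>
      (\<forall>x. planar x \<in> \<Omega> \<longrightarrow>
         riemann (cylindrical G) 3 1 1 2 x = 0 \<and>
         riemann (cylindrical G) 3 2 2 1 x = 0 \<and>
         riemann_low (cylindrical G) 1 2 1 2 x = 0)"
  shows "(cond_i \<longleftrightarrow> cond_ii) \<and> (cond_ii \<longleftrightarrow> cond_iii) \<and>
    (cond_i \<longleftrightarrow> curvatures_vanish) \<and> (cond_ii \<longleftrightarrow> curvatures_vanish) \<and>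
    (cond_iii \<longleftrightarrow> curvatures_vanish)"
proof -
  interpret F: spd_field \<Omega> G by (rule extended_metric_bounds(1)[OF assms(1,2,5,6)])
  obtain B where B: "\<And>x i k l. x \<in> \<Omega> \<Longrightarrow> \<bar>chr G i k l x\<bar> \<le> B" "\<And>x i k. x \<in> \<Omega> \<Longrightarrow> \<bar>G x $ i $ k\<bar> \<le> B"
    using extended_metric_bounds(2)[OF assms(1,2,5,6)] by blast
  have t: "trace (G x) \<le> 3 * \<bar>B\<bar> + 1" if "x \<in> \<Omega>" for x
    using B(2)[OF that, of 1 1] B(2)[OF that, of 2 2] B(2)[OF that, of 3 3] by (simp add: trace_def sum_3)
  have imm: "immersion \<Omega> G y" if "y \<in> iso_immersions \<Omega> G" for y by unfold_locales (rule that)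
  define C where "C \<longleftrightarrow> (\<exists>y\<in>iso_immersions \<Omega> G. immersion.compatible \<Omega> G y)"
  have energy: "bending_energy W \<Omega> G y = 0 \<longleftrightarrow> immersion.compatible \<Omega> G y" if "y \<in> iso_immersions \<Omega> G" for y
    by (rule immersion.bending_energy_zero_iff[OF imm[OF that] assms(7) _ t]) simp
  \<comment> \<open>Energies are nonnegative, so an immersion of energy zero is automatically a
    minimiser.\<close>
  have i: "cond_i \<longleftrightarrow> C"
    unfolding cond_i_def C_def is_arg_min_def using energy by (metis not_less_zero)
  have ii: "cond_ii \<longleftrightarrow> C"
    unfolding cond_ii_def C_def by (intro bex_cong refl immersion.sym_bending_zero_iff imm)
  have iii: "cond_iii \<longleftrightarrow> C"
    unfolding cond_iii_def C_def by (intro bex_cong refl immersion.second_ff_iff imm)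
  have "C \<longleftrightarrow> curvatures_vanish"
    unfolding curvatures_vanish_def F.curvatures_vanish_iff
  proof
    assume C
    then obtain y where "y \<in> iso_immersions \<Omega> G" "immersion.compatible \<Omega> G y" by (auto simp: C_def)
    then show "\<forall>x\<in>\<Omega>. \<forall>s i. curv G s i x = 0" using immersion.curvature_zero[OF imm] by blast
  next
    assume "\<forall>x\<in>\<Omega>. \<forall>s i. curv G s i x = 0"
    from F.compatible_immersion_exists[OF assms(2-4) B this] show C unfolding C_def .
  qed
  then show ?thesis using i ii iii by blast
qed

end
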